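(* Let $p$ be an integer partition with only odd parts, with sum $n=s(p)$ and length $k=l(p)$, and set $g=(n-k)/2$. Then $d(p)$ depends only on $n$ and $k$, and \[ d(p)=\frac{(n-1)!}{2^{g}}. \]
   Context: For a partition $p$ of $N$ with only odd parts: fix $\sigma\in S_N$ of cycle type $p$ and $*\in\{1,\dots,N\}$; to each pair $(\tau_t,\tau_b)$ of $N$-cycles in $S_N$ with $\tau_t\tau_b^{-1}=\sigma$ associate the standard labeled permutation on $(\{1,\dots,N\}\setminus\{*\})\cup\{r_t,r_b\}$ with top row $r_t,\tau_t( * ),\dots,\tau_t^{N-1}( * ),r_b$ and bottom row $r_b,\tau_b( * ),\dots,\tau_b^{N-1}( * ),r_t$. $c_s(p)$ is the number of pairs whose associated permutation has spin parity $s\in\{0,1\}$ (Kontsevich–Zorich spin parity of a Veech suspension of the permutation, i.e. the Arf invariant of the quadratic form $\gamma\mapsto\mathrm{ind}(\gamma)+1 \bmod 2$ on $H_1(\cdot;\mathbb Z/2)$), and $d(p)=c_1(p)-c_0(p)$. *)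

theory Defs
  imports
    "HOL-Analysis.Analysis"
    "HOL-Complex_Analysis.Winding_Numbers"
    "HOL-Combinatorics.Orbits"
    "HOL-Library.Function_Algebras"
    "HOL-Library.Multiset"
    "HOL-Library.Z2"
begin

section \<open>Veech suspensions of labeled permutations\<close>

text \<open>
  A labeled permutation is given by its two rows \<open>t\<close> (top) and \<open>b\<close> (bottom), duplicate-free lists
  with the same letters. A suspension datum \<open>\<zeta>\<close> attaches a complex number to every letter. From the
  origin one draws the broken line with steps \<open>\<zeta>\<close> read along \<open>t\<close> and the one read along \<open>b\<close>. They
  bound a polygon, and the suspension is the translation surface obtained by gluing, for every
  letter, its top side to its bottom side by a translation.
\<close>

definition side_start :: "('a \<Rightarrow> complex) \<Rightarrow> 'a list \<Rightarrow> 'a \<Rightarrow> complex" where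
  "side_start \<zeta> w a = (\<Sum>x\<leftarrow>takeWhile (\<lambda>x. x \<noteq> a) w. \<zeta> x)"

definition side_point :: "('a \<Rightarrow> complex) \<Rightarrow> 'a list \<Rightarrow> 'a \<Rightarrow> real \<Rightarrow> complex" where
  "side_point \<zeta> w a r = side_start \<zeta> w a + of_real r * \<zeta> a"

definition open_side :: "('a \<Rightarrow> complex) \<Rightarrow> 'a list \<Rightarrow> 'a \<Rightarrow> complex set" where
  "open_side \<zeta> w a = side_point \<zeta> w a ` {0<..<1}"

definition broken_line :: "('a \<Rightarrow> complex) \<Rightarrow> 'a list \<Rightarrow> complex set" where
  "broken_line \<zeta> w = (\<Union>a\<in>set w. side_point \<zeta> w a ` {0..1})"

text \<open>
  The first three conditions are Veech's. The last one says that the broken lines meet only at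
  their common endpoints, so that they do bound a polygon.
\<close>

definition veech_suspension :: "'a list \<Rightarrow> 'a list \<Rightarrow> ('a \<Rightarrow> complex) \<Rightarrow> bool" where
  "veech_suspension t b \<zeta> \<longleftrightarrow>
     (\<forall>a\<in>set t. Re (\<zeta> a) > 0) \<and>
     (\<forall>j. 0 < j \<and> j < length t \<longrightarrow> Im (\<Sum>x\<leftarrow>take j t. \<zeta> x) > 0) \<and>
     (\<forall>j. 0 < j \<and> j < length b \<longrightarrow> Im (\<Sum>x\<leftarrow>take j b. \<zeta> x) < 0) \<and>
     broken_line \<zeta> t \<inter> broken_line \<zeta> b = {0, \<Sum>x\<leftarrow>t. \<zeta> x}"

definition polygon_interior :: "'a list \<Rightarrow> 'a list \<Rightarrow> ('a \<Rightarrow> complex) \<Rightarrow> complex set" where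
  "polygon_interior t b \<zeta> =
     {z. \<exists>u\<in>broken_line \<zeta> t. \<exists>w\<in>broken_line \<zeta> b.
           Re u = Re z \<and> Re w = Re z \<and> Im w < Im z \<and> Im z < Im u}"

text \<open>Gluing of the open sides; vertices are treated separately, in \<open>boundaries\<close> below.\<close>

definition glued :: "'a list \<Rightarrow> 'a list \<Rightarrow> ('a \<Rightarrow> complex) \<Rightarrow> complex \<Rightarrow> complex \<Rightarrow> bool" where
  "glued t b \<zeta> z w \<longleftrightarrow>
     (\<exists>a\<in>set t. \<exists>r\<in>{0<..<1}.
        (z = side_point \<zeta> t a r \<and> w = side_point \<zeta> b a r) \<or>
        (z = side_point \<zeta> b a r \<and> w = side_point \<zeta> t a r))"


section \<open>Closed curves on the suspension and their index\<close>

text \<open>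
  An immersed closed \<open>C\<^sup>1\<close> curve avoiding the vertices and crossing the sides \<open>m > 0\<close> times,
  parametrized by \<open>[0, m]\<close> so that the crossings occur at the integers. Its \<open>i\<close>-th arc \<open>c i\<close>, which
  runs inside the polygon, is defined on \<open>[i, i + 1]\<close>. Since the gluing maps are translations, the
  velocity \<open>v\<close> is a single continuous loop in the punctured plane. (A curve that stays inside the
  polygon is null-homotopic; such curves are not represented.)
\<close>

definition closed_curve ::
  "'a list \<Rightarrow> 'a list \<Rightarrow> ('a \<Rightarrow> complex) \<Rightarrow> nat \<Rightarrow> (real \<Rightarrow> complex) \<Rightarrow> (nat \<Rightarrow> real \<Rightarrow> complex) \<Rightarrow> bool"
  where
  "closed_curve t b \<zeta> m v c \<longleftrightarrow>
     m > 0 \<and>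
     continuous_on {0..real m} v \<and> (\<forall>s\<in>{0..real m}. v s \<noteq> 0) \<and> v (real m) = v 0 \<and>
     (\<forall>i<m.
        (\<forall>s\<in>{real i..real (Suc i)}.
           (c i has_vector_derivative v s) (at s within {real i..real (Suc i)})) \<and>
        (\<forall>s\<in>{real i<..<real (Suc i)}. c i s \<in> polygon_interior t b \<zeta>) \<and>
        glued t b \<zeta> (c i (real (Suc i))) (c (Suc i mod m) (real (Suc i mod m))))"

definition simple_closed_curve ::
  "'a list \<Rightarrow> 'a list \<Rightarrow> ('a \<Rightarrow> complex) \<Rightarrow> nat \<Rightarrow> (real \<Rightarrow> complex) \<Rightarrow> (nat \<Rightarrow> real \<Rightarrow> complex) \<Rightarrow> bool"
  where
  "simple_closed_curve t b \<zeta> m v c \<longleftrightarrow>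
     closed_curve t b \<zeta> m v c \<and>
     (\<forall>i<m. \<forall>j<m. \<forall>s\<in>{real i..<real (Suc i)}. \<forall>s'\<in>{real j..<real (Suc j)}.
        c i s = c j s' \<or> glued t b \<zeta> (c i s) (c j s') \<longrightarrow> s = s')"

definition curve_index :: "nat \<Rightarrow> (real \<Rightarrow> complex) \<Rightarrow> int" where
  "curve_index m v = (THE d::int. winding_number (\<lambda>x. v (real m * x)) 0 = of_int d)"


section \<open>Homology with coefficients in the field with two elements\<close>

text \<open>
  Cellular homology of the cell decomposition dual to the polygon: one 0-cell (the polygon), for
  each letter a 1-cell that crosses its side once, and for each vertex of the surface a 2-cell.
  All 1-chains are cycles. A 2-chain is a function \<open>f\<close> on the vertices of the polygon that is
  compatible with the gluing; its boundary contains the 1-cell dual to a side with coefficient the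
  sum of the values of \<open>f\<close> at the two ends of that side. So \<open>H\<^sub>1\<close> is \<open>chains t\<close> modulo
  \<open>boundaries t b \<zeta>\<close>.
\<close>

definition chains :: "'a list \<Rightarrow> ('a \<Rightarrow> bit) set" where
  "chains t = {x. \<forall>a. a \<notin> set t \<longrightarrow> x a = 0}"

definition boundaries :: "'a list \<Rightarrow> 'a list \<Rightarrow> ('a \<Rightarrow> complex) \<Rightarrow> ('a \<Rightarrow> bit) set" where
  "boundaries t b \<zeta> =
     {(\<lambda>a. if a \<in> set t then f (side_point \<zeta> t a 0) + f (side_point \<zeta> t a 1) else 0) |
        f :: complex \<Rightarrow> bit.
        \<forall>a\<in>set t. f (side_point \<zeta> t a 0) = f (side_point \<zeta> b a 0) \<and>
                  f (side_point \<zeta> t a 1) = f (side_point \<zeta> b a 1)}"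

text \<open>A closed curve is homologous to the 1-chain of its crossing numbers with the sides.\<close>

definition curve_class ::
  "'a list \<Rightarrow> 'a list \<Rightarrow> ('a \<Rightarrow> complex) \<Rightarrow> nat \<Rightarrow> (nat \<Rightarrow> real \<Rightarrow> complex) \<Rightarrow> 'a \<Rightarrow> bit" where
  "curve_class t b \<zeta> m c a =
     (if a \<in> set t
      then of_nat (card {i. i < m \<and> c i (real (Suc i)) \<in> open_side \<zeta> t a \<union> open_side \<zeta> b a})
      else 0)"


section \<open>Quadratic forms and the Arf invariant\<close>

definition polar :: "(('a \<Rightarrow> bit) \<Rightarrow> bit) \<Rightarrow> ('a \<Rightarrow> bit) \<Rightarrow> ('a \<Rightarrow> bit) \<Rightarrow> bit" where
  "polar q x y = q (x + y) - q x - q y"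

text \<open>
  Quadratic forms on the quotient of \<open>V\<close> by \<open>R\<close>. Over the field with two elements biadditivity of
  the polar form already gives \<open>q 0 = 0\<close>, hence homogeneity.
\<close>

definition quadratic_form_mod ::
  "('a \<Rightarrow> bit) set \<Rightarrow> ('a \<Rightarrow> bit) set \<Rightarrow> (('a \<Rightarrow> bit) \<Rightarrow> bit) \<Rightarrow> bool" where
  "quadratic_form_mod V R q \<longleftrightarrow>
     (\<forall>x\<in>V. \<forall>r\<in>R. q (x + r) = q x) \<and>
     (\<forall>x\<in>V. \<forall>y\<in>V. \<forall>z\<in>V. polar q (x + y) z = polar q x z + polar q y z)"

text \<open>
  \<open>x\<^sub>0, y\<^sub>0, \<dots>, x\<^sub>h\<^sub>-\<^sub>1, y\<^sub>h\<^sub>-\<^sub>1\<close> represent a symplectic basis of the quotient of \<open>V\<close> by \<open>R\<close> for the polar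
  form of \<open>q\<close>; linear independence follows from the duality relations.
\<close>

definition symplectic_basis_mod ::
  "('a \<Rightarrow> bit) set \<Rightarrow> ('a \<Rightarrow> bit) set \<Rightarrow> (('a \<Rightarrow> bit) \<Rightarrow> bit) \<Rightarrow>
   nat \<Rightarrow> (nat \<Rightarrow> 'a \<Rightarrow> bit) \<Rightarrow> (nat \<Rightarrow> 'a \<Rightarrow> bit) \<Rightarrow> bool" where
  "symplectic_basis_mod V R q h x y \<longleftrightarrow>
     (\<forall>i<h. x i \<in> V \<and> y i \<in> V) \<and>
     (\<forall>i<h. \<forall>j<h. polar q (x i) (y j) = (if i = j then 1 else 0) \<and>
                  polar q (x i) (x j) = 0 \<and> polar q (y i) (y j) = 0) \<and>
     (\<forall>u\<in>V. \<exists>I J. \<exists>r\<in>R. I \<subseteq> {..<h} \<and> J \<subseteq> {..<h} \<and> u = (\<Sum>i\<in>I. x i) + (\<Sum>j\<in>J. y j) + r)"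

definition has_arf_invariant ::
  "('a \<Rightarrow> bit) set \<Rightarrow> ('a \<Rightarrow> bit) set \<Rightarrow> (('a \<Rightarrow> bit) \<Rightarrow> bit) \<Rightarrow> bit \<Rightarrow> bool" where
  "has_arf_invariant V R q s \<longleftrightarrow>
     (\<exists>h x y. symplectic_basis_mod V R q h x y \<and> s = (\<Sum>i<h. q (x i) * q (y i)))"


section \<open>Spin parity\<close>

text \<open>\<open>q\<close> is the quadratic form on \<open>H\<^sub>1\<close> whose value on every simple closed curve is its index plus one.\<close>

definition spin_form :: "'a list \<Rightarrow> 'a list \<Rightarrow> ('a \<Rightarrow> complex) \<Rightarrow> (('a \<Rightarrow> bit) \<Rightarrow> bit) \<Rightarrow> bool" where
  "spin_form t b \<zeta> q \<longleftrightarrow>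
     quadratic_form_mod (chains t) (boundaries t b \<zeta>) q \<and>
     (\<forall>m v c. simple_closed_curve t b \<zeta> m v c \<longrightarrow>
        q (curve_class t b \<zeta> m c) = of_int (curve_index m v + 1))"

definition has_spin_parity :: "'a list \<Rightarrow> 'a list \<Rightarrow> bit \<Rightarrow> bool" where
  "has_spin_parity t b s \<longleftrightarrow>
     (\<exists>\<zeta> q. veech_suspension t b \<zeta> \<and> spin_form t b \<zeta> q \<and>
            has_arf_invariant (chains t) (boundaries t b \<zeta>) q s)"


section \<open>Standard permutations attached to pairs of cycles\<close>

definition cycle_type :: "nat \<Rightarrow> (nat \<Rightarrow> nat) \<Rightarrow> nat multiset" where
  "cycle_type N \<sigma> = image_mset card (mset_set (orbit \<sigma> ` {1..N}))"

definition is_long_cycle :: "nat \<Rightarrow> (nat \<Rightarrow> nat) \<Rightarrow> bool" where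
  "is_long_cycle N \<tau> \<longleftrightarrow> \<tau> permutes {1..N} \<and> cyclic_on \<tau> {1..N}"

datatype letter = Rt | Rb | Lt nat

definition standard_top :: "nat \<Rightarrow> nat \<Rightarrow> (nat \<Rightarrow> nat) \<Rightarrow> letter list" where
  "standard_top N star \<tau> = Rt # map (\<lambda>i. Lt ((\<tau> ^^ i) star)) [1..<N] @ [Rb]"

definition standard_bottom :: "nat \<Rightarrow> nat \<Rightarrow> (nat \<Rightarrow> nat) \<Rightarrow> letter list" where
  "standard_bottom N star \<tau> = Rb # map (\<lambda>i. Lt ((\<tau> ^^ i) star)) [1..<N] @ [Rt]"

definition spin_count :: "nat \<Rightarrow> (nat \<Rightarrow> nat) \<Rightarrow> nat \<Rightarrow> bit \<Rightarrow> nat" where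
  "spin_count N \<sigma> star s =
     card {(\<tau>t, \<tau>b). is_long_cycle N \<tau>t \<and> is_long_cycle N \<tau>b \<and> \<tau>t \<circ> inv \<tau>b = \<sigma> \<and>
                     has_spin_parity (standard_top N star \<tau>t) (standard_bottom N star \<tau>b) s}"

definition spin_difference :: "nat \<Rightarrow> (nat \<Rightarrow> nat) \<Rightarrow> nat \<Rightarrow> int" where
  "spin_difference N \<sigma> star = int (spin_count N \<sigma> star 1) - int (spin_count N \<sigma> star 0)"

text \<open>The choices of \<open>\<sigma>\<close> and \<open>*\<close> that may be used to compute \<open>d p\<close>.\<close>

definition admissible :: "nat multiset \<Rightarrow> (nat \<Rightarrow> nat) \<Rightarrow> nat \<Rightarrow> bool" where
  "admissible p \<sigma> star \<longleftrightarrow>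
     \<sigma> permutes {1..sum_mset p} \<and> cycle_type (sum_mset p) \<sigma> = p \<and> star \<in> {1..sum_mset p}"

end

theory Submission
  imports Defs
begin

text \<open>
  The Arf invariant of a quadratic form \<open>q\<close> over the field with two elements is the sign of the Gauss
  sum of \<open>(-1)\<^sup>q\<close>. For every suspension of a permutation, the form defined by the index of curves is
  \<open>q\<^sub>0 x = (\<Sum>a. x a) + (\<Sum>(a, c). x a * x c)\<close>, the second sum being over the inverted pairs of letters.
  Indeed, the argument of the secants of an arc (Hopf's proof of the Umlaufsatz) shows that a simple
  closed curve turns once for every arc that returns leftward to its row, and the parity of the number of
  these arcs follows from the fact that the arcs do not cross. Conversely, curves made of upward arcs
  determine the form.

  For the standard permutation attached to a pair of cycles the Gauss sum of \<open>q\<^sub>0\<close> is \<open>-2\<close> times the sum,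
  over the sets \<open>X\<close> of odd size, of the sign of the relative order of the two cyclic orders on \<open>X\<close>; for
  odd \<open>X\<close> this sign does not depend on where the cycles are cut. The total of these sums over all
  pairs with \<open>t \<circ> inv b = \<sigma>\<close> is computed by removing an element from both cycles. This produces the same
  sums over sets of even size, cut at \<open>u\<close> and \<open>v\<close>: up to sign they equal the odd sums if \<open>u\<close> and \<open>v\<close>
  lie in one cycle of \<open>\<sigma>\<close>, and otherwise they cancel.
\<close>

text \<open>Two normalisations meet in the final count. The standard permutation has n + 1 letters
  and the radical of its form has 2 ^ (k - 1) elements, k being the number of cycles of \<sigma>.
  The nondegenerate part has dimension 2 * (g + 1), so every pair of cycles has an odd sum of
  absolute value 2 ^ (g + k - 1), with the sign given by the parity. The total of the odd sums is (n
  - 1)! * 2 ^ (k - 1), and the quotient is (n - 1)! / 2 ^ g. Odd cycles enter twice: they make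
  \<open>q0\<close> vanish on its radical, and in the recursion the cycle of the removed element is
  either merged with another one or split into two; a split into two even cycles contributes
  nothing, because an even cycle forces the odd sum to vanish. The number of remaining possibilities
  does not depend on the cycle type. Since \<open>has_spin_parity\<close> only asks for some
  suspension and some form, a concrete suspension has to be exhibited, and on every suspension any
  admissible form has to be shown equal to \<open>q0\<close>, so that the sign of one Gauss sum
  decides.\<close>

declare add_bit_eq_xor [simp del] mult_bit_eq_and [simp del]

section \<open>Relative sign of two orders\<close>

definition inv_count :: "('a \<Rightarrow> 'k::linorder) \<Rightarrow> ('a \<Rightarrow> 'l::linorder) \<Rightarrow> 'a set \<Rightarrow> nat" where
  "inv_count f g X = card {(x, y). x \<in> X \<and> y \<in> X \<and> f x < f y \<and> g y < g x}"

definition inv_sign :: "('a \<Rightarrow> 'k::linorder) \<Rightarrow> ('a \<Rightarrow> 'l::linorder) \<Rightarrow> 'a set \<Rightarrow> int" where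
  "inv_sign f g X = (-1) ^ inv_count f g X"

text \<open>Symmetric difference with \<open>{y}\<close>: an involution that exchanges the subsets
  of even and of odd size and so turns sums over one kind into sums over the other.\<close>

definition toggle :: "'a \<Rightarrow> 'a set \<Rightarrow> 'a set" where
  "toggle y X = (if y \<in> X then X - {y} else insert y X)"

lemma toggle_toggle [simp]: "toggle y (toggle y X) = X"
  by (auto simp: toggle_def)

lemma toggle_subset: "y \<in> S \<Longrightarrow> X \<subseteq> S \<Longrightarrow> toggle y X \<subseteq> S"
  by (auto simp: toggle_def)

lemma even_card_toggle: "finite X \<Longrightarrow> even (card (toggle y X)) \<longleftrightarrow> odd (card X)"
  using card_gt_0_iff[of X] by (cases "y \<in> X") (auto simp: toggle_def)

lemma inv_count_commute: "inv_count f g X = inv_count g f X"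
proof -
  have "bij_betw prod.swap {(x, y). x \<in> X \<and> y \<in> X \<and> f x < f y \<and> g y < g x}
      {(x, y). x \<in> X \<and> y \<in> X \<and> g x < g y \<and> f y < f x}"
    by (rule bij_betwI[where g = prod.swap]) auto
  thus ?thesis
    unfolding inv_count_def by (rule bij_betw_same_card)
qed

lemma inv_sign_commute: "inv_sign f g X = inv_sign g f X"
  unfolding inv_sign_def by (subst inv_count_commute) (rule refl)

lemma inv_count_cong:
  assumes "\<And>x y. x \<in> X \<Longrightarrow> y \<in> X \<Longrightarrow> (f x < f y \<longleftrightarrow> f' x < f' y) \<and> (g x < g y \<longleftrightarrow> g' x < g' y)"
  shows "inv_count f g X = inv_count f' g' X"
  unfolding inv_count_def by (rule arg_cong[where f = card]) (use assms in auto)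

lemma inv_sign_cong:
  assumes "\<And>x y. x \<in> X \<Longrightarrow> y \<in> X \<Longrightarrow> (f x < f y \<longleftrightarrow> f' x < f' y) \<and> (g x < g y \<longleftrightarrow> g' x < g' y)"
  shows "inv_sign f g X = inv_sign f' g' X"
  unfolding inv_sign_def by (subst inv_count_cong[of X f f' g g']) (use assms in auto)

lemma inv_count_image:
  assumes "inj_on h X"
  shows "inv_count f g (h ` X) = inv_count (f \<circ> h) (g \<circ> h) X"
proof -
  have "inj_on (map_prod h h) {(x, y). x \<in> X \<and> y \<in> X \<and> f (h x) < f (h y) \<and> g (h y) < g (h x)}"
    using assms by (auto simp: inj_on_def)
  moreover have "map_prod h h ` {(x, y). x \<in> X \<and> y \<in> X \<and> f (h x) < f (h y) \<and> g (h y) < g (h x)}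
      = {(x, y). x \<in> h ` X \<and> y \<in> h ` X \<and> f x < f y \<and> g y < g x}"
    by (auto simp: image_iff)
  ultimately show ?thesis
    unfolding inv_count_def o_def by (metis (no_types, lifting) card_image)
qed

text \<open>The new inverted pairs all contain \<open>y\<close>, and each \<open>x\<close> yields at
  most one of them, according to which of the two possible disagreements occurs.\<close>

lemma inv_count_insert:
  assumes fin: "finite X" and y: "y \<notin> X" and f: "inj_on f (insert y X)" and g: "inj_on g (insert y X)"
  shows "inv_count f g (insert y X) = inv_count f g X + card {x \<in> X. (f x < f y) \<noteq> (g x < g y)}"
proof -
  let ?I = "\<lambda>X. {(x, y). x \<in> X \<and> y \<in> X \<and> f x < f y \<and> g y < g x}"
  let ?A = "{x \<in> X. f x < f y \<and> g y < g x}" and ?B = "{x \<in> X. f y < f x \<and> g x < g y}"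
  have eq: "?I (insert y X) = ?I X \<union> ((\<lambda>x. (x, y)) ` ?A \<union> (\<lambda>x. (y, x)) ` ?B)"
    using y by auto
  have fI: "finite (?I X)"
    by (rule finite_subset[of _ "X \<times> X"]) (use fin in auto)
  have neq: "f x \<noteq> f y \<and> g x \<noteq> g y" if "x \<in> X" for x
    using that y f g by (auto simp: inj_on_def)
  have "card (?I (insert y X)) = card (?I X) + card ((\<lambda>x. (x, y)) ` ?A \<union> (\<lambda>x. (y, x)) ` ?B)"
    unfolding eq by (rule card_Un_disjoint) (use fin fI y in auto)
  also have "card ((\<lambda>x. (x, y)) ` ?A \<union> (\<lambda>x. (y, x)) ` ?B) = card ?A + card ?B"
    by (subst card_Un_disjoint) (use fin y in \<open>auto simp: card_image inj_on_def\<close>)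
  also have "\<dots> = card (?A \<union> ?B)"
    by (rule card_Un_disjoint[symmetric]) (use fin in auto)
  also have "?A \<union> ?B = {x \<in> X. (f x < f y) \<noteq> (g x < g y)}"
    using neq by (auto dest: order.asym)
  finally show ?thesis
    by (simp add: inv_count_def)
qed

lemma inv_sign_sq [simp]: "inv_sign f g X * inv_sign f g X = 1"
  by (simp add: inv_sign_def flip: power_add)

text \<open>An element that is first for \<open>g\<close> is inverted precisely with the elements
  that precede it for \<open>f\<close>. Adding and removing it change the sign alike, hence the
  formulation with \<open>toggle\<close>.\<close>

lemma inv_sign_toggle_first:
  assumes fin: "finite X" and f: "inj_on f (insert y X)"
    and first: "\<And>x. x \<in> X \<Longrightarrow> x \<noteq> y \<Longrightarrow> g y < g x" and g: "inj_on g (insert y X)"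
  shows "inv_sign f g (toggle y X) = inv_sign f g X * (-1) ^ card {x \<in> X. f x < f y}"
proof -
  have main: "inv_count f g (insert y Y) = inv_count f g Y + card {x \<in> Y. f x < f y}"
    if "finite Y" "y \<notin> Y" "insert y Y \<subseteq> insert y X" for Y
  proof -
    have "{x \<in> Y. (f x < f y) \<noteq> (g x < g y)} = {x \<in> Y. f x < f y}"
      using first that by (auto dest: order.asym)
    thus ?thesis
      using inv_count_insert[of Y y f g] inj_on_subset[OF f that(3)] inj_on_subset[OF g that(3)] that by simp
  qed
  show ?thesis
  proof (cases "y \<in> X")
    case False
    thus ?thesis using main[of X] fin by (simp add: toggle_def inv_sign_def power_add)
  next
    case True
    have "{x \<in> X - {y}. f x < f y} = {x \<in> X. f x < f y}" by auto
    thus ?thesis using main[of "X - {y}"] fin True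
      by (simp add: toggle_def inv_sign_def insert_absorb power_add mult.assoc)
  qed
qed

lemma inv_sign_toggle_last:
  assumes fin: "finite X" and f: "inj_on f (insert y X)"
    and last: "\<And>x. x \<in> X \<Longrightarrow> x \<noteq> y \<Longrightarrow> g x < g y" and g: "inj_on g (insert y X)"
  shows "inv_sign f g (toggle y X) = inv_sign f g X * (-1) ^ card {x \<in> X. f y < f x}"
proof -
  have main: "inv_count f g (insert y Y) = inv_count f g Y + card {x \<in> Y. f y < f x}"
    if "finite Y" "y \<notin> Y" "insert y Y \<subseteq> insert y X" for Y
  proof -
    have "{x \<in> Y. (f x < f y) \<noteq> (g x < g y)} = {x \<in> Y. f y < f x}"
    proof -
      have "f x \<noteq> f y" if "x \<in> Y" for x
        using f that \<open>y \<notin> Y\<close> \<open>insert y Y \<subseteq> insert y X\<close> by (auto simp: inj_on_def)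
      moreover have "g x < g y" if "x \<in> Y" for x
        using last that \<open>y \<notin> Y\<close> \<open>insert y Y \<subseteq> insert y X\<close> by auto
      ultimately show ?thesis by (auto dest: order.asym)
    qed
    thus ?thesis
      using inv_count_insert[of Y y f g] inj_on_subset[OF f that(3)] inj_on_subset[OF g that(3)] that by simp
  qed
  show ?thesis
  proof (cases "y \<in> X")
    case False
    thus ?thesis using main[of X] fin by (simp add: toggle_def inv_sign_def power_add)
  next
    case True
    have "{x \<in> X - {y}. f y < f x} = {x \<in> X. f y < f x}" by auto
    thus ?thesis using main[of "X - {y}"] fin True
      by (simp add: toggle_def inv_sign_def insert_absorb power_add mult.assoc)
  qed
qed

text \<open>Moving \<open>y\<close> from the first to the last place: removing it costs the number
  of elements before it for \<open>f\<close>, reinserting it the number after it, together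
  \<open>card X - 1\<close>. For sets of odd size the move is invisible.\<close>

lemma inv_sign_rotate:
  assumes fin: "finite X" and f: "inj_on f (insert y X)"
    and g: "inj_on g (insert y X)" and g': "inj_on g' (insert y X)"
    and first: "\<And>x. x \<in> X \<Longrightarrow> x \<noteq> y \<Longrightarrow> g y < g x"
    and last: "\<And>x. x \<in> X \<Longrightarrow> x \<noteq> y \<Longrightarrow> g' x < g' y"
    and same: "\<And>x x'. x \<in> X - {y} \<Longrightarrow> x' \<in> X - {y} \<Longrightarrow> g x < g x' \<longleftrightarrow> g' x < g' x'"
  shows "inv_sign f g' X = inv_sign f g X * (if y \<in> X then (-1) ^ (card X - 1) else 1)"
proof (cases "y \<in> X")
  case False
  thus ?thesis using same by (auto intro!: inv_sign_cong)
next
  case True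
  let ?Y = "X - {y}"
  have ins: "insert y ?Y = X" "toggle y ?Y = X" using True by (auto simp: toggle_def)
  have eq: "inv_sign f g' ?Y = inv_sign f g ?Y"
    by (rule inv_sign_cong) (use same in auto)
  have 1: "inv_sign f g X = inv_sign f g ?Y * (-1) ^ card {x \<in> ?Y. f x < f y}"
    using inv_sign_toggle_first[of ?Y f y g] fin f g first ins True by (auto simp: insert_absorb)
  have 2: "inv_sign f g' X = inv_sign f g' ?Y * (-1) ^ card {x \<in> ?Y. f y < f x}"
    using inv_sign_toggle_last[of ?Y f y g'] fin f g' last ins True by (auto simp: insert_absorb)
  have "?Y = {x \<in> ?Y. f x < f y} \<union> {x \<in> ?Y. f y < f x}"
  proof -
    have "f x \<noteq> f y" if "x \<in> ?Y" for x using f that by (auto simp: inj_on_def)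
    thus ?thesis by (auto simp: neq_iff)
  qed
  hence "card ?Y = card ({x \<in> ?Y. f x < f y} \<union> {x \<in> ?Y. f y < f x})" by (rule arg_cong)
  also have "\<dots> = card {x \<in> ?Y. f x < f y} + card {x \<in> ?Y. f y < f x}"
    by (rule card_Un_disjoint) (use fin in auto)
  finally have "card X - 1 = card {x \<in> ?Y. f x < f y} + card {x \<in> ?Y. f y < f x}"
    using True fin by simp
  thus ?thesis using True unfolding 1 2 eq
    by (simp add: power_add mult.assoc)
qed

section \<open>Pairs of long cycles\<close>

text \<open>\<open>is_long_cycle\<close> on an arbitrary set, since the recursion removes
  elements.\<close>

definition long_cycle :: "'a set \<Rightarrow> ('a \<Rightarrow> 'a) \<Rightarrow> bool" where
  "long_cycle S \<tau> \<longleftrightarrow> \<tau> permutes S \<and> cyclic_on \<tau> S"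

text \<open>\<open>rk \<tau> u x\<close> is the position of \<open>x\<close> in the linear order
  that arises when the cycle \<tau> is cut open in front of \<open>u\<close>.\<close>

abbreviation rk :: "('a \<Rightarrow> 'a) \<Rightarrow> 'a \<Rightarrow> 'a \<Rightarrow> nat" where
  "rk \<equiv> funpow_dist"

lemma long_cycle_permutes: "long_cycle S \<tau> \<Longrightarrow> \<tau> permutes S"
  by (simp add: long_cycle_def)

lemma long_cycle_finite: "long_cycle S \<tau> \<Longrightarrow> finite S"
  by (auto simp: long_cycle_def dest: finite_cyclic_on)

lemma long_cycle_in: "long_cycle S \<tau> \<Longrightarrow> \<tau> x \<in> S \<longleftrightarrow> x \<in> S"
  using permutes_in_image long_cycle_permutes by metis

lemma long_cycle_inj: "long_cycle S \<tau> \<Longrightarrow> \<tau> x = \<tau> y \<longleftrightarrow> x = y"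
  using permutes_inj long_cycle_permutes by (metis injD)

lemma long_cycle_orbit: "long_cycle S \<tau> \<Longrightarrow> x \<in> S \<Longrightarrow> orbit \<tau> x = S"
  by (simp add: long_cycle_def orbit_cyclic_eq3)

lemma rk_prop: "long_cycle S \<tau> \<Longrightarrow> u \<in> S \<Longrightarrow> x \<in> S \<Longrightarrow> (\<tau> ^^ rk \<tau> u x) u = x"
  by (rule funpow_dist_prop) (simp add: long_cycle_orbit)

lemma rk_self [simp]: "rk \<tau> u u = 0"
  by (rule funpow_dist_0) simp

lemma rk_eq_0_iff: "long_cycle S \<tau> \<Longrightarrow> u \<in> S \<Longrightarrow> x \<in> S \<Longrightarrow> rk \<tau> u x = 0 \<longleftrightarrow> x = u"
  by (subst funpow_dist_0_eq) (auto simp: long_cycle_orbit)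

lemma inj_on_rk:
  assumes "long_cycle S \<tau>" "u \<in> S"
  shows "inj_on (rk \<tau> u) S"
proof (rule inj_onI)
  fix x y assume "x \<in> S" "y \<in> S" "rk \<tau> u x = rk \<tau> u y"
  thus "x = y" using rk_prop[OF assms, of x] rk_prop[OF assms, of y] by metis
qed

lemma inj_on_rk_subset: "long_cycle S \<tau> \<Longrightarrow> u \<in> S \<Longrightarrow> X \<subseteq> S \<Longrightarrow> inj_on (rk \<tau> u) X"
  by (rule inj_on_subset[OF inj_on_rk])

lemma rk_step:
  "long_cycle S \<tau> \<Longrightarrow> u \<in> S \<Longrightarrow> x \<in> S \<Longrightarrow> x \<noteq> u \<Longrightarrow> rk \<tau> u x = Suc (rk \<tau> (\<tau> u) x)"
  by (rule funpow_dist_step) (auto simp: long_cycle_orbit)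

lemma rk_succ:
  assumes \<tau>: "long_cycle S \<tau>" and "u \<in> S" "x \<in> S" "\<tau> x \<noteq> u"
  shows "rk \<tau> u (\<tau> x) = Suc (rk \<tau> u x)"
proof (rule antisym)
  have "(\<tau> ^^ Suc (rk \<tau> u x)) u = \<tau> x"
    using rk_prop[OF assms(1-3)] by simp
  thus "rk \<tau> u (\<tau> x) \<le> Suc (rk \<tau> u x)"
    unfolding funpow_dist_def by (rule Least_le)
  have "rk \<tau> u (\<tau> x) \<noteq> 0"
    using assms rk_eq_0_iff[OF \<tau>, of u "\<tau> x"] by (simp add: long_cycle_in)
  then obtain m where m: "rk \<tau> u (\<tau> x) = Suc m"
    using not0_implies_Suc by blast
  have "\<tau> ((\<tau> ^^ m) u) = \<tau> x"
    using rk_prop[OF \<tau>, of u "\<tau> x"] m assms by (simp add: long_cycle_in)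
  hence "(\<tau> ^^ m) u = x"
    using long_cycle_inj[OF \<tau>] by simp
  hence "rk \<tau> u x \<le> m"
    unfolding funpow_dist_def by (rule Least_le)
  thus "Suc (rk \<tau> u x) \<le> rk \<tau> u (\<tau> x)"
    by (simp add: m)
qed

text \<open>With \<open>p\<close> one more than the rank of the predecessor \<open>y\<close> of
  \<open>u\<close>, the power \<open>\<tau> ^^ p\<close> fixes \<open>u\<close>. Exponents can be
  reduced modulo \<open>p\<close>, so the least exponent that reaches \<open>x\<close> is below
  \<open>p\<close>.\<close>

lemma rk_last:
  assumes \<tau>: "long_cycle S \<tau>" and "u \<in> S" "x \<in> S" "\<tau> y = u"
  shows "rk \<tau> u x \<le> rk \<tau> u y"
proof -
  let ?p = "Suc (rk \<tau> u y)"
  have y: "y \<in> S" using assms long_cycle_in by metis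
  have "(\<tau> ^^ ?p) u = u"
    using rk_prop[OF \<tau> \<open>u \<in> S\<close> y] assms by simp
  hence "(\<tau> ^^ (rk \<tau> u x mod ?p)) u = x"
    by (simp add: funpow_mod_eq rk_prop[OF assms(1-3)] del: funpow.simps)
  hence "rk \<tau> u x \<le> rk \<tau> u x mod ?p"
    unfolding funpow_dist_def by (rule Least_le)
  also have "\<dots> < ?p" by simp
  finally show ?thesis by simp
qed

lemma rk_last_less:
  assumes "long_cycle S \<tau>" "u \<in> S" "x \<in> S" "\<tau> y = u" "x \<noteq> y"
  shows "rk \<tau> u x < rk \<tau> u y"
  using rk_last[OF assms(1-4)] inj_on_rk[OF assms(1,2)] assms long_cycle_in[OF assms(1), of y]
  by (auto simp: inj_on_def order.order_iff_strict)

lemma rk_first_less: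
  assumes "long_cycle S \<tau>" "u \<in> S" "x \<in> S" "x \<noteq> u"
  shows "rk \<tau> u u < rk \<tau> u x"
  using rk_eq_0_iff[OF assms(1-3)] assms(4) by simp

lemma long_cycle_closed_induct:
  assumes \<tau>: "long_cycle S \<tau>" and "u \<in> S" "x \<in> S" and "P u" and "\<And>y. y \<in> S \<Longrightarrow> P y \<Longrightarrow> P (\<tau> y)"
  shows "P x"
proof -
  have "P ((\<tau> ^^ n) u) \<and> (\<tau> ^^ n) u \<in> S" for n
    by (induction n) (use assms in \<open>auto simp: long_cycle_in\<close>)
  thus ?thesis using rk_prop[OF assms(1-3)] by metis
qed

section \<open>Dependence of the relative sign on the two cuts\<close>

locale cycle_pair =
  fixes S :: "'a set" and t b :: "'a \<Rightarrow> 'a"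
  assumes t: "long_cycle S t" and b: "long_cycle S b"
begin

definition sg :: "'a \<Rightarrow> 'a \<Rightarrow> 'a set \<Rightarrow> int" where
  "sg u v X = inv_sign (rk t u) (rk b v) X"

lemma fin: "finite S"
  using t by (rule long_cycle_finite)

lemma fin_subset: "X \<subseteq> S \<Longrightarrow> finite X"
  using fin finite_subset by blast

text \<open>Advancing the bottom cut from \<open>v\<close> to \<open>b v\<close> carries
  \<open>v\<close> from the first to the last place and leaves the other elements in order.\<close>

lemma sg_rotate_bottom:
  assumes "u \<in> S" "v \<in> S" "X \<subseteq> S"
  shows "sg u (b v) X = sg u v X * (if v \<in> X then (-1) ^ (card X - 1) else 1)"
  unfolding sg_def
proof (rule inv_sign_rotate)
  have sub: "insert v X \<subseteq> S" and bv: "b v \<in> S"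
    using assms b by (auto simp: long_cycle_in)
  show "inj_on (rk t u) (insert v X)" "inj_on (rk b v) (insert v X)" "inj_on (rk b (b v)) (insert v X)"
    using inj_on_rk_subset[OF t _ sub] inj_on_rk_subset[OF b _ sub] assms bv by blast+
  show "rk b v v < rk b v x" if "x \<in> X" "x \<noteq> v" for x
    using rk_first_less[OF b, of v x] that assms by blast
  show "rk b (b v) x < rk b (b v) v" if "x \<in> X" "x \<noteq> v" for x
    using rk_last_less[OF b bv, of x v] that assms by auto
  show "rk b v x < rk b v x' \<longleftrightarrow> rk b (b v) x < rk b (b v) x'" if "x \<in> X - {v}" "x' \<in> X - {v}" for x x'
  proof -
    have "rk b v x = Suc (rk b (b v) x)" "rk b v x' = Suc (rk b (b v) x')"
      using rk_step[OF b, of v x] rk_step[OF b, of v x'] that assms by blast+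
    thus ?thesis by simp
  qed
qed (use assms fin_subset in auto)

lemma sg_odd_bottom:
  assumes "u \<in> S" "v \<in> S" "v' \<in> S" "X \<subseteq> S" "odd (card X)"
  shows "sg u v' X = sg u v X"
  by (rule long_cycle_closed_induct[OF b assms(2,3)]) (use assms sg_rotate_bottom in auto)

end

lemma cycle_pair_swap: "cycle_pair S t b \<Longrightarrow> cycle_pair S b t"
  by (auto simp: cycle_pair_def)

context cycle_pair
begin

text \<open>For odd sets each rotation costs an even power of -1. Only the bottom cut is moved
  directly; the top cut follows by exchanging the roles of \<open>t\<close> and
  \<open>b\<close>.\<close>

lemma sg_odd:
  assumes "u \<in> S" "v \<in> S" "u' \<in> S" "v' \<in> S" "X \<subseteq> S" "odd (card X)"
  shows "sg u' v' X = sg u v X"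
proof -
  interpret sw: cycle_pair S b t using cycle_pair_swap cycle_pair_axioms .
  have "sg u' v' X = sw.sg v' u' X" by (simp only: sg_def sw.sg_def inv_sign_commute[of "rk t u'"])
  also have "\<dots> = sw.sg v' u X" using assms by (intro sw.sg_odd_bottom)
  also have "\<dots> = sg u v' X" by (simp only: sg_def sw.sg_def inv_sign_commute[of "rk t u"])
  also have "\<dots> = sg u v X" using assms by (intro sg_odd_bottom)
  finally show ?thesis .
qed

text \<open>The sign of \<open>toggle v X\<close> cut at \<open>u\<close> and \<open>v\<close> (see
  \<open>sg_toggle_first\<close>), written in terms of \<open>X\<close>. For odd \<open>X\<close>
  the dependence on the cuts is confined to the second factor.\<close>

definition G :: "'a \<Rightarrow> 'a \<Rightarrow> 'a set \<Rightarrow> int" where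
  "G u v X = sg u v X * (-1) ^ card {x \<in> X. rk t u x < rk t u v}"

lemma sg_toggle_first:
  assumes "u \<in> S" "v \<in> S" "X \<subseteq> S"
  shows "sg u v (toggle v X) = G u v X"
  unfolding sg_def G_def
proof (rule inv_sign_toggle_first)
  have sub: "insert v X \<subseteq> S" using assms by auto
  show "inj_on (rk t u) (insert v X)" "inj_on (rk b v) (insert v X)"
    using inj_on_rk_subset[OF t _ sub] inj_on_rk_subset[OF b _ sub] assms by blast+
  show "rk b v v < rk b v x" if "x \<in> X" "x \<noteq> v" for x
    using rk_first_less[OF b, of v x] that assms by blast
qed (use assms fin_subset in auto)

text \<open>Cut at \<open>b y\<close>, the bottom order ends with \<open>y\<close>, so toggling
  \<open>y\<close> costs the elements of \<open>X\<close> behind \<open>y\<close> in the top order.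
  These and the elements before \<open>t y\<close>, which \<open>G\<close> counts, together make up
  the odd set \<open>X\<close>, hence the opposite signs. If \<open>t y = u\<close>, both counts are
  zero.\<close>

lemma sg_toggle_last:
  assumes u: "u \<in> S" and y: "y \<in> S" and X: "X \<subseteq> S" and odd: "odd (card X)"
  shows "sg u (b y) (toggle y X) = (if t y = u then 1 else -1) * G u (t y) X"
proof -
  have v: "b y \<in> S" using y b by (simp add: long_cycle_in)
  have ty: "t y \<in> S" using y t by (simp add: long_cycle_in)
  have sub: "insert y X \<subseteq> S" using X y by auto
  have 1: "sg u (b y) (toggle y X) = sg u (b y) X * (-1) ^ card {x \<in> X. rk t u y < rk t u x}"
    unfolding sg_def
  proof (rule inv_sign_toggle_last)
    show "inj_on (rk t u) (insert y X)" "inj_on (rk b (b y)) (insert y X)"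
      using inj_on_rk_subset[OF t _ sub] inj_on_rk_subset[OF b _ sub] u v by auto
    show "rk b (b y) x < rk b (b y) y" if "x \<in> X" "x \<noteq> y" for x
      using rk_last_less[OF b v, of x y] that X by auto
  qed (use X fin_subset in auto)
  have 2: "sg u (b y) X = sg u (t y) X"
    using u v ty X odd by (intro sg_odd)
  show ?thesis
  proof (cases "t y = u")
    case True
    have "{x \<in> X. rk t u y < rk t u x} = {}"
      using rk_last[OF t u _ True] X by (auto simp: not_less)
    hence "card {x \<in> X. rk t u y < rk t u x} = 0" by (simp only: card.empty)
    thus ?thesis using 1 2 True by (simp add: G_def)
  next
    case False
    let ?A = "{x \<in> X. rk t u y < rk t u x}" and ?B = "{x \<in> X. rk t u x < rk t u (t y)}"
    have "X = ?A \<union> ?B" "?A \<inter> ?B = {}"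
      using rk_succ[OF t u y False] by auto
    hence "card X = card ?A + card ?B"
      using card_Un_disjoint[of ?A ?B] fin_subset[OF X] by simp
    hence "odd (card ?A + card ?B)" using odd by simp
    hence "(-1) ^ card ?A = - ((-1) ^ card ?B :: int)"
      by (cases "even (card ?A)") auto
    thus ?thesis using 1 2 False by (simp add: G_def)
  qed
qed

text \<open>Toggling \<open>y\<close> and \<open>b y\<close> transports the bottom cut from
  \<open>b y\<close> to \<open>t y\<close>, its image under \<open>t \<circ> inv b\<close>. Iterated
  around a cycle, this yields \<open>sg_shift\<close>.\<close>

lemma G_step:
  assumes u: "u \<in> S" and y: "y \<in> S" and X: "X \<subseteq> S" and odd: "odd (card X)"
  shows "G u (b y) (toggle (b y) (toggle y X)) = (if t y = u then 1 else -1) * G u (t y) X"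
proof -
  have v: "b y \<in> S" using y b by (simp add: long_cycle_in)
  have "sg u (b y) (toggle (b y) (toggle (b y) (toggle y X))) = G u (b y) (toggle (b y) (toggle y X))"
    by (intro sg_toggle_first toggle_subset u v y X)
  thus ?thesis using sg_toggle_last[OF assms] by simp
qed

lemma G_self: "G u u X = sg u u X"
  by (simp add: G_def)

text \<open>By \<open>sg_odd\<close> the cuts are immaterial, so an arbitrary element is chosen for
  both.\<close>

definition odd_sum :: int where
  "odd_sum = (\<Sum>X | X \<subseteq> S \<and> odd (card X). sg (SOME u. u \<in> S) (SOME u. u \<in> S) X)"

definition even_sum :: "'a \<Rightarrow> 'a \<Rightarrow> int" where
  "even_sum u v = (\<Sum>X | X \<subseteq> S \<and> even (card X). sg u v X)"

lemma odd_sum_eq: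
  assumes "u \<in> S" "v \<in> S"
  shows "odd_sum = (\<Sum>X | X \<subseteq> S \<and> odd (card X). sg u v X)"
  unfolding odd_sum_def
  by (rule sum.cong) (use assms someI[of "\<lambda>u. u \<in> S" u] in \<open>auto intro!: sg_odd\<close>)

lemma bij_toggle:
  assumes "y \<in> S"
  shows "bij_betw (toggle y) {X. X \<subseteq> S \<and> odd (card X)} {X. X \<subseteq> S \<and> even (card X)}"
    "bij_betw (toggle y) {X. X \<subseteq> S \<and> even (card X)} {X. X \<subseteq> S \<and> odd (card X)}"
proof -
  have "toggle y X \<subseteq> S \<and> (even (card (toggle y X)) \<longleftrightarrow> odd (card X))" if "X \<subseteq> S" for X
    using toggle_subset[OF assms that] even_card_toggle[OF fin_subset[OF that]] by blast
  thus "bij_betw (toggle y) {X. X \<subseteq> S \<and> odd (card X)} {X. X \<subseteq> S \<and> even (card X)}"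
    "bij_betw (toggle y) {X. X \<subseteq> S \<and> even (card X)} {X. X \<subseteq> S \<and> odd (card X)}"
    by (auto intro!: bij_betwI[where g = "toggle y"])
qed

lemma even_sum_eq:
  assumes "u \<in> S" "v \<in> S"
  shows "even_sum u v = (\<Sum>X | X \<subseteq> S \<and> odd (card X). G u v X)"
  unfolding even_sum_def
  by (subst sum.reindex_bij_betw[OF bij_toggle(1)[OF assms(2)], symmetric])
     (rule sum.cong, use assms in \<open>auto simp: sg_toggle_first\<close>)

text \<open>The sets of even size are parametrised in two ways by those of odd size, through
  \<open>toggle y\<close> and through \<open>toggle (t y)\<close>, and \<open>sg_toggle_last\<close>
  compares the two.\<close>

lemma even_sum_step:
  assumes u: "u \<in> S" and y: "y \<in> S"
  shows "even_sum u (b y) = (if t y = u then 1 else -1) * even_sum u (t y)"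
proof -
  have v: "b y \<in> S" using y b by (simp add: long_cycle_in)
  have ty: "t y \<in> S" using y t by (simp add: long_cycle_in)
  have "even_sum u (b y) = (\<Sum>X | X \<subseteq> S \<and> odd (card X). sg u (b y) (toggle y X))"
    unfolding even_sum_def by (subst sum.reindex_bij_betw[OF bij_toggle(1)[OF y], symmetric]) simp
  also have "\<dots> = (\<Sum>X | X \<subseteq> S \<and> odd (card X). (if t y = u then 1 else -1) * G u (t y) X)"
    by (rule sum.cong) (use u y in \<open>auto simp: sg_toggle_last\<close>)
  also have "\<dots> = (if t y = u then 1 else -1) * even_sum u (t y)"
    using u ty by (simp add: even_sum_eq sum_distrib_left)
  finally show ?thesis .
qed

lemma even_sum_self: "u \<in> S \<Longrightarrow> even_sum u u = odd_sum"
  by (simp add: even_sum_eq G_self odd_sum_eq[of u u])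

end

section \<open>Transport of the bottom cut along the cycles of the quotient permutation\<close>

context cycle_pair
begin

definition sigma :: "'a \<Rightarrow> 'a" where
  "sigma = t \<circ> inv b"

lemma sigma_permutes: "sigma permutes S"
  unfolding sigma_def using t b by (intro permutes_compose permutes_inv long_cycle_permutes)

lemma sigma_b [simp]: "sigma (b y) = t y"
  using permutes_inverses(2)[OF long_cycle_permutes[OF b]] by (simp add: sigma_def)

lemma sigma_in: "sigma x \<in> S \<longleftrightarrow> x \<in> S"
  using sigma_permutes permutes_in_image by metis

lemma obtain_b:
  assumes "v \<in> S"
  obtains y where "y \<in> S" "b y = v"
  using assms permutes_image[OF long_cycle_permutes[OF b]] by (metis imageE)

lemma even_sum_sigma:
  assumes u: "u \<in> S" and v: "v \<in> S"
  shows "even_sum u v = (if sigma v = u then 1 else -1) * even_sum u (sigma v)"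
proof -
  obtain y where "y \<in> S" "b y = v" using obtain_b[OF v] .
  thus ?thesis using even_sum_step[OF u, of y] sigma_b[of y] by simp
qed

text \<open>Each step from \<open>v\<close> to \<open>sigma v\<close> reverses the sign, except the
  last one, which arrives at \<open>u\<close>; there \<open>even_sum_self\<close> applies.\<close>

lemma even_sum_reach:
  assumes u: "u \<in> S"
  shows "v \<in> S \<Longrightarrow> (sigma ^^ Suc m) v = u \<Longrightarrow> (\<And>j. 0 < j \<Longrightarrow> j \<le> m \<Longrightarrow> (sigma ^^ j) v \<noteq> u) \<Longrightarrow>
    even_sum u v = (-1) ^ m * odd_sum"
proof (induction m arbitrary: v)
  case 0
  thus ?case using even_sum_sigma[OF u, of v] even_sum_self[OF u] by simp
next
  case (Suc m)
  have "sigma v \<noteq> u" using Suc.prems(3)[of 1] by simp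
  moreover have "even_sum u (sigma v) = (-1) ^ m * odd_sum"
  proof (rule Suc.IH)
    show "sigma v \<in> S" using Suc.prems by (simp add: sigma_in)
    show "(sigma ^^ Suc m) (sigma v) = u"
      using Suc.prems(2) by (simp only: funpow_Suc_right o_apply)
    show "(sigma ^^ j) (sigma v) \<noteq> u" if "0 < j" "j \<le> m" for j
      using Suc.prems(3)[of "Suc j"] that by (simp only: funpow_Suc_right o_apply) simp
  qed
  ultimately show ?case using even_sum_sigma[OF u Suc.prems(1)] by simp
qed

end

lemma orbit_period:
  assumes "\<sigma> permutes S" "finite S"
  shows "(\<sigma> ^^ card (orbit \<sigma> x)) x = x" "card (orbit \<sigma> x) > 0"
    "\<And>i j. i < card (orbit \<sigma> x) \<Longrightarrow> j < card (orbit \<sigma> x) \<Longrightarrow>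
      (\<sigma> ^^ i) x = (\<sigma> ^^ j) x \<Longrightarrow> i = j"
    "orbit \<sigma> x = {(\<sigma> ^^ i) x | i. i < card (orbit \<sigma> x)}"
proof -
  have p: "permutation \<sigma>" using assms permutation_permutes by blast
  have self: "x \<in> orbit \<sigma> x" by (rule permutation_self_in_orbit[OF p])
  let ?n = "funpow_dist1 \<sigma> x x"
  have o: "orbit \<sigma> x = (\<lambda>n. (\<sigma> ^^ n) x) ` {0..<?n}"
    by (rule orbit_conv_funpow_dist1[OF self])
  have inj: "inj_on (\<lambda>n. (\<sigma> ^^ n) x) {0..<?n}"
    by (rule inj_on_funpow_dist1[OF self])
  have c: "card (orbit \<sigma> x) = ?n"
    using card_image[OF inj] o by simp
  show "(\<sigma> ^^ card (orbit \<sigma> x)) x = x"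
    unfolding c by (rule funpow_dist1_prop[OF self])
  show "card (orbit \<sigma> x) > 0" unfolding c by simp
  show "i = j" if "i < card (orbit \<sigma> x)" "j < card (orbit \<sigma> x)" "(\<sigma> ^^ i) x = (\<sigma> ^^ j) x" for i j
    using inj_onD[OF inj that(3)] that unfolding c by simp
  show "orbit \<sigma> x = {(\<sigma> ^^ i) x | i. i < card (orbit \<sigma> x)}"
    unfolding c using o by auto
qed

context cycle_pair
begin

text \<open>Going once around a cycle of even length, from \<open>u\<close> back to
  \<open>u\<close>, takes an odd number of sign changes, so the odd sum equals its negative.\<close>

lemma odd_sum_even_cycle:
  assumes u: "u \<in> S" and "even (card (orbit sigma u))"
  shows "odd_sum = 0"
proof -
  note per = orbit_period[OF sigma_permutes fin, where x = u]
  obtain m where m: "card (orbit sigma u) = Suc m" using per(2) gr0_implies_Suc by blast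
  have "even_sum u u = (-1) ^ m * odd_sum"
  proof (rule even_sum_reach[OF u u])
    show "(sigma ^^ Suc m) u = u" using per(1) m by simp
    show "(sigma ^^ j) u \<noteq> u" if "0 < j" "j \<le> m" for j
      using per(3)[of j 0] that m by auto
  qed
  thus ?thesis using assms m even_sum_self[OF u] by simp
qed

end

section \<open>Conjugation of pairs and the sums over all pairs\<close>

lemma rk_conjugate:
  assumes "inj \<kappa>" and "\<And>x. \<tau>' (\<kappa> x) = \<kappa> (\<tau> x)"
  shows "rk \<tau>' (\<kappa> u) (\<kappa> x) = rk \<tau> u x"
proof -
  have "(\<tau>' ^^ n) (\<kappa> u) = \<kappa> ((\<tau> ^^ n) u)" for n
    by (induction n) (simp_all add: assms(2))
  thus ?thesis
    unfolding funpow_dist_def using assms(1) by (simp add: inj_eq)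
qed

lemma long_cycle_conjugate:
  assumes \<kappa>: "\<kappa> permutes S" and \<tau>: "long_cycle S \<tau>"
  shows "long_cycle S (\<kappa> \<circ> \<tau> \<circ> inv \<kappa>)"
proof -
  have "(\<kappa> \<circ> \<tau> \<circ> inv \<kappa>) permutes S"
    by (rule permutes_compose[OF permutes_inv[OF \<kappa>] permutes_compose[OF long_cycle_permutes[OF \<tau>] \<kappa>]])
  moreover have "cyclic_on (\<kappa> \<circ> \<tau> \<circ> inv \<kappa>) (\<kappa> ` S)"
    by (rule cyclic_on_image[of \<tau>]) (use \<tau> permutes_inverses[OF \<kappa>] in \<open>auto simp: long_cycle_def\<close>)
  ultimately show ?thesis
    using permutes_image[OF \<kappa>] by (simp add: long_cycle_def)
qed

lemma even_sum_conjugate: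
  assumes "cycle_pair S t b" and \<kappa>: "\<kappa> permutes S" and "u \<in> S" "v \<in> S"
  shows "cycle_pair.even_sum S (\<kappa> \<circ> t \<circ> inv \<kappa>) (\<kappa> \<circ> b \<circ> inv \<kappa>) (\<kappa> u) (\<kappa> v)
    = cycle_pair.even_sum S t b u v"
proof -
  interpret cycle_pair S t b by fact
  interpret c: cycle_pair S "\<kappa> \<circ> t \<circ> inv \<kappa>" "\<kappa> \<circ> b \<circ> inv \<kappa>"
    using long_cycle_conjugate[OF \<kappa>] t b by unfold_locales
  have inj: "inj \<kappa>" using \<kappa> by (rule permutes_inj)
  have rk: "rk (\<kappa> \<circ> t \<circ> inv \<kappa>) (\<kappa> u) \<circ> \<kappa> = rk t u" "rk (\<kappa> \<circ> b \<circ> inv \<kappa>) (\<kappa> v) \<circ> \<kappa> = rk b v"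
    using permutes_inverses[OF \<kappa>] by (auto simp: fun_eq_iff intro!: rk_conjugate[OF inj])
  have card: "card (\<kappa> ` X) = card X" for X
    using inj by (intro card_image inj_on_subset[OF inj]) auto
  have bij: "bij_betw (image \<kappa>) {X. X \<subseteq> S \<and> even (card X)} {X. X \<subseteq> S \<and> even (card X)}"
  proof (rule bij_betwI[where g = "image (inv \<kappa>)"])
    have c': "card (inv \<kappa> ` X) = card X" for X
      by (rule card_image[OF inj_on_subset[OF permutes_inj[OF permutes_inv[OF \<kappa>]] subset_UNIV]])
    have "\<kappa> ` X \<subseteq> S" "inv \<kappa> ` X \<subseteq> S" if "X \<subseteq> S" for X
      using that permutes_in_image[OF \<kappa>] permutes_in_image[OF permutes_inv[OF \<kappa>]] by auto
    thus "image \<kappa> \<in> {X. X \<subseteq> S \<and> even (card X)} \<rightarrow> {X. X \<subseteq> S \<and> even (card X)}"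
      "image (inv \<kappa>) \<in> {X. X \<subseteq> S \<and> even (card X)} \<rightarrow> {X. X \<subseteq> S \<and> even (card X)}"
      using card c' by auto
    have "inv \<kappa> ` \<kappa> ` X = X" "\<kappa> ` inv \<kappa> ` X = X" for X
      using permutes_inv_o[OF \<kappa>] by (simp_all add: image_comp)
    thus "\<And>X. X \<in> {X. X \<subseteq> S \<and> even (card X)} \<Longrightarrow> inv \<kappa> ` \<kappa> ` X = X"
      "\<And>X. X \<in> {X. X \<subseteq> S \<and> even (card X)} \<Longrightarrow> \<kappa> ` inv \<kappa> ` X = X" by blast+
  qed
  have sgn: "inv_sign (rk (\<kappa> \<circ> t \<circ> inv \<kappa>) (\<kappa> u)) (rk (\<kappa> \<circ> b \<circ> inv \<kappa>) (\<kappa> v)) (\<kappa> ` X)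
      = inv_sign (rk t u) (rk b v) X" for X
    unfolding inv_sign_def by (subst inv_count_image) (use inj inj_on_subset rk in auto)
  show ?thesis
    unfolding even_sum_def c.even_sum_def sg_def c.sg_def
    by (subst sum.reindex_bij_betw[OF bij, symmetric]) (simp add: sgn)
qed

definition cyc_pairs :: "'a set \<Rightarrow> ('a \<Rightarrow> 'a) \<Rightarrow> (('a \<Rightarrow> 'a) \<times> ('a \<Rightarrow> 'a)) set" where
  "cyc_pairs S \<sigma> = {(t, b). long_cycle S t \<and> long_cycle S b \<and> t \<circ> inv b = \<sigma>}"

definition odd_total :: "'a set \<Rightarrow> ('a \<Rightarrow> 'a) \<Rightarrow> int" where
  "odd_total S \<sigma> = (\<Sum>(t, b) \<in> cyc_pairs S \<sigma>. cycle_pair.odd_sum S t b)"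

definition even_total :: "'a set \<Rightarrow> ('a \<Rightarrow> 'a) \<Rightarrow> 'a \<Rightarrow> 'a \<Rightarrow> int" where
  "even_total S \<sigma> u v = (\<Sum>(t, b) \<in> cyc_pairs S \<sigma>. cycle_pair.even_sum S t b u v)"

lemma cyc_pairs_locale: "(t, b) \<in> cyc_pairs S \<sigma> \<Longrightarrow> cycle_pair S t b"
  by (simp add: cyc_pairs_def cycle_pair_def)

lemma cyc_pairs_sigma: "(t, b) \<in> cyc_pairs S \<sigma> \<Longrightarrow> cycle_pair.sigma t b = \<sigma>"
  using cycle_pair.sigma_def[OF cyc_pairs_locale] by (auto simp: cyc_pairs_def)

lemma finite_cyc_pairs: "finite S \<Longrightarrow> finite (cyc_pairs S \<sigma>)"
  by (rule finite_subset[of _ "{p. p permutes S} \<times> {p. p permutes S}"])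
     (auto simp: cyc_pairs_def long_cycle_def finite_permutations)

lemma odd_total_even_cycle:
  assumes "u \<in> S" "even (card (orbit \<sigma> u))"
  shows "odd_total S \<sigma> = 0"
  unfolding odd_total_def
proof (rule sum.neutral, clarify)
  fix t b assume "(t, b) \<in> cyc_pairs S \<sigma>"
  thus "cycle_pair.odd_sum S t b = 0"
    using cycle_pair.odd_sum_even_cycle[OF cyc_pairs_locale] cyc_pairs_sigma assms by metis
qed

lemma even_total_reach:
  assumes "u \<in> S" "v \<in> S" "(\<sigma> ^^ Suc m) v = u" "\<And>j. 0 < j \<Longrightarrow> j \<le> m \<Longrightarrow> (\<sigma> ^^ j) v \<noteq> u"
  shows "even_total S \<sigma> u v = (-1) ^ m * odd_total S \<sigma>"
  unfolding odd_total_def even_total_def sum_distrib_left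
proof (rule sum.cong, simp, clarify)
  fix t b assume tb: "(t, b) \<in> cyc_pairs S \<sigma>"
  note s = cyc_pairs_sigma[OF tb]
  show "cycle_pair.even_sum S t b u v = (-1) ^ m * cycle_pair.odd_sum S t b"
    by (rule cycle_pair.even_sum_reach[OF cyc_pairs_locale[OF tb], unfolded s]) (use assms in auto)
qed

text \<open>Conjugation by a permutation that commutes with \<sigma> permutes the pairs with
  quotient \<sigma>. This is the symmetry behind the cancellation in
  \<open>even_total_separate\<close>.\<close>

lemma bij_cyc_pairs_conjugate:
  assumes \<kappa>: "\<kappa> permutes S" and comm: "\<kappa> \<circ> \<sigma> \<circ> inv \<kappa> = \<sigma>"
  shows "bij_betw (\<lambda>(t, b). (\<kappa> \<circ> t \<circ> inv \<kappa>, \<kappa> \<circ> b \<circ> inv \<kappa>)) (cyc_pairs S \<sigma>) (cyc_pairs S \<sigma>)"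
proof (rule bij_betwI[where g = "\<lambda>(t, b). (inv \<kappa> \<circ> t \<circ> \<kappa>, inv \<kappa> \<circ> b \<circ> \<kappa>)"])
  have inv: "inv \<kappa> permutes S" "inv (inv \<kappa>) = \<kappa>"
    using \<kappa> by (auto simp: permutes_inv permutes_inv_inv)
  have k: "\<kappa> \<circ> inv \<kappa> = id" "inv \<kappa> \<circ> \<kappa> = id"
    using permutes_inv_o[OF \<kappa>] by auto
  have kx: "\<kappa> (inv \<kappa> x) = x" "inv \<kappa> (\<kappa> x) = x" for x
    using permutes_inverses[OF \<kappa>] by auto
  have invb: "inv (\<alpha> \<circ> b \<circ> inv \<alpha>) = \<alpha> \<circ> inv b \<circ> inv \<alpha>" if "\<alpha> permutes S" "long_cycle S b" for \<alpha> b
  proof -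
    note bj = permutes_bij[OF that(1)] permutes_bij[OF long_cycle_permutes[OF that(2)]]
    have "inv (\<alpha> \<circ> b \<circ> inv \<alpha>) = inv (inv \<alpha>) \<circ> inv (\<alpha> \<circ> b)"
      using bj by (intro o_inv_distrib) (auto simp: bij_comp bij_imp_bij_inv)
    also have "\<dots> = \<alpha> \<circ> (inv b \<circ> inv \<alpha>)"
      using bj permutes_inv_inv[OF that(1)] o_inv_distrib[OF bj] by simp
    finally show ?thesis by (simp add: comp_assoc)
  qed
  have main: "(\<alpha> \<circ> t \<circ> inv \<alpha>, \<alpha> \<circ> b \<circ> inv \<alpha>) \<in> cyc_pairs S (\<alpha> \<circ> \<sigma> \<circ> inv \<alpha>)"
    if "\<alpha> permutes S" "(t, b) \<in> cyc_pairs S \<sigma>" for \<alpha> t b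
  proof -
    have "inv \<alpha> \<circ> \<alpha> = id" using permutes_inv_o[OF that(1)] by auto
    hence "\<alpha> \<circ> t \<circ> inv \<alpha> \<circ> (\<alpha> \<circ> inv b \<circ> inv \<alpha>) = \<alpha> \<circ> (t \<circ> inv b) \<circ> inv \<alpha>"
      by (simp add: fun_eq_iff)
    thus ?thesis
      using that invb[OF that(1)] long_cycle_conjugate[OF that(1)] by (auto simp: cyc_pairs_def)
  qed
  show "(\<lambda>(t, b). (\<kappa> \<circ> t \<circ> inv \<kappa>, \<kappa> \<circ> b \<circ> inv \<kappa>)) \<in> cyc_pairs S \<sigma> \<rightarrow> cyc_pairs S \<sigma>"
    using main[OF \<kappa>] comm by auto
  have "inv \<kappa> \<circ> \<sigma> \<circ> \<kappa> = \<sigma>"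
  proof -
    have "\<sigma> = inv \<kappa> \<circ> (\<kappa> \<circ> \<sigma> \<circ> inv \<kappa>) \<circ> \<kappa>"
      by (simp add: fun_eq_iff kx)
    thus ?thesis by (simp only: comm)
  qed
  thus "(\<lambda>(t, b). (inv \<kappa> \<circ> t \<circ> \<kappa>, inv \<kappa> \<circ> b \<circ> \<kappa>)) \<in> cyc_pairs S \<sigma> \<rightarrow> cyc_pairs S \<sigma>"
    using main[OF inv(1)] inv(2) by auto
qed (clarsimp simp: fun_eq_iff permutes_inverses[OF \<kappa>])+

text \<open>Conjugation by the restriction of \<open>\<sigma>\<close> to the orbit of \<open>v\<close> fixes \<open>\<sigma>\<close> and \<open>u\<close> and moves \<open>v\<close> to \<open>\<sigma> v\<close>,
  while passing from \<open>v\<close> to \<open>\<sigma> v\<close> changes the sign.\<close>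

lemma even_total_separate:
  assumes \<sigma>: "\<sigma> permutes S" and fin: "finite S" and u: "u \<in> S" and v: "v \<in> S" and sep: "u \<notin> orbit \<sigma> v"
  shows "even_total S \<sigma> u v = 0"
proof -
  have p: "permutation \<sigma>" using \<sigma> fin permutation_permutes by blast
  have self: "x \<in> orbit \<sigma> x" for x by (rule permutation_self_in_orbit[OF p])
  let ?C = "orbit \<sigma> v"
  define \<kappa> where "\<kappa> = perm_restrict \<sigma> ?C"
  have cyc: "cyclic_on \<sigma> ?C" by (rule cyclic_on_orbit[OF \<sigma> fin])
  have C: "?C \<subseteq> S" by (rule permutes_orbit_subset[OF \<sigma> v])
  have in_C: "\<sigma> x \<in> ?C \<longleftrightarrow> x \<in> ?C" for x
    using cyclic_on_f_in[OF \<sigma> cyc] cyclic_on_inI[OF cyc] by blast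
  have \<kappa>C: "\<kappa> permutes S"
  proof -
    have "inj_on \<kappa> S"
      using in_C by (auto simp: inj_on_def \<kappa>_def perm_restrict_def split: if_splits dest: injD[OF permutes_inj[OF \<sigma>]])
    moreover have "\<kappa> ` S \<subseteq> S" using permutes_in_image[OF \<sigma>] by (auto simp: \<kappa>_def perm_restrict_def)
    ultimately have "bij_betw \<kappa> S S" using fin by (simp add: bij_betw_def endo_inj_surj)
    thus ?thesis using C by (intro bij_imp_permutes) (auto simp: \<kappa>_def perm_restrict_def)
  qed
  have comm: "\<kappa> \<circ> \<sigma> = \<sigma> \<circ> \<kappa>"
    using in_C by (auto simp: fun_eq_iff \<kappa>_def perm_restrict_def)
  have "\<kappa> \<circ> \<sigma> \<circ> inv \<kappa> = \<sigma>"
    using permutes_inverses[OF \<kappa>C] comm by (simp add: fun_eq_iff)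
  note bij = bij_cyc_pairs_conjugate[OF \<kappa>C this]
  have ku: "\<kappa> u = u" "\<kappa> v = \<sigma> v" using sep self by (auto simp: \<kappa>_def perm_restrict_def)
  have "even_total S \<sigma> u (\<sigma> v) = even_total S \<sigma> u v"
    unfolding even_total_def
    by (subst sum.reindex_bij_betw[OF bij, symmetric])
       (rule sum.cong, use even_sum_conjugate[OF cyc_pairs_locale \<kappa>C u v] ku in auto)
  moreover have "even_total S \<sigma> u v = - even_total S \<sigma> u (\<sigma> v)"
    unfolding even_total_def sum_negf[symmetric]
  proof (rule sum.cong, simp, clarify)
    fix t b assume tb: "(t, b) \<in> cyc_pairs S \<sigma>"
    note s = cyc_pairs_sigma[OF tb]
    have "\<sigma> v \<noteq> u" using sep orbit.base[of \<sigma> v] by auto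
    thus "cycle_pair.even_sum S t b u v = - cycle_pair.even_sum S t b u (\<sigma> v)"
      using cycle_pair.even_sum_sigma[OF cyc_pairs_locale[OF tb] u v, unfolded s] by simp
  qed
  ultimately show ?thesis by simp
qed

section \<open>Removing an element from a pair of cycles\<close>

text \<open>Inserts \<open>z\<close> in front of \<open>u\<close> into a cycle \<tau> that fixes
  \<open>z\<close>: the predecessor of \<open>u\<close> now goes to \<open>z\<close>, and
  \<open>z\<close> goes to \<open>u\<close>. Multiplication by a transposition is an involution, so
  \<open>ins z (\<tau> z)\<close> removes \<open>z\<close> again.\<close>

abbreviation ins :: "'a \<Rightarrow> 'a \<Rightarrow> ('a \<Rightarrow> 'a) \<Rightarrow> 'a \<Rightarrow> 'a" where
  "ins z u \<tau> \<equiv> Transposition.transpose z u \<circ> \<tau>"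

lemma ins_ins [simp]: "ins z u (ins z u \<tau>) = \<tau>"
  by (simp add: fun_eq_iff)

lemma rk_eqI:
  assumes "(\<tau> ^^ n) u = x" "\<And>i. i < n \<Longrightarrow> (\<tau> ^^ i) u \<noteq> x"
  shows "rk \<tau> u x = n"
  unfolding funpow_dist_def by (rule Least_equality) (use assms not_le in blast)+

lemma rk_less_neq: "i < rk \<tau> u x \<Longrightarrow> (\<tau> ^^ i) u \<noteq> x"
  by (rule funpow_dist_least)

context
  fixes S :: "'a set" and \<tau> :: "'a \<Rightarrow> 'a" and z u :: 'a
  assumes \<tau>: "long_cycle S \<tau>" and z: "z \<notin> S" and u: "u \<in> S"
begin

lemma ins_permutes: "ins z u \<tau> permutes insert z S"
  by (rule permutes_compose)
     (use permutes_subset[OF long_cycle_permutes[OF \<tau>], of "insert z S"] u in \<open>auto intro: permutes_swap_id\<close>)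

lemma ins_z: "ins z u \<tau> z = u"
  using permutes_not_in[OF long_cycle_permutes[OF \<tau>] z] by simp

lemma ins_funpow:
  assumes x: "x \<in> S"
  shows "i \<le> rk \<tau> u x \<Longrightarrow> (ins z u \<tau> ^^ i) u = (\<tau> ^^ i) u"
proof (induction i)
  case (Suc i)
  let ?w = "(\<tau> ^^ Suc i) u"
  have "?w \<in> S"
    by (induction i) (use u long_cycle_in[OF \<tau>] in auto)
  hence "?w \<noteq> z" using z by auto
  moreover have "?w \<noteq> u"
    using funpow_neq_less_funpow_dist[of x \<tau> u "Suc i" 0] Suc.prems x long_cycle_orbit[OF \<tau> u] by auto
  ultimately show ?case using Suc by (simp add: Transposition.transpose_def)
qed simp

lemma rk_ins_u:
  assumes x: "x \<in> S"
  shows "rk (ins z u \<tau>) u x = rk \<tau> u x" and "(ins z u \<tau> ^^ rk \<tau> u x) u = x"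
proof -
  show *: "(ins z u \<tau> ^^ rk \<tau> u x) u = x"
    using ins_funpow[OF x order.refl] rk_prop[OF \<tau> u x] by simp
  show "rk (ins z u \<tau>) u x = rk \<tau> u x"
    by (rule rk_eqI[OF *]) (use ins_funpow[OF x] rk_less_neq[of _ \<tau> u x] in auto)
qed

lemma long_cycle_ins: "long_cycle (insert z S) (ins z u \<tau>)"
proof -
  have p: "permutation (ins z u \<tau>)"
    using ins_permutes long_cycle_finite[OF \<tau>] permutation_permutes by blast
  have "x \<in> orbit (ins z u \<tau>) z" if "x \<in> insert z S" for x
  proof (cases "x = z")
    case True
    thus ?thesis using permutation_self_in_orbit[OF p] by simp
  next
    case False
    hence *: "(ins z u \<tau> ^^ Suc (rk \<tau> u x)) z = x"
      using rk_ins_u(2)[of x] ins_z that by (simp only: funpow_Suc_right o_apply) auto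
    show ?thesis unfolding orbit_altdef mem_Collect_eq
      by (rule exI[of _ "Suc (rk \<tau> u x)"]) (simp only: * zero_less_Suc simp_thms)
  qed
  hence "insert z S = orbit (ins z u \<tau>) z"
    using permutes_orbit_subset[OF ins_permutes, of z] by auto
  thus ?thesis using ins_permutes by (auto simp: long_cycle_def cyclic_on_def)
qed

lemma rk_ins_z: "x \<in> S \<Longrightarrow> rk (ins z u \<tau>) z x = Suc (rk \<tau> u x)"
  using rk_step[OF long_cycle_ins, of z x] z ins_z rk_ins_u(1)[of x] by auto

end

text \<open>Starting from \<open>\<tau> z\<close>, the powers of both permutations agree up to the
  predecessor of \<open>z\<close>, since \<open>z\<close> comes last when the cycle is cut there;
  this already covers \<open>S\<close>.\<close>

lemma long_cycle_remove:
  assumes \<tau>: "long_cycle (insert z S) \<tau>" and z: "z \<notin> S" and S: "S \<noteq> {}"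
  shows "\<tau> z \<in> S" "long_cycle S (ins z (\<tau> z) \<tau>)"
proof -
  note perm = long_cycle_permutes[OF \<tau>]
  have "\<tau> z \<noteq> z"
  proof
    assume "\<tau> z = z"
    hence "orbit \<tau> z = {z}" using orbit_eq_singleton_iff by metis
    thus False using long_cycle_orbit[OF \<tau>, of z] z S by auto
  qed
  thus u: "\<tau> z \<in> S" using long_cycle_in[OF \<tau>, of z] by auto
  let ?u = "\<tau> z" and ?t = "ins z (\<tau> z) \<tau>"
  have "?t permutes insert z S"
    by (rule permutes_compose[OF perm]) (use u in \<open>auto intro: permutes_swap_id\<close>)
  hence tp: "?t permutes S"
    by (rule permutes_superset) (auto simp: Transposition.transpose_def)
  have fp: "(?t ^^ i) ?u = (\<tau> ^^ i) ?u" if x: "x \<in> S" and "i \<le> rk \<tau> ?u x" for x i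
    using that(2)
  proof (induction i)
    case (Suc i)
    let ?w = "(\<tau> ^^ Suc i) ?u"
    have rz: "rk \<tau> ?u x < rk \<tau> ?u z"
      by (rule rk_last_less[OF \<tau>]) (use u x z in auto)
    have "?w \<noteq> z" using rk_less_neq[of "Suc i" \<tau> ?u z] Suc.prems rz by auto
    moreover have "?w \<noteq> ?u"
      using funpow_neq_less_funpow_dist[of x \<tau> ?u "Suc i" 0] Suc.prems x long_cycle_orbit[OF \<tau>, of ?u] u by auto
    ultimately show ?case using Suc by (simp add: Transposition.transpose_def)
  qed simp
  have p: "permutation ?t"
    using tp long_cycle_finite[OF \<tau>] permutation_permutes by (metis finite_insert)
  have "x \<in> orbit ?t ?u" if "x \<in> S" for x
  proof -
    have *: "(?t ^^ rk \<tau> ?u x) ?u = x"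
      using fp[OF that order.refl] rk_prop[OF \<tau>, of ?u x] u that by simp
    show ?thesis unfolding orbit_altdef_permutation[OF p] mem_Collect_eq
      by (rule exI[of _ "rk \<tau> ?u x"]) (simp only: * simp_thms)
  qed
  hence "S = orbit ?t ?u"
    using permutes_orbit_subset[OF tp u] by auto
  thus "long_cycle S ?t" using tp u unfolding long_cycle_def cyclic_on_def by blast
qed

text \<open>Cut at \<open>z\<close>, both enlarged cycles begin with \<open>z\<close>, which
  therefore takes part in no inversion, and continue with the old orders cut at \<open>u\<close> and
  \<open>v\<close>. The odd sets without \<open>z\<close> give the odd sum; those with
  \<open>z\<close> correspond to the even subsets of \<open>S\<close>.\<close>

lemma odd_sum_ins:
  assumes cp: "cycle_pair S t b" and z: "z \<notin> S" and u: "u \<in> S" and v: "v \<in> S"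
  shows "cycle_pair.odd_sum (insert z S) (ins z u t) (ins z v b)
    = cycle_pair.odd_sum S t b + cycle_pair.even_sum S t b u v"
proof -
  interpret cycle_pair S t b by fact
  interpret c: cycle_pair "insert z S" "ins z u t" "ins z v b"
    using long_cycle_ins[OF t z u] long_cycle_ins[OF b z v] by unfold_locales
  have sg: "c.sg z z X = sg u v X" if "X \<subseteq> S" for X
  proof -
    have r: "rk (ins z u t) z x = Suc (rk t u x)" "rk (ins z v b) z x = Suc (rk b v x)" if "x \<in> X" for x
      using that \<open>X \<subseteq> S\<close> rk_ins_z[OF t z u] rk_ins_z[OF b z v] by blast+
    show ?thesis
      unfolding c.sg_def sg_def by (rule inv_sign_cong) (simp add: r)
  qed
  have sg': "c.sg z z (insert z X) = sg u v X" if "X \<subseteq> S" for X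
  proof -
    have "z \<notin> X" using that z by auto
    hence "c.sg z z (insert z X) = c.G z z X"
      using c.sg_toggle_first[of z z X] that by (auto simp: toggle_def)
    thus ?thesis using sg[OF that] by (simp add: c.G_self)
  qed
  have split: "{X. X \<subseteq> insert z S \<and> odd (card X)}
      = {X. X \<subseteq> S \<and> odd (card X)} \<union> insert z ` {X. X \<subseteq> S \<and> even (card X)}" (is "?A = ?B \<union> ?C")
  proof (intro equalityI subsetI)
    fix X assume X: "X \<in> ?A"
    show "X \<in> ?B \<union> ?C"
    proof (cases "z \<in> X")
      case True
      hence "X = insert z (X - {z})" "even (card (X - {z}))"
        using X c.fin_subset[of X] by auto
      moreover have "X - {z} \<subseteq> S" using X by auto
      ultimately show ?thesis by blast
    qed (use X in auto)
  next
    fix X assume "X \<in> ?B \<union> ?C"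
    thus "X \<in> ?A"
    proof
      assume "X \<in> ?C"
      then obtain Y where Y: "X = insert z Y" "Y \<subseteq> S" "even (card Y)" by auto
      moreover have "z \<notin> Y" "finite Y" using Y z fin_subset by auto
      ultimately show ?thesis by auto
    qed auto
  qed
  have "c.odd_sum = (\<Sum>X\<in>?B \<union> ?C. c.sg z z X)"
    using c.odd_sum_eq[of z z] split by simp
  also have "\<dots> = (\<Sum>X\<in>?B. c.sg z z X) + (\<Sum>X\<in>?C. c.sg z z X)"
    by (rule sum.union_disjoint) (use z fin in auto)
  also have "(\<Sum>X\<in>?B. c.sg z z X) = odd_sum"
    unfolding odd_sum_eq[OF u v] by (rule sum.cong) (use sg in auto)
  also have "(\<Sum>X\<in>?C. c.sg z z X) = (\<Sum>X | X \<subseteq> S \<and> even (card X). c.sg z z (insert z X))"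
  proof (rule sum.reindex_cong[where l = "insert z"])
    show "inj_on (insert z) {X. X \<subseteq> S \<and> even (card X)}"
    proof (rule inj_onI)
      fix X Y assume "X \<in> {X. X \<subseteq> S \<and> even (card X)}" "Y \<in> {X. X \<subseteq> S \<and> even (card X)}"
        and eq: "insert z X = insert z Y"
      hence "z \<notin> X" "z \<notin> Y" using z by auto
      thus "X = Y" using eq by (simp add: insert_ident)
    qed
  qed auto
  also have "\<dots> = even_sum u v"
    unfolding even_sum_def by (rule sum.cong) (use sg' in auto)
  finally show ?thesis .
qed

text \<open>What remains of the quotient \<sigma> when \<open>z\<close> is removed from both cycles
  of a pair with \<open>b z = v\<close>, and hence \<open>t z = \<sigma> v\<close>.\<close>

definition reduce :: "'a \<Rightarrow> ('a \<Rightarrow> 'a) \<Rightarrow> 'a \<Rightarrow> 'a \<Rightarrow> 'a" where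
  "reduce z \<sigma> v = Transposition.transpose z (\<sigma> v) \<circ> \<sigma> \<circ> Transposition.transpose z v"

text \<open>The pairs are classified by \<open>v = b z\<close>, which together with \<sigma>
  determines \<open>t z = \<sigma> v\<close>; neither is \<open>z\<close>, as a cycle of at least
  two elements has no fixed point. Removal of \<open>z\<close> is inverted by \<open>ins\<close>,
  and \<open>odd_sum_ins\<close> evaluates the summand, the cuts being \<open>\<sigma> v\<close> and
  \<open>v\<close>.\<close>

lemma odd_total_insert:
  assumes \<sigma>: "\<sigma> permutes insert z S" and fin: "finite S" and z: "z \<notin> S" and S: "S \<noteq> {}"
  shows "odd_total (insert z S) \<sigma> =
    (\<Sum>v | v \<in> S \<and> \<sigma> v \<noteq> z. odd_total S (reduce z \<sigma> v) + even_total S (reduce z \<sigma> v) (\<sigma> v) v)"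
proof -
  let ?V = "{v. v \<in> S \<and> \<sigma> v \<noteq> z}"
  let ?D = "SIGMA v:?V. cyc_pairs S (reduce z \<sigma> v)"
  let ?f = "\<lambda>(v, t, b). (ins z (\<sigma> v) t, ins z v b)"
  let ?g = "\<lambda>(t, b). (b z, ins z (t z) t, ins z (b z) b)"
  have inv_tr: "inv (ins z v b) = inv b \<circ> Transposition.transpose z v" if "bij b" for b v
  proof -
    have "inv (ins z v b) = inv b \<circ> inv (Transposition.transpose z v)"
      by (rule o_inv_distrib[OF permutes_bij[OF permutes_swap_id[of z UNIV v]] that]) auto
    thus ?thesis by simp
  qed
  have fV: "\<sigma> v \<in> S" if "v \<in> ?V" for v
    using that permutes_in_image[OF \<sigma>, of v] by auto
  have "bij_betw ?f ?D (cyc_pairs (insert z S) \<sigma>)"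
  proof (rule bij_betwI[where g = ?g])
    show "?f \<in> ?D \<rightarrow> cyc_pairs (insert z S) \<sigma>"
    proof clarify
      fix v t b assume v: "v \<in> S" "\<sigma> v \<noteq> z" and tb: "(t, b) \<in> cyc_pairs S (reduce z \<sigma> v)"
      have lc: "long_cycle S t" "long_cycle S b" and eq: "t \<circ> inv b = reduce z \<sigma> v"
        using tb by (auto simp: cyc_pairs_def)
      have "ins z (\<sigma> v) t \<circ> inv (ins z v b) = Transposition.transpose z (\<sigma> v) \<circ> (t \<circ> inv b) \<circ> Transposition.transpose z v"
        using inv_tr[OF permutes_bij[OF long_cycle_permutes[OF lc(2)]]] by (simp add: comp_assoc)
      also have "\<dots> = \<sigma>"
        unfolding eq reduce_def by (simp add: fun_eq_iff)
      finally show "(ins z (\<sigma> v) t, ins z v b) \<in> cyc_pairs (insert z S) \<sigma>"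
        using long_cycle_ins[OF lc(1) z fV] long_cycle_ins[OF lc(2) z] v by (auto simp: cyc_pairs_def)
    qed
    show "?g \<in> cyc_pairs (insert z S) \<sigma> \<rightarrow> ?D"
    proof (rule funcsetI)
      fix x assume "x \<in> cyc_pairs (insert z S) \<sigma>"
      then obtain t b where x: "x = (t, b)" and tb: "(t, b) \<in> cyc_pairs (insert z S) \<sigma>" by (cases x) auto
      hence lc: "long_cycle (insert z S) t" "long_cycle (insert z S) b" and eq: "t \<circ> inv b = \<sigma>"
        by (auto simp: cyc_pairs_def)
      have bij: "bij b" using permutes_bij[OF long_cycle_permutes[OF lc(2)]] .
      have tz: "t z = \<sigma> (b z)"
        unfolding eq[symmetric] using permutes_inverses(2)[OF long_cycle_permutes[OF lc(2)]] by simp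
      note rt = long_cycle_remove[OF lc(1) z S] and rb = long_cycle_remove[OF lc(2) z S]
      have "ins z (t z) t \<circ> inv (ins z (b z) b) = Transposition.transpose z (t z) \<circ> (t \<circ> inv b) \<circ> Transposition.transpose z (b z)"
        unfolding inv_tr[OF bij] by (simp add: comp_assoc)
      also have "\<dots> = reduce z \<sigma> (b z)"
        unfolding eq reduce_def tz ..
      finally have "(ins z (t z) t, ins z (b z) b) \<in> cyc_pairs S (reduce z \<sigma> (b z))"
        using rt rb by (simp add: cyc_pairs_def)
      moreover have "b z \<in> ?V" using rb(1) rt(1) tz z by auto
      ultimately show "?g x \<in> ?D" unfolding x by simp
    qed
    show "?g (?f x) = x" if xD: "x \<in> ?D" for x
    proof -
      obtain v t b where x: "x = (v, t, b)" and v: "v \<in> ?V" and tb: "(t, b) \<in> cyc_pairs S (reduce z \<sigma> v)"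
        using xD by (cases x) auto
      have lc: "long_cycle S t" "long_cycle S b" using tb by (auto simp: cyc_pairs_def)
      have "ins z (\<sigma> v) t z = \<sigma> v" "ins z v b z = v"
        using ins_z[OF lc(1) z fV[OF v]] ins_z[OF lc(2) z] v by auto
      thus ?thesis unfolding x by (simp del: comp_apply)
    qed
    show "?f (?g x) = x" if "x \<in> cyc_pairs (insert z S) \<sigma>" for x
    proof -
      obtain t b where x: "x = (t, b)" by (cases x)
      hence lc: "long_cycle (insert z S) b" and eq: "t \<circ> inv b = \<sigma>"
        using that by (auto simp: cyc_pairs_def)
      have tz: "\<sigma> (b z) = t z"
        unfolding eq[symmetric] using permutes_inverses(2)[OF long_cycle_permutes[OF lc]] by simp
      show ?thesis unfolding x by (simp add: tz del: comp_apply)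
    qed
  qed
  hence "odd_total (insert z S) \<sigma> = (\<Sum>x\<in>?D. case ?f x of (t, b) \<Rightarrow> cycle_pair.odd_sum (insert z S) t b)"
    unfolding odd_total_def by (rule sum.reindex_bij_betw[symmetric])
  also have "\<dots> = (\<Sum>x\<in>?D. case x of (v, t, b) \<Rightarrow> cycle_pair.odd_sum S t b + cycle_pair.even_sum S t b (\<sigma> v) v)"
  proof (rule sum.cong, simp, clarify)
    fix v t b assume v: "v \<in> S" "\<sigma> v \<noteq> z" and tb: "(t, b) \<in> cyc_pairs S (reduce z \<sigma> v)"
    show "cycle_pair.odd_sum (insert z S) (ins z (\<sigma> v) t) (ins z v b) =
        cycle_pair.odd_sum S t b + cycle_pair.even_sum S t b (\<sigma> v) v"
      by (rule odd_sum_ins[OF cyc_pairs_locale[OF tb] z]) (use v fV in auto)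
  qed
  also have "\<dots> = (\<Sum>v\<in>?V. \<Sum>(t, b)\<in>cyc_pairs S (reduce z \<sigma> v).
      cycle_pair.odd_sum S t b + cycle_pair.even_sum S t b (\<sigma> v) v)"
    using fin finite_cyc_pairs[OF fin] by (subst sum.Sigma) auto
  also have "\<dots> = (\<Sum>v\<in>?V. odd_total S (reduce z \<sigma> v) + even_total S (reduce z \<sigma> v) (\<sigma> v) v)"
    unfolding odd_total_def even_total_def by (simp add: sum.distrib case_prod_unfold)
  finally show ?thesis .
qed

section \<open>Cycles of the quotient after the removal of an element\<close>

lemma orbit_in_iff:
  assumes "\<sigma> permutes S" "finite S"
  shows "\<sigma> x \<in> orbit \<sigma> y \<longleftrightarrow> x \<in> orbit \<sigma> y"
  using cyclic_on_f_in[OF assms(1) cyclic_on_orbit[OF assms]] orbit.step by metis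

lemma orbit_self:
  assumes "\<sigma> permutes S" "finite S"
  shows "x \<in> orbit \<sigma> x"
  using assms permutation_permutes permutation_self_in_orbit by metis

lemma orbit_eq:
  assumes "\<sigma> permutes S" "finite S" "y \<in> orbit \<sigma> x"
  shows "orbit \<sigma> y = orbit \<sigma> x"
  using orbit_cyclic_eq3[OF cyclic_on_orbit[OF assms(1,2)] assms(3)] .

lemma finite_orbit_permutes:
  assumes "\<sigma> permutes S" "finite S"
  shows "finite (orbit \<sigma> x)"
  by (rule finite_orbit[OF orbit_self[OF assms]])

lemma funpow_in_orbit_self:
  assumes "\<sigma> permutes S" "finite S"
  shows "(\<sigma> ^^ n) x \<in> orbit \<sigma> x"
  by (rule funpow_in_orbit[OF orbit_self[OF assms]])

context
  fixes S :: "'a set" and z v :: 'a and \<sigma> :: "'a \<Rightarrow> 'a"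
  assumes \<sigma>: "\<sigma> permutes insert z S" and fin: "finite S" and z: "z \<notin> S" and v: "v \<in> S" and vz: "\<sigma> v \<noteq> z"
begin

private abbreviation "\<sigma>' \<equiv> reduce z \<sigma> v"
private abbreviation "l \<equiv> card (orbit \<sigma> z)"

private lemma fin': "finite (insert z S)" using fin by simp
private lemma inj: "\<sigma> x = \<sigma> y \<longleftrightarrow> x = y" using permutes_inj[OF \<sigma>] by (metis injD)
private lemma v_z: "v \<noteq> z" using v z by auto

lemma reduce_z: "\<sigma>' z = z"
  by (simp add: reduce_def)

lemma reduce_permutes: "\<sigma>' permutes S"
proof (rule permutes_superset)
  show "\<sigma>' permutes insert z S"
    unfolding reduce_def
    by (intro permutes_compose \<sigma> permutes_swap_id) (use v permutes_in_image[OF \<sigma>] in auto)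
qed (use reduce_z in auto)

lemma reduce_other: "x \<noteq> z \<Longrightarrow> x \<noteq> v \<Longrightarrow> \<sigma> x \<noteq> z \<Longrightarrow> \<sigma>' x = \<sigma> x"
  using inj by (simp add: reduce_def)

lemma reduce_pred:
  assumes "x \<noteq> z" "\<sigma> x = z"
  shows "\<sigma>' x = \<sigma> v"
proof -
  have "x \<noteq> v" using assms vz by auto
  thus ?thesis using assms by (simp add: reduce_def)
qed

lemma reduce_v: "\<sigma>' v = (if \<sigma> z = z then \<sigma> v else \<sigma> z)"
  using inj v_z by (simp add: reduce_def)

private lemmas per = orbit_period[OF \<sigma> fin', where x = z]

lemma orbit_pow_neq: "0 < i \<Longrightarrow> i < l \<Longrightarrow> (\<sigma> ^^ i) z \<noteq> z"
  using per(3)[of i 0] per(2) by auto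

text \<open>In \<open>reduce z \<sigma> v\<close> the element \<open>v\<close> takes over the
  successor of \<open>z\<close>, so its powers follow the orbit of \<open>z\<close> under \<sigma>
  until that orbit returns to \<open>z\<close> or meets \<open>v\<close>.\<close>

lemma reduce_path:
  "0 < i \<Longrightarrow> i < l \<Longrightarrow> (\<And>j. 0 < j \<Longrightarrow> j < i \<Longrightarrow> (\<sigma> ^^ j) z \<noteq> v) \<Longrightarrow> (\<sigma>' ^^ i) v = (\<sigma> ^^ i) z"
proof (induction i)
  case (Suc i)
  show ?case
  proof (cases "i = 0")
    case True
    thus ?thesis using orbit_pow_neq[of 1] Suc.prems reduce_v by auto
  next
    case False
    hence "(\<sigma>' ^^ i) v = (\<sigma> ^^ i) z" using Suc by auto
    thus ?thesis
      using reduce_other[of "(\<sigma> ^^ i) z"] False Suc.prems orbit_pow_neq[of i] orbit_pow_neq[of "Suc i"] by auto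
  qed
qed simp

context
  assumes merge: "v \<notin> orbit \<sigma> z"
begin

lemma merge_pow:
  assumes "0 < i" "i < l"
  shows "(\<sigma>' ^^ i) v = (\<sigma> ^^ i) z"
  using reduce_path[OF assms] merge funpow_in_orbit_self[OF \<sigma> fin'] by metis

text \<open>After \<open>l\<close> steps the path leaves the former cycle of \<open>z\<close> and
  enters that of \<open>v\<close> at \<open>\<sigma> v\<close>. This distance fixes the sign in
  \<open>even_total_reach\<close>.\<close>

lemma merge_full: "(\<sigma>' ^^ l) v = \<sigma> v"
proof (cases "l = 1")
  case True
  thus ?thesis using per(1) reduce_v by simp
next
  case False
  then obtain m where m: "l = Suc m" "0 < m" using per(2) by (cases l) auto
  have "(\<sigma>' ^^ m) v = (\<sigma> ^^ m) z" "(\<sigma> ^^ m) z \<noteq> z"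
    using merge_pow[of m] orbit_pow_neq[of m] m by auto
  moreover have "\<sigma> ((\<sigma> ^^ m) z) = z" using per(1) m by simp
  ultimately show ?thesis using m reduce_pred by simp
qed

lemma merge_neq:
  assumes "0 < i" "i < l"
  shows "(\<sigma>' ^^ i) v \<noteq> \<sigma> v"
proof
  assume "(\<sigma>' ^^ i) v = \<sigma> v"
  hence "\<sigma> v \<in> orbit \<sigma> z"
    using merge_pow[OF assms] funpow_in_orbit_self[OF \<sigma> fin', of i z] by simp
  thus False using merge orbit_in_iff[OF \<sigma> fin'] by simp
qed

private lemma z_v: "z \<notin> orbit \<sigma> v"
  using orbit_eq[OF \<sigma> fin'] orbit_self[OF \<sigma> fin', of v] merge by metis

text \<open>The old cycle of \<open>z\<close> is covered by \<open>merge_pow\<close>. The old cycle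
  of \<open>v\<close> is followed by induction, where \<open>merge_full\<close> bridges the step
  from \<open>v\<close> to \<open>\<sigma> v\<close>.\<close>

lemma orbit_merge: "orbit \<sigma>' v = (orbit \<sigma> z \<union> orbit \<sigma> v) - {z}"
proof (intro equalityI subsetI)
  note in_iff = orbit_in_iff[OF \<sigma> fin']
  note self = orbit_self[OF \<sigma> fin'] orbit_self[OF reduce_permutes fin]
  fix x
  {
    assume "x \<in> orbit \<sigma>' v"
    thus "x \<in> (orbit \<sigma> z \<union> orbit \<sigma> v) - {z}"
    proof (induction rule: orbit.induct)
      case base
      show ?case using reduce_v self vz in_iff by auto
    next
      case (step y)
      have "\<sigma>' y \<in> orbit \<sigma> z \<union> orbit \<sigma> v"
      proof (cases "y = v \<or> \<sigma> y = z")
        case True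
        thus ?thesis using reduce_v reduce_pred[of y] step self in_iff by auto
      qed (use step reduce_other[of y] in_iff in auto)
      moreover have "\<sigma>' y \<noteq> z"
        using step permutes_inj[OF reduce_permutes] reduce_z by (metis DiffE injD insertI1)
      ultimately show ?case by simp
    qed
  }
  {
    assume x: "x \<in> (orbit \<sigma> z \<union> orbit \<sigma> v) - {z}"
    show "x \<in> orbit \<sigma>' v"
    proof (cases "x \<in> orbit \<sigma> z")
      case True
      then obtain i where i: "x = (\<sigma> ^^ i) z" "i < l" using per(4) by blast
      hence "i > 0" using x by (cases i) auto
      thus ?thesis using merge_pow[of i] i funpow_in_orbit[OF self(2), of i v] by simp
    next
      case False
      have "(\<sigma> ^^ n) v \<in> orbit \<sigma>' v" for n
      proof (induction n)
        case 0
        show ?case using self by simp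
      next
        case (Suc n)
        let ?w = "(\<sigma> ^^ n) v"
        show ?case
        proof (cases "?w = v")
          case True
          thus ?thesis using merge_full funpow_in_orbit[OF self(2), of l v] by simp
        next
          case False
          have "?w \<in> orbit \<sigma> v" by (rule funpow_in_orbit_self[OF \<sigma> fin'])
          hence "?w \<noteq> z" "\<sigma> ?w \<noteq> z" using z_v in_iff by metis+
          thus ?thesis using orbit.step[OF Suc.IH] reduce_other[of ?w] False by simp
        qed
      qed
      moreover obtain i where "x = (\<sigma> ^^ i) v"
        using orbit_period(4)[OF \<sigma> fin', of v] x False by blast
      ultimately show ?thesis by simp
    qed
  }
qed

lemma orbit_merge_other:
  assumes "x \<notin> orbit \<sigma> z" "x \<notin> orbit \<sigma> v"
  shows "orbit \<sigma>' x = orbit \<sigma> x"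
proof (rule orbit_cong[OF orbit_self[OF \<sigma> fin']])
  fix s assume s: "s \<in> orbit \<sigma> x"
  have "s \<notin> orbit \<sigma> z" "s \<notin> orbit \<sigma> v"
    using orbit_eq[OF \<sigma> fin' s] orbit_eq[OF \<sigma> fin', of s] orbit_self[OF \<sigma> fin', of x] assms by metis+
  hence "s \<noteq> z" "s \<noteq> v" "\<sigma> s \<noteq> z"
    using orbit_self[OF \<sigma> fin'] orbit_in_iff[OF \<sigma> fin'] by metis+
  thus "\<sigma>' s = \<sigma> s" by (rule reduce_other)
qed

lemma orbits_merge:
  "orbit \<sigma>' ` S = (orbit \<sigma> ` insert z S - {orbit \<sigma> z, orbit \<sigma> v}) \<union> {(orbit \<sigma> z \<union> orbit \<sigma> v) - {z}}"
proof (intro equalityI subsetI)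
  fix A assume "A \<in> orbit \<sigma>' ` S"
  then obtain x where x: "x \<in> S" "A = orbit \<sigma>' x" by auto
  show "A \<in> (orbit \<sigma> ` insert z S - {orbit \<sigma> z, orbit \<sigma> v}) \<union> {(orbit \<sigma> z \<union> orbit \<sigma> v) - {z}}"
  proof (cases "x \<in> orbit \<sigma> z \<union> orbit \<sigma> v")
    case True
    hence "x \<in> orbit \<sigma>' v" using orbit_merge x z by auto
    hence "A = (orbit \<sigma> z \<union> orbit \<sigma> v) - {z}"
      using orbit_eq[OF reduce_permutes fin, of x v] orbit_merge x by simp
    thus ?thesis by blast
  next
    case False
    thus ?thesis using orbit_merge_other[of x] x orbit_self[OF \<sigma> fin', of x] by auto
  qed
next
  fix A assume A: "A \<in> (orbit \<sigma> ` insert z S - {orbit \<sigma> z, orbit \<sigma> v}) \<union> {(orbit \<sigma> z \<union> orbit \<sigma> v) - {z}}"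
  show "A \<in> orbit \<sigma>' ` S"
  proof (cases "A = (orbit \<sigma> z \<union> orbit \<sigma> v) - {z}")
    case True
    thus ?thesis using orbit_merge v by auto
  next
    case False
    then obtain x where x: "x \<in> insert z S" "A = orbit \<sigma> x" "A \<noteq> orbit \<sigma> z" "A \<noteq> orbit \<sigma> v"
      using A by auto
    hence "x \<notin> orbit \<sigma> z" "x \<notin> orbit \<sigma> v" using orbit_eq[OF \<sigma> fin'] by metis+
    thus ?thesis using orbit_merge_other[of x] x by auto
  qed
qed

lemma card_orbits_merge: "Suc (card (orbit \<sigma>' ` S)) = card (orbit \<sigma> ` insert z S)"
proof -
  let ?O = "orbit \<sigma> ` insert z S" and ?A = "orbit \<sigma> z" and ?B = "orbit \<sigma> v"
  have AB: "?A \<in> ?O" "?B \<in> ?O" using v by auto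
  have "?A \<noteq> ?B" using merge orbit_self[OF \<sigma> fin', of v] by auto
  hence c: "card {?A, ?B} = 2" by simp
  have new: "(?A \<union> ?B) - {z} \<notin> ?O - {?A, ?B}"
  proof
    assume "(?A \<union> ?B) - {z} \<in> ?O - {?A, ?B}"
    then obtain x where x: "(?A \<union> ?B) - {z} = orbit \<sigma> x" "orbit \<sigma> x \<noteq> ?B" by auto
    have "v \<in> orbit \<sigma> x" using x(1) orbit_self[OF \<sigma> fin', of v] v_z by auto
    thus False using orbit_eq[OF \<sigma> fin'] x(2) by metis
  qed
  have finO: "finite ?O" using fin by simp
  have "card (?O - {?A, ?B}) = card ?O - 2"
    using card_Diff_subset[of "{?A, ?B}" ?O] AB c by simp
  moreover have "2 \<le> card ?O" using card_mono[OF finO, of "{?A, ?B}"] AB c by simp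
  ultimately show ?thesis
    unfolding orbits_merge using new finO by (simp add: card_insert_if)
qed

text \<open>Cycles of lengths \<open>a\<close> and \<open>c\<close> are replaced by one of length
  \<open>a + c - 1\<close>.\<close>

lemma odd_merge:
  assumes "\<And>x. x \<in> insert z S \<Longrightarrow> odd (card (orbit \<sigma> x))" "x \<in> S"
  shows "odd (card (orbit \<sigma>' x))"
proof (cases "x \<in> orbit \<sigma> z \<union> orbit \<sigma> v")
  case True
  hence "x \<in> orbit \<sigma>' v" using orbit_merge assms z by auto
  hence "orbit \<sigma>' x = (orbit \<sigma> z \<union> orbit \<sigma> v) - {z}"
    using orbit_eq[OF reduce_permutes fin] orbit_merge by auto
  moreover have "orbit \<sigma> z \<inter> orbit \<sigma> v = {}"
  proof (rule ccontr)
    assume "orbit \<sigma> z \<inter> orbit \<sigma> v \<noteq> {}"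
    then obtain y where "y \<in> orbit \<sigma> z" "y \<in> orbit \<sigma> v" by auto
    hence "orbit \<sigma> z = orbit \<sigma> v" using orbit_eq[OF \<sigma> fin'] by metis
    thus False using merge orbit_self[OF \<sigma> fin', of v] by simp
  qed
  moreover have "card (orbit \<sigma> z \<union> orbit \<sigma> v) = card (orbit \<sigma> z) + card (orbit \<sigma> v)"
    by (rule card_Un_disjoint) (use calculation finite_orbit_permutes[OF \<sigma> fin'] in auto)
  moreover have "card (orbit \<sigma> z \<union> orbit \<sigma> v - {z}) = card (orbit \<sigma> z \<union> orbit \<sigma> v) - 1"
    using orbit_self[OF \<sigma> fin', of z] by (intro card_Diff_singleton) auto
  ultimately show ?thesis
    using assms(1)[of z] assms(1)[of v] v per(2) by simp
next
  case False
  thus ?thesis using orbit_merge_other[of x] assms by simp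
qed

end

context
  fixes j :: nat
  assumes split: "v = (\<sigma> ^^ j) z" and j: "0 < j" "j < l"
begin

text \<open>\<open>j = l - 1\<close> would mean \<open>\<sigma> v = z\<close>, which is
  excluded.\<close>

lemma split_bound: "Suc j < l"
proof (rule ccontr)
  assume "\<not> Suc j < l"
  hence "l = Suc j" using j by simp
  thus False using per(1) split vz by simp
qed

lemma split_pow1:
  assumes "0 < i" "i \<le> j"
  shows "(\<sigma>' ^^ i) v = (\<sigma> ^^ i) z"
proof (rule reduce_path)
  show "(\<sigma> ^^ i') z \<noteq> v" if "0 < i'" "i' < i" for i'
    using per(3)[of i' j] that assms j split by auto
qed (use assms j in auto)

lemma split_pow2:
  assumes "j + i < l - 1"
  shows "(\<sigma>' ^^ i) (\<sigma> v) = (\<sigma> ^^ (Suc j + i)) z"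
  using assms
proof (induction i)
  case 0
  show ?case using split by simp
next
  case (Suc i)
  let ?w = "(\<sigma> ^^ (Suc j + i)) z"
  have "?w \<noteq> z" "\<sigma> ?w \<noteq> z" using orbit_pow_neq[of "Suc j + i"] orbit_pow_neq[of "Suc j + Suc i"] Suc.prems by auto
  moreover have "?w \<noteq> v"
  proof -
    have "Suc j + i < l" using Suc.prems by simp
    thus ?thesis using per(3)[of "Suc j + i" j] j split by auto
  qed
  ultimately show ?case using Suc reduce_other[of ?w] by simp
qed

text \<open>The cycle of \<open>z\<close> without \<open>z\<close> falls into the segment that ends
  at \<open>v\<close> and the segment that begins at \<open>\<sigma> v\<close>, each closing up
  separately; the lengths are \<open>j\<close> and \<open>l - 1 - j\<close>.\<close>

lemma orbit_split1: "orbit \<sigma>' v = (\<lambda>i. (\<sigma> ^^ i) z) ` {1..j}"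
proof -
  have "(\<sigma>' ^^ j) v = v" using split_pow1[of j] j split by simp
  hence "orbit \<sigma>' v = {(\<sigma>' ^^ m) v | m. m < j}" using j by (intro orbit_altdef_bounded) auto
  also have "\<dots> = (\<lambda>i. (\<sigma> ^^ i) z) ` {1..j}"
  proof (intro equalityI subsetI)
    fix x assume "x \<in> {(\<sigma>' ^^ m) v | m. m < j}"
    then obtain m where m: "m < j" "x = (\<sigma>' ^^ m) v" by auto
    show "x \<in> (\<lambda>i. (\<sigma> ^^ i) z) ` {1..j}"
    proof (cases "m = 0")
      case True
      thus ?thesis using m split j by auto
    qed (use m split_pow1[of m] in auto)
  next
    fix x assume "x \<in> (\<lambda>i. (\<sigma> ^^ i) z) ` {1..j}"
    then obtain i where i: "i \<in> {1..j}" "x = (\<sigma> ^^ i) z" by auto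
    show "x \<in> {(\<sigma>' ^^ m) v | m. m < j}"
    proof (cases "i = j")
      case True
      thus ?thesis using i split j by (auto intro: exI[of _ 0])
    next
      case False
      thus ?thesis using i split_pow1[of i] by (auto intro!: exI[of _ i])
    qed
  qed
  finally show ?thesis .
qed

lemma orbit_split2: "orbit \<sigma>' (\<sigma> v) = (\<lambda>i. (\<sigma> ^^ i) z) ` {Suc j..<l}"
proof -
  let ?n = "l - 1 - j"
  have n: "0 < ?n" using split_bound by simp
  then obtain m where m: "?n = Suc m" using gr0_implies_Suc by blast
  have lm: "l = Suc (Suc j + m)" using m split_bound by simp
  have "(\<sigma>' ^^ m) (\<sigma> v) = (\<sigma> ^^ (Suc j + m)) z" by (rule split_pow2) (use m in simp)
  moreover have "(\<sigma> ^^ (Suc j + m)) z \<noteq> z" by (rule orbit_pow_neq) (use lm in auto)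
  moreover have "\<sigma> ((\<sigma> ^^ (Suc j + m)) z) = z" using per(1) lm by simp
  ultimately have "(\<sigma>' ^^ ?n) (\<sigma> v) = \<sigma> v" unfolding m using reduce_pred by simp
  hence "orbit \<sigma>' (\<sigma> v) = {(\<sigma>' ^^ m) (\<sigma> v) | m. m < ?n}" using n by (rule orbit_altdef_bounded)
  also have "\<dots> = (\<lambda>i. (\<sigma> ^^ i) z) ` {Suc j..<l}"
  proof (intro equalityI subsetI)
    fix x assume "x \<in> {(\<sigma>' ^^ m) (\<sigma> v) | m. m < ?n}"
    then obtain m where "m < ?n" "x = (\<sigma>' ^^ m) (\<sigma> v)" by auto
    thus "x \<in> (\<lambda>i. (\<sigma> ^^ i) z) ` {Suc j..<l}" using split_pow2[of m] by (auto intro!: image_eqI[of _ _ "Suc j + m"])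
  next
    fix x assume "x \<in> (\<lambda>i. (\<sigma> ^^ i) z) ` {Suc j..<l}"
    then obtain i where i: "i \<in> {Suc j..<l}" "x = (\<sigma> ^^ i) z" by auto
    hence "x = (\<sigma>' ^^ (i - Suc j)) (\<sigma> v)" "i - Suc j < ?n" using split_pow2[of "i - Suc j"] by auto
    thus "x \<in> {(\<sigma>' ^^ m) (\<sigma> v) | m. m < ?n}" by blast
  qed
  finally show ?thesis .
qed

private lemma inj_pow: "inj_on (\<lambda>i. (\<sigma> ^^ i) z) {..<l}"
  using per(3) by (auto simp: inj_on_def)

lemma card_split: "card (orbit \<sigma>' v) = j" "card (orbit \<sigma>' (\<sigma> v)) = l - 1 - j"
proof -
  show "card (orbit \<sigma>' v) = j"
    unfolding orbit_split1 by (subst card_image) (use j in \<open>auto intro: inj_on_subset[OF inj_pow]\<close>)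
  show "card (orbit \<sigma>' (\<sigma> v)) = l - 1 - j"
    unfolding orbit_split2 by (subst card_image) (auto intro: inj_on_subset[OF inj_pow])
qed

lemma split_disjoint: "orbit \<sigma>' v \<inter> orbit \<sigma>' (\<sigma> v) = {}"
proof -
  have "i = i'" if "(\<sigma> ^^ i) z = (\<sigma> ^^ i') z" "i \<in> {1..j}" "i' \<in> {Suc j..<l}" for i i'
    using per(3)[of i i'] that j by auto
  thus ?thesis unfolding orbit_split1 orbit_split2 by fastforce
qed

lemma split_union: "orbit \<sigma>' v \<union> orbit \<sigma>' (\<sigma> v) = orbit \<sigma> z - {z}"
proof -
  have "{1..j} \<union> {Suc j..<l} = {1..<l}" using j by auto
  hence "orbit \<sigma>' v \<union> orbit \<sigma>' (\<sigma> v) = (\<lambda>i. (\<sigma> ^^ i) z) ` {1..<l}"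
    unfolding orbit_split1 orbit_split2 by (simp flip: image_Un)
  also have "\<dots> = orbit \<sigma> z - {z}"
  proof (intro equalityI subsetI)
    fix x assume "x \<in> orbit \<sigma> z - {z}"
    then obtain i where i: "x = (\<sigma> ^^ i) z" "i < l" "x \<noteq> z" using per(4) by blast
    hence "i \<noteq> 0" by (cases i) auto
    thus "x \<in> (\<lambda>i. (\<sigma> ^^ i) z) ` {1..<l}" using i by auto
  qed (use orbit_pow_neq funpow_in_orbit_self[OF \<sigma> fin'] in auto)
  finally show ?thesis .
qed

lemma orbit_split_other:
  assumes "x \<notin> orbit \<sigma> z"
  shows "orbit \<sigma>' x = orbit \<sigma> x"
proof (rule orbit_cong[OF orbit_self[OF \<sigma> fin']])
  fix s assume s: "s \<in> orbit \<sigma> x"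
  have "s \<notin> orbit \<sigma> z"
    using orbit_eq[OF \<sigma> fin' s] orbit_eq[OF \<sigma> fin', of s] orbit_self[OF \<sigma> fin', of x] assms by metis
  moreover have "v \<in> orbit \<sigma> z" using split funpow_in_orbit_self[OF \<sigma> fin'] by simp
  ultimately have "s \<noteq> z" "s \<noteq> v" "\<sigma> s \<noteq> z"
    using orbit_self[OF \<sigma> fin'] orbit_in_iff[OF \<sigma> fin'] by metis+
  thus "\<sigma>' s = \<sigma> s" by (rule reduce_other)
qed

lemma orbits_split:
  "orbit \<sigma>' ` S = (orbit \<sigma> ` insert z S - {orbit \<sigma> z}) \<union> {orbit \<sigma>' v, orbit \<sigma>' (\<sigma> v)}"
proof (intro equalityI subsetI)
  fix A assume "A \<in> orbit \<sigma>' ` S"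
  then obtain x where x: "x \<in> S" "A = orbit \<sigma>' x" by auto
  show "A \<in> (orbit \<sigma> ` insert z S - {orbit \<sigma> z}) \<union> {orbit \<sigma>' v, orbit \<sigma>' (\<sigma> v)}"
  proof (cases "x \<in> orbit \<sigma> z")
    case True
    hence "x \<in> orbit \<sigma>' v \<union> orbit \<sigma>' (\<sigma> v)" using split_union x z by auto
    thus ?thesis using orbit_eq[OF reduce_permutes fin] x by blast
  next
    case False
    thus ?thesis using orbit_split_other[of x] x orbit_self[OF \<sigma> fin', of x] by auto
  qed
next
  fix A assume A: "A \<in> (orbit \<sigma> ` insert z S - {orbit \<sigma> z}) \<union> {orbit \<sigma>' v, orbit \<sigma>' (\<sigma> v)}"
  show "A \<in> orbit \<sigma>' ` S"
  proof (cases "A \<in> {orbit \<sigma>' v, orbit \<sigma>' (\<sigma> v)}")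
    case True
    moreover have "\<sigma> v \<in> S" using vz v permutes_in_image[OF \<sigma>, of v] by auto
    ultimately show ?thesis using v by auto
  next
    case False
    then obtain x where x: "x \<in> insert z S" "A = orbit \<sigma> x" "A \<noteq> orbit \<sigma> z"
      using A by auto
    hence "x \<notin> orbit \<sigma> z" using orbit_eq[OF \<sigma> fin'] by metis
    thus ?thesis using orbit_split_other[of x] x by auto
  qed
qed

lemma card_orbits_split: "card (orbit \<sigma>' ` S) = Suc (card (orbit \<sigma> ` insert z S))"
proof -
  let ?O = "orbit \<sigma> ` insert z S" and ?A = "orbit \<sigma>' v" and ?B = "orbit \<sigma>' (\<sigma> v)"
  have "?A \<noteq> ?B" using split_disjoint orbit_nonempty[of \<sigma>' v] by auto
  hence c: "card {?A, ?B} = 2" by simp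
  have new: "(?O - {orbit \<sigma> z}) \<inter> {?A, ?B} = {}"
  proof -
    have "C \<notin> {?A, ?B}" if C: "C \<in> ?O - {orbit \<sigma> z}" for C
    proof
      assume "C \<in> {?A, ?B}"
      hence sub: "C \<subseteq> orbit \<sigma> z" "C \<noteq> {}" using split_union orbit_nonempty[of \<sigma>'] by auto
      obtain x where x: "C = orbit \<sigma> x" "C \<noteq> orbit \<sigma> z" using C by blast
      hence "x \<in> orbit \<sigma> z" using sub orbit_self[OF \<sigma> fin', of x] by auto
      thus False using orbit_eq[OF \<sigma> fin'] x by metis
    qed
    thus ?thesis by blast
  qed
  have "card (orbit \<sigma>' ` S) = card (?O - {orbit \<sigma> z}) + card {?A, ?B}"
    unfolding orbits_split by (rule card_Un_disjoint) (use fin new in auto)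
  also have "card (?O - {orbit \<sigma> z}) = card ?O - 1"
    by (rule card_Diff_singleton) simp
  finally show ?thesis using c fin card_gt_0_iff[of ?O] by simp
qed

text \<open>As \<open>l\<close> is odd, \<open>j\<close> and \<open>l - 1 - j\<close> have the same
  parity.\<close>

lemma odd_split:
  assumes "\<And>x. x \<in> insert z S \<Longrightarrow> odd (card (orbit \<sigma> x))" "odd j" "x \<in> S"
  shows "odd (card (orbit \<sigma>' x))"
proof (cases "x \<in> orbit \<sigma> z")
  case True
  hence "x \<in> orbit \<sigma>' v \<or> x \<in> orbit \<sigma>' (\<sigma> v)" using split_union assms z by blast
  hence "orbit \<sigma>' x = orbit \<sigma>' v \<or> orbit \<sigma>' x = orbit \<sigma>' (\<sigma> v)"
    using orbit_eq[OF reduce_permutes fin] by blast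
  thus ?thesis using card_split assms(1)[of z] assms(2) split_bound by auto
next
  case False
  thus ?thesis using orbit_split_other[of x] assms by simp
qed

lemma split_separate: "\<sigma> v \<notin> orbit \<sigma>' v"
  using split_disjoint orbit_self[OF reduce_permutes fin, of "\<sigma> v"] by auto

end

end

section \<open>The sum over all pairs of cycles\<close>

lemma odd_total_singleton: "odd_total {z} id = 1"
proof -
  have lc: "long_cycle {z} \<tau> \<longleftrightarrow> \<tau> = id" for \<tau> :: "'a \<Rightarrow> 'a"
  proof
    have "cyclic_on id {z}" using orbit_eq_singleton_iff[of id z] by (intro cyclic_on_singleI[of z]) simp_all
    thus "\<tau> = id \<Longrightarrow> long_cycle {z} \<tau>" by (simp add: long_cycle_def)
  qed (simp add: long_cycle_def)
  have "inv id = id" by (rule inv_id)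
  hence pairs: "cyc_pairs {z} id = {(id, id)}" unfolding cyc_pairs_def lc by (auto simp del: id_apply)
  interpret cycle_pair "{z}" id id using lc by (simp add: cycle_pair_def)
  have sets: "{X. X \<subseteq> {z} \<and> odd (card X)} = {{z}}"
  proof -
    have "X = {z}" if "X \<subseteq> {z}" "odd (card X)" for X
      using that by (cases "X = {}") auto
    thus ?thesis by auto
  qed
  have "odd_sum = sg z z {z}" using odd_sum_eq[of z z] by (simp add: sets)
  also have "\<dots> = 1" proof -
    have "{(x, y). x \<in> {z} \<and> y \<in> {z} \<and> rk id z x < rk id z y \<and> rk id z y < rk id z x} = {}" by auto
    thus ?thesis unfolding sg_def inv_sign_def inv_count_def by (simp only: card.empty power_0)
  qed
  finally show ?thesis by (simp add: odd_total_def pairs)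
qed

lemma sum_odd_interval: "(\<Sum>j\<in>{1..<2 * m}. if odd j then (M::int) else 0) = int m * M"
proof (induction m)
  case (Suc m)
  show ?case
  proof (cases "m = 0")
    case False
    hence "{1..<2 * Suc m} = insert (2 * m + 1) (insert (2 * m) {1..<2 * m})" by auto
    thus ?thesis using Suc by (simp add: algebra_simps)
  next
    case True
    have "{1..<2} = {1::nat}" by auto
    thus ?thesis using True by simp
  qed
qed simp

text \<open>Write \<open>n\<close> for the size of \<open>S\<close> and \<open>l = 2 * h + 1\<close>
  for the length of the cycle of \<open>z\<close>. Each of the \<open>n + 1 - l\<close> elements
  \<open>v\<close> outside this cycle contributes half of \<open>M\<close>: there is one cycle
  fewer, but the odd and even totals agree. Inside, the \<open>h\<close> positions with odd
  \<open>j\<close> contribute \<open>M\<close> each: there is one cycle more, and the even total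
  vanishes. Twice the total is therefore \<open>(n + 1 - l + 2 * h) * M = n * M\<close>.\<close>

theorem odd_total_odd_type:
  assumes "finite S" "S \<noteq> {}" "\<sigma> permutes S" "\<And>x. x \<in> S \<Longrightarrow> odd (card (orbit \<sigma> x))"
  shows "odd_total S \<sigma> = fact (card S - 1) * 2 ^ (card (orbit \<sigma> ` S) - 1)"
  using assms
proof (induction S arbitrary: \<sigma> rule: finite_ne_induct)
  case (singleton z)
  hence "\<sigma> = id" by simp
  thus ?case by (simp add: odd_total_singleton del: id_apply)
next
  case (insert z S)
  note fin = insert.hyps(1) and z = insert.hyps(3) and \<sigma> = insert.prems(1) and odd = insert.prems(2)
  have fin': "finite (insert z S)" using fin by simp
  note per = orbit_period[OF \<sigma> fin', where x = z]
  let ?l = "card (orbit \<sigma> z)" and ?k = "card (orbit \<sigma> ` insert z S)" and ?n = "card S"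
  define M where "M = (fact (?n - 1) * 2 ^ ?k :: int)"
  let ?V = "{v. v \<in> S \<and> \<sigma> v \<noteq> z}"
  let ?F = "\<lambda>v. odd_total S (reduce z \<sigma> v) + even_total S (reduce z \<sigma> v) (\<sigma> v) v"
  have n: "0 < ?n" using insert.hyps by (simp add: card_gt_0_iff)
  have k: "0 < ?k" using fin by (simp add: card_gt_0_iff)
  have \<sigma>S: "\<sigma> v \<in> S" if "v \<in> ?V" for v
    using that permutes_in_image[OF \<sigma>, of v] by auto
  have merge: "2 * ?F v = M" if v: "v \<in> ?V" "v \<notin> orbit \<sigma> z" for v
  proof -
    have vS: "v \<in> S" and vz: "\<sigma> v \<noteq> z" using v by auto
    note ctx = \<sigma> fin z vS vz
    let ?\<sigma>' = "reduce z \<sigma> v"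
    obtain m where m: "?l = Suc m" using per(2) gr0_implies_Suc by blast
    have "even m" using odd[of z] m by simp
    have "even_total S ?\<sigma>' (\<sigma> v) v = (-1) ^ m * odd_total S ?\<sigma>'"
    proof (rule even_total_reach)
      show "(?\<sigma>' ^^ Suc m) v = \<sigma> v" using merge_full[OF ctx v(2)] m by simp
      show "(?\<sigma>' ^^ j) v \<noteq> \<sigma> v" if "0 < j" "j \<le> m" for j
        using merge_neq[OF ctx v(2), of j] that m by simp
    qed (use v \<sigma>S in auto)
    \<comment> \<open>The transport from \<open>v\<close> to \<open>\<sigma> v\<close> takes
      \<open>l - 1\<close> sign changes, an even number.\<close>
    hence "?F v = 2 * odd_total S ?\<sigma>'" using \<open>even m\<close> by simp
    moreover have "odd_total S ?\<sigma>' = fact (?n - 1) * 2 ^ (card (orbit ?\<sigma>' ` S) - 1)"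
      by (rule insert.IH[OF reduce_permutes[OF ctx] odd_merge[OF ctx v(2) odd]])
    moreover have "0 < card (orbit ?\<sigma>' ` S)"
      using fin insert.hyps(2) by (simp add: card_gt_0_iff)
    then obtain c where c: "card (orbit ?\<sigma>' ` S) = Suc c" using gr0_implies_Suc by blast
    moreover have "?k = Suc (Suc c)" using card_orbits_merge[OF ctx v(2)] c by simp
    ultimately show ?thesis by (simp add: M_def)
  qed
  have split: "?F v = (if odd j then M else 0)" if v: "v = (\<sigma> ^^ j) z" "0 < j" "j < ?l - 1" for v j
  proof -
    have jl: "j < ?l" "Suc j < ?l" using v by auto
    have "v \<noteq> z" using per(3)[of j 0] v jl per(2) by auto
    moreover have "v \<in> insert z S"
      using permutes_orbit_subset[OF \<sigma>, of z] funpow_in_orbit_self[OF \<sigma> fin', of j z] v by auto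
    ultimately have vS: "v \<in> S" by simp
    have vz: "\<sigma> v \<noteq> z" using per(3)[of "Suc j" 0] v jl per(2) by auto
    note ctx = \<sigma> fin z vS vz v(1,2) jl(1)
    let ?\<sigma>' = "reduce z \<sigma> v"
    have E: "even_total S ?\<sigma>' (\<sigma> v) v = 0"
      by (rule even_total_separate[OF reduce_permutes[OF ctx(1-5)] fin _ vS split_separate[OF ctx]])
         (use \<sigma>S vS vz in auto)
    show ?thesis
    proof (cases "odd j")
      case True
      have "odd_total S ?\<sigma>' = fact (?n - 1) * 2 ^ (card (orbit ?\<sigma>' ` S) - 1)"
        by (rule insert.IH[OF reduce_permutes[OF ctx(1-5)] odd_split[OF ctx odd True]])
      thus ?thesis using True E card_orbits_split[OF ctx] by (simp add: M_def)
    next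
      case False
      hence "odd_total S ?\<sigma>' = 0"
        using odd_total_even_cycle[OF vS] card_split(1)[OF ctx] by simp
      thus ?thesis using False E by simp
    qed
  qed
  let ?A = "{v \<in> ?V. v \<notin> orbit \<sigma> z}" and ?B = "(\<lambda>j. (\<sigma> ^^ j) z) ` {1..<?l - 1}"
  obtain h where h: "?l = 2 * h + 1" using odd[of z] by (auto elim: oddE)
  have orbS: "orbit \<sigma> z \<subseteq> insert z S" by (rule permutes_orbit_subset[OF \<sigma>]) simp
  have VB: "{v \<in> ?V. v \<in> orbit \<sigma> z} = ?B"
  proof (intro equalityI subsetI)
    fix v assume v: "v \<in> {v \<in> ?V. v \<in> orbit \<sigma> z}"
    then obtain i where i: "v = (\<sigma> ^^ i) z" "i < ?l" using per(4) by blast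
    have "i \<noteq> 0" using i v z by (cases i) auto
    moreover have "i \<noteq> ?l - 1"
    proof
      assume "i = ?l - 1"
      hence "\<sigma> v = (\<sigma> ^^ ?l) z" using i per(2) by (cases ?l) auto
      thus False using per(1) v by auto
    qed
    ultimately show "v \<in> ?B" using i by auto
  next
    fix v assume "v \<in> ?B"
    then obtain j where j: "v = (\<sigma> ^^ j) z" "1 \<le> j" "j < ?l - 1" by auto
    have jl: "j < ?l" "Suc j < ?l" using j by auto
    have "v \<noteq> z" using per(3)[of j 0] j jl per(2) by auto
    moreover have "\<sigma> v \<noteq> z" using per(3)[of "Suc j" 0] j jl per(2) by auto
    moreover have "v \<in> orbit \<sigma> z" using j funpow_in_orbit_self[OF \<sigma> fin'] by simp
    ultimately show "v \<in> {v \<in> ?V. v \<in> orbit \<sigma> z}" using orbS by auto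
  qed
  have "?A = S - orbit \<sigma> z"
  proof -
    have "\<sigma> v \<noteq> z" if "v \<notin> orbit \<sigma> z" for v
      using that orbit_in_iff[OF \<sigma> fin', of v z] orbit_self[OF \<sigma> fin', of z] by auto
    thus ?thesis by auto
  qed
  moreover have "S - orbit \<sigma> z = insert z S - orbit \<sigma> z"
    using orbit_self[OF \<sigma> fin', of z] by auto
  ultimately have cA: "card ?A = Suc ?n - ?l"
    using card_Diff_subset[of "orbit \<sigma> z" "insert z S"] orbS finite_orbit_permutes[OF \<sigma> fin'] fin z by simp
  have l_le: "?l \<le> Suc ?n" using card_mono[OF fin' orbS] fin z by simp
  have V: "?V = ?A \<union> ?B" "?A \<inter> ?B = {}" using VB by blast+
  have "odd_total (insert z S) \<sigma> = (\<Sum>v\<in>?V. ?F v)"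
    by (rule odd_total_insert[OF \<sigma> fin z insert.hyps(2)])
  also have "\<dots> = (\<Sum>v\<in>?A. ?F v) + (\<Sum>v\<in>?B. ?F v)"
    by (subst V(1), rule sum.union_disjoint) (use V(2) fin in auto)
  finally have total: "2 * odd_total (insert z S) \<sigma> = (\<Sum>v\<in>?A. 2 * ?F v) + 2 * (\<Sum>v\<in>?B. ?F v)"
    by (simp only: distrib_left sum_distrib_left)
  have "(\<Sum>v\<in>?A. 2 * ?F v) = (\<Sum>v\<in>?A. M)"
    by (rule sum.cong) (use merge in auto)
  hence sA: "(\<Sum>v\<in>?A. 2 * ?F v) = int (Suc ?n - ?l) * M"
    using cA by simp
  have "(\<Sum>v\<in>?B. ?F v) = (\<Sum>j\<in>{1..<?l - 1}. ?F ((\<sigma> ^^ j) z))"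
  proof (rule sum.reindex_cong[OF _ refl refl], rule inj_onI)
    fix i j assume ij: "i \<in> {1..<?l - 1}" "j \<in> {1..<?l - 1}" "(\<sigma> ^^ i) z = (\<sigma> ^^ j) z"
    hence "i < ?l" "j < ?l" by auto
    thus "i = j" using per(3)[of i j] ij by simp
  qed
  also have "\<dots> = (\<Sum>j\<in>{1..<?l - 1}. if odd j then M else 0)"
    by (rule sum.cong) (use split in auto)
  finally have sB: "(\<Sum>v\<in>?B. ?F v) = int h * M"
    using sum_odd_interval[of M h] h by simp
  have "2 * odd_total (insert z S) \<sigma> = int ?n * M"
    unfolding total sA sB using l_le h by (simp add: of_nat_diff algebra_simps)
  also have "\<dots> = 2 * (fact ?n * 2 ^ (?k - 1))"
    using n k by (cases ?k; cases ?n) (simp_all add: M_def algebra_simps)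
  finally show ?case using fin z by simp
qed

section \<open>Moving a set along a cycle\<close>

lemma mem_toggle: "x \<in> toggle y X \<longleftrightarrow> (x \<in> X) \<noteq> (x = y)"
  by (auto simp: toggle_def)

lemma xor_insert:
  assumes "a \<longrightarrow> \<not> c" "d \<longrightarrow> \<not> e"
  shows "((((x \<noteq> d) \<noteq> a) \<noteq> c) \<noteq> e) = ((x \<noteq> (a \<or> c)) \<noteq> (d \<or> e))"
  using assms by (cases a; cases c; cases d; cases e) auto

context cycle_pair
begin

context
  fixes w :: 'a
  assumes w: "w \<in> S" and odd: "odd (card (orbit sigma w))"
begin

private abbreviation "p i \<equiv> (sigma ^^ i) w"
private abbreviation "y i \<equiv> inv b (p i)"
private abbreviation "L \<equiv> card (orbit sigma w)"

private lemma pS: "p i \<in> S"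
  by (induction i) (simp_all add: w sigma_in)

private lemma b_y: "b (y i) = p i"
  using permutes_inverses(1)[OF long_cycle_permutes[OF b]] by simp

private lemma yS: "y i \<in> S"
  using long_cycle_in[OF b, of "y i"] by (simp add: b_y pS)

private lemma t_y: "t (y i) = p (Suc i)"
  using sigma_b[of "y i"] by (simp add: b_y)

text \<open>\<open>T n\<close> toggles \<open>p i\<close> and its bottom predecessor
  \<open>y i\<close> for all \<open>i < n\<close>. The largest index acts first, which is the order
  in which \<open>G_step\<close> can be chained.\<close>

private fun T :: "nat \<Rightarrow> 'a set \<Rightarrow> 'a set" where
  "T 0 X = X"
| "T (Suc n) X = T n (toggle (p n) (toggle (y n) X))"

private lemma toggles:
  "X \<subseteq> S \<Longrightarrow> odd (card X) \<Longrightarrow> toggle (p n) (toggle (y n) X) \<subseteq> S \<and> odd (card (toggle (p n) (toggle (y n) X)))"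
  using toggle_subset[OF yS, of X n] toggle_subset[OF pS, of "toggle (y n) X" n]
    even_card_toggle[OF fin_subset, of X "y n"] even_card_toggle[OF fin_subset, of "toggle (y n) X" "p n"]
  by simp

private lemma T_odd: "X \<subseteq> S \<Longrightarrow> odd (card X) \<Longrightarrow> T n X \<subseteq> S \<and> odd (card (T n X))"
proof (induction n arbitrary: X)
  case (Suc n)
  thus ?case using toggles[OF Suc.prems] by simp
qed simp

text \<open>The elements \<open>p i\<close> with \<open>i < L\<close> are distinct, so
  \<open>x\<close> is toggled at most twice: once as some \<open>p i\<close>, and once as the
  \<open>y i\<close> with \<open>b x = p i\<close>.\<close>

private lemma mem_T:
  "n \<le> L \<Longrightarrow> x \<in> T n X \<longleftrightarrow> ((x \<in> X) \<noteq> (x \<in> p ` {..<n})) \<noteq> (b x \<in> p ` {..<n})"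
proof (induction n arbitrary: X)
  case (Suc n)
  have new: "p n \<notin> p ` {..<n}"
  proof
    assume "p n \<in> p ` {..<n}"
    then obtain i where "i < n" "p i = p n" by auto
    thus False using orbit_period(3)[OF sigma_permutes fin, of i w n] Suc.prems by simp
  qed
  have e: "x = y n \<longleftrightarrow> b x = p n"
    using b_y[of n] long_cycle_inj[OF b, of x "y n"] by simp
  have IH: "x \<in> T (Suc n) X \<longleftrightarrow>
      ((x \<in> toggle (p n) (toggle (y n) X)) \<noteq> (x \<in> p ` {..<n})) \<noteq> (b x \<in> p ` {..<n})"
    using Suc.IH[of "toggle (p n) (toggle (y n) X)"] Suc.prems by simp
  have ins: "p ` {..<Suc n} = insert (p n) (p ` {..<n})"
    by (simp add: lessThan_Suc)
  have new1: "x = p n \<longrightarrow> x \<notin> p ` {..<n}" and new2: "b x = p n \<longrightarrow> b x \<notin> p ` {..<n}"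
    using new by (metis (no_types))+
  show ?case
    unfolding IH mem_toggle e ins insert_iff by (rule xor_insert[OF new1 new2])
qed simp

private lemma G_T: "n < L \<Longrightarrow> X \<subseteq> S \<Longrightarrow> odd (card X) \<Longrightarrow> G w w (T n X) = (-1) ^ n * G w (p n) X"
proof (induction n arbitrary: X)
  case (Suc n)
  have "G w w (T (Suc n) X) = (-1) ^ n * G w (p n) (toggle (p n) (toggle (y n) X))"
    using Suc.IH[of "toggle (p n) (toggle (y n) X)"] toggles[OF Suc.prems(2,3)] Suc.prems(1) by simp
  moreover have "p (Suc n) \<noteq> w"
    using orbit_period(3)[OF sigma_permutes fin, of "Suc n" w 0] Suc.prems(1) by auto
  ultimately show ?case
    using G_step[OF w yS[of n] Suc.prems(2,3)] by (simp add: b_y t_y del: funpow.simps)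
qed simp

text \<open>Running \<open>G_step\<close> once around an odd cycle of \<open>sigma\<close> brings
  the cut back to \<open>w\<close> with \<open>L - 1\<close> sign changes, an even number. The
  toggles add up to the symmetric difference with the cycle and with its preimage under
  \<open>b\<close>, the shape in which the boundary of a vertex appears in the radical.\<close>

lemma sg_shift:
  assumes X: "X \<subseteq> S" "odd (card X)" and uv: "u \<in> S" "v \<in> S"
  defines "X' \<equiv> {x \<in> S. ((x \<in> X) \<noteq> (x \<in> orbit sigma w)) \<noteq> (b x \<in> orbit sigma w)}"
  shows "odd (card X')" "sg u v X' = sg u v X"
proof -
  obtain n where n: "L = Suc n" using odd by (cases L) auto
  have C: "p ` {..<L} = orbit sigma w"
    using orbit_period(4)[OF sigma_permutes fin, where x = w] by auto
  have TL: "T L X \<subseteq> S" "odd (card (T L X))" using T_odd[OF X] by auto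
  have X': "T L X = X'"
    unfolding X'_def using TL(1) mem_T[of L _ X] C by auto
  thus "odd (card X')" using TL by simp
  have "p (Suc n) = w" using orbit_period(1)[OF sigma_permutes fin, where x = w] n by simp
  moreover have "G w w (T L X) = (-1) ^ n * G w (p n) (toggle (p n) (toggle (y n) X))"
    using G_T[of n "toggle (p n) (toggle (y n) X)"] toggles[OF X] n by simp
  ultimately have "G w w (T L X) = (-1) ^ n * G w w X"
    using G_step[OF w yS[of n] X] by (simp add: b_y t_y del: funpow.simps)
  moreover have "even n" using odd n by simp
  ultimately have "sg w w X' = sg w w X"
    using X' by (simp add: G_self)
  thus "sg u v X' = sg u v X"
    using sg_odd[OF w w uv X] sg_odd[OF w w uv TL] X' by simp
qed

end

end

section \<open>Gauss sums and the Arf invariant\<close>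

text \<open>The nontrivial additive character of the field with two elements.\<close>

definition bsgn :: "bit \<Rightarrow> int" where
  "bsgn s = (if s = 0 then 1 else -1)"

lemma bit_cases: "s = 0 \<or> s = (1::bit)"
  by (cases s) auto

lemma bit_add_self [simp]: "x + x = (0::bit)"
  using bit_cases[of x] by auto

lemma bit_fun_add_self [simp]: "x + x = (0 :: 'a \<Rightarrow> bit)"
  by (simp add: fun_eq_iff)

lemma bsgn_add: "bsgn (x + y) = bsgn x * bsgn y"
  using bit_cases[of x] bit_cases[of y] by (auto simp: bsgn_def)

lemma bsgn_simps [simp]: "bsgn 0 = 1" "bsgn 1 = -1"
  by (auto simp: bsgn_def)

lemma bsgn_of_nat: "bsgn (of_nat n) = (-1) ^ n"
  by (induction n) (auto simp: bsgn_add)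

definition bit_space :: "('a \<Rightarrow> bit) set \<Rightarrow> bool" where
  "bit_space V \<longleftrightarrow> finite V \<and> 0 \<in> V \<and> (\<forall>x\<in>V. \<forall>y\<in>V. x + y \<in> V)"

lemma bit_space_sum:
  assumes "bit_space V" "\<And>i. i \<in> I \<Longrightarrow> x i \<in> V"
  shows "sum x I \<in> V"
  using assms(2) by (induction I rule: infinite_finite_induct) (use assms(1) in \<open>auto simp: bit_space_def\<close>)

locale bit_form =
  fixes V R :: "('a \<Rightarrow> bit) set" and q :: "('a \<Rightarrow> bit) \<Rightarrow> bit"
  assumes V: "bit_space V" and R: "bit_space R" and RV: "R \<subseteq> V" and q: "quadratic_form_mod V R q"
begin

abbreviation "B \<equiv> polar q"

lemma V_add: "x \<in> V \<Longrightarrow> y \<in> V \<Longrightarrow> x + y \<in> V" and V_0: "0 \<in> V" and finV: "finite V"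
  using V by (auto simp: bit_space_def)

lemma R_V: "r \<in> R \<Longrightarrow> r \<in> V"
  using R RV by (auto simp: bit_space_def)

lemma B_commute: "B x y = B y x"
  by (simp add: polar_def ac_simps)

lemma B_add_left: "x \<in> V \<Longrightarrow> y \<in> V \<Longrightarrow> z \<in> V \<Longrightarrow> B (x + y) z = B x z + B y z"
  using q by (simp add: quadratic_form_mod_def)

lemma B_add_right: "x \<in> V \<Longrightarrow> y \<in> V \<Longrightarrow> z \<in> V \<Longrightarrow> B z (x + y) = B z x + B z y"
  unfolding B_commute[of z] by (rule B_add_left)

lemma B_0 [simp]: "z \<in> V \<Longrightarrow> B 0 z = 0" "z \<in> V \<Longrightarrow> B z 0 = 0"
proof -
  show "z \<in> V \<Longrightarrow> B 0 z = 0" for z using B_add_left[of 0 0 z] V_0 by simp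
  thus "z \<in> V \<Longrightarrow> B z 0 = 0" using B_commute by metis
qed

lemma q_0 [simp]: "q 0 = 0"
  using B_0(1)[OF V_0] by (simp add: polar_def)

lemma q_add: "q (x + y) = q x + q y + B x y"
  using bit_cases[of "q x"] bit_cases[of "q y"] by (auto simp: polar_def)

lemma B_self: "B x x = 0"
  using q_0 by (simp add: polar_def)

lemma q_mod: "x \<in> V \<Longrightarrow> r \<in> R \<Longrightarrow> q (x + r) = q x"
  using q by (simp add: quadratic_form_mod_def)

lemma q_R: "r \<in> R \<Longrightarrow> q r = 0"
  using q_mod[of 0 r] V_0 by simp

lemma B_R: "x \<in> V \<Longrightarrow> r \<in> R \<Longrightarrow> B x r = 0" "x \<in> V \<Longrightarrow> r \<in> R \<Longrightarrow> B r x = 0"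
proof -
  show "x \<in> V \<Longrightarrow> r \<in> R \<Longrightarrow> B x r = 0" for x r using q_mod q_R by (simp add: polar_def)
  thus "x \<in> V \<Longrightarrow> r \<in> R \<Longrightarrow> B r x = 0" using B_commute by metis
qed

lemma B_sum_left:
  assumes "\<And>i. i \<in> I \<Longrightarrow> x i \<in> V" "z \<in> V"
  shows "B (sum x I) z = (\<Sum>i\<in>I. B (x i) z)"
  using assms(1)
proof (induction I rule: infinite_finite_induct)
  case (insert i I)
  hence "sum x I \<in> V" by (intro bit_space_sum[OF V]) auto
  hence "B (x i + sum x I) z = B (x i) z + B (sum x I) z" using insert.prems assms(2) by (intro B_add_left) auto
  moreover have "B (sum x I) z = (\<Sum>i\<in>I. B (x i) z)" using insert by auto
  ultimately show ?case by (simp only: sum.insert[OF insert.hyps(1,2)])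
qed (use assms(2) in auto)

context
  fixes h :: nat and x y :: "nat \<Rightarrow> 'a \<Rightarrow> bit"
  assumes sb: "symplectic_basis_mod V R q h x y"
begin

private abbreviation "comb I J \<equiv> sum x I + sum y J"

private lemma xV: "i < h \<Longrightarrow> x i \<in> V" and yV: "i < h \<Longrightarrow> y i \<in> V"
  using sb by (auto simp: symplectic_basis_mod_def)

private lemma Bxy: "i < h \<Longrightarrow> j < h \<Longrightarrow> B (x i) (y j) = (if i = j then 1 else 0)"
  and Bxx: "i < h \<Longrightarrow> j < h \<Longrightarrow> B (x i) (x j) = 0" and Byy: "i < h \<Longrightarrow> j < h \<Longrightarrow> B (y i) (y j) = 0"
  using sb by (auto simp: symplectic_basis_mod_def)

private lemma sumV: "I \<subseteq> {..<h} \<Longrightarrow> sum x I \<in> V" "I \<subseteq> {..<h} \<Longrightarrow> sum y I \<in> V"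
  using bit_space_sum[OF V] xV yV by (metis lessThan_iff subsetD)+

private lemma combV: "I \<subseteq> {..<h} \<Longrightarrow> J \<subseteq> {..<h} \<Longrightarrow> comb I J \<in> V"
  using sumV V_add by blast

private lemma B_comb_y:
  assumes "I \<subseteq> {..<h}" "J \<subseteq> {..<h}" "j < h"
  shows "B (comb I J) (y j) = (if j \<in> I then 1 else 0)"
proof -
  have fin: "finite I" using assms finite_subset by blast
  have "B (sum x I) (y j) = (\<Sum>i\<in>I. B (x i) (y j))"
    by (rule B_sum_left) (use assms xV yV in auto)
  also have "\<dots> = (\<Sum>i\<in>I. if i = j then 1 else 0)"
    by (rule sum.cong) (use assms Bxy in auto)
  finally have 1: "B (sum x I) (y j) = (if j \<in> I then 1 else 0)" using fin by simp
  have "B (sum y J) (y j) = (\<Sum>i\<in>J. B (y i) (y j))"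
    by (rule B_sum_left) (use assms yV in auto)
  also have "\<dots> = 0" by (rule sum.neutral) (use assms Byy in auto)
  finally show ?thesis using 1 B_add_left[OF sumV(1)[OF assms(1)] sumV(2)[OF assms(2)] yV[OF assms(3)]] by simp
qed

private lemma B_comb_x:
  assumes "I \<subseteq> {..<h}" "J \<subseteq> {..<h}" "j < h"
  shows "B (comb I J) (x j) = (if j \<in> J then 1 else 0)"
proof -
  have fin: "finite J" using assms finite_subset by blast
  have "B (sum y J) (x j) = (\<Sum>i\<in>J. B (y i) (x j))"
    by (rule B_sum_left) (use assms xV yV in auto)
  also have "\<dots> = (\<Sum>i\<in>J. if i = j then 1 else 0)"
    by (rule sum.cong) (use assms Bxy B_commute[of "y _"] in auto)
  finally have 1: "B (sum y J) (x j) = (if j \<in> J then 1 else 0)" using fin by simp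
  have "B (sum x I) (x j) = (\<Sum>i\<in>I. B (x i) (x j))"
    by (rule B_sum_left) (use assms xV in auto)
  also have "\<dots> = 0" by (rule sum.neutral) (use assms Bxx in auto)
  finally show ?thesis using 1 B_add_left[OF sumV(1)[OF assms(1)] sumV(2)[OF assms(2)] xV[OF assms(3)]] by simp
qed

text \<open>Pairing with \<open>y j\<close> and with \<open>x j\<close> reads off the coefficients,
  so the decomposition of a vector is unique.\<close>

lemma bij_comb: "bij_betw (\<lambda>((I, J), r). comb I J + r) ((Pow {..<h} \<times> Pow {..<h}) \<times> R) V"
proof (rule bij_betw_imageI)
  show "inj_on (\<lambda>((I, J), r). comb I J + r) ((Pow {..<h} \<times> Pow {..<h}) \<times> R)"
  proof (rule inj_onI, clarsimp)
    fix I J r I' J' r'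
    assume IJ: "I \<subseteq> {..<h}" "J \<subseteq> {..<h}" "I' \<subseteq> {..<h}" "J' \<subseteq> {..<h}" and r: "r \<in> R" "r' \<in> R"
      and eq: "comb I J + r = comb I' J' + r'"
    have By: "B (comb I J + r) z = B (comb I J) z" if "I \<subseteq> {..<h}" "J \<subseteq> {..<h}" "r \<in> R" "z \<in> V" for I J r z
      using B_add_left[OF combV[OF that(1,2)] R_V[OF that(3)] that(4)] B_R(2)[OF that(4,3)] by simp
    have "(j \<in> I) = (j \<in> I')" "(j \<in> J) = (j \<in> J')" if "j < h" for j
      using By[OF IJ(1,2) r(1) yV[OF that]] By[OF IJ(3,4) r(2) yV[OF that]] B_comb_y[OF IJ(1,2) that] B_comb_y[OF IJ(3,4) that]
        By[OF IJ(1,2) r(1) xV[OF that]] By[OF IJ(3,4) r(2) xV[OF that]] B_comb_x[OF IJ(1,2) that] B_comb_x[OF IJ(3,4) that] eq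
      by (auto split: if_splits)
    hence "I = I'" "J = J'" using IJ by auto
    thus "I = I' \<and> J = J' \<and> r = r'" using eq by simp
  qed
  show "(\<lambda>((I, J), r). comb I J + r) ` ((Pow {..<h} \<times> Pow {..<h}) \<times> R) = V"
  proof (intro equalityI subsetI)
    fix u assume "u \<in> V"
    then obtain I J r where "r \<in> R" "I \<subseteq> {..<h}" "J \<subseteq> {..<h}" "u = comb I J + r"
      using sb unfolding symplectic_basis_mod_def by blast
    thus "u \<in> (\<lambda>((I, J), r). comb I J + r) ` ((Pow {..<h} \<times> Pow {..<h}) \<times> R)" by force
  qed (use combV R_V V_add in auto)
qed

lemma card_V: "card V = 2 ^ h * 2 ^ h * card R"
  using bij_betw_same_card[OF bij_comb] by (simp add: card_cartesian_product card_Pow)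

private lemma q_comb_step:
  assumes "I \<subseteq> {..<m}" "J \<subseteq> {..<m}" "m < h"
  shows "q (comb I (insert m J)) = q (comb I J) + q (y m)"
    "q (comb (insert m I) J) = q (comb I J) + q (x m)"
    "q (comb (insert m I) (insert m J)) = q (comb I J) + q (x m) + q (y m) + 1"
proof -
  have sub: "I \<subseteq> {..<h}" "J \<subseteq> {..<h}" using assms by auto
  have fin: "finite I" "finite J" "m \<notin> I" "m \<notin> J" using assms finite_subset by auto
  have Bx: "B (comb I J) (x m) = 0" and By: "B (comb I J) (y m) = 0"
    using B_comb_x[OF sub assms(3)] B_comb_y[OF sub assms(3)] fin by auto
  have e1: "comb I (insert m J) = comb I J + y m" and e2: "comb (insert m I) J = comb I J + x m"
    and e3: "comb (insert m I) (insert m J) = comb I J + x m + y m"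
    using fin by (auto simp: ac_simps)
  show "q (comb I (insert m J)) = q (comb I J) + q (y m)" unfolding e1 q_add[of "comb I J"] By by simp
  show "q (comb (insert m I) J) = q (comb I J) + q (x m)" unfolding e2 q_add[of "comb I J"] Bx by simp
  have "B (comb I J + x m) (y m) = 1"
    using B_add_left[OF combV[OF sub] xV[OF assms(3)] yV[OF assms(3)]] By Bxy[OF assms(3,3)] by simp
  thus "q (comb (insert m I) (insert m J)) = q (comb I J) + q (x m) + q (y m) + 1"
    unfolding e3 q_add[of "comb I J + x m"] q_add[of "comb I J" "x m"] Bx by simp
qed

text \<open>Each hyperbolic plane multiplies the sum by
  \<open>1 + bsgn (q x) + bsgn (q y) - bsgn (q x + q y)\<close>, which is -2 if both values are 1
  and 2 otherwise.\<close>

private lemma gauss_part: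
  "m \<le> h \<Longrightarrow> (\<Sum>(I, J)\<in>Pow {..<m} \<times> Pow {..<m}. bsgn (q (comb I J))) = 2 ^ m * bsgn (\<Sum>i<m. q (x i) * q (y i))"
proof (induction m)
  case (Suc m)
  let ?P = "Pow {..<m}"
  let ?F = "\<lambda>I J. bsgn (q (comb I J))"
  have P: "Pow {..<Suc m} = ?P \<union> insert m ` ?P" by (simp add: lessThan_Suc Pow_insert)
  have dis: "?P \<inter> insert m ` ?P = {}" by auto
  have inj: "inj_on (insert m) ?P" by (auto simp: inj_on_def)
  have split: "(\<Sum>I\<in>Pow {..<Suc m}. f I) = (\<Sum>I\<in>?P. f I + f (insert m I))" for f :: "nat set \<Rightarrow> int"
    unfolding P using dis by (subst sum.union_disjoint) (auto simp: sum.reindex[OF inj] sum.distrib)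
  have "(\<Sum>(I, J)\<in>Pow {..<Suc m} \<times> Pow {..<Suc m}. ?F I J) = (\<Sum>I\<in>Pow {..<Suc m}. \<Sum>J\<in>Pow {..<Suc m}. ?F I J)"
    by (rule sum.cartesian_product[symmetric])
  also have "\<dots> = (\<Sum>I\<in>?P. \<Sum>J\<in>?P. (?F I J + ?F I (insert m J)) + (?F (insert m I) J + ?F (insert m I) (insert m J)))"
    unfolding split by (simp only: sum.distrib)
  also have "\<dots> = (\<Sum>I\<in>?P. \<Sum>J\<in>?P. 2 * bsgn (q (x m) * q (y m)) * ?F I J)"
  proof (intro sum.cong refl)
    fix I J assume "I \<in> ?P" "J \<in> ?P"
    hence IJ: "I \<subseteq> {..<m}" "J \<subseteq> {..<m}" "m < h" using Suc.prems by auto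
    show "(?F I J + ?F I (insert m J)) + (?F (insert m I) J + ?F (insert m I) (insert m J)) = 2 * bsgn (q (x m) * q (y m)) * ?F I J"
      unfolding q_comb_step[OF IJ] bsgn_add using bit_cases[of "q (x m)"] bit_cases[of "q (y m)"] by auto
  qed
  also have "\<dots> = 2 * bsgn (q (x m) * q (y m)) * (\<Sum>I\<in>?P. \<Sum>J\<in>?P. ?F I J)"
    by (simp only: sum_distrib_left)
  also have "(\<Sum>I\<in>?P. \<Sum>J\<in>?P. ?F I J) = 2 ^ m * bsgn (\<Sum>i<m. q (x i) * q (y i))"
    by (subst sum.cartesian_product) (rule Suc.IH, use Suc.prems in simp)
  finally show ?case by (simp add: bsgn_add)
qed simp

lemma gauss_sum: "(\<Sum>v\<in>V. bsgn (q v)) = 2 ^ h * int (card R) * bsgn (\<Sum>i<h. q (x i) * q (y i))"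
proof -
  have "(\<Sum>v\<in>V. bsgn (q v)) = (\<Sum>((I, J), r)\<in>(Pow {..<h} \<times> Pow {..<h}) \<times> R. bsgn (q (comb I J + r)))"
    by (subst sum.reindex_bij_betw[OF bij_comb, symmetric]) (simp add: case_prod_unfold)
  also have "\<dots> = (\<Sum>((I, J), r)\<in>(Pow {..<h} \<times> Pow {..<h}) \<times> R. bsgn (q (comb I J)))"
    by (rule sum.cong) (auto simp: q_mod combV)
  also have "\<dots> = (\<Sum>p\<in>Pow {..<h} \<times> Pow {..<h}. \<Sum>r\<in>R. case p of (I, J) \<Rightarrow> bsgn (q (comb I J)))"
    by (subst sum.cartesian_product) (simp add: case_prod_unfold)
  also have "\<dots> = int (card R) * (\<Sum>(I, J)\<in>Pow {..<h} \<times> Pow {..<h}. bsgn (q (comb I J)))"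
    by (simp add: sum_distrib_left)
  finally show ?thesis using gauss_part[of h] by simp
qed

end

text \<open>Neither the cardinality of \<open>V\<close> nor the Gauss sum refers to a basis, so the
  sign of the sum determines the Arf invariant.\<close>

lemma arf_gauss:
  assumes "has_arf_invariant V R q s"
  obtains h where "card V = 2 ^ h * 2 ^ h * card R" "(\<Sum>v\<in>V. bsgn (q v)) = 2 ^ h * int (card R) * bsgn s"
  using assms card_V gauss_sum unfolding has_arf_invariant_def by metis

end

text \<open>Unless the polar form vanishes on \<open>V\<close>, a hyperbolic plane spanned by
  \<open>a\<close> and \<open>c\<close> splits off, and its orthogonal complement is smaller and
  satisfies the same hypotheses.\<close>

lemma symplectic_basis_exists:
  assumes "bit_form V R q" "\<And>x. x \<in> V \<Longrightarrow> (\<And>y. y \<in> V \<Longrightarrow> polar q x y = 0) \<Longrightarrow> x \<in> R"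
  shows "\<exists>h x y. symplectic_basis_mod V R q h x y"
  using assms
proof (induction "card V" arbitrary: V rule: less_induct)
  case less
  interpret bit_form V R q by fact
  show ?case
  proof (cases "\<forall>x\<in>V. \<forall>y\<in>V. B x y = 0")
    case True
    hence "V \<subseteq> R" using less.prems(2) by blast
    hence "symplectic_basis_mod V R q 0 (\<lambda>_. 0) (\<lambda>_. 0)"
      by (auto simp: symplectic_basis_mod_def)
    thus ?thesis by blast
  next
    case False
    then obtain a c where a: "a \<in> V" and c: "c \<in> V" and ac: "B a c \<noteq> 0" by blast
    hence ac1: "B a c = 1" using bit_cases by blast
    define W where "W = {v \<in> V. B v a = 0 \<and> B v c = 0}"
    have WV: "W \<subseteq> V" by (auto simp: W_def)
    have "a \<notin> W" using ac1 by (simp add: W_def)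
    hence card: "card W < card V" using WV a finV by (metis psubset_card_mono psubsetI)
    have RW: "R \<subseteq> W" using R_V B_R(2)[OF a] B_R(2)[OF c] by (auto simp: W_def)
    have "bit_space W"
      using V_0 V_add finite_subset[OF WV finV] a c by (auto simp: bit_space_def W_def B_add_left)
    moreover have "quadratic_form_mod W R q"
      using q WV unfolding quadratic_form_mod_def by blast
    ultimately have bW: "bit_form W R q" using R RW by (simp add: bit_form_def)
    \<comment> \<open>Projection to \<open>W\<close>: the coefficients of \<open>a\<close> and
      \<open>c\<close> in \<open>u\<close> are \<open>B u c\<close> and \<open>B u a\<close>, and
      subtracting is the same as adding.\<close>
    define pr where "pr u = u + ((if B u c = 1 then a else 0) + (if B u a = 1 then c else 0))" for u
    have aa: "B a a = 0" "B c c = 0" "B c a = 1" using B_self ac1 B_commute by metis+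
    have pr: "pr u \<in> W" if "u \<in> V" for u
    proof -
      have "(if B u c = 1 then a else 0) + (if B u a = 1 then c else 0) \<in> V" using a c V_add V_0 by auto
      moreover have "B (pr u) a = 0 \<and> B (pr u) c = 0"
        unfolding pr_def using that a c V_0 V_add bit_cases[of "B u a"] bit_cases[of "B u c"]
        by (auto simp: B_add_left aa ac1)
      ultimately show ?thesis using that V_add unfolding W_def pr_def by auto
    qed
    have "x \<in> R" if x: "x \<in> W" and orth: "\<And>y. y \<in> W \<Longrightarrow> B x y = 0" for x
    proof (rule less.prems(2))
      show "x \<in> V" using x WV by auto
      fix u assume u: "u \<in> V"
      let ?w = "(if B u c = 1 then a else 0) + (if B u a = 1 then c else 0)"
      have wV: "?w \<in> V" using a c V_add V_0 by auto
      have "B x ?w = 0" using x a c V_0 by (auto simp: W_def B_add_right)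
      moreover have "u = pr u + ?w" by (simp add: pr_def add.assoc)
      ultimately show "B x u = 0"
        using B_add_right[of "pr u" ?w x] orth[OF pr[OF u]] pr[OF u] WV wV x by (metis subsetD add.right_neutral)
    qed
    then obtain h x y where sb: "symplectic_basis_mod W R q h x y"
      using less.hyps[OF card bW] by blast
    define x' where "x' = x(h := a)"
    define y' where "y' = y(h := c)"
    have xW: "i < h \<Longrightarrow> x i \<in> W \<and> y i \<in> W" for i using sb by (auto simp: symplectic_basis_mod_def)
    have orth: "i < h \<Longrightarrow> B (x i) a = 0 \<and> B (x i) c = 0 \<and> B (y i) a = 0 \<and> B (y i) c = 0" for i
      using xW by (auto simp: W_def)
    have orth': "i < h \<Longrightarrow> B a (x i) = 0 \<and> B c (x i) = 0 \<and> B a (y i) = 0 \<and> B c (y i) = 0" for i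
      using orth B_commute by metis
    have "symplectic_basis_mod V R q (Suc h) x' y'"
      unfolding symplectic_basis_mod_def
    proof (intro conjI allI impI ballI)
      fix i assume "i < Suc h"
      thus "x' i \<in> V" "y' i \<in> V" using xW[of i] WV a c by (auto simp: x'_def y'_def less_Suc_eq)
    next
      fix i j assume ij: "i < Suc h" "j < Suc h"
      have old: "i < h \<Longrightarrow> j < h \<Longrightarrow> B (x i) (y j) = (if i = j then 1 else 0) \<and> B (x i) (x j) = 0 \<and> B (y i) (y j) = 0"
        using sb by (auto simp: symplectic_basis_mod_def)
      show "B (x' i) (y' j) = (if i = j then 1 else 0)" "B (x' i) (x' j) = 0" "B (y' i) (y' j) = 0"
        using ij old orth[of i] orth'[of j] aa ac1 by (auto simp: x'_def y'_def less_Suc_eq)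
    next
      fix u assume u: "u \<in> V"
      from pr[OF u] obtain I J r where IJ: "I \<subseteq> {..<h}" "J \<subseteq> {..<h}" "r \<in> R" "pr u = sum x I + sum y J + r"
        using sb unfolding symplectic_basis_mod_def by blast
      let ?I = "I \<union> (if B u c = 1 then {h} else {})" and ?J = "J \<union> (if B u a = 1 then {h} else {})"
      have fin: "finite I" "finite J" "h \<notin> I" "h \<notin> J" using IJ finite_subset by auto
      have "sum x' I = sum x I" "sum y' J = sum y J"
        by (rule sum.cong; use fin in \<open>auto simp: x'_def y'_def\<close>)+
      hence s: "sum x' ?I = sum x I + (if B u c = 1 then a else 0)" "sum y' ?J = sum y J + (if B u a = 1 then c else 0)"
        using fin by (auto simp: x'_def y'_def ac_simps)
      have "u = pr u + ((if B u c = 1 then a else 0) + (if B u a = 1 then c else 0))"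
        by (simp add: pr_def add.assoc)
      also have "\<dots> = sum x' ?I + sum y' ?J + r"
        unfolding s IJ(4) by (simp add: ac_simps)
      finally show "\<exists>I J. \<exists>r\<in>R. I \<subseteq> {..<Suc h} \<and> J \<subseteq> {..<Suc h} \<and> u = sum x' I + sum y' J + r"
        using IJ by (intro exI[of _ ?I] exI[of _ ?J] bexI[of _ r]) auto
    qed
    thus ?thesis by blast
  qed
qed

section \<open>The quadratic form of a permutation\<close>

definition pos :: "'a list \<Rightarrow> 'a \<Rightarrow> nat" where
  "pos w a = length (takeWhile (\<lambda>x. x \<noteq> a) w)"

lemma pos_Cons: "pos (c # w) a = (if c = a then 0 else Suc (pos w a))"
  by (simp add: pos_def)

lemma pos_less: "a \<in> set w \<Longrightarrow> pos w a < length w"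
  by (induction w) (auto simp: pos_Cons)

lemma nth_pos: "a \<in> set w \<Longrightarrow> w ! pos w a = a"
  by (induction w) (auto simp: pos_Cons)

lemma pos_nth: "distinct w \<Longrightarrow> i < length w \<Longrightarrow> pos w (w ! i) = i"
proof (induction w arbitrary: i)
  case (Cons c w)
  thus ?case by (cases i) (auto simp: pos_Cons)
qed simp

lemma inj_on_pos: "inj_on (pos w) (set w)"
  by (rule inj_on_inverseI[where g = "\<lambda>i. w ! i"]) (rule nth_pos)

lemma takeWhile_eq_take_pos: "takeWhile (\<lambda>x. x \<noteq> a) w = take (pos w a) w"
  unfolding pos_def by (rule takeWhile_eq_take)

lemma sum_bit_fun_apply: "(\<Sum>i\<in>I. x i) c = (\<Sum>i\<in>I. x i c :: bit)"
  by (induction I rule: infinite_finite_induct) auto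

locale list_pair =
  fixes t b :: "'a list"
  assumes dt: "distinct t" and db: "distinct b" and set_eq: "set b = set t"
begin

definition inverted :: "'a \<Rightarrow> 'a \<Rightarrow> bool" where
  "inverted a c \<longleftrightarrow> (pos t a < pos t c) \<noteq> (pos b a < pos b c)"

definition inv_pairs :: "('a \<times> 'a) set" where
  "inv_pairs = {(a, c). a \<in> set t \<and> c \<in> set t \<and> pos t a < pos t c \<and> pos b c < pos b a}"

definition q0 :: "('a \<Rightarrow> bit) \<Rightarrow> bit" where
  "q0 x = (\<Sum>a\<in>set t. x a) + (\<Sum>(a, c)\<in>inv_pairs. x a * x c)"

lemma finite_inv_pairs: "finite inv_pairs"
  by (rule finite_subset[of _ "set t \<times> set t"]) (auto simp: inv_pairs_def)

lemma pos_neq: "a \<in> set t \<Longrightarrow> c \<in> set t \<Longrightarrow> a \<noteq> c \<Longrightarrow> pos t a \<noteq> pos t c \<and> pos b a \<noteq> pos b c"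
  using inj_on_pos[of t] inj_on_pos[of b] set_eq by (auto simp: inj_on_def)

lemma inverted_iff:
  assumes "a \<in> set t" "c \<in> set t"
  shows "inverted a c \<longleftrightarrow> (a, c) \<in> inv_pairs \<or> (c, a) \<in> inv_pairs"
  using assms pos_neq[OF assms] by (cases "a = c") (auto simp: inverted_def inv_pairs_def)

lemma polar_q0: "polar q0 x y = (\<Sum>(a, c)\<in>inv_pairs. x a * y c + y a * x c)"
proof -
  have e: "(x a + y a) * (x c + y c) = x a * x c + y a * y c + (x a * y c + y a * x c)" for a c
    by (simp add: algebra_simps)
  have "q0 (x + y) = q0 x + q0 y + (\<Sum>(a, c)\<in>inv_pairs. x a * y c + y a * x c)"
    unfolding q0_def plus_fun_apply e by (simp add: case_prod_unfold sum.distrib)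
  moreover have "u + v + w - u - v = w" for u v w :: bit
    using bit_cases[of u] bit_cases[of v] bit_cases[of w] by auto
  ultimately show ?thesis by (simp only: polar_def)
qed

lemma polar_q0_add: "polar q0 (x + y) z = polar q0 x z + polar q0 y z"
  unfolding polar_q0 plus_fun_apply by (simp add: case_prod_unfold sum.distrib algebra_simps)

text \<open>The 1-cell dual to the side \<open>a\<close>, that is, the class of a curve that crosses
  this side once and no other.\<close>

definition unit :: "'a \<Rightarrow> 'a \<Rightarrow> bit" where
  "unit a c = (if c = a then 1 else 0)"

lemma unit_in_chains: "a \<in> set t \<Longrightarrow> unit a \<in> chains t"
  by (auto simp: chains_def unit_def)

lemma polar_q0_unit:
  assumes a: "a \<in> set t"
  shows "polar q0 x (unit a) = (\<Sum>c | c \<in> set t \<and> inverted c a. x c)"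
proof -
  have fin: "finite {c. c \<in> set t \<and> P c}" for P by simp
  have "polar q0 x (unit a) = (\<Sum>p\<in>inv_pairs. if snd p = a then x (fst p) else 0) + (\<Sum>p\<in>inv_pairs. if fst p = a then x (snd p) else 0)"
  proof -
    have e: "(case p of (c, d) \<Rightarrow> x c * unit a d + unit a c * x d) =
        (if snd p = a then x (fst p) else 0) + (if fst p = a then x (snd p) else 0)" for p
      by (cases p) (auto simp: unit_def)
    show ?thesis unfolding polar_q0 e by (rule sum.distrib)
  qed
  also have "(\<Sum>p\<in>inv_pairs. if snd p = a then x (fst p) else 0) = (\<Sum>p\<in>{p \<in> inv_pairs. snd p = a}. x (fst p))"
    by (rule sum.inter_filter[symmetric]) (rule finite_inv_pairs)
  also have "\<dots> = (\<Sum>c | c \<in> set t \<and> (c, a) \<in> inv_pairs. x c)"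
    by (rule sum.reindex_bij_witness[of _ "\<lambda>c. (c, a)" fst]) (auto simp: inv_pairs_def)
  also have "(\<Sum>p\<in>inv_pairs. if fst p = a then x (snd p) else 0) = (\<Sum>p\<in>{p \<in> inv_pairs. fst p = a}. x (snd p))"
    by (rule sum.inter_filter[symmetric]) (rule finite_inv_pairs)
  also have "\<dots> = (\<Sum>c | c \<in> set t \<and> (a, c) \<in> inv_pairs. x c)"
    by (rule sum.reindex_bij_witness[of _ "\<lambda>c. (a, c)" snd]) (auto simp: inv_pairs_def)
  also have "(\<Sum>c | c \<in> set t \<and> (c, a) \<in> inv_pairs. x c) + (\<Sum>c | c \<in> set t \<and> (a, c) \<in> inv_pairs. x c) =
      (\<Sum>c\<in>{c. c \<in> set t \<and> (c, a) \<in> inv_pairs} \<union> {c. c \<in> set t \<and> (a, c) \<in> inv_pairs}. x c)"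
    by (rule sum.union_disjoint[symmetric]) (auto simp: inv_pairs_def)
  also have "{c. c \<in> set t \<and> (c, a) \<in> inv_pairs} \<union> {c. c \<in> set t \<and> (a, c) \<in> inv_pairs} = {c. c \<in> set t \<and> inverted c a}"
    using inverted_iff[OF _ a] by auto
  finally show ?thesis .
qed

lemma q0_unit: "a \<in> set t \<Longrightarrow> q0 (unit a) = 1"
proof -
  assume a: "a \<in> set t"
  have "(\<Sum>(c, d)\<in>inv_pairs. unit a c * unit a d) = 0"
    by (rule sum.neutral) (auto simp: inv_pairs_def unit_def)
  thus ?thesis using a by (simp add: q0_def unit_def)
qed

lemma polar_unit_unit: "a \<in> set t \<Longrightarrow> c \<in> set t \<Longrightarrow> polar q0 (unit a) (unit c) = (if inverted a c then 1 else 0)"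
  by (simp add: polar_q0_unit) (simp add: unit_def sum.If_cases if_distrib cong: if_cong)

text \<open>Letters before \<open>a\<close> in both rows count twice and cancel; those that remain
  are the letters inverted with \<open>a\<close>.\<close>

lemma polar_q0_prefix:
  assumes a: "a \<in> set t"
  shows "polar q0 x (unit a) = (\<Sum>c | c \<in> set t \<and> pos t c < pos t a. x c) + (\<Sum>c | c \<in> set t \<and> pos b c < pos b a. x c)"
proof -
  let ?T = "{c. c \<in> set t \<and> pos t c < pos t a}" and ?B = "{c. c \<in> set t \<and> pos b c < pos b a}"
  have fin: "finite ?T" "finite ?B" by auto
  have "sum x ?T + sum x ?B = (sum x (?T - ?B) + sum x (?T \<inter> ?B)) + (sum x (?B - ?T) + sum x (?B \<inter> ?T))"
    using fin sum.Int_Diff[of ?T x ?B] sum.Int_Diff[of ?B x ?T] by (simp add: add.commute)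
  also have "\<dots> = sum x (?T - ?B) + sum x (?B - ?T) + (sum x (?T \<inter> ?B) + sum x (?T \<inter> ?B))"
    by (simp only: Int_commute ac_simps)
  also have "\<dots> = sum x (?T - ?B) + sum x (?B - ?T)" by simp
  also have "\<dots> = sum x ((?T - ?B) \<union> (?B - ?T))"
    by (rule sum.union_disjoint[symmetric]) auto
  also have "(?T - ?B) \<union> (?B - ?T) = {c. c \<in> set t \<and> inverted c a}"
    by (auto simp: inverted_def)
  finally show ?thesis using polar_q0_unit[OF a] by simp
qed

lemma chain_expand: "x \<in> chains t \<Longrightarrow> x = (\<Sum>a | a \<in> set t \<and> x a = 1. unit a)"
proof
  fix c assume x: "x \<in> chains t"
  have "(\<Sum>a | a \<in> set t \<and> x a = 1. unit a) c = (\<Sum>a | a \<in> set t \<and> x a = 1. unit a c)"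
    by (rule sum_bit_fun_apply)
  also have "\<dots> = x c"
    using x bit_cases[of "x c"] by (auto simp: unit_def chains_def)
  finally show "x c = (\<Sum>a | a \<in> set t \<and> x a = 1. unit a) c" by simp
qed

end

lemma finite_chains: "finite (chains t)"
proof -
  have "chains t \<subseteq> (\<lambda>A a. if a \<in> A then 1 else 0) ` Pow (set t)"
  proof
    fix x assume "x \<in> chains t"
    hence "x = (\<lambda>a. if a \<in> {a. x a = 1} then 1 else 0)" "{a. x a = 1} \<subseteq> set t"
      by (auto simp: chains_def fun_eq_iff)
    thus "x \<in> (\<lambda>A a. if a \<in> A then 1 else 0) ` Pow (set t)" by blast
  qed
  thus ?thesis by (rule finite_subset) simp
qed

lemma bit_space_chains: "bit_space (chains t)"
  using finite_chains by (auto simp: bit_space_def chains_def)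

lemma bij_chains: "bij_betw (\<lambda>A a. if a \<in> A then 1 else 0) (Pow (set t)) (chains t)"
  by (rule bij_betwI[where g = "\<lambda>x. {a. x a = 1}"]) (auto simp: chains_def fun_eq_iff)

lemma card_chains: "distinct t \<Longrightarrow> card (chains t) = 2 ^ length t"
  using bij_betw_same_card[OF bij_chains[of t]] by (simp add: card_Pow distinct_card)

section \<open>The kernel of the polar form\<close>

context list_pair
begin

text \<open>Stated by prefix sums because for a boundary these are the values of the vertex function
  at the left ends of the two copies of a side, up to its value at the origin.
  \<open>radical_iff\<close> identifies the set with the kernel of the polar form.\<close>

definition radical :: "('a \<Rightarrow> bit) set" where
  "radical = {x \<in> chains t. \<forall>a\<in>set t.
     (\<Sum>c | c \<in> set t \<and> pos t c < pos t a. x c) = (\<Sum>c | c \<in> set t \<and> pos b c < pos b a. x c)}"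

lemma polar_q0_sum:
  "polar q0 x (\<Sum>a\<in>A. unit a) = (\<Sum>a\<in>A. polar q0 x (unit a))"
proof -
  have comm: "polar q0 u v = polar q0 v u" for u v by (simp add: polar_def ac_simps)
  have "polar q0 (\<Sum>a\<in>A. unit a) x = (\<Sum>a\<in>A. polar q0 (unit a) x)"
  proof (induction A rule: infinite_finite_induct)
    case (insert a A)
    thus ?case using polar_q0_add[of "unit a" "\<Sum>a\<in>A. unit a" x]
      by (simp only: sum.insert[OF insert.hyps(1,2)])
  qed (simp_all add: polar_q0)
  thus ?thesis by (simp only: comm[of x])
qed

lemma radical_iff: "x \<in> radical \<longleftrightarrow> x \<in> chains t \<and> (\<forall>y\<in>chains t. polar q0 x y = 0)"
proof -
  have eq: "u + v = 0 \<longleftrightarrow> u = v" for u v :: bit using bit_cases[of u] bit_cases[of v] by auto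
  have 1: "x \<in> radical \<longleftrightarrow> x \<in> chains t \<and> (\<forall>a\<in>set t. polar q0 x (unit a) = 0)"
    unfolding radical_def by (auto simp: polar_q0_prefix eq)
  have "polar q0 x y = 0" if "\<forall>a\<in>set t. polar q0 x (unit a) = 0" "y \<in> chains t" for y
  proof -
    have "polar q0 x (\<Sum>a | a \<in> set t \<and> y a = 1. unit a) = 0"
      unfolding polar_q0_sum by (rule sum.neutral) (use that in auto)
    thus ?thesis using chain_expand[OF that(2)] by simp
  qed
  thus ?thesis using 1 unit_in_chains by blast
qed

text \<open>The radical is orthogonal to all chains, so only the values of \<open>q0\<close> on the
  radical itself could prevent the form from passing to the quotient.\<close>

lemma bit_form_radical:
  assumes "\<And>r. r \<in> radical \<Longrightarrow> q0 r = 0"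
  shows "bit_form (chains t) radical q0"
proof
  show "bit_space (chains t)" by (rule bit_space_chains)
  show sub: "radical \<subseteq> chains t" by (auto simp: radical_def)
  have z: "polar q0 0 y = 0" for y by (simp add: polar_q0)
  show "bit_space radical"
    using finite_subset[OF sub finite_chains] bit_space_chains[of t]
    by (auto simp: bit_space_def radical_iff polar_q0_add z)
  show "quadratic_form_mod (chains t) radical q0"
    unfolding quadratic_form_mod_def
  proof (intro conjI ballI)
    fix x r assume x: "x \<in> chains t" and r: "r \<in> radical"
    have "polar q0 r x = 0" using x r by (simp add: radical_iff)
    hence "q0 (r + x) = q0 r + q0 x" using bit_cases[of "q0 (r + x)"] bit_cases[of "q0 r"] bit_cases[of "q0 x"]
      by (auto simp: polar_def)
    thus "q0 (x + r) = q0 x" using assms[OF r] by (simp add: add.commute)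
  qed (rule polar_q0_add)
qed

text \<open>For the chain with support \<open>A\<close> the linear part of \<open>q0\<close> counts
  the letters and the quadratic part the inversions.\<close>

lemma bsgn_q0:
  assumes "A \<subseteq> set t"
  shows "bsgn (q0 (\<lambda>a. if a \<in> A then 1 else 0)) = (-1) ^ card A * inv_sign (pos t) (pos b) A"
proof -
  have fin: "finite A" using assms finite_subset by auto
  have 1: "(\<Sum>a\<in>set t. if a \<in> A then 1 else 0) = (of_nat (card A) :: bit)"
    using assms by (simp add: sum.If_cases Int_absorb1)
  have "(\<Sum>(a, c)\<in>inv_pairs. (if a \<in> A then 1 else 0) * (if c \<in> A then 1 else 0)) =
      (\<Sum>p\<in>inv_pairs. if p \<in> A \<times> A then 1 else (0::bit))"
    by (rule sum.cong) (auto split: if_splits)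
  also have "\<dots> = of_nat (card (inv_pairs \<inter> A \<times> A))"
    using finite_inv_pairs by (simp add: sum.If_cases Int_def)
  also have "inv_pairs \<inter> A \<times> A = {(x, y). x \<in> A \<and> y \<in> A \<and> pos t x < pos t y \<and> pos b y < pos b x}"
    using assms by (auto simp: inv_pairs_def)
  finally show ?thesis
    using 1 by (simp add: q0_def bsgn_add bsgn_of_nat inv_sign_def inv_count_def)
qed

end

section \<open>Standard permutations\<close>

lemma sum_prefix_nth:
  assumes "distinct w" "k \<le> length w"
  shows "(\<Sum>c | c \<in> set w \<and> pos w c < k. x c) = (\<Sum>i<k. (x (w ! i) :: 'b::comm_monoid_add))"
proof (rule sum.reindex_bij_witness[where i = "\<lambda>i. w ! i" and j = "pos w"])
  show "pos w (w ! i) = i" if "i \<in> {..<k}" for i using that assms by (simp add: pos_nth)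
  show "w ! i \<in> {c. c \<in> set w \<and> pos w c < k}" if "i \<in> {..<k}" for i
    using that assms by (simp add: pos_nth)
qed (auto simp: nth_pos)

text \<open>Invariant sets are unions of orbits, and avoiding \<open>s\<close> rules out exactly one
  orbit.\<close>

lemma card_invariant_sets:
  assumes \<sigma>: "\<sigma> permutes S" and fin: "finite S" and s: "s \<in> S"
  shows "card {A. A \<subseteq> S \<and> s \<notin> A \<and> (\<forall>x\<in>S. \<sigma> x \<in> A \<longleftrightarrow> x \<in> A)} = 2 ^ (card (orbit \<sigma> ` S) - 1)"
proof -
  let ?D = "Pow (orbit \<sigma> ` S - {orbit \<sigma> s})"
  let ?I = "{A. A \<subseteq> S \<and> s \<notin> A \<and> (\<forall>x\<in>S. \<sigma> x \<in> A \<longleftrightarrow> x \<in> A)}"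
  note self = orbit_self[OF \<sigma> fin] and eq = orbit_eq[OF \<sigma> fin] and in_iff = orbit_in_iff[OF \<sigma> fin]
  have closed: "orbit \<sigma> x \<subseteq> A" if "A \<in> ?I" "x \<in> A" for A x
  proof
    fix y assume "y \<in> orbit \<sigma> x"
    thus "y \<in> A" by induction (use that in auto)
  qed
  have "bij_betw Union ?D ?I"
  proof (rule bij_betwI[where g = "\<lambda>A. orbit \<sigma> ` A"])
    show "Union \<in> ?D \<rightarrow> ?I"
    proof
      fix D assume D: "D \<in> ?D"
      have "\<Union>D \<subseteq> S" using D permutes_orbit_subset[OF \<sigma>] by blast
      moreover have "s \<notin> \<Union>D"
      proof
        assume "s \<in> \<Union>D"
        then obtain x where "orbit \<sigma> x \<in> D" "s \<in> orbit \<sigma> x" using D by blast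
        thus False using eq[of s x] D by auto
      qed
      moreover have "\<sigma> x \<in> \<Union>D \<longleftrightarrow> x \<in> \<Union>D" for x
      proof -
        have "\<sigma> x \<in> C \<longleftrightarrow> x \<in> C" if "C \<in> D" for C
        proof -
          obtain y where "C = orbit \<sigma> y" using D \<open>C \<in> D\<close> by blast
          thus ?thesis using in_iff by simp
        qed
        thus ?thesis by blast
      qed
      ultimately show "\<Union>D \<in> ?I" by blast
    qed
    show "(\<lambda>A. orbit \<sigma> ` A) \<in> ?I \<rightarrow> ?D"
    proof
      fix A assume A: "A \<in> ?I"
      have "orbit \<sigma> x \<noteq> orbit \<sigma> s" if "x \<in> A" for x
        using closed[OF A that] self[of s] A by auto
      thus "orbit \<sigma> ` A \<in> ?D" using A by auto
    qed
    show "orbit \<sigma> ` \<Union>D = D" if D: "D \<in> ?D" for D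
    proof (intro equalityI subsetI)
      fix C assume "C \<in> orbit \<sigma> ` \<Union>D"
      then obtain y x where "C = orbit \<sigma> y" "y \<in> orbit \<sigma> x" "orbit \<sigma> x \<in> D" using D by blast
      thus "C \<in> D" using eq by metis
    next
      fix C assume C: "C \<in> D"
      then obtain x where "C = orbit \<sigma> x" using D by blast
      thus "C \<in> orbit \<sigma> ` \<Union>D" using self[of x] C by blast
    qed
    show "\<Union>(orbit \<sigma> ` A) = A" if A: "A \<in> ?I" for A
      using closed[OF A] self by blast
  qed
  hence "card ?I = card ?D" by (simp only: bij_betw_same_card)
  also have "\<dots> = 2 ^ (card (orbit \<sigma> ` S) - 1)"
    using fin s by (simp add: card_Pow card_Diff_singleton)
  finally show ?thesis .
qed

section \<open>The two rows of a standard permutation\<close>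

locale standard_pair =
  fixes N star :: nat and \<tau>t \<tau>b :: "nat \<Rightarrow> nat"
  assumes lt: "long_cycle {1..N} \<tau>t" and lb: "long_cycle {1..N} \<tau>b" and star: "star \<in> {1..N}"
begin

abbreviation "S \<equiv> {1..N}"
abbreviation "tw \<equiv> standard_top N star \<tau>t"
abbreviation "bw \<equiv> standard_bottom N star \<tau>b"

sublocale cyc: cycle_pair S \<tau>t \<tau>b
  using lt lb by unfold_locales

lemma N_pos: "0 < N"
  using star by auto

context
  fixes \<tau> :: "nat \<Rightarrow> nat" and w :: "letter list" and x y :: letter
  assumes lc: "long_cycle S \<tau>" and w: "w = x # map (\<lambda>i. Lt ((\<tau> ^^ i) star)) [1..<N] @ [y]"
    and xy: "{x, y} = {Rt, Rb}"
begin

private lemma orb: "orbit \<tau> star = S"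
  by (rule long_cycle_orbit[OF lc star])

lemma pow_eq: "i < N \<Longrightarrow> j < N \<Longrightarrow> (\<tau> ^^ i) star = (\<tau> ^^ j) star \<Longrightarrow> i = j"
  using orbit_period(3)[OF long_cycle_permutes[OF lc] finite_atLeastAtMost, where x = star] orb by simp

lemma pow_N: "(\<tau> ^^ N) star = star"
  using orbit_period(1)[OF long_cycle_permutes[OF lc] finite_atLeastAtMost, where x = star] orb by simp

lemma pow_image: "(\<lambda>i. (\<tau> ^^ i) star) ` {..<N} = S"
  using orbit_period(4)[OF long_cycle_permutes[OF lc] finite_atLeastAtMost, where x = star] orb by auto

lemma rk_pow: "i < N \<Longrightarrow> rk \<tau> star ((\<tau> ^^ i) star) = i"
proof (rule rk_eqI[OF refl])
  fix j assume "i < N" "j < i"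
  thus "(\<tau> ^^ j) star \<noteq> (\<tau> ^^ i) star" using pow_eq[of j i] by auto
qed

lemma rk_less: "z \<in> S \<Longrightarrow> rk \<tau> star z < N"
proof -
  assume "z \<in> S"
  then obtain i where "i < N" "z = (\<tau> ^^ i) star" using pow_image by (metis (no_types, lifting) imageE lessThan_iff)
  thus "rk \<tau> star z < N" using rk_pow by simp
qed

lemma pow_rk: "z \<in> S \<Longrightarrow> (\<tau> ^^ rk \<tau> star z) star = z"
  using rk_prop[OF lc star] .

lemma length_row: "length w = N + 1"
  using N_pos by (simp add: w)

lemma row_0: "w ! 0 = x"
  by (simp add: w)

lemma row_N: "w ! N = y"
  using N_pos by (simp add: w nth_append)

lemma row_mid: "0 < i \<Longrightarrow> i < N \<Longrightarrow> w ! i = Lt ((\<tau> ^^ i) star)"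
  by (auto simp: w nth_append nth_Cons')

lemma pow_image': "(\<lambda>i. (\<tau> ^^ i) star) ` {1..<N} = S - {star}"
proof -
  have "{..<N} = insert 0 {1..<N}" using N_pos by auto
  hence "insert star ((\<lambda>i. (\<tau> ^^ i) star) ` {1..<N}) = S" using pow_image by simp
  moreover have "star \<notin> (\<lambda>i. (\<tau> ^^ i) star) ` {1..<N}"
  proof
    assume "star \<in> (\<lambda>i. (\<tau> ^^ i) star) ` {1..<N}"
    then obtain i where "i \<in> {1..<N}" "(\<tau> ^^ i) star = star" by auto
    thus False using pow_eq[of i 0] by simp
  qed
  ultimately show ?thesis by (metis Diff_insert_absorb)
qed

lemma set_row: "set w = insert Rt (insert Rb (Lt ` (S - {star})))"
proof -
  have "set w = {x, y} \<union> Lt ` (\<lambda>i. (\<tau> ^^ i) star) ` {1..<N}" by (auto simp: w)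
  thus ?thesis unfolding pow_image' xy by auto
qed

lemma distinct_row: "distinct w"
proof -
  have "x \<noteq> y" using xy by (auto simp: doubleton_eq_iff)
  moreover have "x \<notin> range Lt" "y \<notin> range Lt" using xy by (auto simp: doubleton_eq_iff)
  moreover have "inj_on (\<lambda>i. Lt ((\<tau> ^^ i) star)) {1..<N}"
  proof (rule inj_onI)
    fix i j assume "i \<in> {1..<N}" "j \<in> {1..<N}" "Lt ((\<tau> ^^ i) star) = Lt ((\<tau> ^^ j) star)"
    thus "i = j" using pow_eq[of i j] by simp
  qed
  ultimately show ?thesis by (auto simp: w distinct_map)
qed

lemma pos_row_0: "pos w x = 0" and pos_row_N: "pos w y = N"
  using pos_nth[OF distinct_row, of 0] pos_nth[OF distinct_row, of N] length_row row_0 row_N by auto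

lemma pos_row_Lt:
  assumes "z \<in> S - {star}"
  shows "pos w (Lt z) = rk \<tau> star z"
proof -
  obtain i where i: "i \<in> {1..<N}" "z = (\<tau> ^^ i) star" using assms pow_image' by blast
  hence "pos w (Lt z) = i" using pos_nth[OF distinct_row, of i] length_row row_mid[of i] by auto
  thus ?thesis using rk_pow[of i] i by simp
qed

lemma row_prefix:
  assumes A: "star \<notin> A" and X: "\<And>i. i < N \<Longrightarrow> X (w ! i) = of_bool (((\<tau> ^^ i) star \<in> A) \<noteq> (\<tau> ((\<tau> ^^ i) star) \<in> A))"
  shows "k \<le> N \<Longrightarrow> (\<Sum>i<k. X (w ! i)) = (of_bool ((\<tau> ^^ k) star \<in> A) :: bit)"
proof (induction k)
  case (Suc k)
  thus ?case using X[of k] by (cases "(\<tau> ^^ k) star \<in> A") auto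
qed (simp add: A)

text \<open>The step from the last element of the cycle back to \<open>star\<close> is a
  wrap-around; there the vanishing of the sum over the first \<open>N\<close> letters is
  used.\<close>

lemma row_step:
  assumes f: "\<And>z. z \<in> S \<Longrightarrow> f z = (\<Sum>i<rk \<tau> star z. X (w ! i) :: bit)" and total: "(\<Sum>i<N. X (w ! i)) = 0"
    and z: "z \<in> S"
  shows "f (\<tau> z) = f z + X (w ! rk \<tau> star z)"
proof -
  have tz: "\<tau> z \<in> S" using z long_cycle_in[OF lc] by simp
  show ?thesis
  proof (cases "\<tau> z = star")
    case False
    thus ?thesis using rk_succ[OF lc star z] f[OF z] f[OF tz] by simp
  next
    case True
    have "rk \<tau> star z = N - 1"
    proof -
      have "(\<tau> ^^ Suc (N - 1)) star = star" using pow_N N_pos by simp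
      hence "\<tau> ((\<tau> ^^ (N - 1)) star) = \<tau> z" using True by simp
      hence "(\<tau> ^^ (N - 1)) star = z" using long_cycle_inj[OF lc] by blast
      thus ?thesis using rk_pow[of "N - 1"] N_pos by simp
    qed
    moreover have "N = Suc (N - 1)" using N_pos by simp
    ultimately have "f z + X (w ! rk \<tau> star z) = 0"
      using f[OF z] total by (metis sum.lessThan_Suc)
    moreover have "f (\<tau> z) = 0" using f[OF tz] True by simp
    ultimately show ?thesis by simp
  qed
qed

end

lemma row_xy: "{Rt, Rb} = {Rt, Rb}" "{Rb, Rt} = {Rt, Rb}" by auto

sublocale list_pair tw bw
proof
  show "distinct tw" by (rule distinct_row[OF lt standard_top_def row_xy(1)])
  show "distinct bw" by (rule distinct_row[OF lb standard_bottom_def row_xy(2)])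
  show "set bw = set tw"
    unfolding set_row[OF lt standard_top_def row_xy(1)] set_row[OF lb standard_bottom_def row_xy(2)] ..
qed

lemmas set_top = set_row[OF lt standard_top_def row_xy(1)]
lemmas set_bot = set_row[OF lb standard_bottom_def row_xy(2)]
lemmas length_top = length_row[OF lt standard_top_def row_xy(1)]
lemmas length_bot = length_row[OF lb standard_bottom_def row_xy(2)]
lemmas pos_top = pos_row_0[OF lt standard_top_def row_xy(1)] pos_row_N[OF lt standard_top_def row_xy(1)]
  pos_row_Lt[OF lt standard_top_def row_xy(1)]
lemmas pos_bot = pos_row_0[OF lb standard_bottom_def row_xy(2)] pos_row_N[OF lb standard_bottom_def row_xy(2)]
  pos_row_Lt[OF lb standard_bottom_def row_xy(2)]

lemma rk_pos: "z \<in> S - {star} \<Longrightarrow> 0 < rk \<tau>t star z \<and> rk \<tau>t star z < N \<and> 0 < rk \<tau>b star z \<and> rk \<tau>b star z < N"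
  using rk_first_less[OF lt star, of z] rk_first_less[OF lb star, of z]
    rk_less[OF lt standard_top_def row_xy(1), of z] rk_less[OF lb standard_bottom_def row_xy(2), of z] by auto

abbreviation "is \<equiv> inv_sign (pos tw) (pos bw)"

lemma is_Lt:
  assumes "X \<subseteq> S - {star}"
  shows "is (Lt ` X) = cyc.sg star star X"
proof -
  have "inv_count (pos tw) (pos bw) (Lt ` X) = inv_count (pos tw \<circ> Lt) (pos bw \<circ> Lt) X"
    by (rule inv_count_image) (auto simp: inj_on_def)
  also have "\<dots> = inv_count (rk \<tau>t star) (rk \<tau>b star) X"
  proof -
    have "pos tw (Lt z) = rk \<tau>t star z" "pos bw (Lt z) = rk \<tau>b star z" if "z \<in> X" for z
      using that assms pos_top(3) pos_bot(3) by blast+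
    thus ?thesis by (intro inv_count_cong) simp
  qed
  finally show ?thesis by (simp add: inv_sign_def cyc.sg_def)
qed

lemma inj_pos_sub: "A \<subseteq> set tw \<Longrightarrow> inj_on (pos tw) A \<and> inj_on (pos bw) A"
  using inj_on_pos[of tw] inj_on_pos[of bw] inj_on_subset set_eq by metis

text \<open>\<open>Rt\<close> is first on top and last at the bottom, \<open>Rb\<close> conversely,
  so each of them is inverted with every other letter.\<close>

lemma is_insert:
  assumes X: "X \<subseteq> S - {star}"
  shows "is (insert Rt (Lt ` X)) = is (Lt ` X) * (-1) ^ card X"
    "is (insert Rb (Lt ` X)) = is (Lt ` X) * (-1) ^ card X"
    "is (insert Rt (insert Rb (Lt ` X))) = - is (Lt ` X)"
proof -
  have fin: "finite (Lt ` X)" using X finite_subset by (intro finite_imageI) blast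
  have sub: "insert Rt (insert Rb (Lt ` X)) \<subseteq> set tw" using X set_top by auto
  have rkX: "z \<in> X \<Longrightarrow> 0 < pos tw (Lt z) \<and> pos tw (Lt z) < N \<and> 0 < pos bw (Lt z) \<and> pos bw (Lt z) < N" for z
    using X rk_pos[of z] pos_top(3)[of z] pos_bot(3)[of z] by (auto dest!: subsetD)
  have cX: "card (Lt ` X) = card X" by (rule card_image) (auto simp: inj_on_def)
  have inj: "inj_on (pos tw) A" "inj_on (pos bw) A" if "A \<subseteq> insert Rt (insert Rb (Lt ` X))" for A
    using inj_pos_sub[of A] sub that by auto
  have 1: "{z \<in> Lt ` X. (pos tw z < pos tw Rt) \<noteq> (pos bw z < pos bw Rt)} = Lt ` X"
    "{z \<in> Lt ` X. (pos tw z < pos tw Rb) \<noteq> (pos bw z < pos bw Rb)} = Lt ` X"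
    using rkX pos_top pos_bot by auto
  have 2: "{z \<in> insert Rb (Lt ` X). (pos tw z < pos tw Rt) \<noteq> (pos bw z < pos bw Rt)} = insert Rb (Lt ` X)"
    using rkX pos_top pos_bot N_pos by auto
  show "is (insert Rt (Lt ` X)) = is (Lt ` X) * (-1) ^ card X"
  proof -
    have "inv_count (pos tw) (pos bw) (insert Rt (Lt ` X)) = inv_count (pos tw) (pos bw) (Lt ` X) + card X"
      by (subst inv_count_insert[OF fin _ inj(1) inj(2)]) (auto simp only: 1 cX)
    thus ?thesis by (simp add: inv_sign_def power_add)
  qed
  show Rb: "is (insert Rb (Lt ` X)) = is (Lt ` X) * (-1) ^ card X"
  proof -
    have "inv_count (pos tw) (pos bw) (insert Rb (Lt ` X)) = inv_count (pos tw) (pos bw) (Lt ` X) + card X"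
      by (subst inv_count_insert[OF fin _ inj(1) inj(2)]) (auto simp only: 1 cX)
    thus ?thesis by (simp add: inv_sign_def power_add)
  qed
  have c2: "card (insert Rb (Lt ` X)) = Suc (card X)" using fin cX by (subst card_insert_disjoint) auto
  have "is (insert Rt (insert Rb (Lt ` X))) = is (insert Rb (Lt ` X)) * (-1) ^ card (insert Rb (Lt ` X))"
  proof -
    have "inv_count (pos tw) (pos bw) (insert Rt (insert Rb (Lt ` X))) =
        inv_count (pos tw) (pos bw) (insert Rb (Lt ` X)) + card (insert Rb (Lt ` X))"
      by (subst inv_count_insert[OF finite.insertI[OF fin] _ inj(1) inj(2)]) (auto simp only: 2)
    thus ?thesis by (simp add: inv_sign_def power_add)
  qed
  thus "is (insert Rt (insert Rb (Lt ` X))) = - is (Lt ` X)"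
    unfolding Rb c2 by (simp add: mult.assoc)
qed

lemma sg_star: "X \<subseteq> S \<Longrightarrow> cyc.sg star star (toggle star X) = cyc.sg star star X"
  using cyc.sg_toggle_first[OF star star] by (simp add: cyc.G_self)

text \<open>\<open>star\<close> is first in both orders and takes part in no inversion, so it can be
  added to a set or removed from it to adjust the parity of the size.\<close>

lemma odd_sum_star: "cyc.odd_sum = (\<Sum>X\<in>Pow (S - {star}). cyc.sg star star X)"
proof -
  let ?h = "\<lambda>X. if odd (card X) then X else insert star X"
  have "cyc.odd_sum = (\<Sum>X | X \<subseteq> S \<and> odd (card X). cyc.sg star star X)"
    by (rule cyc.odd_sum_eq[OF star star])
  also have "\<dots> = (\<Sum>X\<in>Pow (S - {star}). cyc.sg star star X)"
  proof (rule sum.reindex_bij_witness[where j = "\<lambda>X. X - {star}" and i = ?h])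
    fix X assume X: "X \<in> {X. X \<subseteq> S \<and> odd (card X)}"
    hence fin: "finite X" using finite_subset by auto
    show "?h (X - {star}) = X" using X fin by (cases "star \<in> X") auto
    show "X - {star} \<in> Pow (S - {star})" using X by auto
    show "cyc.sg star star (X - {star}) = cyc.sg star star X"
      using sg_star[of X] X by (cases "star \<in> X") (auto simp: toggle_def)
  next
    fix X assume X: "X \<in> Pow (S - {star})"
    hence fin: "finite X" using finite_subset by auto
    show "?h X - {star} = X" using X by auto
    show "?h X \<in> {X. X \<subseteq> S \<and> odd (card X)}"
      using X fin star by (auto simp: card_insert_if)
  qed
  finally show ?thesis .
qed

text \<open>Each \<open>X \<subseteq> S - {star}\<close> occurs in four sets of letters. The one
  without \<open>Rt\<close> and \<open>Rb\<close> and the one with both cancel; the two with exactly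
  one of them contribute minus the sign of \<open>X\<close> each.\<close>

lemma gauss_q0: "(\<Sum>x\<in>chains tw. bsgn (q0 x)) = -2 * cyc.odd_sum"
proof -
  let ?P = "Pow (S - {star})"
  let ?F = "\<lambda>A. (-1) ^ card A * is A"
  have "(\<Sum>x\<in>chains tw. bsgn (q0 x)) = (\<Sum>A\<in>Pow (set tw). ?F A)"
    by (subst sum.reindex_bij_betw[OF bij_chains, symmetric]) (rule sum.cong, auto simp: bsgn_q0)
  also have "Pow (set tw) = (Pow (Lt ` (S - {star})) \<union> insert Rb ` Pow (Lt ` (S - {star}))) \<union>
      insert Rt ` (Pow (Lt ` (S - {star})) \<union> insert Rb ` Pow (Lt ` (S - {star})))"
    unfolding set_top Pow_insert ..
  also have "Pow (Lt ` (S - {star})) = image Lt ` ?P" by (rule image_Pow_surj[symmetric]) simp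
  also have "(\<Sum>A\<in>(image Lt ` ?P \<union> insert Rb ` image Lt ` ?P) \<union> insert Rt ` (image Lt ` ?P \<union> insert Rb ` image Lt ` ?P). ?F A)
      = (\<Sum>A\<in>image Lt ` ?P \<union> insert Rb ` image Lt ` ?P. ?F A) + (\<Sum>A\<in>insert Rt ` (image Lt ` ?P \<union> insert Rb ` image Lt ` ?P). ?F A)"
    by (rule sum.union_disjoint) auto
  also have "(\<Sum>A\<in>insert Rt ` (image Lt ` ?P \<union> insert Rb ` image Lt ` ?P). ?F A) = (\<Sum>A\<in>image Lt ` ?P \<union> insert Rb ` image Lt ` ?P. ?F (insert Rt A))"
    by (subst sum.reindex) (auto simp: inj_on_def insert_ident image_iff)
  also have "(\<Sum>A\<in>image Lt ` ?P \<union> insert Rb ` image Lt ` ?P. ?F A) + (\<Sum>A\<in>image Lt ` ?P \<union> insert Rb ` image Lt ` ?P. ?F (insert Rt A))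
      = (\<Sum>A\<in>image Lt ` ?P \<union> insert Rb ` image Lt ` ?P. ?F A + ?F (insert Rt A))"
    by (rule sum.distrib[symmetric])
  also have "\<dots> = (\<Sum>A\<in>image Lt ` ?P. ?F A + ?F (insert Rt A)) + (\<Sum>A\<in>insert Rb ` image Lt ` ?P. ?F A + ?F (insert Rt A))"
    by (rule sum.union_disjoint) auto
  also have "(\<Sum>A\<in>insert Rb ` image Lt ` ?P. ?F A + ?F (insert Rt A)) = (\<Sum>A\<in>image Lt ` ?P. ?F (insert Rb A) + ?F (insert Rt (insert Rb A)))"
    by (subst sum.reindex) (auto simp: inj_on_def insert_ident image_iff)
  also have "(\<Sum>A\<in>image Lt ` ?P. ?F A + ?F (insert Rt A)) + (\<Sum>A\<in>image Lt ` ?P. ?F (insert Rb A) + ?F (insert Rt (insert Rb A)))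
      = (\<Sum>A\<in>image Lt ` ?P. (?F A + ?F (insert Rt A)) + (?F (insert Rb A) + ?F (insert Rt (insert Rb A))))"
    by (rule sum.distrib[symmetric])
  also have "\<dots> = (\<Sum>X\<in>?P. (?F (Lt ` X) + ?F (insert Rt (Lt ` X))) + (?F (insert Rb (Lt ` X)) + ?F (insert Rt (insert Rb (Lt ` X)))))"
    by (subst sum.reindex) (auto simp: inj_on_def inj_image_eq_iff)
  also have "\<dots> = (\<Sum>X\<in>?P. -2 * cyc.sg star star X)"
  proof (rule sum.cong[OF refl])
    fix X assume "X \<in> ?P"
    hence X: "X \<subseteq> S - {star}" by simp
    have fin: "finite (Lt ` X)" using X finite_subset by (intro finite_imageI) blast
    have cX: "card (Lt ` X) = card X" by (rule card_image) (auto simp: inj_on_def)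
    have c: "card (insert Rt (Lt ` X)) = Suc (card X)" "card (insert Rb (Lt ` X)) = Suc (card X)"
      "card (insert Rt (insert Rb (Lt ` X))) = Suc (Suc (card X))"
      using fin cX by (auto simp: card_insert_if)
    have p: "(-1) ^ card X * (i * (-1) ^ card X) = (i :: int)" for i
      by (cases "even (card X)") auto
    show "(?F (Lt ` X) + ?F (insert Rt (Lt ` X))) + (?F (insert Rb (Lt ` X)) + ?F (insert Rt (insert Rb (Lt ` X)))) = -2 * cyc.sg star star X"
      unfolding is_insert[OF X] c cX is_Lt[OF X, symmetric] using p by simp
  qed
  also have "\<dots> = -2 * cyc.odd_sum" unfolding odd_sum_star by (simp add: sum_distrib_left)
  finally show ?thesis .
qed

end

section \<open>Values of the form on the radical\<close>

context standard_pair
begin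

text \<open>Leaving out \<open>star\<close> selects one set from each pair of complementary
  invariant sets, which have the same boundary.\<close>

definition inv_sets :: "nat set set" where
  "inv_sets = {A. A \<subseteq> S \<and> star \<notin> A \<and> (\<forall>x\<in>S. cyc.sigma x \<in> A \<longleftrightarrow> x \<in> A)}"

text \<open>The radical consists of the boundaries \<open>rx A\<close> of the \<open>\<sigma>\<close>-invariant sets \<open>A\<close>: vertices of the surface
  correspond to cycles of \<open>\<sigma>\<close>.\<close>

definition vd :: "nat set \<Rightarrow> nat \<Rightarrow> bit" where
  "vd A y = of_bool ((y \<in> A) \<noteq> (\<tau>b y \<in> A))"

definition rx :: "nat set \<Rightarrow> letter \<Rightarrow> bit" where
  "rx A c = (case c of Lt y \<Rightarrow> (if y \<in> S - {star} then vd A y else 0) | _ \<Rightarrow> vd A star)"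

lemmas pow_t_in = long_cycle_in[OF lt] and pow_b_in = long_cycle_in[OF lb]

lemma prefix_tw: "k \<le> N + 1 \<Longrightarrow> (\<Sum>c | c \<in> set tw \<and> pos tw c < k. x c) = (\<Sum>i<k. (x (tw ! i) :: bit))"
  using sum_prefix_nth[OF dt] length_top by simp

lemma prefix_bw: "k \<le> N + 1 \<Longrightarrow> (\<Sum>c | c \<in> set tw \<and> pos bw c < k. x c) = (\<Sum>i<k. (x (bw ! i) :: bit))"
  using sum_prefix_nth[OF db] length_bot set_eq by simp

lemma pow_in: "(\<tau>t ^^ i) star \<in> S" "(\<tau>b ^^ i) star \<in> S"
  by (induction i) (use star pow_t_in pow_b_in in auto)

lemmas nth_tw = row_0[OF lt standard_top_def row_xy(1)] row_N[OF lt standard_top_def row_xy(1)] row_mid[OF lt standard_top_def row_xy(1)]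
lemmas nth_bw = row_0[OF lb standard_bottom_def row_xy(2)] row_N[OF lb standard_bottom_def row_xy(2)] row_mid[OF lb standard_bottom_def row_xy(2)]
lemmas t_facts = pow_N[OF lt standard_top_def row_xy(1)] pow_eq[OF lt standard_top_def row_xy(1)] pow_rk[OF lt standard_top_def row_xy(1)] rk_less[OF lt standard_top_def row_xy(1)]
lemmas b_facts = pow_N[OF lb standard_bottom_def row_xy(2)] pow_eq[OF lb standard_bottom_def row_xy(2)] pow_rk[OF lb standard_bottom_def row_xy(2)] rk_less[OF lb standard_bottom_def row_xy(2)]

lemma vd_t: "A \<in> inv_sets \<Longrightarrow> y \<in> S \<Longrightarrow> vd A y = of_bool ((y \<in> A) \<noteq> (\<tau>t y \<in> A))"
proof -
  assume A: "A \<in> inv_sets" and y: "y \<in> S"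
  hence "\<tau>b y \<in> S" using pow_b_in by blast
  hence "cyc.sigma (\<tau>b y) \<in> A \<longleftrightarrow> \<tau>b y \<in> A" using A unfolding inv_sets_def by blast
  thus "vd A y = of_bool ((y \<in> A) \<noteq> (\<tau>t y \<in> A))" unfolding cyc.sigma_b vd_def by simp
qed

text \<open>\<open>Rt\<close> on top and \<open>Rb\<close> at the bottom stand where
  \<open>star\<close> would be. Along either row, \<open>rx A\<close> thus lists the jumps of the
  indicator of \<open>A\<close> along the cycle, and the sums telescope. For the top row invariance
  under \<open>sigma\<close> replaces \<open>\<tau>b y\<close> by \<open>\<tau>t y\<close>.\<close>

lemma rx_prefix:
  assumes A: "A \<in> inv_sets" and k: "k \<le> N"
  shows "(\<Sum>i<k. rx A (tw ! i)) = of_bool ((\<tau>t ^^ k) star \<in> A)"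
    "(\<Sum>i<k. rx A (bw ! i)) = of_bool ((\<tau>b ^^ k) star \<in> A)"
proof -
  have s: "star \<notin> A" using A by (simp add: inv_sets_def)
  have t: "rx A (tw ! i) = vd A ((\<tau>t ^^ i) star)" and b: "rx A (bw ! i) = vd A ((\<tau>b ^^ i) star)" if "i < N" for i
  proof -
    have "0 < i \<Longrightarrow> (\<tau>t ^^ i) star \<noteq> star" "0 < i \<Longrightarrow> (\<tau>b ^^ i) star \<noteq> star"
      using t_facts(2)[of i 0] b_facts(2)[of i 0] that by auto
    thus "rx A (tw ! i) = vd A ((\<tau>t ^^ i) star)" "rx A (bw ! i) = vd A ((\<tau>b ^^ i) star)"
      using that nth_tw nth_bw pow_in[of i] by (cases "i = 0"; auto simp: rx_def)+
  qed
  show "(\<Sum>i<k. rx A (tw ! i)) = of_bool ((\<tau>t ^^ k) star \<in> A)"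
    by (rule row_prefix[OF lt standard_top_def row_xy(1) s _ k]) (use t vd_t[OF A pow_in(1)] in simp)
  show "(\<Sum>i<k. rx A (bw ! i)) = of_bool ((\<tau>b ^^ k) star \<in> A)"
    by (rule row_prefix[OF lb standard_bottom_def row_xy(2) s _ k]) (use b in \<open>simp add: vd_def\<close>)
qed

lemma Lt_mem: "Lt y \<in> set tw \<longleftrightarrow> y \<in> S - {star}"
  unfolding set_top by (simp add: image_iff)

lemma rx_radical:
  assumes A: "A \<in> inv_sets"
  shows "rx A \<in> radical"
  unfolding radical_def
proof (intro CollectI conjI ballI)
  have s: "star \<notin> A" using A by (simp add: inv_sets_def)
  show "rx A \<in> chains tw" by (auto simp: chains_def set_top rx_def split: letter.splits)
  fix a assume a: "a \<in> set tw"
  have le: "pos tw a \<le> N" "pos bw a \<le> N"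
    using pos_less[OF a] length_top pos_less[of a bw] a set_eq length_bot by auto
  have "of_bool ((\<tau>t ^^ pos tw a) star \<in> A) = (of_bool ((\<tau>b ^^ pos bw a) star \<in> A) :: bit)"
  proof (cases a)
    case Rt
    thus ?thesis using pos_top pos_bot b_facts(1) by simp
  next
    case Rb
    thus ?thesis using pos_top pos_bot t_facts(1) by simp
  next
    case (Lt y)
    hence "y \<in> S - {star}" using a by (simp only: Lt_mem)
    thus ?thesis using Lt pos_top(3)[of y] pos_bot(3)[of y] t_facts(3)[of y] b_facts(3)[of y] by simp
  qed
  thus "(\<Sum>c | c \<in> set tw \<and> pos tw c < pos tw a. rx A c) = (\<Sum>c | c \<in> set tw \<and> pos bw c < pos bw a. rx A c)"
    unfolding prefix_tw[OF trans_le_add1[OF le(1)]] prefix_bw[OF trans_le_add1[OF le(2)]]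
      rx_prefix(1)[OF A le(1)] rx_prefix(2)[OF A le(2)] .
qed

lemma rx_inj: "inj_on rx inv_sets"
proof (rule inj_onI)
  fix A B assume A: "A \<in> inv_sets" and B: "B \<in> inv_sets" and eq: "rx A = rx B"
  have "(y \<in> A) = (y \<in> B)" if y: "y \<in> S" for y
  proof -
    have k: "rk \<tau>t star y \<le> N" using t_facts(4)[OF y] by simp
    have "(of_bool (y \<in> A) :: bit) = of_bool (y \<in> B)"
      using rx_prefix(1)[OF A k] rx_prefix(1)[OF B k] eq t_facts(3)[OF y] by simp
    thus ?thesis by (simp only: of_bool_eq_iff)
  qed
  thus "A = B" using A B unfolding inv_sets_def by blast
qed

text \<open>The prefix sums of \<open>x\<close> define a function \<open>f\<close> on
  \<open>S\<close> that can be computed along either row. Hence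
  \<open>f (\<tau>t y) = f (\<tau>b y)\<close>, and the set where \<open>f\<close> is 1 is
  invariant.\<close>

lemma rx_surj:
  assumes x: "x \<in> radical"
  shows "\<exists>A\<in>inv_sets. x = rx A"
proof -
  have rad: "(\<Sum>i<pos tw a. x (tw ! i)) = (\<Sum>i<pos bw a. x (bw ! i))" if a: "a \<in> set tw" for a
  proof -
    have le: "pos tw a \<le> N + 1" "pos bw a \<le> N + 1"
      using pos_less[OF a] length_top pos_less[of a bw] a set_eq length_bot by auto
    show ?thesis using x a prefix_tw[OF le(1), of x] prefix_bw[OF le(2), of x] by (simp add: radical_def)
  qed
  have chain: "x c = 0" if "c \<notin> set tw" for c using x that by (auto simp: radical_def chains_def)
  \<comment> \<open>\<open>Rb\<close> is last on top and first at the bottom, \<open>Rt\<close>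
    conversely, so one of the two prefixes is empty.\<close>
  have totals: "(\<Sum>i<N. x (tw ! i)) = 0" "(\<Sum>i<N. x (bw ! i)) = 0"
    using rad[of Rb] rad[of Rt] pos_top pos_bot set_top by auto
  \<comment> \<open>The full sum, taken along a row, reduces to the last letter of that row; this
    gives the equality of the values at \<open>Rt\<close> and \<open>Rb\<close>.\<close>
  have all: "(\<Sum>c\<in>set tw. x c) = x Rb" "(\<Sum>c\<in>set tw. x c) = x Rt"
  proof -
    have "{c. c \<in> set tw \<and> pos tw c < N + 1} = set tw" "{c. c \<in> set tw \<and> pos bw c < N + 1} = set tw"
      using pos_less[of _ tw] pos_less[of _ bw] length_top length_bot set_eq by auto
    hence "(\<Sum>c\<in>set tw. x c) = (\<Sum>i<N + 1. x (tw ! i))" "(\<Sum>c\<in>set tw. x c) = (\<Sum>i<N + 1. x (bw ! i))"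
      using prefix_tw[of "N + 1" x] prefix_bw[of "N + 1" x] by simp_all
    thus "(\<Sum>c\<in>set tw. x c) = x Rb" "(\<Sum>c\<in>set tw. x c) = x Rt"
      using totals nth_tw nth_bw by simp_all
  qed
  hence RtRb: "x Rt = x Rb" by simp
  define f where "f y = (\<Sum>i<rk \<tau>t star y. x (tw ! i))" for y
  have fb: "f y = (\<Sum>i<rk \<tau>b star y. x (bw ! i))" if y: "y \<in> S" for y
  proof (cases "y = star")
    case False
    hence "Lt y \<in> set tw" "y \<in> S - {star}" using y set_top by auto
    thus ?thesis using rad[of "Lt y"] pos_top(3)[of y] pos_bot(3)[of y] by (simp add: f_def)
  qed (simp add: f_def)
  have xt: "x (tw ! rk \<tau>t star y) = (if y = star then x Rt else x (Lt y))"
    and xb: "x (bw ! rk \<tau>b star y) = (if y = star then x Rb else x (Lt y))" if y: "y \<in> S" for y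
    using nth_tw nth_bw t_facts(3,4)[OF y] b_facts(3,4)[OF y] rk_pos[of y] y by (auto simp: rk_self)
  have step_t: "f (\<tau>t y) = f y + x (tw ! rk \<tau>t star y)" if "y \<in> S" for y
    by (rule row_step[OF lt standard_top_def row_xy(1) _ totals(1) that]) (simp add: f_def)
  have step_b: "f (\<tau>b y) = f y + x (bw ! rk \<tau>b star y)" if "y \<in> S" for y
    by (rule row_step[OF lb standard_bottom_def row_xy(2) _ totals(2) that]) (rule fb)
  have same: "f (\<tau>t y) = f (\<tau>b y)" if "y \<in> S" for y
    using step_t[OF that] step_b[OF that] xt[OF that] xb[OF that] RtRb by simp
  define A where "A = {y \<in> S. f y = 1}"
  have "f star = 0" by (simp add: f_def)
  moreover have "cyc.sigma v \<in> A \<longleftrightarrow> v \<in> A" if vS: "v \<in> S" for v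
  proof -
    obtain y where y: "y \<in> S" "\<tau>b y = v" using cyc.obtain_b[OF vS] .
    have "\<tau>t y \<in> A \<longleftrightarrow> \<tau>b y \<in> A"
      unfolding A_def using same[OF y(1)] pow_t_in[of y] pow_b_in[of y] y(1) by simp
    thus ?thesis using cyc.sigma_b[of y] y(2) by simp
  qed
  moreover have "A \<subseteq> S" by (auto simp: A_def)
  ultimately have A: "A \<in> inv_sets" unfolding inv_sets_def mem_Collect_eq using A_def by fastforce
  have vd: "vd A y = x (bw ! rk \<tau>b star y)" if y: "y \<in> S" for y
  proof -
    have "f y + f (\<tau>b y) = x (bw ! rk \<tau>b star y)"
      using step_b[OF y] by (simp flip: add.assoc)
    moreover have "vd A y = f y + f (\<tau>b y)"
      using y pow_b_in[of y] bit_cases[of "f y"] bit_cases[of "f (\<tau>b y)"] by (auto simp: vd_def A_def)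
    ultimately show ?thesis by simp
  qed
  have "x c = rx A c" for c
  proof (cases c)
    case Rt
    thus ?thesis using vd[OF star] xb[OF star] RtRb by (simp add: rx_def)
  next
    case Rb
    thus ?thesis using vd[OF star] xb[OF star] by (simp add: rx_def)
  next
    case (Lt y)
    show ?thesis
    proof (cases "y \<in> S - {star}")
      case True
      thus ?thesis using Lt vd[of y] xb[of y] by (simp add: rx_def)
    next
      case False
      hence "c \<notin> set tw" using Lt by (simp only: Lt_mem not_False_eq_True)
      moreover have "rx A c = 0" unfolding Lt rx_def using False by (simp only: letter.case if_False)
      ultimately show ?thesis using chain[of c] by simp
    qed
  qed
  hence "x = rx A" by (simp add: fun_eq_iff)
  thus ?thesis using A by blast
qed

lemma card_radical: "card radical = 2 ^ (card (orbit cyc.sigma ` S) - 1)"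
proof -
  have "rx ` inv_sets = radical" using rx_radical rx_surj by blast
  hence "card radical = card inv_sets" using card_image[OF rx_inj] by simp
  thus ?thesis unfolding inv_sets_def
    using card_invariant_sets[OF cyc.sigma_permutes cyc.fin star] by simp
qed

text \<open>The cycles of \<open>sigma\<close> in \<open>A\<close> are removed one at a time by
  \<open>sg_shift\<close>, without effect on the sign, until only \<open>{star}\<close>
  remains.\<close>

lemma sg_invariant:
  assumes odd: "\<And>x. x \<in> S \<Longrightarrow> odd (card (orbit cyc.sigma x))"
    and A: "A \<subseteq> S" "\<And>x. x \<in> S \<Longrightarrow> cyc.sigma x \<in> A \<longleftrightarrow> x \<in> A"
  defines "X \<equiv> \<lambda>A. {x \<in> S. ((x = star) \<noteq> (x \<in> A)) \<noteq> (\<tau>b x \<in> A)}"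
  shows "odd (card (X A)) \<and> cyc.sg star star (X A) = 1"
  using A
proof (induction "card A" arbitrary: A rule: less_induct)
  case less
  note \<sigma> = cyc.sigma_permutes cyc.fin
  show ?case
  proof (cases "A = {}")
    case True
    hence "X A = {star}" using star by (auto simp: X_def)
    moreover have "{(x, y). x \<in> {star} \<and> y \<in> {star} \<and> rk \<tau>t star x < rk \<tau>t star y \<and> rk \<tau>b star y < rk \<tau>b star x} = {}"
      by auto
    hence "inv_count (rk \<tau>t star) (rk \<tau>b star) {star} = 0" unfolding inv_count_def by (simp only: card.empty)
    ultimately show ?thesis by (simp add: cyc.sg_def inv_sign_def)
  next
    case False
    then obtain w where w: "w \<in> A" by auto
    let ?C = "orbit cyc.sigma w"
    have wS: "w \<in> S" using w less.prems by auto
    have CA: "?C \<subseteq> A"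
    proof
      fix y assume "y \<in> ?C"
      thus "y \<in> A" by induction (use w less.prems in auto)
    qed
    have finA: "finite A" using less.prems finite_subset by auto
    have "w \<in> ?C" by (rule orbit_self[OF \<sigma>])
    hence "A - ?C \<subset> A" using w by auto
    hence card: "card (A - ?C) < card A" by (rule psubset_card_mono[OF finA])
    have IH: "odd (card (X (A - ?C))) \<and> cyc.sg star star (X (A - ?C)) = 1"
    proof (rule less.hyps[OF card])
      show "A - ?C \<subseteq> S" using less.prems by auto
      show "cyc.sigma x \<in> A - ?C \<longleftrightarrow> x \<in> A - ?C" if "x \<in> S" for x
        using less.prems(2)[OF that] orbit_in_iff[OF \<sigma>, of x w] by auto
    qed
    have eq: "{x \<in> S. ((x \<in> X (A - ?C)) \<noteq> (x \<in> ?C)) \<noteq> (\<tau>b x \<in> ?C)} = X A"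
      using CA unfolding X_def by auto
    have "X (A - ?C) \<subseteq> S" by (auto simp: X_def)
    from cyc.sg_shift[OF wS odd[OF wS] this _ star star] IH show ?thesis unfolding eq by auto
  qed
qed

text \<open>The set \<open>X\<close> of \<open>sg_invariant\<close> arises from the support of
  \<open>vd A\<close> by toggling \<open>star\<close>. In the support of \<open>rx A\<close>, the
  element \<open>star\<close> is represented by the two letters \<open>Rt\<close> and
  \<open>Rb\<close> together. With \<open>is_insert\<close>, the odd size and the sign 1 of
  \<open>X\<close> translate into the value 0 of \<open>q0\<close>.\<close>

lemma q0_radical:
  assumes odd: "\<And>x. x \<in> S \<Longrightarrow> odd (card (orbit cyc.sigma x))" and x: "x \<in> radical"
  shows "q0 x = 0"
proof -
  obtain A where A: "A \<in> inv_sets" "x = rx A" using rx_surj[OF x] by blast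
  define r where "r = {y \<in> S. vd A y = 1}"
  define X where "X = {x \<in> S. ((x = star) \<noteq> (x \<in> A)) \<noteq> (\<tau>b x \<in> A)}"
  have XS: "X \<subseteq> S" by (auto simp: X_def)
  have oX: "odd (card X)" and sX: "cyc.sg star star X = 1"
    using sg_invariant[OF odd, of A] A by (auto simp: inv_sets_def X_def)
  have Xr: "x \<in> X \<longleftrightarrow> x \<in> S \<and> ((x = star) \<noteq> (x \<in> r))" for x
    by (auto simp: X_def r_def vd_def)
  let ?X0 = "r - {star}"
  have X0: "?X0 \<subseteq> S - {star}" by (auto simp: r_def)
  have fin: "finite ?X0" using X0 finite_subset by blast
  have cX: "card (Lt ` ?X0) = card ?X0" by (rule card_image) (auto simp: inj_on_def)
  have X0X: "?X0 = X - {star}"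
  proof (rule set_eqI)
    fix y show "y \<in> ?X0 \<longleftrightarrow> y \<in> X - {star}"
      using Xr[of y] by (cases "y = star") (auto simp: r_def)
  qed
  have s1: "cyc.sg star star ?X0 = 1"
    using sg_star[OF XS] sX unfolding X0X by (cases "star \<in> X") (auto simp: toggle_def)
  define supp where "supp = Lt ` ?X0 \<union> (if star \<in> r then {Rt, Rb} else {})"
  have supp: "supp \<subseteq> set tw" using X0 set_top by (auto simp: supp_def)
  have "rx A = (\<lambda>a. if a \<in> supp then 1 else 0)"
  proof
    fix c show "rx A c = (if c \<in> supp then 1 else 0)"
      using star by (cases c) (auto simp: rx_def supp_def r_def)
  qed
  hence q: "bsgn (q0 x) = (-1) ^ card supp * is supp" using bsgn_q0[OF supp] A by simp
  have "bsgn (q0 x) = 1"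
  proof (cases "star \<in> r")
    case False
    hence "supp = Lt ` ?X0" by (simp add: supp_def)
    moreover have "X = insert star ?X0" using X0X Xr star False by auto
    hence "card X = Suc (card ?X0)" using fin by (metis card_insert_disjoint DiffD2 singletonI)
    hence "even (card ?X0)" using oX by simp
    ultimately show ?thesis using q is_Lt[OF X0] s1 cX by simp
  next
    case True
    hence su: "supp = insert Rt (insert Rb (Lt ` ?X0))" by (auto simp: supp_def)
    have "X = ?X0" using X0X Xr True by auto
    hence "odd (card ?X0)" using oX by simp
    moreover have "card supp = Suc (Suc (card ?X0))" unfolding su using fin cX by (auto simp: card_insert_if)
    moreover have "is supp = - 1" unfolding su is_insert(3)[OF X0] is_Lt[OF X0] s1 ..
    ultimately show ?thesis using q by simp
  qed
  thus ?thesis using bit_cases[of "q0 x"] by auto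
qed

text \<open>Comparing cardinalities gives \<open>N + 1 = 2 * h + (k - 1)\<close>, that is
  \<open>h = g + 1\<close>. The Gauss sum \<open>-2 * odd_sum\<close> is therefore
  \<open>2 ^ (g + k)\<close> with the sign of the Arf invariant.\<close>

theorem odd_sum_arf:
  assumes odd: "\<And>x. x \<in> S \<Longrightarrow> odd (card (orbit cyc.sigma x))"
    and k: "k = card (orbit cyc.sigma ` S)" and g: "g = (N - k) div 2"
  shows "\<exists>s. has_arf_invariant (chains tw) radical q0 s \<and> cyc.odd_sum = - bsgn s * 2 ^ (g + k - 1)"
proof -
  interpret bf: bit_form "chains tw" radical q0
    by (rule bit_form_radical) (rule q0_radical[OF odd])
  have "\<exists>h x y. symplectic_basis_mod (chains tw) radical q0 h x y"
    by (rule symplectic_basis_exists[OF bf.bit_form_axioms]) (auto simp: radical_iff)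
  then obtain s where s: "has_arf_invariant (chains tw) radical q0 s"
    unfolding has_arf_invariant_def by blast
  obtain h where h: "card (chains tw) = 2 ^ h * 2 ^ h * card radical"
    and sum: "(\<Sum>v\<in>chains tw. bsgn (q0 v)) = 2 ^ h * int (card radical) * bsgn s"
    using bf.arf_gauss[OF s] .
  have kpos: "0 < k" unfolding k using star by (auto simp: card_gt_0_iff)
  have r: "card radical = 2 ^ (k - 1)" using card_radical k by simp
  have "(2::nat) ^ (N + 1) = 2 ^ (h + h + (k - 1))"
    using h card_chains[OF dt] length_top r by (simp add: power_add)
  hence Nh: "N + 1 = h + h + (k - 1)" using power_inject_exp[of "2::nat" "N + 1" "h + h + (k - 1)"] by simp
  have kN: "k \<le> N" unfolding k using card_image_le[OF finite_atLeastAtMost, of "orbit cyc.sigma" 1 N] by simp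
  have hg: "h + (k - 1) = Suc (g + k - 1)" using Nh kpos kN g by (cases k) auto
  have "-2 * cyc.odd_sum = 2 ^ h * int (card radical) * bsgn s"
    using sum gauss_q0 by simp
  also have "2 ^ h * int (card radical) = 2 ^ (h + (k - 1))"
    unfolding r power_add by simp
  also have "\<dots> = 2 * 2 ^ (g + k - 1)" unfolding hg by (rule power_Suc)
  finally have "-2 * cyc.odd_sum = 2 * (2 ^ (g + k - 1) * bsgn s)" by (simp only: mult.assoc)
  hence "cyc.odd_sum = - (2 ^ (g + k - 1) * bsgn s)" by linarith
  hence "cyc.odd_sum = - bsgn s * 2 ^ (g + k - 1)" by (simp only: mult.commute mult_minus_left)
  thus ?thesis using s by blast
qed

end

section \<open>Crossing chords\<close>

text \<open>The chords that join \<open>a\<close> to \<open>b\<close> and \<open>c\<close> to \<open>d\<close> in the upper half plane cross.\<close>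

definition interl :: "real \<Rightarrow> real \<Rightarrow> real \<Rightarrow> real \<Rightarrow> bool" where
  "interl a b c d \<longleftrightarrow> ((a < c) \<noteq> (b < c)) \<noteq> ((a < d) \<noteq> (b < d))"

text \<open>Interleaves two sequences. The boundary points met by a closed curve form one cyclic
  sequence, which splits into consecutive pairs in two ways: into crossings and into arcs.\<close>

definition word :: "(nat \<Rightarrow> real) \<Rightarrow> (nat \<Rightarrow> real) \<Rightarrow> nat \<Rightarrow> real" where
  "word P Q a = (if even a then P (a div 2) else Q (a div 2))"

lemma word_simps [simp]: "word P Q (2 * i) = P i" "word P Q (Suc (2 * i)) = Q i"
  by (simp_all add: word_def)

lemma minus_one_power_card_xor:
  assumes "finite S"
  shows "(-1) ^ card {x \<in> S. A x} * (-1) ^ card {x \<in> S. B x} = ((-1) ^ card {x \<in> S. A x \<noteq> B x} :: int)"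
  using assms
proof (induction S)
  case (insert x S)
  have split: "{y \<in> insert x S. C y} = (if C x then insert x {y \<in> S. C y} else {y \<in> S. C y})" for C
    by auto
  show ?case unfolding split using insert by (cases "A x"; cases "B x") (auto simp: algebra_simps)
qed simp

lemma card_word_greater: "(-1) ^ card {x. x < 2 * n \<and> y < word P Q x} = ((-1) ^ card {i. i < n \<and> (y < P i) \<noteq> (y < Q i)} :: int)"
proof (induction n)
  case (Suc n)
  have 1: "{x. x < 2 * Suc n \<and> y < word P Q x} = {x. x < 2 * n \<and> y < word P Q x} \<union>
      ((if y < P n then {2 * n} else {}) \<union> (if y < Q n then {Suc (2 * n)} else {}))"
    by (auto simp: less_Suc_eq)
  have 2: "{i. i < Suc n \<and> (y < P i) \<noteq> (y < Q i)} = {i. i < n \<and> (y < P i) \<noteq> (y < Q i)} \<union> (if (y < P n) \<noteq> (y < Q n) then {n} else {})"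
    by (auto simp: less_Suc_eq)
  show ?case unfolding 1 2
    by (subst card_Un_disjoint; (subst card_Un_disjoint)?) (use Suc in \<open>auto simp: power_add card_insert_if\<close>)
qed simp

text \<open>Two pairs have an odd number of inversions between them exactly when they interlace, and
  a pair has an inner inversion when it runs backwards.\<close>

lemma inv_sign_word:
  assumes "inj_on (word P Q) {..<2 * n}"
  shows "inv_sign (\<lambda>a. a) (word P Q) {..<2 * n} =
    (-1) ^ card {i. i < n \<and> Q i < P i} * (-1) ^ card {(i, j). i < j \<and> j < n \<and> interl (P i) (Q i) (P j) (Q j)}"
  using assms
proof (induction n)
  case 0
  have "{(x, y). x \<in> ({..<2 * 0} :: nat set) \<and> y \<in> {..<2 * 0} \<and> x < y \<and> word P Q y < word P Q x} = {}" by auto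
  thus ?case by (simp add: inv_sign_def inv_count_def)
next
  case (Suc n)
  let ?K = "word P Q" and ?X = "{..<2 * n}"
  have X: "{..<2 * Suc n} = insert (Suc (2 * n)) (insert (2 * n) ?X)" by auto
  have inj: "inj_on ?K (insert (Suc (2 * n)) (insert (2 * n) ?X))" using Suc.prems unfolding X .
  have IH: "inv_sign (\<lambda>a. a) ?K ?X = (-1) ^ card {i. i < n \<and> Q i < P i} * (-1) ^ card {(i, j). i < j \<and> j < n \<and> interl (P i) (Q i) (P j) (Q j)}"
    by (rule Suc.IH) (rule inj_on_subset[OF Suc.prems], auto)
  have gt: "?K x < ?K y \<longleftrightarrow> \<not> ?K y < ?K x" if "x \<in> {..<2 * Suc n}" "y \<in> {..<2 * Suc n}" "x \<noteq> y" for x y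
  proof -
    have "?K x \<noteq> ?K y" using inj_onD[OF Suc.prems, of x y] that by blast
    thus ?thesis by (auto simp: neq_iff)
  qed
  have c1: "{x \<in> ?X. (x < 2 * n) \<noteq> (?K x < ?K (2 * n))} = {x. x < 2 * n \<and> P n < ?K x}"
    using gt[of _ "2 * n"] by auto
  have c2: "{x \<in> insert (2 * n) ?X. (x < Suc (2 * n)) \<noteq> (?K x < ?K (Suc (2 * n)))} =
      {x. x < 2 * n \<and> Q n < ?K x} \<union> (if Q n < P n then {2 * n} else {})"
  proof (rule set_eqI)
    fix x show "x \<in> {x \<in> insert (2 * n) ?X. (x < Suc (2 * n)) \<noteq> (?K x < ?K (Suc (2 * n)))} \<longleftrightarrow>
        x \<in> {x. x < 2 * n \<and> Q n < ?K x} \<union> (if Q n < P n then {2 * n} else {})"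
      using gt[of x "Suc (2 * n)"] by (cases "x = 2 * n"; cases "x < 2 * n") auto
  qed
  have s1: "inv_count (\<lambda>a. a) ?K (insert (2 * n) ?X) = inv_count (\<lambda>a. a) ?K ?X + card {x. x < 2 * n \<and> P n < ?K x}"
    unfolding c1[symmetric] by (rule inv_count_insert[OF _ _ _ inj_on_subset[OF inj]]) auto
  have s2: "inv_count (\<lambda>a. a) ?K (insert (Suc (2 * n)) (insert (2 * n) ?X)) =
      inv_count (\<lambda>a. a) ?K (insert (2 * n) ?X) + card ({x. x < 2 * n \<and> Q n < ?K x} \<union> (if Q n < P n then {2 * n} else {}))"
    unfolding c2[symmetric] by (rule inv_count_insert) (use inj in auto)
  have c3: "card ({x. x < 2 * n \<and> Q n < ?K x} \<union> (if Q n < P n then {2 * n} else {})) =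
      card {x. x < 2 * n \<and> Q n < ?K x} + (if Q n < P n then 1 else 0)"
    by (subst card_Un_disjoint) auto
  have c4: "(-1) ^ card {x. x < 2 * n \<and> P n < ?K x} * (-1) ^ card {x. x < 2 * n \<and> Q n < ?K x} =
      ((-1) ^ card {i. i < n \<and> interl (P i) (Q i) (P n) (Q n)} :: int)"
  proof -
    have ne: "(P n < P i) = (\<not> P i < P n)" "(P n < Q i) = (\<not> Q i < P n)" "(Q n < P i) = (\<not> P i < Q n)" "(Q n < Q i) = (\<not> Q i < Q n)"
      if "i < n" for i
      using gt[of "2 * n" "2 * i"] gt[of "2 * n" "Suc (2 * i)"] gt[of "Suc (2 * n)" "2 * i"] gt[of "Suc (2 * n)" "Suc (2 * i)"] that by auto
    have "{i \<in> {..<n}. ((P n < P i) \<noteq> (P n < Q i)) \<noteq> ((Q n < P i) \<noteq> (Q n < Q i))} = {i. i < n \<and> interl (P i) (Q i) (P n) (Q n)}"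
      unfolding interl_def using ne by auto
    thus ?thesis
      unfolding card_word_greater
      using minus_one_power_card_xor[of "{..<n}" "\<lambda>i. (P n < P i) \<noteq> (P n < Q i)" "\<lambda>i. (Q n < P i) \<noteq> (Q n < Q i)"] by simp
  qed
  have c5: "card {i. i < Suc n \<and> Q i < P i} = card {i. i < n \<and> Q i < P i} + (if Q n < P n then 1 else 0)"
  proof -
    have "{i. i < Suc n \<and> Q i < P i} = {i. i < n \<and> Q i < P i} \<union> (if Q n < P n then {n} else {})" by (auto simp: less_Suc_eq)
    thus ?thesis by (simp only:) (subst card_Un_disjoint, auto)
  qed
  have c6: "card {(i, j). i < j \<and> j < Suc n \<and> interl (P i) (Q i) (P j) (Q j)} =
      card {(i, j). i < j \<and> j < n \<and> interl (P i) (Q i) (P j) (Q j)} + card {i. i < n \<and> interl (P i) (Q i) (P n) (Q n)}"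
  proof -
    have "{(i, j). i < j \<and> j < Suc n \<and> interl (P i) (Q i) (P j) (Q j)} =
        {(i, j). i < j \<and> j < n \<and> interl (P i) (Q i) (P j) (Q j)} \<union> (\<lambda>i. (i, n)) ` {i. i < n \<and> interl (P i) (Q i) (P n) (Q n)}"
      by (auto simp: less_Suc_eq)
    moreover have "finite {(i, j). i < j \<and> j < n \<and> interl (P i) (Q i) (P j) (Q j)}"
      by (rule finite_subset[of _ "{..<n} \<times> {..<n}"]) auto
    ultimately show ?thesis by (simp only:) (subst card_Un_disjoint, auto simp: card_image inj_on_def)
  qed
  show ?case
    unfolding X inv_sign_def s2 s1 c3 power_add c5 c6
    unfolding inv_sign_def[symmetric] IH c4[symmetric] by (simp only: ac_simps)
qed

text \<open>The sequences \<open>e 0, s 0, e 1, ...\<close> and \<open>s 0, e 1, s 1, ...\<close>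
  differ by a rotation of \<open>2 * m\<close> terms, which reverses the sign because
  \<open>2 * m - 1\<close> is odd. The pairs of the second sequence do not interlace, so there only
  the backward pairs count.\<close>

lemma parity_pairs:
  fixes e s :: "nat \<Rightarrow> real"
  assumes m: "0 < m" and e: "inj_on e {..<m}" and s: "inj_on s {..<m}"
    and es: "\<And>i j. i < m \<Longrightarrow> j < m \<Longrightarrow> e i \<noteq> s j"
    and nc: "\<And>i j. i < m \<Longrightarrow> j < m \<Longrightarrow> i \<noteq> j \<Longrightarrow> \<not> interl (s i) (e (Suc i mod m)) (s j) (e (Suc j mod m))"
  shows "(-1) ^ card {i. i < m \<and> e (Suc i mod m) < s i} =
    - ((-1) ^ card {i. i < m \<and> s i < e i} * (-1) ^ card {(i, j). i < j \<and> j < m \<and> interl (e i) (s i) (e j) (s j)} :: int)"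
proof -
  let ?K = "word e s" and ?K' = "word s (\<lambda>i. e (Suc i mod m))" and ?X = "{..<2 * m}"
  \<comment> \<open>\<open>h\<close> shifts the positions cyclically and \<open>f\<close> ranks
    position 0 last, so that \<open>f \<circ> h\<close> is increasing.\<close>
  define h where "h a = Suc a mod (2 * m)" for a
  define f where "f a = (if a = 0 then 2 * m else a)" for a :: nat
  have hX: "h ` ?X = ?X"
  proof (rule endo_inj_surj)
    show "h ` ?X \<subseteq> ?X" using m by (auto simp: h_def)
    show "inj_on h ?X"
    proof (rule inj_onI)
      fix x y assume "x \<in> ?X" "y \<in> ?X" "h x = h y"
      thus "x = y" by (cases "Suc x = 2 * m"; cases "Suc y = 2 * m") (auto simp: h_def)
    qed
  qed simp
  have injh: "inj_on h ?X" using hX by (intro eq_card_imp_inj_on) auto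
  have K'h: "?K (h a) = ?K' a" if "a \<in> ?X" for a
  proof -
    obtain i where "a = 2 * i \<or> a = Suc (2 * i)" by (metis oddE evenE Suc_eq_plus1)
    thus ?thesis
    proof
      assume a: "a = 2 * i"
      hence "h a = Suc (2 * i)" using that by (simp add: h_def)
      thus ?thesis by (simp add: a)
    next
      assume a: "a = Suc (2 * i)"
      have "h a = 2 * (Suc i mod m)"
        using that a mult_mod_right[of 2 "Suc i" m] by (simp add: h_def)
      thus ?thesis by (simp add: a)
    qed
  qed
  have injK: "inj_on ?K ?X"
  proof (rule inj_onI)
    fix x y assume xy: "x \<in> ?X" "y \<in> ?X" "?K x = ?K y"
    obtain i where i: "x = 2 * i \<or> x = Suc (2 * i)" by (metis oddE evenE Suc_eq_plus1)
    obtain j where j: "y = 2 * j \<or> y = Suc (2 * j)" by (metis oddE evenE Suc_eq_plus1)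
    show "x = y" using i j xy inj_onD[OF e, of i j] inj_onD[OF s, of i j] es[of i j] es[of j i] by auto
  qed
  have injK': "inj_on ?K' ?X"
  proof (rule inj_onI)
    fix x y assume xy: "x \<in> ?X" "y \<in> ?X" "?K' x = ?K' y"
    hence "?K (h x) = ?K (h y)" using K'h by simp
    hence "h x = h y" using injK hX xy by (metis imageI inj_onD)
    thus "x = y" using injh xy by (metis inj_onD)
  qed
  have "inv_sign ?K f ?X = inv_sign ?K (\<lambda>a. a) ?X * (if 0 \<in> ?X then (-1) ^ (card ?X - 1) else 1)"
    by (rule inv_sign_rotate) (use m injK in \<open>auto simp: f_def insert_absorb inj_on_def\<close>)
  hence rot: "inv_sign f ?K ?X = - inv_sign (\<lambda>a. a) ?K ?X"
  proof -
    have "odd (card ?X - 1)" "0 \<in> ?X" using m by auto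
    thus ?thesis
      using \<open>inv_sign ?K f ?X = _\<close> inv_sign_commute[of ?K f ?X] inv_sign_commute[of ?K "\<lambda>a. a" ?X] by simp
  qed
  have "inv_count f ?K ?X = inv_count f ?K (h ` ?X)" unfolding hX ..
  also have "\<dots> = inv_count (f \<circ> h) (?K \<circ> h) ?X" by (rule inv_count_image[OF injh])
  also have "\<dots> = inv_count (\<lambda>a. a) ?K' ?X"
  proof (rule inv_count_cong)
    have fh: "f (h a) = Suc a" if "a \<in> ?X" for a using that by (cases "Suc a = 2 * m") (auto simp: f_def h_def)
    fix x y assume "x \<in> ?X" "y \<in> ?X"
    thus "((f \<circ> h) x < (f \<circ> h) y) = (x < y) \<and> ((?K \<circ> h) x < (?K \<circ> h) y) = (?K' x < ?K' y)"
      by (simp add: fh K'h)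
  qed
  finally have "inv_sign (\<lambda>a. a) ?K' ?X = - inv_sign (\<lambda>a. a) ?K ?X" using rot by (simp add: inv_sign_def)
  moreover have "{(i, j). i < j \<and> j < m \<and> interl (s i) (e (Suc i mod m)) (s j) (e (Suc j mod m))} = {}"
  proof -
    have "\<not> interl (s i) (e (Suc i mod m)) (s j) (e (Suc j mod m))" if "i < j" "j < m" for i j
      using nc[of i j] that by linarith
    thus ?thesis by blast
  qed
  hence "card {(i, j). i < j \<and> j < m \<and> interl (s i) (e (Suc i mod m)) (s j) (e (Suc j mod m))} = 0"
    by (simp only: card.empty)
  ultimately show ?thesis
    using inv_sign_word[OF injK] inv_sign_word[OF injK'] by simp
qed

section \<open>Geometry of a suspension\<close>

fun height :: "('a \<Rightarrow> complex) \<Rightarrow> 'a list \<Rightarrow> real \<Rightarrow> real" where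
  "height \<zeta> [] x = 0"
| "height \<zeta> (a # w) x = (if x \<le> Re (\<zeta> a) then x * (Im (\<zeta> a) / Re (\<zeta> a)) else Im (\<zeta> a) + height \<zeta> w (x - Re (\<zeta> a)))"

lemma side_start_Cons: "side_start \<zeta> (c # w) a = (if c = a then 0 else \<zeta> c + side_start \<zeta> w a)"
  by (simp add: side_start_def)

context
  fixes \<zeta> :: "'a \<Rightarrow> complex"
begin

lemma height_0: "(\<And>a. a \<in> set w \<Longrightarrow> Re (\<zeta> a) > 0) \<Longrightarrow> height \<zeta> w 0 = 0"
  by (cases w) (auto simp: less_imp_le)

lemma continuous_height:
  "(\<And>a. a \<in> set w \<Longrightarrow> Re (\<zeta> a) > 0) \<Longrightarrow> continuous_on UNIV (height \<zeta> w)"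
proof (induction w)
  case (Cons a w)
  have h0: "height \<zeta> w 0 = 0" using Cons.prems by (intro height_0) auto
  have IH: "continuous_on UNIV (height \<zeta> w)" using Cons by auto
  have "continuous_on ({..Re (\<zeta> a)} \<union> {Re (\<zeta> a)..}) (height \<zeta> (a # w))"
    unfolding height.simps
  proof (rule continuous_on_cases_le[where h = "\<lambda>x. x" and a = "Re (\<zeta> a)", THEN continuous_on_subset])
    show "continuous_on {t \<in> UNIV. t \<le> Re (\<zeta> a)} (\<lambda>x. x * (Im (\<zeta> a) / Re (\<zeta> a)))" by (intro continuous_intros)
    show "continuous_on {t \<in> UNIV. Re (\<zeta> a) \<le> t} (\<lambda>x. Im (\<zeta> a) + height \<zeta> w (x - Re (\<zeta> a)))"
      by (intro continuous_intros continuous_on_compose2[OF IH]) auto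
    show "continuous_on UNIV (\<lambda>x::real. x)" by (intro continuous_intros)
    show "t * (Im (\<zeta> a) / Re (\<zeta> a)) = Im (\<zeta> a) + height \<zeta> w (t - Re (\<zeta> a))" if "t \<in> UNIV" "t = Re (\<zeta> a)" for t
      using that h0 Cons.prems[of a] by simp
  qed auto
  moreover have "{..Re (\<zeta> a)} \<union> {Re (\<zeta> a)..} = UNIV" by auto
  ultimately show ?case by simp
qed auto

lemma height_side_point:
  "(\<And>a. a \<in> set w \<Longrightarrow> Re (\<zeta> a) > 0) \<Longrightarrow> a \<in> set w \<Longrightarrow> 0 \<le> r \<Longrightarrow> r \<le> 1 \<Longrightarrow>
    Im (side_point \<zeta> w a r) = height \<zeta> w (Re (side_point \<zeta> w a r)) \<and>
    0 \<le> Re (side_start \<zeta> w a) \<and> Re (side_start \<zeta> w a) + Re (\<zeta> a) \<le> Re (\<Sum>x\<leftarrow>w. \<zeta> x)"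
proof (induction w)
  case (Cons c w)
  have pos: "\<And>a. a \<in> set w \<Longrightarrow> Re (\<zeta> a) > 0" and c: "Re (\<zeta> c) > 0" using Cons.prems by auto
  show ?case
  proof (cases "c = a")
    case True
    have "0 \<le> Re (\<Sum>x\<leftarrow>w. \<zeta> x)" using pos by (induction w) (auto simp: less_imp_le add_nonneg_nonneg)
    moreover have "r * Re (\<zeta> a) \<le> Re (\<zeta> a)" using Cons.prems c True mult_right_mono[of r 1 "Re (\<zeta> a)"] by auto
    ultimately show ?thesis using True c by (auto simp: side_point_def side_start_Cons)
  next
    case False
    hence a: "a \<in> set w" using Cons.prems by simp
    note IH = Cons.IH[OF pos a Cons.prems(3,4)]
    let ?p = "side_point \<zeta> w a r"
    have p: "side_point \<zeta> (c # w) a r = \<zeta> c + ?p" using False by (simp add: side_point_def side_start_Cons add.assoc)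
    have nn: "0 \<le> Re ?p"
      using IH Cons.prems less_imp_le[OF pos[OF a]] by (auto simp: side_point_def intro!: add_nonneg_nonneg mult_nonneg_nonneg)
    have "Im (\<zeta> c + ?p) = height \<zeta> (c # w) (Re (\<zeta> c + ?p))"
    proof (cases "Re ?p = 0")
      case True
      thus ?thesis using IH c height_0[OF pos] by simp
    qed (use nn IH in auto)
    thus ?thesis using IH False c unfolding p by (auto simp: side_start_Cons)
  qed
qed simp

lemma ex_side_point:
  "(\<And>a. a \<in> set w \<Longrightarrow> Re (\<zeta> a) > 0) \<Longrightarrow> w \<noteq> [] \<Longrightarrow> distinct w \<Longrightarrow> 0 \<le> x \<Longrightarrow> x \<le> Re (\<Sum>x\<leftarrow>w. \<zeta> x) \<Longrightarrow>
    \<exists>a\<in>set w. \<exists>r\<in>{0..1}. Re (side_point \<zeta> w a r) = x"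
proof (induction w arbitrary: x)
  case (Cons c w)
  have c: "Re (\<zeta> c) > 0" using Cons.prems by auto
  show ?case
  proof (cases "x \<le> Re (\<zeta> c)")
    case True
    hence "Re (side_point \<zeta> (c # w) c (x / Re (\<zeta> c))) = x" "x / Re (\<zeta> c) \<in> {0..1}"
      using c Cons.prems by (auto simp: side_point_def side_start_Cons)
    thus ?thesis by auto
  next
    case False
    hence "w \<noteq> []" using Cons.prems by auto
    then obtain a r where a: "a \<in> set w" "r \<in> {0..1}" "Re (side_point \<zeta> w a r) = x - Re (\<zeta> c)"
      using Cons.IH[of "x - Re (\<zeta> c)"] Cons.prems False by auto
    moreover have "c \<noteq> a" using a Cons.prems by auto
    ultimately have "Re (side_point \<zeta> (c # w) a r) = x" by (simp add: side_point_def side_start_Cons)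
    thus ?thesis using a(1,2) by (intro bexI[of _ a] bexI[of _ r]) auto
  qed
qed simp

lemma side_start_mono:
  "(\<And>a. a \<in> set w \<Longrightarrow> Re (\<zeta> a) > 0) \<Longrightarrow> a \<in> set w \<Longrightarrow> c \<in> set w \<Longrightarrow> pos w a < pos w c \<Longrightarrow>
    Re (side_start \<zeta> w a) + Re (\<zeta> a) \<le> Re (side_start \<zeta> w c)"
proof (induction w)
  case (Cons d w)
  show ?case
  proof (cases "d = a")
    case True
    hence "c \<in> set w" "d \<noteq> c" using Cons.prems by (auto simp: pos_Cons)
    moreover have "0 \<le> Re (side_start \<zeta> w c)" using height_side_point[of w c 0] Cons.prems \<open>c \<in> set w\<close> by auto
    ultimately show ?thesis using True by (simp add: side_start_Cons)
  next
    case False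
    moreover have "d \<noteq> c" using Cons.prems by (auto simp: pos_Cons)
    ultimately show ?thesis using Cons by (auto simp: side_start_Cons pos_Cons)
  qed
qed simp

end

section \<open>The polygon between the two broken lines\<close>

locale suspension = list_pair t b for t b :: "'a list" +
  fixes \<zeta> :: "'a \<Rightarrow> complex"
  assumes veech: "veech_suspension t b \<zeta>" and long: "2 \<le> length t"
begin

lemma Re_pos: "a \<in> set t \<Longrightarrow> Re (\<zeta> a) > 0"
  using veech by (auto simp: veech_suspension_def)

text \<open>\<open>True\<close> stands for the top row and \<open>False\<close> for the bottom row,
  so that both are covered by the same statements.\<close>

definition wt :: "bool \<Rightarrow> 'a list" where
  "wt up = (if up then t else b)"

lemma set_wt [simp]: "set (wt up) = set t"
  using set_eq by (simp add: wt_def)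

lemma distinct_wt: "distinct (wt up)"
  using dt db by (simp add: wt_def)

lemma wt_simps [simp]: "wt True = t" "wt False = b"
  by (auto simp: wt_def)

definition ht :: "bool \<Rightarrow> real \<Rightarrow> real" where
  "ht up = height \<zeta> (wt up)"

definition X :: real where
  "X = Re (\<Sum>x\<leftarrow>t. \<zeta> x)"

definition sp :: "bool \<Rightarrow> 'a \<Rightarrow> real \<Rightarrow> complex" where
  "sp up a r = side_point \<zeta> (wt up) a r"

definition xs :: "bool \<Rightarrow> 'a \<Rightarrow> real" where
  "xs up a = Re (side_start \<zeta> (wt up) a)"

lemma sum_wt: "(\<Sum>x\<leftarrow>wt up. \<zeta> x) = (\<Sum>x\<leftarrow>t. \<zeta> x)"
  by (cases up) (auto simp: sum_list_distinct_conv_sum_set dt db set_eq)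

lemma Re_wt: "a \<in> set (wt up) \<Longrightarrow> Re (\<zeta> a) > 0"
  using Re_pos by simp

lemma Re_sp: "Re (sp up a r) = xs up a + r * Re (\<zeta> a)"
  by (simp add: sp_def side_point_def xs_def)

lemma Im_sp:
  assumes "a \<in> set t" "0 \<le> r" "r \<le> 1"
  shows "Im (sp up a r) = ht up (xs up a + r * Re (\<zeta> a))"
  using height_side_point[of "wt up" \<zeta> a r] Re_wt assms unfolding Re_sp[symmetric] by (simp add: sp_def ht_def)

lemma xs_bounds: "a \<in> set t \<Longrightarrow> 0 \<le> xs up a \<and> xs up a + Re (\<zeta> a) \<le> X"
  using height_side_point[of "wt up" \<zeta> a 0] Re_wt by (auto simp: xs_def X_def sum_wt)

lemma sp_x_range:
  assumes "a \<in> set t" "0 < r" "r < 1"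
  shows "xs up a < xs up a + r * Re (\<zeta> a)" "xs up a + r * Re (\<zeta> a) < xs up a + Re (\<zeta> a)"
    "0 < xs up a + r * Re (\<zeta> a)" "xs up a + r * Re (\<zeta> a) < X"
  using assms Re_pos[of a] xs_bounds[of a up] by (auto intro!: add_nonneg_pos) (smt (verit) mult_less_cancel_right2)

lemma xs_mono: "a \<in> set t \<Longrightarrow> c \<in> set t \<Longrightarrow> pos (wt up) a < pos (wt up) c \<Longrightarrow> xs up a + Re (\<zeta> a) \<le> xs up c"
  unfolding xs_def by (rule side_start_mono) (use Re_wt in auto)

lemma pos_wt_neq: "a \<in> set t \<Longrightarrow> c \<in> set t \<Longrightarrow> a \<noteq> c \<Longrightarrow> pos (wt up) a \<noteq> pos (wt up) c"
  using pos_neq by (cases up) auto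

lemma sp_x_less:
  assumes "a \<in> set t" "c \<in> set t" "a \<noteq> c" "0 < r" "r < 1" "0 < r'" "r' < 1"
  shows "xs up a + r * Re (\<zeta> a) < xs up c + r' * Re (\<zeta> c) \<longleftrightarrow> pos (wt up) a < pos (wt up) c"
proof (cases "pos (wt up) a < pos (wt up) c")
  case True
  thus ?thesis using xs_mono[OF assms(1,2) True] sp_x_range(2)[of a r up] sp_x_range(1)[of c r' up] assms by auto
next
  case False
  hence "pos (wt up) c < pos (wt up) a" using pos_wt_neq[OF assms(1-3), of up] by simp
  thus ?thesis using xs_mono[OF assms(2,1)] sp_x_range(1)[of a r up] sp_x_range(2)[of c r' up] assms by fastforce
qed

lemma sp_inj:
  assumes "a \<in> set t" "c \<in> set t" "0 < r" "r < 1" "0 < r'" "r' < 1"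
    and eq: "xs up a + r * Re (\<zeta> a) = xs up c + r' * Re (\<zeta> c)"
  shows "a = c \<and> r = r'"
proof (cases "a = c")
  case True
  thus ?thesis using eq Re_pos[OF assms(1)] by simp
next
  case False
  thus ?thesis using sp_x_less[OF assms(1,2) False assms(3-6), of up] sp_x_less[OF assms(2,1) _ assms(5,6,3,4), of up] eq
      pos_wt_neq[OF assms(1,2) False, of up] by auto
qed

lemma continuous_ht: "continuous_on UNIV (ht up)"
  unfolding ht_def by (rule continuous_height) (rule Re_wt)

lemma continuous_ht' [continuous_intros]: "continuous_on S f \<Longrightarrow> continuous_on S (\<lambda>x. ht up (f x))"
  by (rule continuous_on_compose2[OF continuous_ht]) auto

lemma ex_sp:
  assumes "0 \<le> x" "x \<le> X"
  shows "\<exists>a\<in>set t. \<exists>r\<in>{0..1}. Re (sp up a r) = x \<and> Im (sp up a r) = ht up x"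
proof -
  have "wt up \<noteq> []" using long set_wt[of up] by (metis list.size(3) not_numeral_le_zero set_empty)
  then obtain a r where a: "a \<in> set t" "r \<in> {0..1}" "Re (sp up a r) = x"
    using ex_side_point[of "wt up" \<zeta> x] Re_wt distinct_wt assms by (auto simp: sp_def X_def sum_wt)
  thus ?thesis using Im_sp[of a r up] unfolding Re_sp[symmetric] by (intro bexI[of _ a] bexI[of _ r]) auto
qed

lemma broken_line_eq: "broken_line \<zeta> (wt up) = {z. 0 \<le> Re z \<and> Re z \<le> X \<and> Im z = ht up (Re z)}"
proof (intro equalityI subsetI)
  fix z assume "z \<in> broken_line \<zeta> (wt up)"
  then obtain a r where a: "a \<in> set t" "r \<in> {0..1}" "z = sp up a r" by (auto simp: broken_line_def sp_def)
  have "0 \<le> r * Re (\<zeta> a)" "r * Re (\<zeta> a) \<le> Re (\<zeta> a)"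
    using a Re_pos[OF a(1)] mult_right_mono[of r 1 "Re (\<zeta> a)"] by auto
  thus "z \<in> {z. 0 \<le> Re z \<and> Re z \<le> X \<and> Im z = ht up (Re z)}"
    using xs_bounds[OF a(1), of up] Im_sp[of a r up] a by (auto simp: Re_sp)
next
  fix z assume "z \<in> {z. 0 \<le> Re z \<and> Re z \<le> X \<and> Im z = ht up (Re z)}"
  then obtain a r where "a \<in> set t" "r \<in> {0..1}" "z = sp up a r"
    using ex_sp[of "Re z" up] by (auto simp: complex_eq_iff)
  thus "z \<in> broken_line \<zeta> (wt up)" unfolding broken_line_def set_wt sp_def by blast
qed

lemma ht_0: "ht up 0 = 0"
  unfolding ht_def by (rule height_0) (rule Re_wt)

lemma meet: "broken_line \<zeta> t \<inter> broken_line \<zeta> b = {0, \<Sum>x\<leftarrow>t. \<zeta> x}"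
  using veech by (auto simp: veech_suspension_def)

lemma ht_X: "ht up X = Im (\<Sum>x\<leftarrow>t. \<zeta> x)"
proof -
  have "(\<Sum>x\<leftarrow>t. \<zeta> x) \<in> broken_line \<zeta> (wt up)" using meet by (cases up) auto
  thus ?thesis unfolding broken_line_eq X_def by auto
qed

text \<open>Close to 0 the rows are given by their first sides, one of which rises while the other
  falls.\<close>

lemma ht_first:
  obtains x where "0 < x" "x < X" "ht False x < ht True x"
proof -
  obtain a t' where t': "t = a # t'" using long by (cases t) auto
  have lb: "length b = length t" using dt db set_eq distinct_card by metis
  then obtain c b' where b': "b = c # b'" using long by (cases b) auto
  have a: "a \<in> set t" and c: "c \<in> set t" using t' b' set_eq by auto
  have Im: "Im (\<zeta> a) > 0" "Im (\<zeta> c) < 0"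
    using veech long lb unfolding veech_suspension_def t' b' by (auto dest!: spec[of _ "Suc 0"])
  let ?x = "min (Re (\<zeta> a)) (Re (\<zeta> c)) / 2"
  have x: "0 < ?x" "?x < Re (\<zeta> a)" "?x < Re (\<zeta> c)" using Re_pos[OF a] Re_pos[OF c] by auto
  have "ht True ?x = ?x * (Im (\<zeta> a) / Re (\<zeta> a))" "ht False ?x = ?x * (Im (\<zeta> c) / Re (\<zeta> c))"
    using x unfolding ht_def wt_simps by (simp_all add: t' b')
  moreover have "0 < ?x * (Im (\<zeta> a) / Re (\<zeta> a))" "?x * (Im (\<zeta> c) / Re (\<zeta> c)) < 0"
    using x Im Re_pos[OF a] Re_pos[OF c] by (auto intro!: mult_pos_pos mult_pos_neg divide_pos_pos divide_neg_pos)
  moreover have "?x < X" using x xs_bounds[OF a, of True] by linarith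
  ultimately have "?x < X" "ht False ?x < ht True ?x" by linarith+
  thus ?thesis using that x(1) by blast
qed

text \<open>The two graphs meet only over 0 and \<open>X\<close>, so by the intermediate value
  theorem their order near 0 persists.\<close>

lemma ht_less:
  assumes "0 < x" "x < X"
  shows "ht False x < ht True x"
proof (rule ccontr)
  assume *: "\<not> ht False x < ht True x"
  obtain y where y: "0 < y" "y < X" "ht False y < ht True y" by (rule ht_first)
  have ne: "ht False z \<noteq> ht True z" if "0 < z" "z < X" for z
  proof
    assume eq: "ht False z = ht True z"
    have "Complex z (ht True z) \<in> broken_line \<zeta> (wt True) \<inter> broken_line \<zeta> (wt False)"
      unfolding broken_line_eq using that eq by auto
    hence "Complex z (ht True z) \<in> {0, \<Sum>x\<leftarrow>t. \<zeta> x}" using meet by simp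
    thus False using that by (auto simp: X_def complex_eq_iff)
  qed
  have "connected ((\<lambda>z. ht True z - ht False z) ` {0<..<X})"
    by (rule connected_continuous_image) (auto intro!: continuous_intros)
  moreover have "ht True y - ht False y \<in> (\<lambda>z. ht True z - ht False z) ` {0<..<X}"
    "ht True x - ht False x \<in> (\<lambda>z. ht True z - ht False z) ` {0<..<X}" using assms y by auto
  ultimately have "0 \<in> (\<lambda>z. ht True z - ht False z) ` {0<..<X}"
    using * y by (elim connected_contains_Icc[THEN subsetD, of _ "ht True x - ht False x" "ht True y - ht False y"]) auto
  then obtain z where "0 < z" "z < X" "ht True z = ht False z" by auto
  thus False using ne[of z] by simp
qed

lemma interior_iff:
  "z \<in> polygon_interior t b \<zeta> \<longleftrightarrow> 0 < Re z \<and> Re z < X \<and> ht False (Re z) < Im z \<and> Im z < ht True (Re z)"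
proof
  assume "z \<in> polygon_interior t b \<zeta>"
  then obtain u w where uw: "u \<in> broken_line \<zeta> (wt True)" "w \<in> broken_line \<zeta> (wt False)" "Re u = Re z" "Re w = Re z" "Im w < Im z" "Im z < Im u"
    by (auto simp: polygon_interior_def)
  hence *: "0 \<le> Re z" "Re z \<le> X" "ht False (Re z) < Im z" "Im z < ht True (Re z)"
    unfolding broken_line_eq by auto
  moreover have "Re z \<noteq> 0" "Re z \<noteq> X" using * ht_0[of True] ht_0[of False] ht_X[of True] ht_X[of False] by auto
  ultimately show "0 < Re z \<and> Re z < X \<and> ht False (Re z) < Im z \<and> Im z < ht True (Re z)" by auto
next
  assume z: "0 < Re z \<and> Re z < X \<and> ht False (Re z) < Im z \<and> Im z < ht True (Re z)"
  have "Complex (Re z) (ht True (Re z)) \<in> broken_line \<zeta> (wt True)" "Complex (Re z) (ht False (Re z)) \<in> broken_line \<zeta> (wt False)"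
    unfolding broken_line_eq using z by auto
  thus "z \<in> polygon_interior t b \<zeta>"
    using z unfolding polygon_interior_def wt_simps
    by (intro CollectI bexI[of _ "Complex (Re z) (ht True (Re z))"] bexI[of _ "Complex (Re z) (ht False (Re z))"]) auto
qed

lemma sp_complex: "a \<in> set t \<Longrightarrow> 0 \<le> r \<Longrightarrow> r \<le> 1 \<Longrightarrow> sp up a r = Complex (xs up a + r * Re (\<zeta> a)) (ht up (xs up a + r * Re (\<zeta> a)))"
  by (simp add: complex_eq_iff Re_sp Im_sp)

lemma sp_eq_iff:
  assumes "a \<in> set t" "c \<in> set t" "0 < r" "r < 1" "0 < r'" "r' < 1"
  shows "sp up a r = sp up' c r' \<longleftrightarrow> up = up' \<and> a = c \<and> r = r'"
proof
  assume eq: "sp up a r = sp up' c r'"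
  have x: "xs up a + r * Re (\<zeta> a) = xs up' c + r' * Re (\<zeta> c)" using arg_cong[OF eq, of Re] by (simp add: Re_sp)
  have y: "ht up (xs up a + r * Re (\<zeta> a)) = ht up' (xs up a + r * Re (\<zeta> a))"
    using arg_cong[OF eq, of Im] Im_sp[of a r up] Im_sp[of c r' up'] assms x by simp
  have "up = up'"
    using y ht_less[of "xs up a + r * Re (\<zeta> a)"] sp_x_range(3,4)[of a r up] assms by (cases up; cases up') auto
  thus "up = up' \<and> a = c \<and> r = r'" using sp_inj[OF assms, of up] x by simp
qed simp

lemma glued_iff:
  "glued t b \<zeta> z w \<longleftrightarrow> (\<exists>a\<in>set t. \<exists>r\<in>{0<..<1}. \<exists>up. z = sp up a r \<and> w = sp (\<not> up) a r)"
  unfolding glued_def sp_def by (auto simp: ex_bool_eq)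

lemma mem_open_side: "z \<in> open_side \<zeta> (wt up) a \<longleftrightarrow> (\<exists>r\<in>{0<..<1}. z = sp up a r)"
  by (auto simp: open_side_def sp_def)

lemma ht_linear:
  assumes "a \<in> set t" "xs up a \<le> x" "x \<le> xs up a + Re (\<zeta> a)" "xs up a \<le> y" "y \<le> xs up a + Re (\<zeta> a)"
  shows "ht up x - ht up y = (x - y) * (Im (\<zeta> a) / Re (\<zeta> a))"
proof -
  have *: "ht up z = Im (side_start \<zeta> (wt up) a) + (z - xs up a) * (Im (\<zeta> a) / Re (\<zeta> a))"
    if "xs up a \<le> z" "z \<le> xs up a + Re (\<zeta> a)" for z
  proof -
    let ?r = "(z - xs up a) / Re (\<zeta> a)"
    have r: "0 \<le> ?r" "?r \<le> 1" "xs up a + ?r * Re (\<zeta> a) = z" using Re_pos[OF assms(1)] that by (auto simp: field_simps)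
    have "Im (sp up a ?r) = ht up z" using Im_sp[OF assms(1) r(1,2), of up] r(3) by simp
    thus ?thesis by (simp add: sp_def side_point_def)
  qed
  show ?thesis using *[OF assms(2,3)] *[OF assms(4,5)] by (simp add: algebra_simps diff_divide_distrib)
qed

end

section \<open>Arcs in the polygon\<close>

text \<open>Transport to \<open>real ^ 2\<close>, for which the Fashoda theorem is stated.\<close>

definition vec2 :: "complex \<Rightarrow> real ^ 2" where
  "vec2 z = Re z *\<^sub>R axis 1 1 + Im z *\<^sub>R axis 2 1"

lemma vec2_simps [simp]: "vec2 z $ 1 = Re z" "vec2 z $ 2 = Im z"
  by (simp_all add: vec2_def axis_def)

lemma vec2_inject: "vec2 z = vec2 w \<longleftrightarrow> z = w"
  by (auto simp: vec_eq_iff forall_2 complex_eq_iff)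

lemma continuous_on_vec2: "continuous_on S f \<Longrightarrow> continuous_on S (\<lambda>x. vec2 (f x))"
  unfolding vec2_def by (intro continuous_intros)

text \<open>In a large box that rests on the real line, two paths whose end points interlace on the
  bottom edge have to meet.\<close>

lemma half_plane_fashoda:
  fixes f g :: "real \<Rightarrow> complex"
  assumes f: "path f" and g: "path g" and disj: "path_image f \<inter> path_image g = {}"
    and up: "\<And>z. z \<in> path_image f \<union> path_image g \<Longrightarrow> 0 \<le> Im z"
    and ends: "Im (pathstart f) = 0" "Im (pathfinish f) = 0" "Im (pathstart g) = 0" "Im (pathfinish g) = 0"
    and order: "Re (pathstart f) < Re (pathstart g)" "Re (pathstart g) < Re (pathfinish f)" "Re (pathfinish f) < Re (pathfinish g)"
  shows False
proof -
  have "bounded (path_image f \<union> path_image g)"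
    using f g by (simp add: bounded_path_image)
  then obtain M where M: "\<And>z. z \<in> path_image f \<union> path_image g \<Longrightarrow> norm z \<le> M"
    unfolding bounded_iff by blast
  have sub: "vec2 z \<in> cbox (vector [-M, 0]) (vector [M, M])" if "z \<in> path_image f \<union> path_image g" for z
  proof -
    have "\<bar>Re z\<bar> \<le> M" "\<bar>Im z\<bar> \<le> M"
      using M[OF that] abs_Re_le_cmod[of z] abs_Im_le_cmod[of z] by linarith+
    thus ?thesis using up[OF that] by (auto simp: mem_box_cart forall_2)
  qed
  have pf: "path (vec2 \<circ> f)" "path (vec2 \<circ> g)"
    using f g unfolding path_def o_def by (auto intro: continuous_on_vec2)
  obtain z where "z \<in> path_image (vec2 \<circ> f)" "z \<in> path_image (vec2 \<circ> g)"
  proof (rule fashoda_interlace[OF pf, of "vector [-M, 0]" "vector [M, M]"])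
    show "path_image (vec2 \<circ> f) \<subseteq> cbox (vector [-M, 0]) (vector [M, M])"
      "path_image (vec2 \<circ> g) \<subseteq> cbox (vector [-M, 0]) (vector [M, M])"
      using sub by (auto simp: path_image_compose)
  qed (use ends order in \<open>auto simp: pathstart_def pathfinish_def\<close>)
  thus False using disj vec2_inject by (auto simp: path_image_compose)
qed

lemma interl_swap: "interl b a c d = interl a b c d" "interl a b d c = interl a b c d"
  by (auto simp: interl_def)

lemma interl_cases:
  assumes "interl a b c d" "a \<noteq> c" "a \<noteq> d" "b \<noteq> c" "b \<noteq> d"
  shows "(min a b < min c d \<and> min c d < max a b \<and> max a b < max c d) \<or>
    (min c d < min a b \<and> min a b < max c d \<and> max c d < max a b)"
proof -
  have ord: "(a < c) \<noteq> (c < a)" "(a < d) \<noteq> (d < a)" "(b < c) \<noteq> (c < b)" "(b < d) \<noteq> (d < b)"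
    using assms(2-5) by (simp_all add: neq_iff) linarith+
  have main: "(x < z \<and> z < y \<and> y < w) \<or> (z < x \<and> x < w \<and> w < y)"
    if "x \<le> y" "z \<le> w" "(x < z) \<noteq> (z < x)" "(x < w) \<noteq> (w < x)" "(y < z) \<noteq> (z < y)" "(y < w) \<noteq> (w < y)"
      "interl x y z w" for x y z w
  proof (cases "x < z")
    case True
    hence "z < y" "y < w" using that unfolding interl_def by auto
    thus ?thesis using True by simp
  next
    case False
    hence "x < w" "w < y" using that unfolding interl_def by auto
    thus ?thesis using False that by simp
  qed
  show ?thesis
    using main[of "min a b" "max a b" "min c d" "max c d"] ord assms(1) interl_swap
    by (cases "a \<le> b"; cases "c \<le> d") (auto simp: min_absorb1 min_absorb2 max_absorb1 max_absorb2)
qed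

text \<open>Reversing the paths where necessary, both run from left to right; then either of them
  may start first.\<close>

lemma half_plane_no_interl:
  fixes f g :: "real \<Rightarrow> complex"
  assumes f: "path f" and g: "path g" and disj: "path_image f \<inter> path_image g = {}"
    and up: "\<And>z. z \<in> path_image f \<union> path_image g \<Longrightarrow> 0 \<le> Im z"
    and ends: "Im (pathstart f) = 0" "Im (pathfinish f) = 0" "Im (pathstart g) = 0" "Im (pathfinish g) = 0"
  shows "\<not> interl (Re (pathstart f)) (Re (pathfinish f)) (Re (pathstart g)) (Re (pathfinish g))"
proof
  assume il: "interl (Re (pathstart f)) (Re (pathfinish f)) (Re (pathstart g)) (Re (pathfinish g))"
  have ne: "Re z \<noteq> Re w" if "z \<in> {pathstart f, pathfinish f}" "w \<in> {pathstart g, pathfinish g}" for z w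
  proof
    assume "Re z = Re w"
    hence "z = w" using that ends by (auto simp: complex_eq_iff)
    thus False using that disj pathstart_in_path_image[of f] pathfinish_in_path_image[of f]
        pathstart_in_path_image[of g] pathfinish_in_path_image[of g] by auto
  qed
  define o' where "o' h = (if Re (pathstart h) < Re (pathfinish h) then h else reversepath h)" for h :: "real \<Rightarrow> complex"
  have o': "path (o' h) = path h" "path_image (o' h) = path_image h" for h by (auto simp: o'_def)
  have oe: "Re (pathstart (o' h)) = min (Re (pathstart h)) (Re (pathfinish h))"
    "Re (pathfinish (o' h)) = max (Re (pathstart h)) (Re (pathfinish h))" for h by (auto simp: o'_def)
  have oi: "Im (pathstart (o' h)) = 0" "Im (pathfinish (o' h)) = 0" if "Im (pathstart h) = 0" "Im (pathfinish h) = 0" for h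
    using that by (auto simp: o'_def)
  have ne': "Re (pathstart f) \<noteq> Re (pathstart g)" "Re (pathstart f) \<noteq> Re (pathfinish g)" "Re (pathfinish f) \<noteq> Re (pathstart g)" "Re (pathfinish f) \<noteq> Re (pathfinish g)"
    using ne by auto
  let ?a = "Re (pathstart (o' f))" and ?b = "Re (pathfinish (o' f))" and ?c = "Re (pathstart (o' g))" and ?d = "Re (pathfinish (o' g))"
  have "(?a < ?c \<and> ?c < ?b \<and> ?b < ?d) \<or> (?c < ?a \<and> ?a < ?d \<and> ?d < ?b)"
    unfolding oe by (rule interl_cases[OF il ne'])
  thus False
  proof
    assume "?a < ?c \<and> ?c < ?b \<and> ?b < ?d"
    thus False using half_plane_fashoda[of "o' f" "o' g"] f g disj up ends oi o' by auto
  next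
    assume "?c < ?a \<and> ?a < ?d \<and> ?d < ?b"
    thus False using half_plane_fashoda[of "o' g" "o' f"] f g disj up ends oi o' by auto
  qed
qed

context suspension
begin

text \<open>The closed polygon without its leftmost and rightmost vertex, where the rows meet and
  the relative height makes no sense.\<close>

definition strip :: "complex set" where
  "strip = {z. 0 < Re z \<and> Re z < X \<and> ht False (Re z) \<le> Im z \<and> Im z \<le> ht True (Re z)}"

text \<open>\<open>uu\<close> is the relative height in the polygon, and \<open>hp\<close> maps the polygon to a closed half annulus in the upper
  half plane, the bottom to the positive and the top to the negative reals (with coordinate \<open>key\<close>).\<close>

definition uu :: "complex \<Rightarrow> real" where
  "uu z = (Im z - ht False (Re z)) / (ht True (Re z) - ht False (Re z))"

definition hp :: "complex \<Rightarrow> complex" where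
  "hp z = exp (Complex (Re z) (pi * uu z))"

lemma uu_range: "z \<in> strip \<Longrightarrow> 0 \<le> uu z \<and> uu z \<le> 1"
  using ht_less[of "Re z"] by (auto simp: strip_def uu_def divide_simps)

lemma continuous_on_hp: "continuous_on strip hp"
proof -
  have "ht True (Re z) - ht False (Re z) \<noteq> 0" if "z \<in> strip" for z
    using ht_less[of "Re z"] that by (auto simp: strip_def)
  hence "continuous_on strip uu" unfolding uu_def by (intro continuous_intros) auto
  thus ?thesis unfolding hp_def Complex_eq by (intro continuous_intros)
qed

lemma Re_hp: "Re (hp z) = exp (Re z) * cos (pi * uu z)" and Im_hp: "Im (hp z) = exp (Re z) * sin (pi * uu z)"
  by (simp_all add: hp_def Re_exp Im_exp)

lemma Im_hp_nonneg: "z \<in> strip \<Longrightarrow> 0 \<le> Im (hp z)"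
proof -
  assume "z \<in> strip"
  hence "0 \<le> pi * uu z" "pi * uu z \<le> pi * 1" using uu_range[of z] by (auto intro!: mult_left_mono)
  thus ?thesis unfolding Im_hp by (intro mult_nonneg_nonneg[OF _ sin_ge_zero]) auto
qed

lemma inj_on_hp: "inj_on hp strip"
proof (rule inj_onI)
  fix z w assume z: "z \<in> strip" and w: "w \<in> strip" and eq: "hp z = hp w"
  have "norm (hp z) = exp (Re z)" for z by (simp add: hp_def norm_exp_eq_Re)
  hence x: "Re z = Re w" using eq by (metis exp_inj_iff)
  have r: "0 \<le> pi * uu z" "pi * uu z \<le> pi" "0 \<le> pi * uu w" "pi * uu w \<le> pi"
    using uu_range[OF z] uu_range[OF w] mult_left_mono[of _ 1 pi] by auto
  have "cos (pi * uu z) = cos (pi * uu w)" using arg_cong[OF eq, of Re] x by (simp add: Re_hp)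
  hence "uu z = uu w" using cos_inj_pi[OF r] by simp
  moreover have "ht True (Re z) - ht False (Re z) \<noteq> 0" using ht_less[of "Re z"] z by (auto simp: strip_def)
  ultimately have "Im z = Im w" using x by (simp add: uu_def)
  thus "z = w" using x by (simp add: complex_eq_iff)
qed

definition key :: "bool \<Rightarrow> real \<Rightarrow> real" where
  "key up x = (if up then - exp x else exp x)"

lemma hp_side:
  assumes "0 < x" "x < X"
  shows "hp (Complex x (ht up x)) = of_real (key up x)"
proof -
  have "uu (Complex x (ht up x)) = (if up then 1 else 0)"
    using ht_less[OF assms] by (cases up) (auto simp: uu_def)
  thus ?thesis by (auto simp: complex_eq_iff Re_hp Im_hp key_def)
qed

text \<open>\<open>hp\<close> is continuous and injective on the strip, so disjoint arcs become
  disjoint paths in the upper half plane, with end points on the real axis at their keys.\<close>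

lemma arcs_no_interl:
  fixes f g :: "real \<Rightarrow> complex"
  assumes f: "continuous_on {p..p + 1} f" and g: "continuous_on {q..q + 1} g"
    and fs: "f ` {p..p + 1} \<subseteq> strip" and gs: "g ` {q..q + 1} \<subseteq> strip"
    and disj: "f ` {p..p + 1} \<inter> g ` {q..q + 1} = {}"
    and ends: "f p = Complex x1 (ht u1 x1)" "f (p + 1) = Complex x2 (ht u2 x2)" "g q = Complex x3 (ht u3 x3)" "g (q + 1) = Complex x4 (ht u4 x4)"
  shows "\<not> interl (key u1 x1) (key u2 x2) (key u3 x3) (key u4 x4)"
proof -
  define F where "F s = hp (f (p + s))" for s
  define G where "G s = hp (g (q + s))" for s
  have img: "(\<lambda>s. r + s) ` {0..1} = {r..r + 1}" for r :: real
    using image_add_atLeastAtMost[of r 0 1] by (simp add: add.commute)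
  have Fi: "path_image F = hp ` f ` {p..p + 1}" and Gi: "path_image G = hp ` g ` {q..q + 1}"
    unfolding path_image_def F_def G_def img[symmetric] image_image by auto
  have "continuous_on {0..1} (\<lambda>s. f (p + s))" "continuous_on {0..1} (\<lambda>s. g (q + s))"
    by (auto intro!: continuous_on_compose2[OF f] continuous_on_compose2[OF g] continuous_intros)
  hence paths: "path F" "path G"
    unfolding path_def F_def G_def using fs gs
    by (auto intro!: continuous_on_compose2[OF continuous_on_hp] simp: image_subset_iff)
  have "path_image F \<inter> path_image G = {}"
    unfolding Fi Gi using inj_on_image_Int[OF inj_on_hp fs gs] disj by auto
  moreover have st: "f p \<in> strip" "f (p + 1) \<in> strip" "g q \<in> strip" "g (q + 1) \<in> strip" using fs gs by auto
  hence e: "pathstart F = of_real (key u1 x1)" "pathfinish F = of_real (key u2 x2)" "pathstart G = of_real (key u3 x3)" "pathfinish G = of_real (key u4 x4)"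
    using hp_side ends by (auto simp: pathstart_def pathfinish_def F_def G_def strip_def)
  moreover have "0 \<le> Im z" if "z \<in> path_image F \<union> path_image G" for z
    using that Im_hp_nonneg fs gs unfolding Fi Gi by auto
  ultimately show ?thesis using half_plane_no_interl[OF paths] by simp
qed

end

section \<open>Secants of an arc\<close>

text \<open>Branches of the logarithm on the plane slit along the lower (upper) half of the imaginary axis.\<close>

definition log_slit :: "bool \<Rightarrow> complex \<Rightarrow> complex" where
  "log_slit up z = (if up then Ln (\<i> * (- z)) + \<i> * pi / 2 else Ln (\<i> * z) - \<i> * pi / 2)"

text \<open>Directions that leave the bottom row or arrive at the top row never point straight down,
  so they lie in \<open>slit True\<close>; \<open>slit False\<close> plays the same role for the top
  row as start and the bottom row as end.\<close>

definition slit :: "bool \<Rightarrow> complex set" where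
  "slit up = {z. Re z \<noteq> 0 \<or> (if up then Im z > 0 else Im z < 0)}"

lemma slit_nonzero: "z \<in> slit up \<Longrightarrow> z \<noteq> 0"
  by (cases up) (auto simp: slit_def)

lemma exp_log_slit:
  assumes "z \<in> slit up"
  shows "exp (log_slit up z) = z"
proof -
  have "exp (\<i> * pi / 2) = \<i>" "exp (- (\<i> * pi / 2)) = - \<i>"
    using Ln_ii Ln_minus_ii by (metis exp_Ln complex_i_not_zero neg_equal_0_iff_equal)+
  note e = this
  have nz: "\<i> * z \<noteq> 0" "\<i> * (- z) \<noteq> 0" using slit_nonzero[OF assms] by auto
  show ?thesis
  proof (cases up)
    case True
    have "exp (log_slit up z) = (\<i> * (- z)) * \<i>"
      unfolding log_slit_def if_P[OF True] exp_add e exp_Ln[OF nz(2)] ..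
    thus ?thesis by (simp add: complex_eq_iff)
  next
    case False
    have "exp (log_slit up z) = (\<i> * z) * (- \<i>)"
      unfolding log_slit_def if_not_P[OF False] diff_conv_add_uminus exp_add e exp_Ln[OF nz(1)] ..
    thus ?thesis by (simp add: complex_eq_iff)
  qed
qed

lemma continuous_on_log_slit:
  assumes "continuous_on S f" "\<And>s. s \<in> S \<Longrightarrow> f s \<in> slit up"
  shows "continuous_on S (\<lambda>s. log_slit up (f s))"
proof (cases up)
  case True
  have "\<i> * (- f s) \<notin> \<real>\<^sub>\<le>\<^sub>0" if "s \<in> S" for s
    using assms(2)[OF that] True by (auto simp: slit_def complex_nonpos_Reals_iff)
  thus ?thesis unfolding log_slit_def using True assms(1) by (auto intro!: continuous_intros)
next
  case False
  have "\<i> * f s \<notin> \<real>\<^sub>\<le>\<^sub>0" if "s \<in> S" for s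
    using assms(2)[OF that] False by (auto simp: slit_def complex_nonpos_Reals_iff)
  thus ?thesis unfolding log_slit_def using False assms(1) by (auto intro!: continuous_intros)
qed

lemma log_slit_right: "Re z > 0 \<Longrightarrow> log_slit up z = Ln z"
  using Ln_times_ii[of z] Ln_times_ii[of "- z"] Ln_minus[of z]
  by (cases "z = 0") (auto simp: log_slit_def algebra_simps)

lemma log_slit_left:
  assumes "Re z < 0"
  shows "log_slit True z = log_slit False z + 2 * pi * \<i>"
  using assms Ln_times_ii[of z] Ln_times_ii[of "- z"] Ln_minus[of z]
  by (cases "z = 0") (auto simp: log_slit_def algebra_simps)

text \<open>The difference of two logarithms of the same function takes values in a discrete set,
  the integer multiples of \<open>2 * pi * \<i>\<close>, and is therefore constant on a connected
  set.\<close>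

lemma continuous_logs_diff:
  fixes f g :: "'a::topological_space \<Rightarrow> complex"
  assumes S: "connected S" and f: "continuous_on S f" and g: "continuous_on S g"
    and eq: "\<And>s. s \<in> S \<Longrightarrow> exp (f s) = exp (g s)" and s: "s \<in> S" "s' \<in> S"
  shows "f s - f s' = g s - g s'"
proof -
  have "(\<lambda>s. f s - g s) constant_on S"
  proof (rule continuous_discrete_range_constant[OF S])
    show "continuous_on S (\<lambda>s. f s - g s)" using f g by (intro continuous_intros)
    fix x assume x: "x \<in> S"
    have "2 * pi \<le> norm ((f y - g y) - (f x - g x))" if y: "y \<in> S" "f y - g y \<noteq> f x - g x" for y
    proof -
      obtain m n :: int where m: "f x = g x + (of_int (2 * m) * pi) * \<i>" and n: "f y = g y + (of_int (2 * n) * pi) * \<i>"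
        using eq[OF x] eq[OF y(1)] exp_eq by metis
      have "(f y - g y) - (f x - g x) = of_int (n - m) * (2 * of_real pi * \<i>)"
        unfolding m n by (simp add: algebra_simps)
      hence "norm ((f y - g y) - (f x - g x)) = \<bar>real_of_int (n - m)\<bar> * (2 * pi)"
        by (simp only: norm_mult norm_of_int) simp
      moreover have "n \<noteq> m" using y m n by auto
      hence "1 \<le> \<bar>n - m\<bar>" by auto
      hence "1 \<le> \<bar>real_of_int (n - m)\<bar>" by linarith
      ultimately show ?thesis using mult_right_mono[of 1 "\<bar>real_of_int (n - m)\<bar>" "2 * pi"] by simp
    qed
    thus "\<exists>e>0. \<forall>y. y \<in> S \<and> f y - g y \<noteq> f x - g x \<longrightarrow> e \<le> norm ((f y - g y) - (f x - g x))"
      by (intro exI[of _ "2 * pi"]) auto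
  qed
  hence "f s - g s = f s' - g s'" using s unfolding constant_on_def by metis
  thus ?thesis by (simp add: algebra_simps)
qed

text \<open>The secant map of Hopf's Umlaufsatz.\<close>

definition secant :: "(real \<Rightarrow> complex) \<Rightarrow> (real \<Rightarrow> complex) \<Rightarrow> real \<Rightarrow> real \<Rightarrow> complex" where
  "secant c v s s' = (if s = s' then v s else (c s' - c s) / of_real (s' - s))"

text \<open>The secant is the mean of \<open>v\<close> over the segment from \<open>s\<close> to
  \<open>s'\<close>, an integral that depends continuously on both end points, also on the
  diagonal.\<close>

lemma continuous_on_secant:
  assumes v: "continuous_on {p..q} v"
    and c: "\<And>s. s \<in> {p..q} \<Longrightarrow> (c has_vector_derivative v s) (at s within {p..q})"
  shows "continuous_on {(s, s'). p \<le> s \<and> s \<le> s' \<and> s' \<le> q} (\<lambda>(s, s'). secant c v s s')"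
proof -
  let ?D = "{(s, s'). p \<le> s \<and> s \<le> s' \<and> s' \<le> q}"
  let ?I = "\<lambda>x. integral (cbox 0 1) (\<lambda>u. v (fst x + u * (snd x - fst x)))"
  have between: "p \<le> s + u * (s' - s) \<and> s + u * (s' - s) \<le> q"
    if "p \<le> s" "s \<le> s'" "s' \<le> q" "0 \<le> u" "u \<le> 1" for s s' u :: real
  proof -
    have "0 \<le> u * (s' - s)" "u * (s' - s) \<le> s' - s"
      using that mult_left_le_one_le[of "s' - s" u] by auto
    thus ?thesis using that by linarith
  qed
  have "continuous_on ?D ?I"
  proof (rule integral_continuous_on_param)
    have "continuous_on (?D \<times> cbox 0 1) (\<lambda>z. v (fst (fst z) + snd z * (snd (fst z) - fst (fst z))))"
    proof (rule continuous_on_compose2[OF v])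
      show "(\<lambda>z. fst (fst z) + snd z * (snd (fst z) - fst (fst z))) ` (?D \<times> cbox 0 1) \<subseteq> {p..q}"
      proof (clarsimp, intro conjI)
        fix s s' u assume *: "p \<le> s" "s \<le> s'" "s' \<le> q" "0 \<le> (u::real)" "u \<le> 1"
        show "p \<le> s + u * (s' - s)" "s + u * (s' - s) \<le> q" using between[OF *] by auto
      qed
    qed (intro continuous_intros)
    thus "continuous_on (?D \<times> cbox 0 1) (\<lambda>(x, u). v (fst x + u * (snd x - fst x)))"
      by (simp add: case_prod_unfold)
  qed
  moreover have "?I x = (case x of (s, s') \<Rightarrow> secant c v s s')" if xD: "x \<in> ?D" for x
  proof -
    obtain s s' where x: "x = (s, s')" and s: "p \<le> s" "s \<le> s'" "s' \<le> q" using xD by auto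
    show ?thesis
    proof (cases "s = s'")
      case True
      thus ?thesis by (simp add: x secant_def)
    next
      case False
      let ?d = "of_real (s' - s) :: complex"
      have d: "?d \<noteq> 0" using False by (simp only: of_real_eq_0_iff)
      have "((\<lambda>u. v (s + u * (s' - s))) has_integral (c (s + 1 * (s' - s)) / ?d - c (s + 0 * (s' - s)) / ?d)) {0..1}"
      proof (rule fundamental_theorem_of_calculus)
        fix u :: real assume u: "u \<in> {0..1}"
        have "((\<lambda>u. s + u * (s' - s)) has_vector_derivative (s' - s)) (at u within {0..1})"
          by (auto intro!: derivative_eq_intros)
        moreover have "(c has_vector_derivative v (s + u * (s' - s))) (at (s + u * (s' - s)) within (\<lambda>u. s + u * (s' - s)) ` {0..1})"
        proof (rule has_vector_derivative_within_subset[OF c])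
          show "s + u * (s' - s) \<in> {p..q}" using between[OF s, of u] u by auto
          show "(\<lambda>u. s + u * (s' - s)) ` {0..1} \<subseteq> {p..q}" using between[OF s] by auto
        qed
        ultimately have "((c \<circ> (\<lambda>u. s + u * (s' - s))) has_vector_derivative (s' - s) *\<^sub>R v (s + u * (s' - s))) (at u within {0..1})"
          by (rule vector_diff_chain_within)
        hence "((\<lambda>u. c (s + u * (s' - s)) / ?d) has_vector_derivative ((s' - s) *\<^sub>R v (s + u * (s' - s))) / ?d) (at u within {0..1})"
          by (auto simp: o_def intro: has_vector_derivative_divide)
        thus "((\<lambda>u. c (s + u * (s' - s)) / ?d) has_vector_derivative v (s + u * (s' - s))) (at u within {0..1})"
          using d by (simp add: scaleR_conv_of_real del: of_real_diff)
      qed simp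
      hence "?I x = c s' / ?d - c s / ?d" by (simp add: x integral_unique)
      thus ?thesis using False by (simp add: x secant_def diff_divide_distrib)
    qed
  qed
  ultimately show ?thesis by (rule continuous_on_eq) auto
qed

text \<open>On the convex triangle \<open>p \<le> s \<le> s' \<le> q\<close> the secant map is
  continuous and nonzero, so it has a logarithm there. The diagonal, where it is the velocity, has
  the same ends as the path along the legs \<open>s = p\<close> and \<open>s' = q\<close>. On these
  the secants avoid a half axis, and \<open>log_slit\<close> computes the change.\<close>

lemma hopf_arc:
  assumes pq: "p < q" and v: "continuous_on {p..q} v"
    and c: "\<And>s. s \<in> {p..q} \<Longrightarrow> (c has_vector_derivative v s) (at s within {p..q})"
    and v0: "\<And>s. s \<in> {p..q} \<Longrightarrow> v s \<noteq> 0" and inj: "inj_on c {p..q}"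
    and \<phi>: "continuous_on {p..q} \<phi>" "\<And>s. s \<in> {p..q} \<Longrightarrow> v s = exp (\<phi> s)"
    and start: "v p \<in> slit up" "\<And>s. s \<in> {p<..q} \<Longrightarrow> c s - c p \<in> slit up"
    and fin: "v q \<in> slit up'" "\<And>s. s \<in> {p..<q} \<Longrightarrow> c q - c s \<in> slit up'"
  defines "d \<equiv> secant c v p q"
  shows "\<phi> q - \<phi> p = (log_slit up d - log_slit up (v p)) + (log_slit up' (v q) - log_slit up' d)"
proof -
  let ?D = "{(s, s'). p \<le> s \<and> s \<le> s' \<and> s' \<le> q}"
  let ?F = "\<lambda>(s, s'). secant c v s s'"
  note cF = continuous_on_secant[OF v c]
  have convex: "convex ?D"
  proof (rule convexI)
    fix x y :: "real \<times> real" and u w :: real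
    assume x: "x \<in> ?D" and y: "y \<in> ?D" and u: "0 \<le> u" "0 \<le> w" "u + w = 1"
    obtain a a' b b' where xy: "x = (a, a')" "y = (b, b')" by (cases x, cases y)
    have "u * p + w * p \<le> u * a + w * b" "u * a + w * b \<le> u * a' + w * b'" "u * a' + w * b' \<le> u * q + w * q"
      using x y u unfolding xy by (auto intro!: add_mono mult_left_mono)
    moreover have "u * p + w * p = p" "u * q + w * q = q" using u(3) by (simp_all flip: distrib_right)
    ultimately show "u *\<^sub>R x + w *\<^sub>R y \<in> ?D" unfolding xy by simp
  qed
  have scale: "z / of_real r \<in> slit b" if "z \<in> slit b" "r > 0" for z r b
    using that by (auto simp: slit_def zero_less_divide_iff divide_less_0_iff split: if_splits)
  \<comment> \<open>Off the diagonal this is the injectivity of the arc, on the diagonal the fact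
    that it is immersed.\<close>
  have nz: "?F x \<noteq> 0" if "x \<in> ?D" for x
  proof -
    obtain s s' where x: "x = (s, s')" "p \<le> s" "s \<le> s'" "s' \<le> q" using \<open>x \<in> ?D\<close> by auto
    have "c s' \<noteq> c s" if "s \<noteq> s'" using inj_onD[OF inj, of s' s] x that by auto
    thus ?thesis using v0[of s] x by (auto simp: secant_def simp flip: of_real_diff)
  qed
  obtain \<Phi> where \<Phi>: "continuous_on ?D \<Phi>" "\<And>x. x \<in> ?D \<Longrightarrow> ?F x = exp (\<Phi> x)"
    using continuous_logarithm_on_contractible[OF cF convex_imp_contractible[OF convex] nz] by blast
  have seg: "connected {p..q}" by simp
  have 1: "\<phi> q - \<phi> p = \<Phi> (q, q) - \<Phi> (p, p)"
  proof (rule continuous_logs_diff[OF seg \<phi>(1)])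
    show "continuous_on {p..q} (\<lambda>s. \<Phi> (s, s))"
      by (rule continuous_on_compose2[OF \<Phi>(1)]) (auto intro!: continuous_intros)
    show "exp (\<phi> s) = exp (\<Phi> (s, s))" if "s \<in> {p..q}" for s
      using \<Phi>(2)[of "(s, s)"] \<phi>(2)[OF that] that by (simp add: secant_def)
  qed (use pq in auto)
  have F1: "secant c v p s \<in> slit up" if "s \<in> {p..q}" for s
    using start scale[of "c s - c p" up "s - p"] that by (auto simp: secant_def)
  have F2: "secant c v s q \<in> slit up'" if "s \<in> {p..q}" for s
    using fin scale[of "c q - c s" up' "q - s"] that by (auto simp: secant_def)
  have cF1: "continuous_on {p..q} (\<lambda>s. secant c v p s)"
  proof -
    have "continuous_on {p..q} (\<lambda>s. ?F (p, s))"
      by (rule continuous_on_compose2[OF cF]) (use pq in \<open>auto intro!: continuous_intros\<close>)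
    thus ?thesis by simp
  qed
  have cF2: "continuous_on {p..q} (\<lambda>s. secant c v s q)"
  proof -
    have "continuous_on {p..q} (\<lambda>s. ?F (s, q))"
      by (rule continuous_on_compose2[OF cF]) (use pq in \<open>auto intro!: continuous_intros\<close>)
    thus ?thesis by simp
  qed
  have 2: "\<Phi> (p, q) - \<Phi> (p, p) = log_slit up (secant c v p q) - log_slit up (secant c v p p)"
  proof (rule continuous_logs_diff[OF seg])
    show "continuous_on {p..q} (\<lambda>s. \<Phi> (p, s))"
      by (rule continuous_on_compose2[OF \<Phi>(1)]) (auto intro!: continuous_intros)
    show "continuous_on {p..q} (\<lambda>s. log_slit up (secant c v p s))"
      by (rule continuous_on_log_slit[OF cF1 F1])
    show "exp (\<Phi> (p, s)) = exp (log_slit up (secant c v p s))" if "s \<in> {p..q}" for s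
      using \<Phi>(2)[of "(p, s)"] exp_log_slit[OF F1[OF that]] that by simp
  qed (use pq in auto)
  have 3: "\<Phi> (q, q) - \<Phi> (p, q) = log_slit up' (secant c v q q) - log_slit up' (secant c v p q)"
  proof (rule continuous_logs_diff[OF seg])
    show "continuous_on {p..q} (\<lambda>s. \<Phi> (s, q))"
      by (rule continuous_on_compose2[OF \<Phi>(1)]) (auto intro!: continuous_intros)
    show "continuous_on {p..q} (\<lambda>s. log_slit up' (secant c v s q))"
      by (rule continuous_on_log_slit[OF cF2 F2])
    show "exp (\<Phi> (s, q)) = exp (log_slit up' (secant c v s q))" if "s \<in> {p..q}" for s
      using \<Phi>(2)[of "(s, q)"] exp_log_slit[OF F2[OF that]] that by simp
  qed (use pq in auto)
  have "secant c v p p = v p" "secant c v q q = v q" by (simp_all add: secant_def)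
  moreover have "\<phi> q - \<phi> p = (\<Phi> (p, q) - \<Phi> (p, p)) + (\<Phi> (q, q) - \<Phi> (p, q))" using 1 by simp
  ultimately show ?thesis unfolding 2 3 by (simp add: d_def)
qed

lemma curve_index_log:
  assumes m: "0 < m" and \<phi>: "continuous_on {0..real m} \<phi>" "\<And>s. s \<in> {0..real m} \<Longrightarrow> v s = exp (\<phi> s)"
    and k: "\<phi> (real m) - \<phi> 0 = 2 * pi * \<i> * of_int k"
  shows "curve_index m v = k"
proof -
  let ?p = "\<lambda>x. \<phi> (real m * x)"
  have in_range: "x \<in> {0..1} \<Longrightarrow> real m * x \<in> {0..real m}" for x
    using m mult_left_mono[of x 1 "real m"] by auto
  have path: "path ?p"
    unfolding path_def by (rule continuous_on_compose2[OF \<phi>(1)]) (use in_range in \<open>auto intro!: continuous_intros\<close>)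
  have "winding_number (\<lambda>x. v (real m * x)) 0 = winding_number (exp \<circ> ?p) 0"
    by (rule winding_number_cong) (use in_range \<phi>(2) in auto)
  also have "\<dots> = (pathfinish ?p - pathstart ?p) / (2 * of_real pi * \<i>)"
    by (rule winding_number_compose_exp[OF path])
  also have "\<dots> = of_int k" using k by (simp add: pathfinish_def pathstart_def field_simps)
  finally have "winding_number (\<lambda>x. v (real m * x)) 0 = of_int k" .
  thus ?thesis by (simp add: curve_index_def)
qed

section \<open>The index of a simple closed curve\<close>

context list_pair
begin

lemma q0_sum_list:
  "q0 (\<Sum>i<m. x i) = (\<Sum>i<m. q0 (x i)) + (\<Sum>j<(m::nat). \<Sum>i<j. polar q0 (x i) (x j))"
proof (induction m)
  case 0
  show ?case by (simp add: q0_def)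
next
  case (Suc m)
  have "polar q0 (\<Sum>i<k. x i) y = (\<Sum>i<k. polar q0 (x i) y)" for k y
  proof (induction k)
    case (Suc k)
    thus ?case using polar_q0_add[of "\<Sum>i<k. x i" "x k" y] by (simp only: sum.lessThan_Suc)
  qed (simp add: polar_q0)
  moreover have "q0 (u + v) = q0 u + q0 v + polar q0 u v" for u v
    using bit_cases[of "q0 u"] bit_cases[of "q0 v"] by (auto simp: polar_def)
  ultimately have "q0 ((\<Sum>i<m. x i) + x m) = q0 (\<Sum>i<m. x i) + q0 (x m) + (\<Sum>i<m. polar q0 (x i) (x m))"
    by simp
  thus ?case using Suc by (simp only: sum.lessThan_Suc) (simp add: ac_simps)
qed

text \<open>Each unit has value 1, and two units pair to 1 exactly for inverted letters. Letters may
  repeat, since no letter is inverted with itself.\<close>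

lemma bsgn_q0_units:
  assumes "\<And>i. i < m \<Longrightarrow> a i \<in> set t"
  shows "bsgn (q0 (\<Sum>i<m. unit (a i))) = (-1) ^ m * (-1) ^ card {(i, j). i < j \<and> j < m \<and> inverted (a i) (a j)}"
proof -
  have "(\<Sum>j<m. \<Sum>i<j. polar q0 (unit (a i)) (unit (a j))) = (\<Sum>j<m. \<Sum>i<j. if inverted (a i) (a j) then 1 else 0)"
    by (intro sum.cong refl polar_unit_unit) (use assms in auto)
  also have "\<dots> = (\<Sum>j<m. of_nat (card {i. i < j \<and> inverted (a i) (a j)}))"
    by (intro sum.cong refl) (simp add: sum.If_cases Int_def)
  also have "\<dots> = of_nat (\<Sum>j<m. card {i. i < j \<and> inverted (a i) (a j)})" by simp
  also have "(\<Sum>j<m. card {i. i < j \<and> inverted (a i) (a j)}) = card (SIGMA j:{..<m}. {i. i < j \<and> inverted (a i) (a j)})"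
    by (rule card_SigmaI[symmetric]) auto
  also have "\<dots> = card {(i, j). i < j \<and> j < m \<and> inverted (a i) (a j)}"
    by (rule bij_betw_same_card[of prod.swap]) (rule bij_betwI[where g = prod.swap], auto)
  finally have "(\<Sum>j<m. \<Sum>i<j. polar q0 (unit (a i)) (unit (a j))) = of_nat (card {(i, j). i < j \<and> j < m \<and> inverted (a i) (a j)})" .
  moreover have "(\<Sum>i<m. q0 (unit (a i))) = of_nat m"
    using assms by (simp add: q0_unit)
  ultimately show ?thesis unfolding q0_sum_list by (simp add: bsgn_add bsgn_of_nat)
qed

end

context suspension
begin

section \<open>Arcs and crossings of a simple closed curve\<close>

context
  fixes m :: nat and v :: "real \<Rightarrow> complex" and c :: "nat \<Rightarrow> real \<Rightarrow> complex"
  assumes simple: "simple_closed_curve t b \<zeta> m v c"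
begin

private abbreviation "nxt i \<equiv> Suc i mod m"

lemma m_pos: "0 < m"
  and v_cont: "continuous_on {0..real m} v"
  and v_nonzero: "s \<in> {0..real m} \<Longrightarrow> v s \<noteq> 0"
  and v_closed: "v (real m) = v 0"
  and c_deriv: "i < m \<Longrightarrow> s \<in> {real i..real (Suc i)} \<Longrightarrow> (c i has_vector_derivative v s) (at s within {real i..real (Suc i)})"
  and c_interior: "i < m \<Longrightarrow> s \<in> {real i<..<real (Suc i)} \<Longrightarrow> c i s \<in> polygon_interior t b \<zeta>"
  and c_glued: "i < m \<Longrightarrow> glued t b \<zeta> (c i (real (Suc i))) (c (nxt i) (real (nxt i)))"
  and c_simple: "i < m \<Longrightarrow> j < m \<Longrightarrow> s \<in> {real i..<real (Suc i)} \<Longrightarrow> s' \<in> {real j..<real (Suc j)} \<Longrightarrow>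
    c i s = c j s' \<or> glued t b \<zeta> (c i s) (c j s') \<Longrightarrow> s = s'"
  using simple unfolding simple_closed_curve_def closed_curve_def by blast+

lemma nxt_less: "nxt i < m"
  using m_pos by simp

lemma nxt_inj: "i < m \<Longrightarrow> j < m \<Longrightarrow> nxt i = nxt j \<Longrightarrow> i = j"
  by (cases "Suc i = m"; cases "Suc j = m") auto

lemma bij_nxt: "bij_betw (\<lambda>i. nxt i) {..<m} {..<m}"
proof -
  have "inj_on (\<lambda>i. nxt i) {..<m}" using nxt_inj by (intro inj_onI) blast
  moreover have "(\<lambda>i. nxt i) ` {..<m} \<subseteq> {..<m}" using nxt_less by auto
  ultimately show ?thesis by (simp add: bij_betw_def endo_inj_surj)
qed

lemma crossings:
  obtains a r u where "\<And>i. i < m \<Longrightarrow> a i \<in> set t \<and> 0 < r i \<and> r i < (1::real) \<and>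
    c i (real (Suc i)) = sp (u i) (a i) (r i) \<and> c (nxt i) (real (nxt i)) = sp (\<not> u i) (a i) (r i)"
proof -
  have "\<exists>a r u. i < m \<longrightarrow> a \<in> set t \<and> 0 < r \<and> r < (1::real) \<and>
    c i (real (Suc i)) = sp u a r \<and> c (nxt i) (real (nxt i)) = sp (\<not> u) a r" for i
    using c_glued[of i] unfolding glued_iff by (metis greaterThanLessThan_iff)
  thus ?thesis using that by metis
qed

context
  fixes a :: "nat \<Rightarrow> 'a" and r :: "nat \<Rightarrow> real" and u :: "nat \<Rightarrow> bool"
  assumes aru: "\<And>i. i < m \<Longrightarrow> a i \<in> set t \<and> 0 < r i \<and> r i < 1 \<and>
    c i (real (Suc i)) = sp (u i) (a i) (r i) \<and> c (nxt i) (real (nxt i)) = sp (\<not> u i) (a i) (r i)"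
begin

private lemma at: "i < m \<Longrightarrow> a i \<in> set t" and r0: "i < m \<Longrightarrow> 0 < r i" and r1: "i < m \<Longrightarrow> r i < 1"
  and c_end: "i < m \<Longrightarrow> c i (real (Suc i)) = sp (u i) (a i) (r i)"
  and c_start: "i < m \<Longrightarrow> c (nxt i) (real (nxt i)) = sp (\<not> u i) (a i) (r i)"
  using aru by auto

private lemma sp_crossing_eq: "i < m \<Longrightarrow> j < m \<Longrightarrow> sp up (a i) (r i) = sp up' (a j) (r j) \<longleftrightarrow> up = up' \<and> a i = a j \<and> r i = r j"
  using sp_eq_iff at r0 r1 by simp

text \<open>\<open>simple_closed_curve\<close> speaks of half-open arcs, so the end of an arc is
  controlled through the point glued to it, where the next arc starts. If the end lay on a half-open
  arc, it would coincide with that starting point, but the two copies of an open side are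
  disjoint.\<close>

lemma end_neq:
  assumes "i < m" "j < m" "s \<in> {real j..<real (Suc j)}"
  shows "c i (real (Suc i)) \<noteq> c j s"
proof
  assume eq: "c i (real (Suc i)) = c j s"
  have "glued t b \<zeta> (c j s) (c (nxt i) (real (nxt i)))" using c_glued[OF assms(1)] eq by simp
  hence s: "s = real (nxt i)" by (intro c_simple[OF assms(2) nxt_less assms(3)]) auto
  hence "nxt i = j" using assms(3) by auto
  hence "sp (u i) (a i) (r i) = sp (\<not> u i) (a i) (r i)" using eq s c_end c_start assms by metis
  thus False using sp_crossing_eq assms by auto
qed

lemma crossing_inj:
  assumes "i < m" "j < m" "c i (real (Suc i)) = c j (real (Suc j)) \<or> c (nxt i) (real (nxt i)) = c (nxt j) (real (nxt j))"
  shows "i = j"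
proof -
  have "u i = u j" "a i = a j" "r i = r j"
    using assms sp_crossing_eq c_end c_start by auto
  hence "c (nxt i) (real (nxt i)) = c (nxt j) (real (nxt j))" using c_start assms by simp
  hence "real (nxt i) = real (nxt j)" by (intro c_simple[OF nxt_less nxt_less]) auto
  thus ?thesis using nxt_inj[OF assms(1,2)] by simp
qed

lemma arc_inj:
  assumes i: "i < m"
  shows "inj_on (c i) {real i..real i + 1}"
proof (rule inj_onI)
  fix s s' assume s: "s \<in> {real i..real i + 1}" "s' \<in> {real i..real i + 1}" and eq: "c i s = c i s'"
  show "s = s'"
  proof (cases "s = real (Suc i) \<or> s' = real (Suc i)")
    case True
    thus ?thesis using end_neq[OF i i, of s] end_neq[OF i i, of s'] s eq by (cases "s = s'") auto
  next
    case False
    thus ?thesis using c_simple[OF i i, of s s'] s eq by auto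
  qed
qed

lemma arcs_disjoint:
  assumes ij: "i < m" "j < m" "i \<noteq> j"
  shows "c i ` {real i..real i + 1} \<inter> c j ` {real j..real j + 1} = {}"
proof -
  have "c i s \<noteq> c j s'" if s: "s \<in> {real i..real i + 1}" "s' \<in> {real j..real j + 1}" for s s'
  proof
    assume eq: "c i s = c j s'"
    consider "s = real (Suc i)" "s' = real (Suc j)" | "s = real (Suc i)" "s' \<in> {real j..<real (Suc j)}"
      | "s \<in> {real i..<real (Suc i)}" "s' = real (Suc j)" | "s \<in> {real i..<real (Suc i)}" "s' \<in> {real j..<real (Suc j)}"
      using s by fastforce
    thus False
    proof cases
      case 1
      thus ?thesis using crossing_inj[OF ij(1,2)] eq ij by simp
    next
      case 2
      thus ?thesis using end_neq[OF ij(1,2)] eq by simp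
    next
      case 3
      thus ?thesis using end_neq[OF ij(2,1)] eq by metis
    next
      case 4
      hence "s = s'" using c_simple[OF ij(1,2)] eq by blast
      hence "real i < real (Suc j)" "real j < real (Suc i)" using 4 by auto
      thus ?thesis using ij by simp
    qed
  qed
  thus ?thesis by auto
qed

lemma sp_strip:
  assumes i: "i < m"
  shows "sp up (a i) (r i) \<in> strip"
proof -
  let ?x = "xs up (a i) + r i * Re (\<zeta> (a i))"
  have "0 < ?x" "?x < X" using sp_x_range(3,4)[OF at[OF i] r0[OF i] r1[OF i]] by auto
  thus ?thesis
    unfolding sp_complex[OF at[OF i] less_imp_le[OF r0[OF i]] less_imp_le[OF r1[OF i]]]
    using ht_less[of ?x] by (cases up) (auto simp: strip_def)
qed

lemma interior_strip: "z \<in> polygon_interior t b \<zeta> \<Longrightarrow> z \<in> strip"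
  by (auto simp: interior_iff strip_def)

lemma arc_strip:
  assumes i: "i < m"
  shows "c i ` {real i..real i + 1} \<subseteq> strip"
proof clarify
  fix s assume s: "s \<in> {real i..real i + 1}"
  have "i \<in> (\<lambda>i. nxt i) ` {..<m}" using bij_nxt i by (simp add: bij_betw_def)
  then obtain k where k: "k < m" "nxt k = i" by auto
  consider "s = real i" | "s = real (Suc i)" | "s \<in> {real i<..<real (Suc i)}" using s by fastforce
  thus "c i s \<in> strip"
  proof cases
    case 1
    thus ?thesis using c_start[OF k(1)] sp_strip[OF k(1)] k(2) by simp
  next
    case 2
    thus ?thesis using c_end[OF i] sp_strip[OF i] by simp
  next
    case 3
    thus ?thesis using c_interior[OF i] interior_strip by blast
  qed
qed

text \<open>The strip has no points above the top row or below the bottom row, so a secant at a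
  point of a side does not point vertically out of the polygon.\<close>

lemma strip_slit:
  assumes i: "i < m" and z: "z \<in> strip"
  shows "z \<noteq> sp (\<not> up) (a i) (r i) \<Longrightarrow> z - sp (\<not> up) (a i) (r i) \<in> slit up"
    "z \<noteq> sp up (a i) (r i) \<Longrightarrow> sp up (a i) (r i) - z \<in> slit up"
proof -
  let ?x = "\<lambda>up. xs up (a i) + r i * Re (\<zeta> (a i))"
  have p: "Re (sp up (a i) (r i)) = ?x up" "Im (sp up (a i) (r i)) = ht up (?x up)" for up
    using Re_sp Im_sp[OF at[OF i], of "r i" up] r0[OF i] r1[OF i] by auto
  show "z \<noteq> sp (\<not> up) (a i) (r i) \<Longrightarrow> z - sp (\<not> up) (a i) (r i) \<in> slit up"
    using z p[of "\<not> up"] by (cases up) (auto simp: slit_def strip_def complex_eq_iff)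
  show "z \<noteq> sp up (a i) (r i) \<Longrightarrow> sp up (a i) (r i) - z \<in> slit up"
    using z p[of up] by (cases up) (auto simp: slit_def strip_def complex_eq_iff)
qed

text \<open>The curve may touch the side tangentially; what has to be excluded is a vertical
  velocity that points back into the polygon. \<open>g\<close> measures the height above the line
  that contains the side, with slope \<kappa>. Shortly before the crossing it has the sign of the
  interior, whereas such a velocity would make it reach 0 from the other side.\<close>

lemma velocity_slit:
  assumes i: "i < m"
  shows "v (real (Suc i)) \<in> slit (u i)"
proof (rule ccontr)
  let ?e = "real (Suc i)" and ?I = "{real i..real (Suc i)}"
  let ?x = "xs (u i) (a i) + r i * Re (\<zeta> (a i))"
  define \<kappa> where "\<kappa> = Im (\<zeta> (a i)) / Re (\<zeta> (a i))"
  define g where "g s = Im (c i s) - Im (c i ?e) - \<kappa> * (Re (c i s) - Re (c i ?e))" for s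
  assume "v ?e \<notin> slit (u i)"
  moreover have "v ?e \<noteq> 0" by (rule v_nonzero) (use i in auto)
  ultimately have v: "Re (v ?e) = 0" "if u i then Im (v ?e) < 0 else Im (v ?e) > 0"
    by (auto simp: slit_def complex_eq_iff split: if_splits)
  have d: "(c i has_vector_derivative v ?e) (at ?e within ?I)" by (rule c_deriv[OF i]) auto
  have dRe: "((\<lambda>s. Re (c i s)) has_real_derivative Re (v ?e)) (at ?e within ?I)"
    and dIm: "((\<lambda>s. Im (c i s)) has_real_derivative Im (v ?e)) (at ?e within ?I)"
    using bounded_linear.has_vector_derivative[OF bounded_linear_Re d] bounded_linear.has_vector_derivative[OF bounded_linear_Im d]
    by (auto simp: has_real_derivative_iff_has_vector_derivative)
  have "(g has_real_derivative (Im (v ?e) - 0) - \<kappa> * (Re (v ?e) - 0)) (at ?e within ?I)"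
    unfolding g_def by (intro DERIV_diff DERIV_cmult DERIV_const dRe dIm)
  hence dg: "(g has_real_derivative Im (v ?e)) (at ?e within ?I)" using v(1) by simp
  have e: "c i ?e = sp (u i) (a i) (r i)" by (rule c_end[OF i])
  have x: "Re (c i ?e) = ?x" "Im (c i ?e) = ht (u i) ?x"
    unfolding e using Re_sp Im_sp[OF at[OF i], of "r i" "u i"] r0[OF i] r1[OF i] by auto
  have "continuous (at ?e within ?I) (\<lambda>s. Re (c i s))"
    by (rule DERIV_continuous[OF dRe])
  hence "((\<lambda>s. Re (c i s)) \<longlongrightarrow> ?x) (at ?e within ?I)"
    unfolding continuous_within x(1) .
  moreover have "xs (u i) (a i) < ?x" "?x < xs (u i) (a i) + Re (\<zeta> (a i))"
    using sp_x_range[OF at[OF i] r0[OF i] r1[OF i], of "u i"] by auto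
  ultimately have "\<forall>\<^sub>F s in at ?e within ?I. xs (u i) (a i) < Re (c i s) \<and> Re (c i s) < xs (u i) (a i) + Re (\<zeta> (a i))"
    by (intro eventually_conj order_tendstoD)
  then obtain \<delta> where \<delta>: "\<delta> > 0" "\<And>s. s \<in> ?I \<Longrightarrow> s \<noteq> ?e \<Longrightarrow> dist s ?e < \<delta> \<Longrightarrow>
      xs (u i) (a i) < Re (c i s) \<and> Re (c i s) < xs (u i) (a i) + Re (\<zeta> (a i))"
    unfolding eventually_at by blast
  have sign: "if u i then g (?e - h) < 0 else g (?e - h) > 0" if h: "0 < h" "h < \<delta>" "h < 1" for h
  proof -
    let ?s = "?e - h"
    have s: "?s \<in> {real i<..<real (Suc i)}" "?s \<in> ?I" "dist ?s ?e < \<delta>" "?s \<noteq> ?e" using h by (auto simp: dist_real_def)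
    have "ht (u i) (Re (c i ?s)) - ht (u i) ?x = (Re (c i ?s) - ?x) * \<kappa>"
      unfolding \<kappa>_def by (rule ht_linear[OF at[OF i]])
        (use \<delta>(2)[OF s(2,4,3)] sp_x_range[OF at[OF i] r0[OF i] r1[OF i], of "u i"] in auto)
    hence "g ?s = Im (c i ?s) - ht (u i) (Re (c i ?s))" unfolding g_def x by (simp add: mult.commute)
    thus ?thesis using c_interior[OF i s(1)] unfolding interior_iff by (cases "u i") auto
  qed
  have g0: "g ?e = 0" by (simp add: g_def)
  show False
  proof (cases "u i")
    case True
    then obtain d where d: "0 < d" "\<And>h. 0 < h \<Longrightarrow> ?e - h \<in> ?I \<Longrightarrow> h < d \<Longrightarrow> g ?e < g (?e - h)"
      using has_real_derivative_neg_dec_left[OF dg] v(2) by auto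
    let ?h = "min (min d \<delta>) 1 / 2"
    have h: "0 < ?h" "?h < d" "?h < \<delta>" "?h < 1" "?e - ?h \<in> ?I" using d(1) \<delta>(1) by auto
    show False using d(2)[OF h(1,5,2)] sign[OF h(1,3,4)] g0 True by simp
  next
    case False
    then obtain d where d: "0 < d" "\<And>h. 0 < h \<Longrightarrow> ?e - h \<in> ?I \<Longrightarrow> h < d \<Longrightarrow> g (?e - h) < g ?e"
      using has_real_derivative_pos_inc_left[OF dg] v(2) by auto
    let ?h = "min (min d \<delta>) 1 / 2"
    have h: "0 < ?h" "?h < d" "?h < \<delta>" "?h < 1" "?e - ?h \<in> ?I" using d(1) \<delta>(1) by auto
    show False using d(2)[OF h(1,5,2)] sign[OF h(1,3,4)] g0 False by simp
  qed
qed

definition chord :: "nat \<Rightarrow> complex" where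
  "chord i = c i (real (Suc i)) - c i (real i)"

text \<open>The contribution of an arc to the index: only arcs that return from a row to the same row in the
  leftward direction pass across the slit of the logarithm.\<close>

definition turn :: "nat \<Rightarrow> int" where
  "turn i = (if u i = u (nxt i) \<or> Re (chord (nxt i)) > 0 then 0 else if u i then 1 else -1)"

lemma v_wrap: "i < m \<Longrightarrow> v (real (nxt i)) = v (real (Suc i))"
  using v_closed by (cases "Suc i = m") auto

text \<open>This is \<open>hopf_arc\<close> with the slits given by the rows of the two crossings.
  The velocity terms belong to the crossings and cancel later; the two logarithms of the chord
  cancel unless the arc returns leftward to its row.\<close>

lemma arc_turning:
  assumes i: "i < m" and \<phi>: "continuous_on {0..real m} \<phi>" "\<And>s. s \<in> {0..real m} \<Longrightarrow> v s = exp (\<phi> s)"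
  defines "L \<equiv> \<lambda>i. log_slit (u i) (v (real (Suc i)))" and "k \<equiv> nxt i"
  shows "\<phi> (real (Suc k)) - \<phi> (real k) = (L k - L i) + 2 * pi * \<i> * of_int (turn i)"
proof -
  have k: "k < m" unfolding k_def by (rule nxt_less)
  have sub: "{real k..real (Suc k)} \<subseteq> {0..real m}" using k by auto
  have P: "c k (real k) = sp (\<not> u i) (a i) (r i)" using c_start[OF i] by (simp add: k_def)
  have E: "c k (real (Suc k)) = sp (u k) (a k) (r k)" by (rule c_end[OF k])
  have inj: "inj_on (c k) {real k..real (Suc k)}" using arc_inj[OF k] by (simp add: add.commute)
  have strip: "s \<in> {real k..real (Suc k)} \<Longrightarrow> c k s \<in> strip" for s
    using arc_strip[OF k] by (auto simp: add.commute)
  have sec: "secant (c k) v (real k) (real (Suc k)) = chord k" by (simp add: secant_def chord_def)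
  have "\<phi> (real (Suc k)) - \<phi> (real k) =
      (log_slit (u i) (chord k) - log_slit (u i) (v (real k))) + (log_slit (u k) (v (real (Suc k))) - log_slit (u k) (chord k))"
    unfolding sec[symmetric]
  proof (rule hopf_arc[OF _ continuous_on_subset[OF v_cont sub] c_deriv[OF k] _ inj continuous_on_subset[OF \<phi>(1) sub]])
    show "v (real k) \<in> slit (u i)" using velocity_slit[OF i] v_wrap[OF i] by (simp add: k_def)
    show "v (real (Suc k)) \<in> slit (u k)" by (rule velocity_slit[OF k])
    show "c k s - c k (real k) \<in> slit (u i)" if s: "s \<in> {real k<..real (Suc k)}" for s
    proof -
      have "c k s \<noteq> c k (real k)" using inj_onD[OF inj, of s "real k"] s by auto
      thus ?thesis unfolding P using strip_slit(1)[OF i strip[of s], of "u i"] s by auto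
    qed
    show "c k (real (Suc k)) - c k s \<in> slit (u k)" if s: "s \<in> {real k..<real (Suc k)}" for s
    proof -
      have "c k s \<noteq> c k (real (Suc k))" using inj_onD[OF inj, of s "real (Suc k)"] s by auto
      thus ?thesis unfolding E using strip_slit(2)[OF k strip[of s], of "u k"] s by auto
    qed
  qed (use v_nonzero \<phi>(2) sub in auto)
  moreover have "log_slit (u i) (chord k) - log_slit (u k) (chord k) = 2 * pi * \<i> * of_int (turn i)"
  proof (cases "u i = u k")
    case False
    hence uk: "u k = (\<not> u i)" by auto
    \<comment> \<open>Two points of one row with the same abscissa coincide, but the arc is
      injective.\<close>
    have "Re (chord k) \<noteq> 0"
    proof
      assume "Re (chord k) = 0"
      hence "Re (sp (\<not> u i) (a k) (r k)) = Re (sp (\<not> u i) (a i) (r i))" unfolding chord_def P E uk by simp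
      hence "a k = a i \<and> r k = r i"
        using sp_inj[OF at[OF k] at[OF i] r0[OF k] r1[OF k] r0[OF i] r1[OF i]] by (simp add: Re_sp)
      hence "c k (real (Suc k)) = c k (real k)" unfolding P E uk by simp
      thus False using inj_onD[OF inj, of "real (Suc k)" "real k"] by auto
    qed
    thus ?thesis
      using log_slit_right[of "chord k"] log_slit_left[of "chord k"] uk
      by (cases "Re (chord k) > 0"; cases "u i") (auto simp: turn_def k_def[symmetric])
  qed (simp add: turn_def k_def[symmetric])
  ultimately show ?thesis
    using v_wrap[OF i] unfolding L_def k_def[symmetric] by (simp add: algebra_simps)
qed

text \<open>Summed around the closed curve, the velocity terms cancel because passing to the next
  crossing permutes the crossings.\<close>

lemma curve_index_turn: "curve_index m v = (\<Sum>i<m. turn i)"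
proof -
  obtain \<phi> where \<phi>: "continuous_on {0..real m} \<phi>" "\<And>s. s \<in> {0..real m} \<Longrightarrow> v s = exp (\<phi> s)"
    using continuous_logarithm_on_contractible[OF v_cont convex_imp_contractible v_nonzero] by (metis convex_real_interval(5))
  let ?L = "\<lambda>i. log_slit (u i) (v (real (Suc i)))"
  have "\<phi> (real m) - \<phi> 0 = (\<Sum>k<m. \<phi> (real (Suc k)) - \<phi> (real k))"
    using sum_lessThan_telescope[of "\<lambda>k. \<phi> (real k)" m] by simp
  also have "\<dots> = (\<Sum>i<m. \<phi> (real (Suc (nxt i))) - \<phi> (real (nxt i)))"
    by (rule sum.reindex_bij_betw[OF bij_nxt, symmetric])
  also have "\<dots> = (\<Sum>i<m. (?L (nxt i) - ?L i) + 2 * pi * \<i> * of_int (turn i))"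
    by (rule sum.cong[OF refl]) (use arc_turning[OF _ \<phi>] in auto)
  also have "\<dots> = (\<Sum>i<m. ?L (nxt i)) - (\<Sum>i<m. ?L i) + 2 * pi * \<i> * of_int (\<Sum>i<m. turn i)"
    by (simp add: sum.distrib sum_subtractf sum_distrib_left)
  also have "(\<Sum>i<m. ?L (nxt i)) = (\<Sum>i<m. ?L i)"
    by (rule sum.reindex_bij_betw[OF bij_nxt])
  finally have "\<phi> (real m) - \<phi> 0 = 2 * pi * \<i> * of_int (\<Sum>i<m. turn i)" by simp
  thus ?thesis by (intro curve_index_log[OF m_pos \<phi>]) (simp_all add: mult.assoc)
qed

section \<open>Parity of the number of turns\<close>

private abbreviation "xx up i \<equiv> xs up (a i) + r i * Re (\<zeta> (a i))"

text \<open>Coordinates on the boundary line: \<open>ke i\<close> of the point where arc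
  \<open>i\<close> reaches a side, \<open>ks i\<close> of the glued point where the curve
  continues.\<close>

definition ke :: "nat \<Rightarrow> real" where
  "ke i = key (u i) (xx (u i) i)"

definition ks :: "nat \<Rightarrow> real" where
  "ks i = key (\<not> u i) (xx (\<not> u i) i)"

lemma key_eq: "key up x = key up' x' \<longleftrightarrow> up = up' \<and> x = x'"
proof -
  have "- exp x \<noteq> exp y" "exp x \<noteq> - exp y" for x y :: real
    using exp_gt_zero[of x] exp_gt_zero[of y] by linarith+
  thus ?thesis by (auto simp: key_def)
qed

text \<open>A point of a side is not crossed twice: in the same direction by
  \<open>crossing_inj\<close>, in opposite directions because the end of one arc would be the start
  of another.\<close>

lemma crossing_x_inj: "i < m \<Longrightarrow> j < m \<Longrightarrow> xx up i = xx up j \<Longrightarrow> i = j"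
proof -
  assume ij: "i < m" "j < m" and eq: "xx up i = xx up j"
  hence aj: "a i = a j" "r i = r j" using sp_inj[OF at[OF ij(1)] at[OF ij(2)] r0[OF ij(1)] r1[OF ij(1)] r0[OF ij(2)] r1[OF ij(2)] eq] by auto
  show "i = j"
  proof (cases "u i = u j")
    case True
    thus ?thesis using crossing_inj[OF ij] c_end ij aj by simp
  next
    case False
    hence uj: "u j = (\<not> u i)" by auto
    have "c i (real (Suc i)) = c (nxt j) (real (nxt j))"
      using c_end[OF ij(1)] c_start[OF ij(2)] aj uj by simp
    thus ?thesis using end_neq[OF ij(1) nxt_less, of "real (nxt j)" j] by auto
  qed
qed

text \<open>The top row occupies the negative half line in reverse order, to the left of the bottom
  row.\<close>

lemma key_less: "key up x < key up' y \<longleftrightarrow> (if up = up' then (x < y) \<noteq> (up \<and> x \<noteq> y) else up)"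
proof -
  have "- exp x < exp y" "\<not> exp x < - exp y" for x y :: real
    using exp_gt_zero[of x] exp_gt_zero[of y] by linarith+
  thus ?thesis by (auto simp: key_def)
qed

text \<open>Arc by arc: an arc between different rows does not turn, and it lowers the key exactly
  when it goes up. An arc within a row turns when it runs leftward, which lowers the key at the
  bottom and raises it on top. In every case the two conditions differ exactly when the arc ends on
  top.\<close>

lemma turn_parity:
  "(-1) ^ card {i \<in> {..<m}. turn i \<noteq> 0} * (-1) ^ card {i \<in> {..<m}. ke (nxt i) < ks i} = ((-1) ^ card {i \<in> {..<m}. u i} :: int)"
proof -
  have "(turn i \<noteq> 0) \<noteq> (ke (nxt i) < ks i) \<longleftrightarrow> u (nxt i)" if i: "i < m" for i
  proof -
    let ?k = "nxt i"
    have k: "?k < m" by (rule nxt_less)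
    have ch: "Re (chord ?k) = xx (u ?k) ?k - xx (\<not> u i) i"
      unfolding chord_def c_end[OF k] c_start[OF i] by (simp add: Re_sp)
    have ne: "xx (u ?k) ?k \<noteq> xx (\<not> u i) i" if "u i \<noteq> u ?k"
    proof
      assume eq: "xx (u ?k) ?k = xx (\<not> u i) i"
      have "u ?k = (\<not> u i)" using that by auto
      hence "?k = i" "c ?k (real (Suc ?k)) = c ?k (real ?k)"
        using crossing_x_inj[OF k i, of "u ?k"] eq c_end[OF k] c_start[OF i] by auto
      thus False using inj_onD[OF arc_inj[OF k], of "real (Suc ?k)" "real ?k"] by auto
    qed
    show ?thesis
      unfolding turn_def ke_def ks_def ch key_less using ne
      by (cases "u i"; cases "u ?k") (auto simp: not_less)
  qed
  hence "{i \<in> {..<m}. (turn i \<noteq> 0) \<noteq> (ke (nxt i) < ks i)} = {i \<in> {..<m}. u (nxt i)}" by auto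
  moreover have "card {i \<in> {..<m}. u (nxt i)} = card {i \<in> {..<m}. u i}"
  proof (rule bij_betw_same_card, rule bij_betw_imageI)
    show "inj_on (\<lambda>i. nxt i) {i \<in> {..<m}. u (nxt i)}" using bij_nxt by (auto simp: bij_betw_def intro: inj_on_subset)
    show "(\<lambda>i. nxt i) ` {i \<in> {..<m}. u (nxt i)} = {i \<in> {..<m}. u i}" using bij_nxt by (auto simp: bij_betw_def)
  qed
  ultimately show ?thesis
    using minus_one_power_card_xor[of "{..<m}" "\<lambda>i. turn i \<noteq> 0" "\<lambda>i. ke (nxt i) < ks i"] by simp
qed

text \<open>The chord of a crossing joins a point on top to a point at the bottom. As the top row is
  reversed on the boundary line, two chords interlace when the rows order the crossings differently;
  two crossings of one side are ordered alike in both rows.\<close>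

lemma interl_inverted:
  assumes ij: "i < m" "j < m" "i \<noteq> j"
  shows "interl (ke i) (ks i) (ke j) (ks j) \<longleftrightarrow> inverted (a i) (a j)"
proof -
  have ne: "xx up i \<noteq> xx up j" for up using crossing_x_inj ij by blast
  have il: "interl (ke i) (ks i) (ke j) (ks j) \<longleftrightarrow> (xx True i < xx True j) \<noteq> (xx False i < xx False j)"
    unfolding interl_def ke_def ks_def key_less using ne[of True] ne[of False]
    by (cases "u i"; cases "u j") auto
  show ?thesis
  proof (cases "a i = a j")
    case True
    thus ?thesis unfolding il by (simp add: xs_def inverted_def Re_pos[OF at[OF ij(2)]])
  next
    case False
    thus ?thesis unfolding il
      using sp_x_less[OF at[OF ij(1)] at[OF ij(2)] False r0[OF ij(1)] r1[OF ij(1)] r0[OF ij(2)] r1[OF ij(2)]]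
      by (simp add: inverted_def)
  qed
qed

text \<open>\<open>parity_pairs\<close> passes from the arcs, which do not interlace, to the
  crossings, which interlace as the letters are inverted. The minus sign of the rotation is the
  summand 1 in index plus one.\<close>

lemma turn_count:
  "(-1) ^ card {i \<in> {..<m}. turn i \<noteq> 0} = - bsgn (q0 (\<Sum>i<m. unit (a i)))"
proof -
  have parity: "(-1) ^ card {i. i < m \<and> ke (nxt i) < ks i} =
      - ((-1) ^ card {i. i < m \<and> ks i < ke i} * (-1) ^ card {(i, j). i < j \<and> j < m \<and> interl (ke i) (ks i) (ke j) (ks j)} :: int)"
  proof (rule parity_pairs[OF m_pos])
    have inj: "i = j" if "i < m" "j < m" "ke i = ke j \<or> ks i = ks j" for i j
    proof -
      have "u i = u j \<and> (\<exists>up. xx up i = xx up j)" using that(3) by (auto simp: ke_def ks_def key_eq)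
      thus ?thesis using crossing_x_inj[OF that(1,2)] by blast
    qed
    show "inj_on ke {..<m}" by (rule inj_onI, rule inj) auto
    show "inj_on ks {..<m}" by (rule inj_onI, rule inj) auto
    show "ke i \<noteq> ks j" if "i < m" "j < m" for i j
    proof
      assume "ke i = ks j"
      hence eq: "u i = (\<not> u j)" "xx (u i) i = xx (u i) j" by (auto simp: ke_def ks_def key_eq)
      hence "i = j" using crossing_x_inj that by blast
      thus False using eq by simp
    qed
    show "\<not> interl (ks i) (ke (nxt i)) (ks j) (ke (nxt j))" if ij: "i < m" "j < m" "i \<noteq> j" for i j
      unfolding ks_def ke_def
    proof (rule arcs_no_interl)
      have n: "nxt i < m" "nxt j < m" "nxt i \<noteq> nxt j" using nxt_less nxt_inj[OF ij(1,2)] ij(3) by blast+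
      have cont: "continuous_on {real k..real k + 1} (c k)" if "k < m" for k
      proof -
        have "continuous_on {real k..real (Suc k)} (c k)"
          by (rule continuous_on_vector_derivative) (rule c_deriv[OF that])
        thus ?thesis by (simp add: add.commute)
      qed
      show "continuous_on {real (nxt i)..real (nxt i) + 1} (c (nxt i))"
        "continuous_on {real (nxt j)..real (nxt j) + 1} (c (nxt j))" using cont n by auto
      show "c (nxt i) ` {real (nxt i)..real (nxt i) + 1} \<subseteq> strip"
        "c (nxt j) ` {real (nxt j)..real (nxt j) + 1} \<subseteq> strip" using arc_strip n by auto
      show "c (nxt i) ` {real (nxt i)..real (nxt i) + 1} \<inter> c (nxt j) ` {real (nxt j)..real (nxt j) + 1} = {}"
        using arcs_disjoint n by auto
      have e: "c k (real k + 1) = Complex (xx (u k) k) (ht (u k) (xx (u k) k))"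
        and st: "c (nxt k) (real (nxt k)) = Complex (xx (\<not> u k) k) (ht (\<not> u k) (xx (\<not> u k) k))" if "k < m" for k
        using c_end[OF that] c_start[OF that] sp_complex[OF at[OF that] less_imp_le[OF r0[OF that]] less_imp_le[OF r1[OF that]]]
        by (auto simp: add.commute)
      show "c (nxt i) (real (nxt i)) = Complex (xx (\<not> u i) i) (ht (\<not> u i) (xx (\<not> u i) i))"
        "c (nxt j) (real (nxt j)) = Complex (xx (\<not> u j) j) (ht (\<not> u j) (xx (\<not> u j) j))" using st ij by auto
      show "c (nxt i) (real (nxt i) + 1) = Complex (xx (u (nxt i)) (nxt i)) (ht (u (nxt i)) (xx (u (nxt i)) (nxt i)))"
        "c (nxt j) (real (nxt j) + 1) = Complex (xx (u (nxt j)) (nxt j)) (ht (u (nxt j)) (xx (u (nxt j)) (nxt j)))" using e n by auto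
    qed
  qed
  have inv: "{(i, j). i < j \<and> j < m \<and> interl (ke i) (ks i) (ke j) (ks j)} = {(i, j). i < j \<and> j < m \<and> inverted (a i) (a j)}"
    using interl_inverted by auto
  have U: "{i. i < m \<and> ks i < ke i} = {i \<in> {..<m}. True \<noteq> u i}"
    by (auto simp: ks_def ke_def key_less)
  have all: "card {i \<in> {..<m}. True} = m" by simp
  have sq: "((-1) ^ n * (-1) ^ n :: int) = 1" for n :: nat by (simp flip: power_add)
  have "((-1) ^ m :: int) * (-1) ^ card {i \<in> {..<m}. u i} = (-1) ^ card {i \<in> {..<m}. True \<noteq> u i}"
    using minus_one_power_card_xor[of "{..<m}" "\<lambda>i. True" u] unfolding all by simp
  hence not_u: "((-1) ^ card {i. i < m \<and> ks i < ke i} :: int) = (-1) ^ m * (-1) ^ card {i \<in> {..<m}. u i}"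
    unfolding U by simp
  let ?T = "(-1) ^ card {i \<in> {..<m}. turn i \<noteq> 0} :: int" and ?K = "(-1) ^ card {i. i < m \<and> ke (nxt i) < ks i} :: int"
  have "{i. i < m \<and> ke (nxt i) < ks i} = {i \<in> {..<m}. ke (nxt i) < ks i}" by auto
  hence TK: "?T * ?K = (-1) ^ card {i \<in> {..<m}. u i}" using turn_parity by (simp only:)
  have KK: "?K * ?K = 1" by (rule sq)
  have "?T = ?T * (?K * ?K)" unfolding KK by simp
  also have "\<dots> = (?T * ?K) * ?K" by (simp only: ac_simps)
  also have "\<dots> = (-1) ^ card {i \<in> {..<m}. u i} * - ((-1) ^ m * (-1) ^ card {i \<in> {..<m}. u i} *
      (-1) ^ card {(i, j). i < j \<and> j < m \<and> inverted (a i) (a j)})"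
    unfolding TK unfolding parity inv not_u ..
  also have "\<dots> = - (((-1) ^ card {i \<in> {..<m}. u i} * (-1) ^ card {i \<in> {..<m}. u i}) * ((-1) ^ m *
      (-1) ^ card {(i, j). i < j \<and> j < m \<and> inverted (a i) (a j)}))" by simp
  also have "\<dots> = - bsgn (q0 (\<Sum>i<m. unit (a i)))"
    unfolding sq using bsgn_q0_units[of m a] at by simp
  finally show ?thesis .
qed

lemma curve_class_units: "curve_class t b \<zeta> m c = (\<Sum>i<m. unit (a i))"
proof
  fix x
  have "c i (real (Suc i)) \<in> open_side \<zeta> t x \<union> open_side \<zeta> b x \<longleftrightarrow> a i = x" if i: "i < m" and x: "x \<in> set t" for i
  proof -
    have "c i (real (Suc i)) \<in> open_side \<zeta> (wt up) x \<longleftrightarrow> up = u i \<and> a i = x" for up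
      unfolding mem_open_side c_end[OF i] using sp_eq_iff[OF at[OF i] x r0[OF i] r1[OF i]] r0[OF i] r1[OF i] by fastforce
    from this[of True] this[of False] show ?thesis by auto
  qed
  hence eq: "{i. i < m \<and> c i (real (Suc i)) \<in> open_side \<zeta> t x \<union> open_side \<zeta> b x} = {i. i < m \<and> a i = x}" if "x \<in> set t"
    using that by auto
  have "(\<Sum>i<m. unit (a i)) x = (\<Sum>i<m. if a i = x then 1 else 0)"
    by (simp add: sum_bit_fun_apply unit_def eq_commute)
  also have "\<dots> = of_nat (card {i. i < m \<and> a i = x})" by (simp add: sum.If_cases Int_def)
  also have "\<dots> = curve_class t b \<zeta> m c x"
  proof (cases "x \<in> set t")
    case True
    thus ?thesis unfolding curve_class_def eq[OF True] by simp
  next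
    case False
    hence e: "{i. i < m \<and> a i = x} = {}" using at by blast
    show ?thesis unfolding e using False by (simp add: curve_class_def)
  qed
  finally show "curve_class t b \<zeta> m c x = (\<Sum>i<m. unit (a i)) x" by simp
qed

lemma of_int_turn_sum: "(of_int (\<Sum>i<m. turn i) :: bit) = of_nat (card {i \<in> {..<m}. turn i \<noteq> 0})"
proof -
  have "(of_int (turn i) :: bit) = (if turn i \<noteq> 0 then 1 else 0)" for i by (simp add: turn_def)
  thus ?thesis by (simp add: sum.If_cases Int_def)
qed

lemma q0_curve_class_aux: "q0 (curve_class t b \<zeta> m c) = of_int (curve_index m v + 1)"
proof -
  have "bsgn (of_int (curve_index m v + 1)) = bsgn (q0 (curve_class t b \<zeta> m c))"
    unfolding curve_index_turn curve_class_units
    using turn_count by (simp add: bsgn_add bsgn_of_nat of_int_turn_sum flip: of_int_sum)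
  thus ?thesis
    using bit_cases[of "of_int (curve_index m v + 1)"] bit_cases[of "q0 (curve_class t b \<zeta> m c)"] by fastforce
qed

end

end

theorem q0_curve_class:
  assumes "simple_closed_curve t b \<zeta> m v c"
  shows "q0 (curve_class t b \<zeta> m c) = of_int (curve_index m v + 1)"
proof -
  obtain a r u where "\<And>i. i < m \<Longrightarrow> a i \<in> set t \<and> 0 < r i \<and> r i < (1::real) \<and>
    c i (real (Suc i)) = sp (u i) (a i) (r i) \<and> c (Suc i mod m) (real (Suc i mod m)) = sp (\<not> u i) (a i) (r i)"
    using crossings[OF assms] by blast
  from q0_curve_class_aux[OF assms this] show ?thesis .
qed

end

section \<open>Curves made of upward arcs\<close>

definition C1 :: "(real \<Rightarrow> real) \<Rightarrow> (real \<Rightarrow> real) \<Rightarrow> bool" where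
  "C1 f f' \<longleftrightarrow> (\<forall>x. (f has_real_derivative f' x) (at x)) \<and> continuous_on UNIV f'"

lemma C1_D: "C1 f f' \<Longrightarrow> (f has_real_derivative f' x) (at x)"
  by (simp add: C1_def)

lemma C1_cont: "C1 f f' \<Longrightarrow> continuous_on UNIV f"
  unfolding C1_def by (meson DERIV_continuous_on has_field_derivative_at_within)

lemma C1_cont': "C1 f f' \<Longrightarrow> continuous_on UNIV f'"
  by (simp add: C1_def)

lemma C1_const: "C1 (\<lambda>x. k) (\<lambda>x. 0)"
  by (auto simp: C1_def intro!: continuous_intros)

lemma C1_linear: "C1 (\<lambda>x. p + x * k) (\<lambda>x. k)"
  by (auto simp: C1_def intro!: derivative_eq_intros continuous_intros)

lemma C1_add: "C1 f f' \<Longrightarrow> C1 g g' \<Longrightarrow> C1 (\<lambda>x. f x + g x) (\<lambda>x. f' x + g' x)"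
  by (auto simp: C1_def intro!: DERIV_add continuous_on_add)

lemma C1_diff: "C1 f f' \<Longrightarrow> C1 g g' \<Longrightarrow> C1 (\<lambda>x. f x - g x) (\<lambda>x. f' x - g' x)"
  by (auto simp: C1_def intro!: DERIV_diff continuous_on_diff)

lemma C1_mult:
  assumes "C1 f f'" "C1 g g'"
  shows "C1 (\<lambda>x. f x * g x) (\<lambda>x. f' x * g x + g' x * f x)"
  using assms C1_cont[OF assms(1)] C1_cont[OF assms(2)]
  by (auto simp: C1_def intro!: DERIV_mult continuous_on_add continuous_on_mult)

lemma C1_sum: "finite A \<Longrightarrow> (\<And>a. a \<in> A \<Longrightarrow> \<exists>f'. C1 (f a) f') \<Longrightarrow> \<exists>f'. C1 (\<lambda>x. \<Sum>a\<in>A. f a x) f'"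
proof (induction A rule: finite_induct)
  case empty
  show ?case using C1_const[of 0] by auto
next
  case (insert a A)
  obtain f' where "C1 (f a) f'" using insert.prems[of a] by blast
  moreover obtain g' where "C1 (\<lambda>x. \<Sum>a\<in>A. f a x) g'" using insert.IH insert.prems by blast
  ultimately have "C1 (\<lambda>x. f a x + (\<Sum>a\<in>A. f a x)) (\<lambda>x. f' x + g' x)" by (rule C1_add)
  thus ?case using insert.hyps by auto
qed

text \<open>Building block of the bumps. At 0 the difference quotient is at most
  \<open>\<bar>h\<bar>\<close> in absolute value.\<close>

lemma C1_max_sq: "C1 (\<lambda>z. (max 0 z)\<^sup>2) (\<lambda>z. 2 * max 0 z)"
  unfolding C1_def
proof (intro conjI allI)
  fix x :: real
  show "((\<lambda>z. (max 0 z)\<^sup>2) has_real_derivative 2 * max 0 x) (at x)"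
  proof (cases x "0::real" rule: linorder_cases)
    case less
    have "\<forall>\<^sub>F z in nhds x. (max 0 z)\<^sup>2 = (0::real)"
      using less by (intro eventually_nhds[THEN iffD2] exI[of _ "{..<0}"]) (auto simp: max_def)
    moreover have "((\<lambda>z. 0) has_real_derivative 2 * max 0 x) (at x)" using less by simp
    ultimately show ?thesis by (subst DERIV_cong_ev[OF refl _ refl])
  next
    case greater
    have "\<forall>\<^sub>F z in nhds x. (max 0 z)\<^sup>2 = z\<^sup>2"
      using greater by (intro eventually_nhds[THEN iffD2] exI[of _ "{0<..}"]) (auto simp: max_def)
    moreover have "((\<lambda>z. z\<^sup>2) has_real_derivative 2 * max 0 x) (at x)"
      using greater by (auto intro!: derivative_eq_intros)
    ultimately show ?thesis by (subst DERIV_cong_ev[OF refl _ refl])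
  next
    case equal
    have "((\<lambda>h. (max 0 h)\<^sup>2 / h) \<longlongrightarrow> 0) (at (0::real))"
    proof (rule Lim_null_comparison)
      show "\<forall>\<^sub>F h in at 0. norm ((max 0 h)\<^sup>2 / h) \<le> \<bar>h :: real\<bar>"
        by (rule always_eventually) (auto simp: max_def power2_eq_square)
      show "((\<lambda>h. \<bar>h :: real\<bar>) \<longlongrightarrow> 0) (at 0)" by (intro tendsto_eq_intros) auto
    qed
    thus ?thesis using equal by (simp add: DERIV_def)
  qed
qed (intro continuous_intros)

lemma C1_compose:
  assumes "C1 f f'" "C1 g g'"
  shows "C1 (\<lambda>x. f (g x)) (\<lambda>x. f' (g x) * g' x)"
  unfolding C1_def
proof (intro conjI allI continuous_on_mult)
  show "((\<lambda>x. f (g x)) has_real_derivative f' (g x) * g' x) (at x)" for x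
    by (rule DERIV_chain2[OF C1_D C1_D]) (fact assms)+
  show "continuous_on UNIV (\<lambda>x. f' (g x))"
    by (rule continuous_on_compose2[OF C1_cont'[OF assms(1)] C1_cont[OF assms(2)]]) simp
qed (rule C1_cont'[OF assms(2)])

definition bump :: "real \<Rightarrow> real \<Rightarrow> real \<Rightarrow> real" where
  "bump p w x = (max 0 (1 - ((x - p) / w)\<^sup>2))\<^sup>2"

lemma C1_bump: "\<exists>f'. C1 (bump p w) f'"
proof -
  have 1: "C1 (\<lambda>x. (x - p) / w) (\<lambda>x. 1 / w)"
    using C1_linear[of "- p / w" "1 / w"] by (simp add: diff_divide_distrib)
  show ?thesis
    unfolding bump_def using C1_compose[OF C1_max_sq C1_diff[OF C1_const[of 1] C1_mult[OF 1 1]]]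
    by (auto simp: power2_eq_square[of "(_ - _) / _"])
qed

lemma bump_center [simp]: "bump p w p = 1"
  by (simp add: bump_def)

lemma bump_range: "0 \<le> bump p w x" "bump p w x \<le> 1"
  by (auto simp: bump_def max_def intro!: power_le_one)

lemma bump_support:
  assumes "bump p w x \<noteq> 0" "0 < w"
  shows "p - w < x" "x < p + w"
proof -
  have "((x - p) / w)\<^sup>2 < 1" using assms by (auto simp: bump_def max_def split: if_splits)
  hence "\<bar>(x - p) / w\<bar> < 1" by (simp add: abs_square_less_1)
  hence "\<bar>x - p\<bar> < w" using assms by (simp add: field_simps)
  thus "p - w < x" "x < p + w" by linarith+
qed

text \<open>The witness is the monotone rational quadratic spline with end slopes \<open>\<alpha>\<close> and \<open>\<beta>\<close>.\<close>

lemma reparametrization: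
  fixes \<alpha> \<beta> :: real
  assumes "\<alpha> > 0" "\<beta> > 0"
  obtains w w' where "\<And>s. s \<in> {0..1} \<Longrightarrow> (w has_real_derivative w' s) (at s)" "continuous_on {0..1} w'"
    "w 0 = 0" "w 1 = 1" "w' 0 = \<alpha>" "w' 1 = \<beta>" "\<And>s. s \<in> {0..1} \<Longrightarrow> 0 < w' s"
proof -
  define D where "D s = 1 + (\<alpha> + \<beta> - 2) * (s * (1 - s))" for s :: real
  define M where "M s = \<beta> * s\<^sup>2 + 2 * (s * (1 - s)) + \<alpha> * (1 - s)\<^sup>2" for s :: real
  have D: "0 < D s" and M: "0 < M s" if s: "s \<in> {0..1}" for s
  proof -
    have nn: "0 \<le> s * (1 - s)" using s by (intro mult_nonneg_nonneg) auto
    have "D s = s\<^sup>2 + (1 - s)\<^sup>2 + (\<alpha> + \<beta>) * (s * (1 - s))" by (simp add: D_def power2_eq_square algebra_simps)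
    moreover have "0 < s\<^sup>2 + (1 - s)\<^sup>2" by (rule sum_power2_gt_zero_iff[THEN iffD2]) auto
    moreover have "0 \<le> (\<alpha> + \<beta>) * (s * (1 - s))" by (rule mult_nonneg_nonneg[OF _ nn(1)]) (use assms in simp)
    ultimately show "0 < D s" by linarith
    have "0 \<le> \<beta> * s\<^sup>2" "0 \<le> \<alpha> * (1 - s)\<^sup>2" using assms by (simp_all add: mult_nonneg_nonneg)
    moreover have "0 < \<beta> * s\<^sup>2 \<or> 0 < \<alpha> * (1 - s)\<^sup>2" using assms by (cases "s = 0") (simp_all add: mult_pos_pos)
    ultimately show "0 < M s" using nn(1) unfolding M_def by linarith
  qed
  show ?thesis
  proof (rule that[of "\<lambda>s. (s\<^sup>2 + \<alpha> * (s * (1 - s))) / D s" "\<lambda>s. M s / (D s)\<^sup>2"])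
    fix s :: real assume s: "s \<in> {0..1}"
    have dD: "(D has_real_derivative (\<alpha> + \<beta> - 2) * (1 - 2 * s)) (at s)"
      unfolding D_def by (auto intro!: derivative_eq_intros simp: algebra_simps)
    have dN: "((\<lambda>s. s\<^sup>2 + \<alpha> * (s * (1 - s))) has_real_derivative 2 * s + \<alpha> * (1 - 2 * s)) (at s)"
      by (auto intro!: derivative_eq_intros simp: algebra_simps)
    have "(2 * s + \<alpha> * (1 - 2 * s)) * D s - (s\<^sup>2 + \<alpha> * (s * (1 - s))) * ((\<alpha> + \<beta> - 2) * (1 - 2 * s)) = M s"
      unfolding D_def M_def by (simp add: power2_eq_square algebra_simps)
    thus "((\<lambda>s. (s\<^sup>2 + \<alpha> * (s * (1 - s))) / D s) has_real_derivative M s / (D s)\<^sup>2) (at s)"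
      using DERIV_divide[OF dN dD] D[OF s] by (simp add: power2_eq_square)
    show "0 < M s / (D s)\<^sup>2" using D[OF s] M[OF s] by simp
  next
    have "D s \<noteq> 0" if "s \<in> {0..1}" for s using D[OF that] by simp
    thus "continuous_on {0..1} (\<lambda>s. M s / (D s)\<^sup>2)" unfolding M_def D_def by (intro continuous_intros) auto
  qed (auto simp: D_def M_def)
qed

lemma glue_continuous:
  fixes f :: "nat \<Rightarrow> real \<Rightarrow> complex"
  assumes "\<And>k. k < m \<Longrightarrow> continuous_on {real k..real (Suc k)} (f k) \<and> f k (real k) = z \<and> f k (real (Suc k)) = z"
  shows "\<exists>v. continuous_on {0..real m} v \<and> v 0 = z \<and> v (real m) = z \<and> (\<forall>k<m. \<forall>s\<in>{real k..real (Suc k)}. v s = f k s)"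
  using assms
proof (induction m)
  case 0
  show ?case by (rule exI[of _ "\<lambda>_. z"]) auto
next
  case (Suc m)
  then obtain v where v: "continuous_on {0..real m} v" "v 0 = z" "v (real m) = z" "\<forall>k<m. \<forall>s\<in>{real k..real (Suc k)}. v s = f k s" by auto
  have f: "continuous_on {real m..real (Suc m)} (f m)" "f m (real m) = z" "f m (real (Suc m)) = z" using Suc.prems[of m] by auto
  let ?v = "\<lambda>s. if s \<le> real m then v s else f m s"
  have "continuous_on ({0..real m} \<union> {real m..real (Suc m)}) ?v"
  proof (rule continuous_on_If)
    show "v x = f m x" if "x \<in> {0..real m}" "\<not> x \<le> real m" for x using that by auto
    show "v x = f m x" if "x \<in> {real m..real (Suc m)}" "x \<le> real m" for x using that v(3) f(2) by (cases "x = real m") auto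
  qed (use v f in auto)
  moreover have "{0..real m} \<union> {real m..real (Suc m)} = {0..real (Suc m)}" by auto
  moreover have "?v s = f k s" if "k < Suc m" "s \<in> {real k..real (Suc k)}" for k s
  proof (cases "k < m")
    case True
    hence "real (Suc k) \<le> real m" by (simp only: of_nat_le_iff)
    hence "s \<le> real m" using that by auto
    thus ?thesis using True that v(4) by auto
  next
    case False
    hence "k = m" using that by simp
    thus ?thesis using that v(3) f(2) by (cases "s = real m") auto
  qed
  ultimately show ?case using v(2) f(3) by (intro exI[of _ ?v]) auto
qed

text \<open>Cubic from 0 to 1 with slope 0 at both ends, so that an arc which follows it
  horizontally leaves and arrives vertically.\<close>

definition smoothstep :: "real \<Rightarrow> real" where
  "smoothstep w = w\<^sup>2 * (3 - 2 * w)"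

lemma smoothstep_range: "w \<in> {0..1} \<Longrightarrow> smoothstep w \<in> {0..1}"
proof -
  assume w: "w \<in> {0..1}"
  have "1 - smoothstep w = (1 - w)\<^sup>2 * (1 + 2 * w)" by (simp add: smoothstep_def power2_eq_square algebra_simps)
  moreover have "0 \<le> (1 - w)\<^sup>2 * (1 + 2 * w)" "0 \<le> smoothstep w"
    unfolding smoothstep_def using w by (auto intro!: mult_nonneg_nonneg)
  ultimately have "0 \<le> smoothstep w" "smoothstep w \<le> 1" by linarith+
  thus ?thesis by simp
qed

lemma smoothstep_ends [simp]: "smoothstep 0 = 0" "smoothstep 1 = 1"
  by (auto simp: smoothstep_def)

lemma smoothstep_deriv: "(smoothstep has_real_derivative 6 * w * (1 - w)) (at w)"
  unfolding smoothstep_def by (auto intro!: derivative_eq_intros simp: power2_eq_square algebra_simps)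

section \<open>Smooth closed curves in the polygon\<close>

context suspension
begin

definition mid :: "bool \<Rightarrow> 'a \<Rightarrow> real" where
  "mid up a = xs up a + 1 / 2 * Re (\<zeta> a)"

text \<open>Around the midpoint of each side, \<open>P\<close> is bent towards the line through that
  side. The bumps are supported inside the sides and hence disjoint, so \<open>W\<close> is at every
  point a convex combination of \<open>P\<close> and the row.\<close>

lemma smooth_row:
  assumes P: "C1 P P'"
  obtains W W' \<theta> where "C1 W W'" "\<And>x. 0 \<le> \<theta> x \<and> \<theta> x \<le> 1 \<and> W x = (1 - \<theta> x) * P x + \<theta> x * ht up x"
    "\<And>a. a \<in> set t \<Longrightarrow> W (mid up a) = ht up (mid up a)"
proof -
  define \<phi> where "\<phi> a = bump (mid up a) (Re (\<zeta> a) / 2)" for a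
  define ln where "ln a x = ht up (mid up a) + (x - mid up a) * (Im (\<zeta> a) / Re (\<zeta> a))" for a x
  define \<theta> where "\<theta> x = (\<Sum>a\<in>set t. \<phi> a x)" for x
  define W where "W x = P x + (\<Sum>a\<in>set t. (ln a x - P x) * \<phi> a x)" for x
  have supp: "xs up a < x \<and> x < xs up a + Re (\<zeta> a)" if "a \<in> set t" "\<phi> a x \<noteq> 0" for a x
    using bump_support[of "mid up a" "Re (\<zeta> a) / 2" x] that Re_pos[OF that(1)] by (auto simp: \<phi>_def mid_def)
  have ln: "ln a x = ht up x" if "a \<in> set t" "\<phi> a x \<noteq> 0" for a x
    using ht_linear[OF that(1), of up x "mid up a"] supp[OF that] Re_pos[OF that(1)] by (simp add: ln_def mid_def)
  have uniq: "\<theta> x = \<phi> a x" if a: "a \<in> set t" "\<phi> a x \<noteq> 0" for a x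
  proof -
    have "\<phi> c x = 0" if c: "c \<in> set t - {a}" for c
    proof (rule ccontr)
      assume "\<phi> c x \<noteq> 0"
      hence "xs up c < x \<and> x < xs up c + Re (\<zeta> c)" using supp c by blast
      moreover have "pos (wt up) a < pos (wt up) c \<or> pos (wt up) c < pos (wt up) a"
        using pos_wt_neq[of a c up] a c by auto
      ultimately show False using supp[OF a] xs_mono[of a c up] xs_mono[of c a up] a c by force
    qed
    hence "(\<Sum>c\<in>set t - {a}. \<phi> c x) = 0" by (intro sum.neutral) auto
    thus ?thesis unfolding \<theta>_def using a by (simp add: sum.remove[of _ a])
  qed
  have range: "0 \<le> \<theta> x \<and> \<theta> x \<le> 1" for x
  proof (cases "\<exists>a\<in>set t. \<phi> a x \<noteq> 0")
    case True
    thus ?thesis using uniq bump_range by (metis \<phi>_def)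
  next
    case False
    thus ?thesis by (simp add: \<theta>_def)
  qed
  have W: "W x = (1 - \<theta> x) * P x + \<theta> x * ht up x" for x
  proof -
    have "(\<Sum>a\<in>set t. (ln a x - P x) * \<phi> a x) = (\<Sum>a\<in>set t. (ht up x - P x) * \<phi> a x)"
      by (rule sum.cong[OF refl]) (use ln in force)
    also have "\<dots> = (ht up x - P x) * \<theta> x" by (simp add: \<theta>_def sum_distrib_left)
    finally show ?thesis by (simp add: W_def algebra_simps)
  qed
  have each: "\<exists>f'. C1 (\<lambda>x. (ln a x - P x) * \<phi> a x) f'" for a
  proof -
    obtain \<phi>' where \<phi>': "C1 (\<phi> a) \<phi>'" using C1_bump unfolding \<phi>_def by blast
    have "C1 (ln a) (\<lambda>x. Im (\<zeta> a) / Re (\<zeta> a))"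
      using C1_linear[of "ht up (mid up a) - mid up a * (Im (\<zeta> a) / Re (\<zeta> a))" "Im (\<zeta> a) / Re (\<zeta> a)"]
      by (simp add: ln_def[abs_def] algebra_simps)
    from C1_mult[OF C1_diff[OF this P] \<phi>'] show ?thesis by blast
  qed
  have "\<exists>f'. C1 (\<lambda>x. \<Sum>a\<in>set t. (ln a x - P x) * \<phi> a x) f'" by (rule C1_sum[OF finite_set each])
  then obtain f' where "C1 (\<lambda>x. \<Sum>a\<in>set t. (ln a x - P x) * \<phi> a x) f'" ..
  from C1_add[OF P this] have "\<exists>W'. C1 W W'" unfolding W_def[abs_def] by blast
  moreover have "W (mid up a) = ht up (mid up a)" if a: "a \<in> set t" for a
    unfolding W using uniq[OF a, of "mid up a"] by (simp add: \<phi>_def)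
  ultimately show ?thesis using that range W by blast
qed

lemma mid_range: "a \<in> set t \<Longrightarrow> 0 < mid up a \<and> mid up a < X"
  using sp_x_range(3,4)[of a "1/2" up] by (simp add: mid_def)

lemma mid_less: "a \<in> set t \<Longrightarrow> c \<in> set t \<Longrightarrow> a \<noteq> c \<Longrightarrow> mid up a < mid up c \<longleftrightarrow> pos (wt up) a < pos (wt up) c"
  unfolding mid_def by (rule sp_x_less) auto

lemma sp_mid: "a \<in> set t \<Longrightarrow> sp up a (1/2) = Complex (mid up a) (ht up (mid up a))"
  unfolding mid_def by (rule sp_complex) auto

text \<open>A polynomial between the broken lines is bent towards them by bump functions at the midpoints of the sides.\<close>

lemma smooth_rows:
  obtains L L' H H' x0 x1 where "C1 L L'" "C1 H H'" "0 < x0" "x1 < X"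
    "\<And>x. x \<in> {x0..x1} \<Longrightarrow> ht False x \<le> L x \<and> L x < H x \<and> H x \<le> ht True x"
    "\<And>a up. a \<in> set t \<Longrightarrow> mid up a \<in> {x0..x1}"
    "\<And>a. a \<in> set t \<Longrightarrow> L (mid False a) = ht False (mid False a)"
    "\<And>a. a \<in> set t \<Longrightarrow> H (mid True a) = ht True (mid True a)"
proof -
  let ?M = "(\<lambda>(up, a). mid up a) ` (UNIV \<times> set t)"
  have fin: "finite ?M" and ne: "?M \<noteq> {}" using long by auto
  define x0 where "x0 = Min ?M"
  define x1 where "x1 = Max ?M"
  have in_I: "mid up a \<in> {x0..x1}" if "a \<in> set t" for up a
    unfolding x0_def x1_def using fin that by (auto intro!: Min_le Max_ge imageI)
  have "x0 \<in> ?M" "x1 \<in> ?M" unfolding x0_def x1_def using fin ne by (auto simp del: image_is_empty intro: Min_in Max_in)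
  hence x: "0 < x0" "x1 < X" using mid_range by auto
  obtain a where "a \<in> set t" using long by (cases t) auto
  hence I: "{x0..x1} \<noteq> {}" using in_I by blast
  obtain z where z: "z \<in> {x0..x1}" "\<And>y. y \<in> {x0..x1} \<Longrightarrow> ht True z - ht False z \<le> ht True y - ht False y"
  proof -
    have "continuous_on {x0..x1} (\<lambda>y. ht True y - ht False y)" by (intro continuous_intros)
    from continuous_attains_inf[OF compact_Icc I this] show ?thesis using that by blast
  qed
  \<comment> \<open>The polynomial is within \<open>e\<close> of the mean of the two rows, and the
    rows are at least \<open>4 * e\<close> apart, so \<open>P - e\<close> and \<open>P + e\<close>
    still lie between them.\<close>
  define e where "e = (ht True z - ht False z) / 4"
  have e: "0 < e" using ht_less[of z] z(1) x by (simp add: e_def)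
  obtain P where P: "real_polynomial_function P" "\<And>y. y \<in> {x0..x1} \<Longrightarrow> \<bar>(ht True y + ht False y) / 2 - P y\<bar> < e"
  proof -
    have "continuous_on {x0..x1} (\<lambda>y. (ht True y + ht False y) / 2)" by (intro continuous_intros) auto
    from Stone_Weierstrass_real_polynomial_function[OF compact_Icc this e] show ?thesis using that by blast
  qed
  obtain P' where P': "real_polynomial_function P'" "\<And>x. (P has_real_derivative P' x) (at x)"
    using has_real_derivative_polynomial_function[OF P(1)] by blast
  have C: "C1 P P'" unfolding C1_def using P' continuous_on_polymonial_function[of P' UNIV] by (auto simp: real_polynomial_function_eq)
  obtain L L' \<theta> where L: "C1 L L'" "\<And>x. 0 \<le> \<theta> x \<and> \<theta> x \<le> 1 \<and> L x = (1 - \<theta> x) * (P x - e) + \<theta> x * ht False x"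
      "\<And>a. a \<in> set t \<Longrightarrow> L (mid False a) = ht False (mid False a)"
    using smooth_row[OF C1_diff[OF C C1_const[of e]], where up = False] by metis
  obtain H H' \<eta> where H: "C1 H H'" "\<And>x. 0 \<le> \<eta> x \<and> \<eta> x \<le> 1 \<and> H x = (1 - \<eta> x) * (P x + e) + \<eta> x * ht True x"
      "\<And>a. a \<in> set t \<Longrightarrow> H (mid True a) = ht True (mid True a)"
    using smooth_row[OF C1_add[OF C C1_const[of e]], where up = True] by metis
  have "ht False y \<le> L y \<and> L y < H y \<and> H y \<le> ht True y" if y: "y \<in> {x0..x1}" for y
  proof -
    have conv: "p \<le> (1 - s) * q + s * p \<and> (1 - s) * q + s * p \<le> q" if "p \<le> q" "0 \<le> s" "s \<le> 1" for p q s :: real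
    proof -
      have "0 \<le> (1 - s) * (q - p)" "0 \<le> s * (q - p)" using that by auto
      thus ?thesis by (simp add: algebra_simps)
    qed
    have conv': "p \<le> (1 - s) * p + s * q \<and> (1 - s) * p + s * q \<le> q" if "p \<le> q" "0 \<le> s" "s \<le> 1" for p q s :: real
      using conv[of p q "1 - s"] that by (simp add: add.commute)
    have "4 * e \<le> ht True y - ht False y" using z(2)[OF y] by (simp add: e_def)
    hence "ht False y \<le> P y - e" "P y + e \<le> ht True y" using P(2)[OF y] unfolding abs_less_iff by argo+
    hence "ht False y \<le> L y \<and> L y \<le> P y - e" "P y + e \<le> H y \<and> H y \<le> ht True y"
      using conv[of "ht False y" "P y - e" "\<theta> y"] conv'[of "P y + e" "ht True y" "\<eta> y"] L(2)[of y] H(2)[of y] by auto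
    thus ?thesis using e by linarith
  qed
  thus ?thesis using that[OF L(1) H(1) x _ in_I L(3) H(3)] by blast
qed

lemma deriv_complex:
  assumes "(f has_real_derivative f') F" "(g has_real_derivative g') F"
  shows "((\<lambda>s. Complex (f s) (g s)) has_vector_derivative Complex f' g') F"
  unfolding Complex_eq using assms
  by (auto intro!: derivative_eq_intros simp: has_real_derivative_iff_has_vector_derivative)

text \<open>The arcs are ordered from left to right at every relative height, hence disjoint, and vertical with
  unit speed at both ends, hence they close up to a \<open>C\<^sup>1\<close> curve.\<close>

lemma upward_curve:
  assumes m: "0 < m" and e: "\<And>i. i < m \<Longrightarrow> e i \<in> set t" and inj: "inj_on e {..<m}"
    and order: "\<And>i j. i < m \<Longrightarrow> j < m \<Longrightarrow> pos b (e i) < pos b (e j) \<Longrightarrow> pos t (e (Suc i mod m)) < pos t (e (Suc j mod m))"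
  shows "\<exists>v c. simple_closed_curve t b \<zeta> m v c \<and> curve_class t b \<zeta> m c = (\<Sum>i<m. unit (e i))"
proof -
  obtain L L' H H' x0 x1 where L: "C1 L L'" and H: "C1 H H'" and x: "0 < x0" "x1 < X"
    and LH: "\<And>x. x \<in> {x0..x1} \<Longrightarrow> ht False x \<le> L x \<and> L x < H x \<and> H x \<le> ht True x"
    and mid: "\<And>a up. a \<in> set t \<Longrightarrow> mid up a \<in> {x0..x1}"
    and Lm: "\<And>a. a \<in> set t \<Longrightarrow> L (mid False a) = ht False (mid False a)"
    and Hm: "\<And>a. a \<in> set t \<Longrightarrow> H (mid True a) = ht True (mid True a)"
    using smooth_rows by blast
  have e': "e (Suc i mod m) \<in> set t" for i using e m by simp
  define p where "p i = mid False (e i)" for i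
  define q where "q i = mid True (e (Suc i mod m))" for i
  have pq: "p i \<in> {x0..x1}" "q i \<in> {x0..x1}" if "i < m" for i
    using mid e e' that by (auto simp: p_def q_def)
  have gap: "0 < H (p i) - L (p i)" "0 < H (q i) - L (q i)" if "i < m" for i
    using LH pq[OF that] by (simp_all add: less_diff_eq)
  \<comment> \<open>\<open>w\<close> is the relative height along an arc. Its end slopes are the
    reciprocals of the gap between \<open>L\<close> and \<open>H\<close>, which gives the arc
    vertical speed 1 at both ends.\<close>
  have "\<exists>w w'. i < m \<longrightarrow> (\<forall>s\<in>{0..1}. (w has_real_derivative w' s) (at s)) \<and> continuous_on {0..1} w' \<and>
      w 0 = 0 \<and> w 1 = 1 \<and> w' 0 = 1 / (H (p i) - L (p i)) \<and> w' 1 = 1 / (H (q i) - L (q i)) \<and> (\<forall>s\<in>{0..1}. 0 < w' s)" for i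
  proof (cases "i < m")
    case True
    from reparametrization[of "1 / (H (p i) - L (p i))" "1 / (H (q i) - L (q i))"] gap[OF True]
    show ?thesis by (metis divide_pos_pos zero_less_one)
  qed simp
  then obtain w w' where "\<And>i. i < m \<longrightarrow> (\<forall>s\<in>{0..1}. (w i has_real_derivative w' i s) (at s)) \<and> continuous_on {0..1} (w' i) \<and>
      w i 0 = 0 \<and> w i 1 = 1 \<and> w' i 0 = 1 / (H (p i) - L (p i)) \<and> w' i 1 = 1 / (H (q i) - L (q i)) \<and> (\<forall>s\<in>{0..1}. 0 < w' i s)"
    by metis
  hence wd: "\<And>i s. i < m \<Longrightarrow> s \<in> {0..1} \<Longrightarrow> (w i has_real_derivative w' i s) (at s)"
    and wc: "\<And>i. i < m \<Longrightarrow> continuous_on {0..1} (w' i)"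
    and we: "\<And>i. i < m \<Longrightarrow> w i 0 = 0 \<and> w i 1 = 1 \<and> w' i 0 = 1 / (H (p i) - L (p i)) \<and> w' i 1 = 1 / (H (q i) - L (q i))"
    and wp: "\<And>i s. i < m \<Longrightarrow> s \<in> {0..1} \<Longrightarrow> 0 < w' i s" by blast+
  have w_less: "w i s < w i s'" if "i < m" "0 \<le> s" "s < s'" "s' \<le> 1" for i s s'
  proof (rule DERIV_pos_imp_increasing[OF that(3)])
    fix y assume "s \<le> y" "y \<le> s'"
    hence "y \<in> {0..1}" using that by auto
    thus "\<exists>d. (w i has_real_derivative d) (at y) \<and> 0 < d" using wd[OF that(1)] wp[OF that(1)] by blast
  qed
  have w_inj: "s = s'" if "i < m" "s \<in> {0..1}" "s' \<in> {0..1}" "w i s = w i s'" for i s s'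
    using w_less[OF that(1), of s s'] w_less[OF that(1), of s' s] that by (cases s s' rule: linorder_cases) auto
  have w_range: "0 \<le> w i s \<and> w i s \<le> 1 \<and> (0 < s \<longrightarrow> 0 < w i s) \<and> (s < 1 \<longrightarrow> w i s < 1)" if "i < m" "s \<in> {0..1}" for i s
    using w_less[OF that(1), of 0 s] w_less[OF that(1), of s 1] that we[OF that(1)]
    by (cases "s = 0"; cases "s = 1") auto
  \<comment> \<open>The horizontal position is a function of the relative height, not of time, so
    that different arcs can be compared at equal height.\<close>
  define Xk where "Xk i r = p i + (q i - p i) * smoothstep r" for i r
  define Y where "Y x r = L x + r * (H x - L x)" for x r
  define g where "g i s = Complex (Xk i (w i s)) (Y (Xk i (w i s)) (w i s))" for i s
  define gx where "gx i s = (q i - p i) * (6 * w i s * (1 - w i s) * w' i s)" for i s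
  define g' where "g' i s = Complex (gx i s) (L' (Xk i (w i s)) * gx i s +
      (w' i s * (H (Xk i (w i s)) - L (Xk i (w i s))) + (H' (Xk i (w i s)) * gx i s - L' (Xk i (w i s)) * gx i s) * w i s))" for i s
  have Xk_convex: "Xk i r = (1 - smoothstep r) * p i + smoothstep r * q i" for i r
    by (simp add: Xk_def algebra_simps)
  have Xk_range: "Xk i r \<in> {x0..x1}" if "i < m" "r \<in> {0..1}" for i r
  proof -
    have "(1 - smoothstep r) *\<^sub>R p i + smoothstep r *\<^sub>R q i \<in> {x0..x1}"
      using pq[OF that(1)] smoothstep_range[OF that(2)]
      by (intro convexD_alt[OF convex_real_interval(5)]) auto
    thus ?thesis by (simp add: Xk_convex)
  qed
  have Xk_less: "Xk i r < Xk j r" if "i < m" "j < m" "p i < p j" "r \<in> {0..1}" for i j r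
  proof -
    have "pos b (e i) < pos b (e j)"
      using that(3) mid_less[OF e[OF that(1)] e[OF that(2)], of False] by (cases "e i = e j") (auto simp: p_def)
    hence less: "pos t (e (Suc i mod m)) < pos t (e (Suc j mod m))" by (rule order[OF that(1,2)])
    hence "q i < q j" using mid_less[OF e' e', of i j True] by (cases "e (Suc i mod m) = e (Suc j mod m)") (auto simp: q_def)
    moreover have s: "0 \<le> smoothstep r" "smoothstep r \<le> 1" using smoothstep_range[OF that(4)] by auto
    ultimately have a: "(1 - smoothstep r) * p i \<le> (1 - smoothstep r) * p j" "smoothstep r * q i \<le> smoothstep r * q j"
      using that(3) by (auto intro!: mult_left_mono)
    have "(1 - smoothstep r) * p i < (1 - smoothstep r) * p j \<or> smoothstep r * q i < smoothstep r * q j"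
      using s that(3) \<open>q i < q j\<close> by (cases "smoothstep r = 0") auto
    thus ?thesis using a unfolding Xk_convex by linarith
  qed
  have Xk_inj: "i = j" if "i < m" "j < m" "r \<in> {0..1}" "Xk i r = Xk j r" for i j r
  proof (rule ccontr)
    assume "i \<noteq> j"
    hence ne: "e i \<noteq> e j" using inj_onD[OF inj, of i j] that by auto
    have "p i \<noteq> p j"
      using mid_less[OF e[OF that(1)] e[OF that(2)] ne, of False] mid_less[OF e[OF that(2)] e[OF that(1)] ne[symmetric], of False]
        pos_wt_neq[OF e[OF that(1)] e[OF that(2)] ne, of False] by (auto simp: p_def)
    thus False using Xk_less[OF that(1,2) _ that(3)] Xk_less[OF that(2,1) _ that(3)] that(4) by (metis less_irrefl neq_iff)
  qed
  have Y_less: "Y x r < Y x r' \<longleftrightarrow> r < r'" if "x \<in> {x0..x1}" for x r r'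
    using LH[OF that] by (simp add: Y_def)
  have Y01: "Y x 0 = L x" "Y x 1 = H x" for x by (simp_all add: Y_def)
  have g_start: "g i 0 = sp False (e i) (1/2)" and g_end: "g i 1 = sp True (e (Suc i mod m)) (1/2)" if "i < m" for i
    using we[OF that] sp_mid[OF e[OF that]] sp_mid[OF e'] Lm[OF e[OF that]] Hm[OF e']
    by (simp_all add: g_def Xk_def Y01 p_def q_def)
  have g'_ends: "g' i 0 = \<i>" "g' i 1 = \<i>" if "i < m" for i
    using we[OF that] gap[OF that] by (simp_all add: g'_def gx_def Xk_def complex_eq_iff)
  have g_deriv: "(g i has_vector_derivative g' i s) (at s)" if "i < m" "s \<in> {0..1}" for i s
  proof -
    have dX: "((\<lambda>s. Xk i (w i s)) has_real_derivative gx i s) (at s)"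
      unfolding Xk_def gx_def
      by (rule derivative_eq_intros DERIV_chain2[OF smoothstep_deriv wd[OF that]] refl)+ simp
    have dL: "((\<lambda>s. L (Xk i (w i s))) has_real_derivative L' (Xk i (w i s)) * gx i s) (at s)"
      and dH: "((\<lambda>s. H (Xk i (w i s))) has_real_derivative H' (Xk i (w i s)) * gx i s) (at s)"
      using DERIV_chain2[OF C1_D[OF L] dX] DERIV_chain2[OF C1_D[OF H] dX] by auto
    show ?thesis
      unfolding g_def g'_def Y_def
      by (intro deriv_complex dX DERIV_add[OF dL] DERIV_mult[OF wd[OF that]] DERIV_diff[OF dH dL])
  qed
  have g'_cont: "continuous_on {0..1} (g' i)" if "i < m" for i
  proof -
    have cw: "continuous_on {0..1} (w i)"
      using wd[OF that] by (meson DERIV_continuous_on has_field_derivative_at_within)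
    have cX: "continuous_on {0..1} (\<lambda>s. Xk i (w i s))"
      unfolding Xk_def smoothstep_def by (intro continuous_intros cw)
    have comp: "continuous_on {0..1} (\<lambda>s. f (Xk i (w i s)))" if "continuous_on UNIV f" for f :: "real \<Rightarrow> real"
      by (rule continuous_on_compose2[OF that cX]) simp
    show ?thesis
      unfolding g'_def gx_def Complex_eq
      by (intro continuous_intros wc[OF that] cw comp C1_cont[OF L] C1_cont'[OF L] C1_cont[OF H] C1_cont'[OF H])
  qed
  have g'_nz: "g' i s \<noteq> 0" if "i < m" "s \<in> {0..1}" for i s
  proof
    assume "g' i s = 0"
    hence z: "gx i s = 0" "w' i s * (H (Xk i (w i s)) - L (Xk i (w i s))) = 0"
      by (auto simp: g'_def complex_eq_iff)
    have "w i s \<in> {0..1}" using w_range[OF that] by auto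
    from LH[OF Xk_range[OF that(1) this]] show False using z(2) wp[OF that] by auto
  qed
  have g_interior: "g i s \<in> polygon_interior t b \<zeta>" if "i < m" "s \<in> {0<..<1}" for i s
  proof -
    let ?x = "Xk i (w i s)"
    have s: "s \<in> {0..1}" using that by auto
    have W: "0 < w i s" "w i s < 1" "w i s \<in> {0..1}" using w_range[OF that(1) s] that by auto
    have r: "?x \<in> {x0..x1}" by (rule Xk_range[OF that(1) W(3)])
    have "L ?x < Y ?x (w i s)" "Y ?x (w i s) < H ?x"
      using Y_less[OF r, of 0 "w i s"] Y_less[OF r, of "w i s" 1] W unfolding Y01 by auto
    moreover have "0 < ?x" "?x < X" using r x by auto
    ultimately show ?thesis using LH[OF r] unfolding interior_iff g_def by auto
  qed
  \<comment> \<open>Before time 1 no arc reaches the top row. As gluing always involves a point of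
    the top row, no two points of half-open arcs are glued.\<close>
  have below: "g i s \<noteq> sp True a r" if "i < m" "s \<in> {0..<1}" "a \<in> set t" "r \<in> {0<..<1}" for i s a r
  proof
    assume eq: "g i s = sp True a r"
    let ?x = "Xk i (w i s)"
    have s: "s \<in> {0..1}" using that by auto
    have W: "w i s < 1" "w i s \<in> {0..1}" using w_range[OF that(1) s] that by auto
    have r: "?x \<in> {x0..x1}" by (rule Xk_range[OF that(1) W(2)])
    have "Y ?x (w i s) < ht True ?x" using Y_less[OF r, of "w i s" 1] W LH[OF r] unfolding Y01 by auto
    moreover have "sp True a r = Complex ?x (ht True ?x)"
      using sp_complex[of a r True] that eq by (auto simp: g_def)
    ultimately show False using eq by (simp add: g_def)
  qed
  have g_inj: "i = j \<and> s = s'" if "i < m" "j < m" "s \<in> {0..<1}" "s' \<in> {0..<1}" "g i s = g j s'" for i j s s'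
  proof -
    have s: "s \<in> {0..1}" "s' \<in> {0..1}" using that by auto
    have W: "w i s \<in> {0..1}" "w j s' \<in> {0..1}" using w_range that s by auto
    have eq: "Xk i (w i s) = Xk j (w j s')" "Y (Xk i (w i s)) (w i s) = Y (Xk i (w i s)) (w j s')"
      using that(5) by (auto simp: g_def)
    have ww: "w i s = w j s'"
      using Y_less[OF Xk_range[OF that(1) W(1)], of "w i s" "w j s'"] Y_less[OF Xk_range[OF that(1) W(1)], of "w j s'" "w i s"] eq(2) by linarith
    hence "i = j" using Xk_inj[OF that(1,2) W(2)] eq(1) by simp
    thus ?thesis using w_inj[OF that(1) s] ww by simp
  qed
  define c where "c i s = g i (s - real i)" for i s
  obtain v where v: "continuous_on {0..real m} v" "v 0 = \<i>" "v (real m) = \<i>"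
    "\<And>k s. k < m \<Longrightarrow> s \<in> {real k..real (Suc k)} \<Longrightarrow> v s = g' k (s - real k)"
  proof -
    have "continuous_on {real k..real (Suc k)} (\<lambda>s. g' k (s - real k))" if "k < m" for k
      by (rule continuous_on_compose2[OF g'_cont[OF that]]) (auto intro!: continuous_intros)
    thus ?thesis using glue_continuous[of m "\<lambda>k s. g' k (s - real k)" \<i>] g'_ends that by auto
  qed
  have closed: "closed_curve t b \<zeta> m v c"
    unfolding closed_curve_def
  proof (intro conjI allI impI ballI)
    show "0 < m" "continuous_on {0..real m} v" "v (real m) = v 0" using m v by auto
    show "v s \<noteq> 0" if s: "s \<in> {0..real m}" for s
    proof (cases "s = real m")
      case False
      define k where "k = nat \<lfloor>s\<rfloor>"
      have k: "real k \<le> s" "s < real k + 1" using s unfolding k_def by auto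
      moreover have "k < m" using s False k by auto
      ultimately show ?thesis using v(4)[of k s] g'_nz[of k "s - real k"] by auto
    qed (use v in simp)
    fix i assume i: "i < m"
    show "(c i has_vector_derivative v s) (at s within {real i..real (Suc i)})" if s: "s \<in> {real i..real (Suc i)}" for s
    proof -
      have "s - real i \<in> {0..1}" using s by auto
      note d = g_deriv[OF i this]
      have sh: "((\<lambda>s. s - real i) has_vector_derivative 1) (at s within {real i..real (Suc i)})"
        by (auto intro!: derivative_eq_intros)
      have "((g i \<circ> (\<lambda>s. s - real i)) has_vector_derivative 1 *\<^sub>R g' i (s - real i)) (at s within {real i..real (Suc i)})"
        by (rule vector_diff_chain_within[OF sh has_vector_derivative_at_within[OF d]])
      thus ?thesis unfolding v(4)[OF i s] c_def[abs_def] o_def by simp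
    qed
    show "c i s \<in> polygon_interior t b \<zeta>" if "s \<in> {real i<..<real (Suc i)}" for s
      unfolding c_def by (rule g_interior[OF i]) (use that in auto)
    have n: "Suc i mod m < m" using m by simp
    have "c i (real (Suc i)) = sp True (e (Suc i mod m)) (1/2)" using g_end[OF i] by (simp add: c_def)
    moreover have "c (Suc i mod m) (real (Suc i mod m)) = sp False (e (Suc i mod m)) (1/2)" using g_start[OF n] by (simp add: c_def)
    ultimately show "glued t b \<zeta> (c i (real (Suc i))) (c (Suc i mod m) (real (Suc i mod m)))"
      unfolding glued_iff by (intro bexI[OF _ e'[of i]] bexI[of _ "1/2"] exI[of _ True]) auto
  qed
  have simple: "simple_closed_curve t b \<zeta> m v c"
    unfolding simple_closed_curve_def
  proof (intro conjI closed allI impI ballI)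
    fix i j s s'
    assume ij: "i < m" "j < m" "s \<in> {real i..<real (Suc i)}" "s' \<in> {real j..<real (Suc j)}"
      and eq: "c i s = c j s' \<or> glued t b \<zeta> (c i s) (c j s')"
    have s: "s - real i \<in> {0..<1}" "s' - real j \<in> {0..<1}" using ij by auto
    have "\<not> glued t b \<zeta> (c i s) (c j s')"
    proof
      assume "glued t b \<zeta> (c i s) (c j s')"
      then obtain a r up where "a \<in> set t" "r \<in> {0<..<1}" "c i s = sp up a r" "c j s' = sp (\<not> up) a r"
        unfolding glued_iff by blast
      thus False using below[OF ij(1) s(1)] below[OF ij(2) s(2)] unfolding c_def by (cases up) auto
    qed
    hence "i = j \<and> s - real i = s' - real j" using eq g_inj[OF ij(1,2) s] by (simp add: c_def)
    thus "s = s'" by simp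
  qed
  have "curve_class t b \<zeta> m c = (\<Sum>i<m. unit (e (Suc i mod m)))"
  proof (rule curve_class_units[OF simple, where r = "\<lambda>_. 1/2" and u = "\<lambda>_. True"])
    fix i assume i: "i < m"
    have n: "Suc i mod m < m" using m by simp
    show "e (Suc i mod m) \<in> set t \<and> 0 < (1/2 :: real) \<and> (1/2 :: real) < 1 \<and>
        c i (real (Suc i)) = sp True (e (Suc i mod m)) (1/2) \<and> c (Suc i mod m) (real (Suc i mod m)) = sp (\<not> True) (e (Suc i mod m)) (1/2)"
      using g_end[OF i] g_start[OF n] e' by (simp add: c_def)
  qed
  also have "\<dots> = (\<Sum>i<m. unit (e i))" by (rule sum.reindex_bij_betw[OF bij_nxt[OF simple]])
  finally show ?thesis using simple by blast
qed

end

section \<open>Uniqueness of the spin form\<close>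

lemma bit_space_boundaries: "bit_space (boundaries t b \<zeta>)"
  unfolding bit_space_def
proof (intro conjI ballI)
  have "boundaries t b \<zeta> \<subseteq> chains t" by (auto simp: boundaries_def chains_def)
  thus "finite (boundaries t b \<zeta>)" using finite_chains by (rule finite_subset)
  show "0 \<in> boundaries t b \<zeta>" unfolding boundaries_def by (rule CollectI, rule exI[of _ "\<lambda>_. 0"]) (simp add: fun_eq_iff)
  fix x y assume "x \<in> boundaries t b \<zeta>" "y \<in> boundaries t b \<zeta>"
  then obtain f f' where f: "x = (\<lambda>a. if a \<in> set t then f (side_point \<zeta> t a 0) + f (side_point \<zeta> t a 1) else 0)"
      "\<forall>a\<in>set t. f (side_point \<zeta> t a 0) = f (side_point \<zeta> b a 0) \<and> f (side_point \<zeta> t a 1) = f (side_point \<zeta> b a 1)"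
    and f': "y = (\<lambda>a. if a \<in> set t then f' (side_point \<zeta> t a 0) + f' (side_point \<zeta> t a 1) else 0)"
      "\<forall>a\<in>set t. f' (side_point \<zeta> t a 0) = f' (side_point \<zeta> b a 0) \<and> f' (side_point \<zeta> t a 1) = f' (side_point \<zeta> b a 1)"
    unfolding boundaries_def by blast
  show "x + y \<in> boundaries t b \<zeta>" unfolding boundaries_def
    by (rule CollectI, rule exI[of _ "\<lambda>z. f z + f' z"]) (use f f' in \<open>auto simp: fun_eq_iff ac_simps\<close>)
qed

lemma boundaries_subset: "boundaries t b \<zeta> \<subseteq> chains t"
  by (auto simp: boundaries_def chains_def)

context suspension
begin

context
  fixes q :: "('a \<Rightarrow> bit) \<Rightarrow> bit" and \<rho> :: 'a
  assumes spin: "spin_form t b \<zeta> q"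
    and \<rho>: "\<rho> \<in> set t" "\<And>x. x \<in> set t \<Longrightarrow> x \<noteq> \<rho> \<Longrightarrow> pos t \<rho> < pos t x \<and> pos b x < pos b \<rho>"
begin

interpretation bf: bit_form "chains t" "boundaries t b \<zeta>" q
  by (rule bit_form.intro[OF bit_space_chains bit_space_boundaries boundaries_subset]) (use spin in \<open>simp add: spin_form_def\<close>)

text \<open>On a simple closed curve both forms are prescribed by the index: \<open>q\<close> by
  assumption and \<open>q0\<close> by \<open>q0_curve_class\<close>.\<close>

lemma spin_upward:
  assumes "0 < m" "\<And>i. i < m \<Longrightarrow> e i \<in> set t" "inj_on e {..<m}"
    "\<And>i j. i < m \<Longrightarrow> j < m \<Longrightarrow> pos b (e i) < pos b (e j) \<Longrightarrow> pos t (e (Suc i mod m)) < pos t (e (Suc j mod m))"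
  shows "q (\<Sum>i<m. unit (e i)) = q0 (\<Sum>i<m. unit (e i))"
  using upward_curve[OF assms] q0_curve_class spin unfolding spin_form_def by metis

lemma spin_unit: "a \<in> set t \<Longrightarrow> q (unit a) = q0 (unit a)"
  using spin_upward[of 1 "\<lambda>_. a"] by (simp add: inj_on_def)

lemma q0_add: "q0 (x + y) = q0 x + q0 y + polar q0 x y"
  using bit_cases[of "q0 x"] bit_cases[of "q0 y"] by (auto simp: polar_def)

text \<open>A curve that alternates between the two sides satisfies the order condition of an upward
  curve because the rows order the sides oppositely.\<close>

lemma spin_inverted:
  assumes a: "a \<in> set t" "d \<in> set t" "inverted a d"
  shows "polar q (unit a) (unit d) = polar q0 (unit a) (unit d)"
proof -
  have ne: "a \<noteq> d" using a by (auto simp: inverted_def)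
  note order = a(3)[unfolded inverted_def] pos_neq[OF a(1,2) ne]
  have "q (\<Sum>i<2. unit ([a, d] ! i)) = q0 (\<Sum>i<2. unit ([a, d] ! i))"
  proof (rule spin_upward)
    show "[a, d] ! i \<in> set t" if "i < 2" for i using that a by (auto dest: less_2_cases)
    show "inj_on ((!) [a, d]) {..<2}" using ne by (auto simp: inj_on_def dest!: less_2_cases)
    show "pos t ([a, d] ! (Suc i mod 2)) < pos t ([a, d] ! (Suc j mod 2))"
      if "i < 2" "j < 2" "pos b ([a, d] ! i) < pos b ([a, d] ! j)" for i j
      using less_2_cases[OF that(1)] less_2_cases[OF that(2)] that(3) order by auto
  qed simp
  hence "q (unit a + unit d) = q0 (unit a + unit d)" by (simp add: numeral_2_eq_2 add.commute)
  thus ?thesis using spin_unit a by (simp add: polar_def)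
qed

lemma inverted_\<rho>: "a \<in> set t \<Longrightarrow> a \<noteq> \<rho> \<Longrightarrow> inverted a \<rho> \<and> inverted \<rho> a"
  using \<rho>(2)[of a] by (auto simp: inverted_def)

text \<open>Two letters in the same order in both rows are treated by a curve that crosses \<open>\<rho>\<close> as well.\<close>

lemma spin_not_inverted:
  assumes a: "a \<in> set t" "d \<in> set t" "pos t a < pos t d" "pos b a < pos b d"
  shows "polar q (unit a) (unit d) = polar q0 (unit a) (unit d)"
proof -
  have ne: "a \<noteq> d" "a \<noteq> \<rho>" "d \<noteq> \<rho>" using a \<rho>(2)[OF a(1)] \<rho>(2)[OF a(2)] by force+
  note order = \<rho>(2)[OF a(1) ne(2)] \<rho>(2)[OF a(2) ne(3)] a(3,4)
  \<comment> \<open>In bottom order the letters are \<open>a\<close>, \<open>d\<close>, \<rho>;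
    their successors \<rho>, \<open>a\<close>, \<open>d\<close> appear in this order on top.\<close>
  let ?e = "\<lambda>i. [a, \<rho>, d] ! i"
  have three: "i = 0 \<or> i = 1 \<or> i = 2" if "i < 3" for i :: nat using that by auto
  have "q (\<Sum>i<3. unit (?e i)) = q0 (\<Sum>i<3. unit (?e i))"
  proof (rule spin_upward)
    show "?e i \<in> set t" if "i < 3" for i using three[OF that] a \<rho> by auto
    show "inj_on ?e {..<3}"
    proof (rule inj_onI)
      fix i j :: nat assume "i \<in> {..<3}" "j \<in> {..<3}" "?e i = ?e j"
      thus "i = j" using three[of i] three[of j] ne by auto
    qed
    show "pos t (?e (Suc i mod 3)) < pos t (?e (Suc j mod 3))"
      if "i < 3" "j < 3" "pos b (?e i) < pos b (?e j)" for i j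
      using three[OF that(1)] three[OF that(2)] that(3) order by auto
  qed simp
  moreover have "(\<Sum>i<3. unit (?e i)) = unit a + unit \<rho> + unit d" by (simp add: numeral_3_eq_3)
  ultimately have eq: "q (unit a + unit \<rho> + unit d) = q0 (unit a + unit \<rho> + unit d)" by (simp only:)
  have ch: "unit a \<in> chains t" "unit \<rho> \<in> chains t" "unit d \<in> chains t" using a \<rho> unit_in_chains by auto
  have "polar q (unit a) (unit \<rho>) = polar q0 (unit a) (unit \<rho>)" "polar q (unit \<rho>) (unit d) = polar q0 (unit \<rho>) (unit d)"
    using spin_inverted inverted_\<rho> a ne \<rho>(1) by blast+
  hence "polar q (unit a) (unit d) + q (unit a + unit \<rho> + unit d) = polar q0 (unit a) (unit d) + q0 (unit a + unit \<rho> + unit d)"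
    unfolding bf.q_add q0_add bf.B_add_left[OF ch(1,2,3)] polar_q0_add
    by (simp add: spin_unit a \<rho>(1) ac_simps)
  thus ?thesis using eq by simp
qed

lemma spin_polar:
  assumes "a \<in> set t" "d \<in> set t"
  shows "polar q (unit a) (unit d) = polar q0 (unit a) (unit d)"
proof -
  have sym: "polar r x y = polar r y x" for r x y by (simp add: polar_def ac_simps)
  consider "a = d" | "inverted a d" | "pos t a < pos t d" "pos b a < pos b d" | "pos t d < pos t a" "pos b d < pos b a"
  proof (cases "a = d \<or> inverted a d")
    case False
    thus ?thesis using that(3,4) pos_neq[OF assms] by (auto simp: inverted_def neq_iff)
  qed (use that in blast)
  thus ?thesis
  proof cases
    case 1
    thus ?thesis using bf.B_self by (simp add: polar_q0)
  next
    case 4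
    thus ?thesis using spin_not_inverted[OF assms(2,1)] sym by metis
  qed (use spin_inverted spin_not_inverted assms in blast)+
qed

text \<open>The forms agree on the units and their polar forms on pairs of units, which determines a
  quadratic form.\<close>

lemma spin_form_unique:
  assumes "x \<in> chains t"
  shows "q x = q0 x"
proof -
  have sym: "polar r x y = polar r y x" for r x y by (simp add: polar_def ac_simps)
  have "q (\<Sum>a\<in>A. unit a) = q0 (\<Sum>a\<in>A. unit a)" if "A \<subseteq> set t" for A
    using finite_subset[OF that finite_set] that
  proof (induction A rule: finite_induct)
    case (insert a A)
    have "polar q (\<Sum>c\<in>A. unit c) (unit a) = (\<Sum>c\<in>A. polar q (unit c) (unit a))"
      by (rule bf.B_sum_left) (use insert unit_in_chains in auto)
    also have "\<dots> = (\<Sum>c\<in>A. polar q0 (unit c) (unit a))"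
      by (rule sum.cong[OF refl]) (use insert spin_polar in auto)
    also have "\<dots> = polar q0 (\<Sum>c\<in>A. unit c) (unit a)"
      using sym[of q0] by (simp add: polar_q0_sum)
    finally have "q ((\<Sum>c\<in>A. unit c) + unit a) = q0 ((\<Sum>c\<in>A. unit c) + unit a)"
      unfolding bf.q_add q0_add using insert spin_unit by auto
    thus ?case by (simp only: sum.insert[OF insert.hyps(1,2)] add.commute)
  qed (simp add: q0_def)
  thus ?thesis using chain_expand[OF assms] by (metis (no_types, lifting) mem_Collect_eq subsetI)
qed

text \<open>The boundaries of an arbitrary suspension are not computed, so the factor is left open;
  its positivity suffices to compare signs.\<close>

lemma spin_arf_sign:
  assumes "has_arf_invariant (chains t) (boundaries t b \<zeta>) q s"
  shows "\<exists>C>0. (\<Sum>x\<in>chains t. bsgn (q0 x)) = C * bsgn s"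
proof -
  obtain h where h: "card (chains t) = 2 ^ h * 2 ^ h * card (boundaries t b \<zeta>)"
    "(\<Sum>v\<in>chains t. bsgn (q v)) = 2 ^ h * int (card (boundaries t b \<zeta>)) * bsgn s"
    using bf.arf_gauss[OF assms] .
  have "card (chains t) > 0" using finite_chains bf.V_0 by (auto simp: card_gt_0_iff)
  hence "0 < 2 ^ h * int (card (boundaries t b \<zeta>))" using h(1) by simp
  moreover have "(\<Sum>v\<in>chains t. bsgn (q v)) = (\<Sum>v\<in>chains t. bsgn (q0 v))" by (simp add: spin_form_unique)
  ultimately show ?thesis using h(2) by metis
qed

end

end

context standard_pair
begin

text \<open>\<open>Rt\<close>, first on top and last at the bottom, serves as the auxiliary letter
  \<rho>.\<close>

lemma spin_parity_sign:
  assumes "has_spin_parity tw bw s"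
  shows "\<exists>C>0. -2 * cyc.odd_sum = C * bsgn s"
proof -
  obtain \<zeta> q where \<zeta>: "veech_suspension tw bw \<zeta>" "spin_form tw bw \<zeta> q" "has_arf_invariant (chains tw) (boundaries tw bw \<zeta>) q s"
    using assms unfolding has_spin_parity_def by blast
  interpret suspension tw bw \<zeta>
    by unfold_locales (use \<zeta>(1) length_top N_pos in auto)
  have "pos tw Rt < pos tw x \<and> pos bw x < pos bw Rt" if x: "x \<in> set tw" "x \<noteq> Rt" for x
  proof -
    have "pos tw x \<noteq> pos tw Rt" "pos bw x \<noteq> pos bw Rt" using pos_neq[OF x(1) _ x(2)] set_top by auto
    moreover have "pos bw x < length bw" using pos_less[of x bw] x set_eq by simp
    ultimately show ?thesis using pos_top(1) pos_bot(2) length_bot by simp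
  qed
  moreover have "Rt \<in> set tw" by (simp add: set_top)
  ultimately have "\<exists>C>0. (\<Sum>x\<in>chains tw. bsgn (q0 x)) = C * bsgn s"
    by (rule spin_arf_sign[OF \<zeta>(2) _ _ \<zeta>(3), rotated])
  thus ?thesis unfolding gauss_q0 .
qed

end

section \<open>A suspension of the standard permutation\<close>

lemma side_point_ends:
  assumes "a \<in> set w"
  shows "side_point \<zeta> w a 0 = (\<Sum>i<pos w a. \<zeta> (w ! i))" "side_point \<zeta> w a 1 = (\<Sum>i<Suc (pos w a). \<zeta> (w ! i))"
proof -
  have "side_start \<zeta> w a = (\<Sum>x\<leftarrow>take (pos w a) w. \<zeta> x)" by (simp add: side_start_def takeWhile_eq_take_pos)
  also have "\<dots> = (\<Sum>i<pos w a. \<zeta> (w ! i))" using pos_less[OF assms] by (simp add: sum_list_sum_nth atLeast0LessThan)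
  finally show "side_point \<zeta> w a 0 = (\<Sum>i<pos w a. \<zeta> (w ! i))" "side_point \<zeta> w a 1 = (\<Sum>i<Suc (pos w a). \<zeta> (w ! i))"
    using nth_pos[OF assms] by (simp_all add: side_point_def)
qed

context standard_pair
begin

text \<open>The top row rises to height 1 with \<open>Rt\<close>, runs horizontally and descends
  with \<open>Rb\<close>; the bottom row descends to height -1 with \<open>Rb\<close> and returns
  with \<open>Rt\<close>.\<close>

definition \<zeta>0 :: "letter \<Rightarrow> complex" where
  "\<zeta>0 a = (case a of Rt \<Rightarrow> 1 + \<i> | Rb \<Rightarrow> 1 - \<i> | Lt _ \<Rightarrow> 1)"

definition vert :: "bool \<Rightarrow> nat \<Rightarrow> complex" where
  "vert up j = Complex (real j) (if 0 < j \<and> j \<le> N then (if up then 1 else -1) else 0)"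

lemma vert_0 [simp]: "vert up 0 = 0" and vert_last: "vert up (Suc N) = of_nat (Suc N)"
  by (simp_all add: vert_def complex_eq_iff)

lemma nth_cases:
  assumes "i \<le> N"
  obtains "i = 0" "tw ! i = Rt" "bw ! i = Rb" | "i = N" "0 < i" "tw ! i = Rb" "bw ! i = Rt"
  | z z' where "0 < i" "i < N" "tw ! i = Lt z" "bw ! i = Lt z'"
  using assms nth_tw nth_bw by (metis le_neq_implies_less neq0_conv)

lemma sum_vert: "j \<le> Suc N \<Longrightarrow> (\<Sum>i<j. \<zeta>0 (tw ! i)) = vert True j \<and> (\<Sum>i<j. \<zeta>0 (bw ! i)) = vert False j"
proof (induction j)
  case (Suc j)
  hence "j \<le> N" by simp
  thus ?case
    by (rule nth_cases) (use Suc N_pos in \<open>auto simp: vert_def \<zeta>0_def complex_eq_iff\<close>)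
qed simp

lemma side_vert:
  assumes "a \<in> set tw"
  shows "side_point \<zeta>0 tw a 0 = vert True (pos tw a)" "side_point \<zeta>0 tw a 1 = vert True (Suc (pos tw a))"
    "side_point \<zeta>0 bw a 0 = vert False (pos bw a)" "side_point \<zeta>0 bw a 1 = vert False (Suc (pos bw a))"
proof -
  have a: "a \<in> set bw" using assms set_eq by simp
  have p: "Suc (pos tw a) \<le> Suc N" "Suc (pos bw a) \<le> Suc N"
    using pos_less[OF assms] pos_less[OF a] length_top length_bot by simp_all
  show "side_point \<zeta>0 tw a 0 = vert True (pos tw a)" "side_point \<zeta>0 tw a 1 = vert True (Suc (pos tw a))"
    "side_point \<zeta>0 bw a 0 = vert False (pos bw a)" "side_point \<zeta>0 bw a 1 = vert False (Suc (pos bw a))"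
    unfolding side_point_ends[OF assms] side_point_ends[OF a]
    using sum_vert[OF p(1)] sum_vert[OF p(2)] sum_vert[of "pos tw a"] sum_vert[of "pos bw a"] p by auto
qed

lemma side_point_convex: "side_point \<zeta> w a r = (1 - of_real r) * side_point \<zeta> w a 0 + of_real r * side_point \<zeta> w a 1"
  by (simp add: side_point_def algebra_simps)

lemma side_point_height:
  assumes "a \<in> set tw" "r \<in> {0..1}"
  shows "0 \<le> Im (side_point \<zeta>0 tw a r) \<and> (Im (side_point \<zeta>0 tw a r) = 0 \<longrightarrow> side_point \<zeta>0 tw a r \<in> {0, of_nat (Suc N)})"
    "Im (side_point \<zeta>0 bw a r) \<le> 0"
proof -
  have p: "pos tw a \<le> N" using pos_less[OF assms(1)] length_top by simp
  have *: "side_point \<zeta>0 tw a r = (1 - of_real r) * vert True (pos tw a) + of_real r * vert True (Suc (pos tw a))"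
    "side_point \<zeta>0 bw a r = (1 - of_real r) * vert False (pos bw a) + of_real r * vert False (Suc (pos bw a))"
    using side_point_convex[of \<zeta>0 tw a r] side_point_convex[of \<zeta>0 bw a r] unfolding side_vert[OF assms(1)] .
  show "0 \<le> Im (side_point \<zeta>0 tw a r) \<and> (Im (side_point \<zeta>0 tw a r) = 0 \<longrightarrow> side_point \<zeta>0 tw a r \<in> {0, of_nat (Suc N)})"
    unfolding * using assms(2) p N_pos by (auto simp: vert_def complex_eq_iff)
  show "Im (side_point \<zeta>0 bw a r) \<le> 0"
    unfolding * using assms(2) by (auto simp: vert_def)
qed

lemma suspension_\<zeta>0: "veech_suspension tw bw \<zeta>0"
  unfolding veech_suspension_def
proof (intro conjI allI impI ballI)
  show "0 < Re (\<zeta>0 a)" for a by (cases a) (auto simp: \<zeta>0_def)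
  have take: "(\<Sum>x\<leftarrow>take j w. \<zeta>0 x) = (\<Sum>i<j. \<zeta>0 (w ! i))" if "j \<le> length w" for j w
    using that by (simp add: sum_list_sum_nth atLeast0LessThan)
  show "0 < Im (\<Sum>x\<leftarrow>take j tw. \<zeta>0 x)" if "0 < j \<and> j < length tw" for j
    using that sum_vert[of j] length_top by (simp add: take vert_def)
  show "Im (\<Sum>x\<leftarrow>take j bw. \<zeta>0 x) < 0" if "0 < j \<and> j < length bw" for j
    using that sum_vert[of j] length_bot by (simp add: take vert_def)
  have all: "(\<Sum>x\<leftarrow>tw. \<zeta>0 x) = of_nat (Suc N)"
    using take[of "length tw" tw] sum_vert[of "Suc N"] length_top vert_last by simp
  have mem: "Rt \<in> set tw" "Rb \<in> set tw" "Rt \<in> set bw" "Rb \<in> set bw" by (simp_all add: set_top set_bot)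
  show "broken_line \<zeta>0 tw \<inter> broken_line \<zeta>0 bw = {0, \<Sum>x\<leftarrow>tw. \<zeta>0 x}"
    unfolding all
  proof (intro equalityI subsetI)
    fix z assume "z \<in> broken_line \<zeta>0 tw \<inter> broken_line \<zeta>0 bw"
    then obtain a r c r' where "a \<in> set tw" "r \<in> {0..1}" "z = side_point \<zeta>0 tw a r"
        "c \<in> set tw" "r' \<in> {0..1}" "z = side_point \<zeta>0 bw c r'"
      using set_eq by (auto simp: broken_line_def)
    thus "z \<in> {0, of_nat (Suc N)}" using side_point_height[of a r] side_point_height(2)[of c r'] by force
  next
    fix z :: complex assume "z \<in> {0, of_nat (Suc N)}"
    moreover have "side_point \<zeta>0 tw Rt 0 = 0" "side_point \<zeta>0 tw Rb 1 = of_nat (Suc N)"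
      "side_point \<zeta>0 bw Rb 0 = 0" "side_point \<zeta>0 bw Rt 1 = of_nat (Suc N)"
      using side_vert[OF mem(1)] side_vert[OF mem(2)] pos_top(1,2) pos_bot(1,2) vert_last by simp_all
    ultimately have "z \<in> {side_point \<zeta>0 tw Rt 0, side_point \<zeta>0 tw Rb 1}" "z \<in> {side_point \<zeta>0 bw Rb 0, side_point \<zeta>0 bw Rt 1}"
      by auto
    thus "z \<in> broken_line \<zeta>0 tw \<inter> broken_line \<zeta>0 bw"
      unfolding broken_line_def using mem by fastforce
  qed
qed

lemma radical_prefix:
  "x \<in> radical \<longleftrightarrow> x \<in> chains tw \<and> (\<forall>a\<in>set tw. (\<Sum>i<pos tw a. x (tw ! i)) = (\<Sum>i<pos bw a. x (bw ! i)))"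
proof -
  have "pos tw a \<le> N + 1 \<and> pos bw a \<le> N + 1" if "a \<in> set tw" for a
    using pos_less[OF that] pos_less[of a bw] that set_eq length_top length_bot by simp
  thus ?thesis unfolding radical_def using prefix_tw prefix_bw by auto
qed

text \<open>Along each row the partial sums of a boundary telescope to differences of vertex values.
  Conversely, the partial sums of an element of the radical define a vertex function that is
  compatible with the gluing.\<close>

lemma boundaries_\<zeta>0: "boundaries tw bw \<zeta>0 = radical"
proof (intro equalityI subsetI)
  have cancel: "p + q + (q + r) = p + r" for p q r :: bit
    using bit_cases[of q] by (auto simp: ac_simps)
  fix x assume x: "x \<in> boundaries tw bw \<zeta>0"
  then obtain f where f: "x = (\<lambda>a. if a \<in> set tw then f (side_point \<zeta>0 tw a 0) + f (side_point \<zeta>0 tw a 1) else 0)"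
    "\<And>a. a \<in> set tw \<Longrightarrow> f (side_point \<zeta>0 tw a 0) = f (side_point \<zeta>0 bw a 0) \<and> f (side_point \<zeta>0 tw a 1) = f (side_point \<zeta>0 bw a 1)"
    unfolding boundaries_def by blast
  have nth: "tw ! i \<in> set tw" "bw ! i \<in> set tw" "pos tw (tw ! i) = i" "pos bw (bw ! i) = i" if "i \<le> N" for i
    using that length_top length_bot set_eq nth_mem[of i tw] nth_mem[of i bw] pos_nth[OF dt] pos_nth[OF db] by auto
  have pt: "(\<Sum>i<j. x (tw ! i)) = f 0 + f (vert True j)" if "j \<le> N" for j
    using that
  proof (induction j)
    case (Suc j)
    hence "x (tw ! j) = f (vert True j) + f (vert True (Suc j))"
      using nth[of j] side_vert[of "tw ! j"] by (simp add: f(1))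
    thus ?case using Suc cancel by simp
  qed simp
  have pb: "(\<Sum>i<j. x (bw ! i)) = f 0 + f (vert False j)" if "j \<le> N" for j
    using that
  proof (induction j)
    case (Suc j)
    hence "x (bw ! j) = f (vert False j) + f (vert False (Suc j))"
      using nth[of j] side_vert[of "bw ! j"] f(2)[of "bw ! j"] by (simp add: f(1))
    thus ?case using Suc cancel by simp
  qed simp
  have "(\<Sum>i<pos tw a. x (tw ! i)) = (\<Sum>i<pos bw a. x (bw ! i))" if a: "a \<in> set tw" for a
    using pt[of "pos tw a"] pb[of "pos bw a"] f(2)[OF a] side_vert[OF a] pos_less[OF a] pos_less[of a bw] a set_eq length_top length_bot
    by simp
  thus "x \<in> radical" unfolding radical_prefix using x boundaries_subset by blast
next
  fix x assume "x \<in> radical"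
  hence x: "x \<in> chains tw" "\<And>a. a \<in> set tw \<Longrightarrow> (\<Sum>i<pos tw a. x (tw ! i)) = (\<Sum>i<pos bw a. x (bw ! i))"
    unfolding radical_prefix by auto
  define pt where "pt j = (\<Sum>i<j. x (tw ! i))" for j
  define pb where "pb j = (\<Sum>i<j. x (bw ! i))" for j
  \<comment> \<open>The sign of the height tells the rows apart, the abscissa is the index of the
    vertex, and the two real vertices, 0 and \<open>N + 1\<close>, are common to both rows.\<close>
  define f where "f z = (if Im z > 0 then pt (nat \<lfloor>Re z\<rfloor>) else if Im z < 0 then pb (nat \<lfloor>Re z\<rfloor>) else if z = 0 then 0 else pt (Suc N))" for z
  \<comment> \<open>Both rows end at the same vertex, so \<open>f\<close> is only consistent there
    if the two full sums agree.\<close>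
  have total: "pb (Suc N) = pt (Suc N)"
  proof -
    have "{c. c \<in> set tw \<and> pos tw c < Suc N} = set tw" "{c. c \<in> set tw \<and> pos bw c < Suc N} = set tw"
      using pos_less[of _ tw] pos_less[of _ bw] length_top length_bot set_eq by auto
    thus ?thesis using prefix_tw[of "Suc N" x] prefix_bw[of "Suc N" x] by (simp add: pt_def pb_def)
  qed
  have f_vert: "f (vert True j) = pt j" "f (vert False j) = pb j" if "j \<le> Suc N" for j
  proof -
    have "j = 0 \<or> j = Suc N \<or> 0 < j \<and> j \<le> N" using that by auto
    thus "f (vert True j) = pt j" "f (vert False j) = pb j"
      using total by (auto simp: f_def vert_def pt_def pb_def complex_eq_iff)
  qed
  have le: "Suc (pos tw a) \<le> Suc N" "Suc (pos bw a) \<le> Suc N" if "a \<in> set tw" for a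
    using pos_less[OF that] pos_less[of a bw] that set_eq length_top length_bot by simp_all
  have eq: "f (side_point \<zeta>0 tw a 0) = f (side_point \<zeta>0 bw a 0) \<and> f (side_point \<zeta>0 tw a 1) = f (side_point \<zeta>0 bw a 1)"
    if a: "a \<in> set tw" for a
  proof -
    have "a \<in> set bw" using a set_eq by simp
    hence "pt (Suc (pos tw a)) = pt (pos tw a) + x a" "pb (Suc (pos bw a)) = pb (pos bw a) + x a"
      using nth_pos[OF a] nth_pos[of a bw] by (simp_all add: pt_def pb_def)
    moreover have "pt (pos tw a) = pb (pos bw a)" using x(2)[OF a] by (simp add: pt_def pb_def)
    ultimately show ?thesis unfolding side_vert[OF a] using f_vert le[OF a] by simp
  qed
  have "x = (\<lambda>a. if a \<in> set tw then f (side_point \<zeta>0 tw a 0) + f (side_point \<zeta>0 tw a 1) else 0)"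
  proof
    fix a show "x a = (if a \<in> set tw then f (side_point \<zeta>0 tw a 0) + f (side_point \<zeta>0 tw a 1) else 0)"
    proof (cases "a \<in> set tw")
      case True
      have "pt (pos tw a) + (pt (pos tw a) + x a) = x a" by (simp flip: add.assoc)
      thus ?thesis using True le[OF True] f_vert nth_pos[OF True] by (simp add: side_vert[OF True] pt_def)
    qed (use x(1) in \<open>simp add: chains_def\<close>)
  qed
  thus "x \<in> boundaries tw bw \<zeta>0" unfolding boundaries_def using eq by blast
qed

lemma spin_parity_exists:
  assumes odd: "\<And>x. x \<in> S \<Longrightarrow> odd (card (orbit cyc.sigma x))"
    and arf: "has_arf_invariant (chains tw) radical q0 s"
  shows "has_spin_parity tw bw s"
proof -
  interpret suspension tw bw \<zeta>0
    by unfold_locales (use suspension_\<zeta>0 length_top N_pos in auto)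
  have "quadratic_form_mod (chains tw) radical q0"
    by (rule bit_form.q[OF bit_form_radical[OF q0_radical[OF odd]]])
  hence "spin_form tw bw \<zeta>0 q0"
    unfolding spin_form_def boundaries_\<zeta>0 using q0_curve_class by blast
  thus ?thesis unfolding has_spin_parity_def using suspension_\<zeta>0 arf boundaries_\<zeta>0 by metis
qed

text \<open>Existence comes from the suspension \<zeta>0, uniqueness from the sign of the Gauss sum,
  which every spin parity has to match.\<close>

theorem has_spin_parity_iff:
  assumes odd: "\<And>x. x \<in> S \<Longrightarrow> odd (card (orbit cyc.sigma x))"
    and k: "k = card (orbit cyc.sigma ` S)" and g: "g = (N - k) div 2"
  shows "\<exists>s0. (\<forall>s. has_spin_parity tw bw s \<longleftrightarrow> s = s0) \<and> cyc.odd_sum = - bsgn s0 * 2 ^ (g + k - 1)"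
proof -
  obtain s0 where s0: "has_arf_invariant (chains tw) radical q0 s0" "cyc.odd_sum = - bsgn s0 * 2 ^ (g + k - 1)"
    using odd_sum_arf[OF odd k g] by blast
  have "s = s0" if "has_spin_parity tw bw s" for s
  proof -
    obtain C where "C > 0" "-2 * cyc.odd_sum = C * bsgn s" using spin_parity_sign[OF \<open>has_spin_parity tw bw s\<close>] by blast
    moreover define D :: int where "D = 2 * 2 ^ (g + k - 1)"
    ultimately have "C * bsgn s = D * bsgn s0" "0 < D" "0 < C" unfolding s0(2) by (simp_all add: mult.commute)
    thus "s = s0" using bit_cases[of s] bit_cases[of s0] by auto
  qed
  thus ?thesis using spin_parity_exists[OF odd s0(1)] s0(2) by blast
qed

end

section \<open>Counting pairs of cycles by parity\<close>

text \<open>A pair of parity 1 has odd sum \<open>2 ^ (g + k - 1)\<close> and a pair of parity 0 its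
  negative, so the total counts the pairs with the signs of \<open>spin_difference\<close>.\<close>

lemma spin_difference_odd_total:
  assumes star: "star \<in> {1..N}" and odd: "\<And>x. x \<in> {1..N} \<Longrightarrow> odd (card (orbit \<sigma> x))"
    and k: "k = card (orbit \<sigma> ` {1..N})" and g: "g = (N - k) div 2"
  shows "spin_difference N \<sigma> star * 2 ^ (g + k - 1) = odd_total {1..N} \<sigma>"
proof -
  let ?P = "cyc_pairs {1..N} \<sigma>"
  let ?h = "\<lambda>s (t, b). has_spin_parity (standard_top N star t) (standard_bottom N star b) s"
  have fin: "finite ?P" by (simp add: finite_cyc_pairs)
  have count: "int (spin_count N \<sigma> star s) = (\<Sum>x\<in>?P. if ?h s x then 1 else 0)" for s
  proof -
    have "{(\<tau>t, \<tau>b). is_long_cycle N \<tau>t \<and> is_long_cycle N \<tau>b \<and> \<tau>t \<circ> inv \<tau>b = \<sigma> \<and> ?h s (\<tau>t, \<tau>b)} = {x \<in> ?P. ?h s x}"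
      by (auto simp: cyc_pairs_def is_long_cycle_def long_cycle_def)
    thus ?thesis using fin by (simp add: spin_count_def sum.If_cases Int_def)
  qed
  have "((if ?h 1 x then 1 else 0) - (if ?h 0 x then 1 else 0)) * 2 ^ (g + k - 1) = (case x of (t, b) \<Rightarrow> cycle_pair.odd_sum {1..N} t b)"
    if "x \<in> ?P" for x
  proof -
    obtain t b where x: "x = (t, b)" by (cases x)
    hence tb: "(t, b) \<in> ?P" using that by simp
    interpret standard_pair N star t b
      using cyc_pairs_locale[OF tb] star by (simp add: standard_pair_def cycle_pair_def)
    have sigma: "cyc.sigma = \<sigma>" by (rule cyc_pairs_sigma[OF tb])
    obtain s0 where "\<And>s. has_spin_parity tw bw s \<longleftrightarrow> s = s0" "cyc.odd_sum = - bsgn s0 * 2 ^ (g + k - 1)"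
      using has_spin_parity_iff[of k g, unfolded sigma] odd k g by blast
    thus ?thesis using bit_cases[of s0] unfolding x by auto
  qed
  hence "(\<Sum>x\<in>?P. ((if ?h 1 x then 1 else 0) - (if ?h 0 x then 1 else 0)) * 2 ^ (g + k - 1)) = odd_total {1..N} \<sigma>"
    unfolding odd_total_def by (rule sum.cong[OF refl])
  thus ?thesis unfolding spin_difference_def count by (simp only: sum_distrib_right sum_subtractf[symmetric])
qed

text \<open>The parts of \<open>p\<close> are the sizes of the orbits, so \<open>k\<close> is their
  number, and the factor \<open>2 ^ (k - 1)\<close> cancels. The identity is kept in multiplied form
  over the integers.\<close>

lemma spin_difference_formula:
  assumes odd: "\<forall>a\<in>#p. odd a" and N: "N = sum_mset p" and k: "k = size p" and g: "g = (N - k) div 2"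
    and adm: "admissible p \<sigma> star"
  shows "spin_difference N \<sigma> star * 2 ^ g = fact (N - 1)"
proof -
  have \<sigma>: "\<sigma> permutes {1..N}" and star: "star \<in> {1..N}" and ct: "cycle_type N \<sigma> = p"
    using adm unfolding admissible_def N by blast+
  have k_orbits: "k = card (orbit \<sigma> ` {1..N})" unfolding k ct[symmetric] by (simp add: cycle_type_def)
  have "set_mset p = card ` orbit \<sigma> ` {1..N}" unfolding ct[symmetric] by (simp add: cycle_type_def)
  hence orb: "odd (card (orbit \<sigma> x))" if "x \<in> {1..N}" for x using odd that by blast
  have "0 < k" unfolding k_orbits using star by (auto simp: card_gt_0_iff)
  hence e: "2 ^ (g + k - 1) = (2 ^ g * 2 ^ (k - 1) :: int)" by (simp flip: power_add)
  have "{1..N} \<noteq> {}" using star by blast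
  hence "odd_total {1..N} \<sigma> = fact (N - 1) * 2 ^ (k - 1)"
    using odd_total_odd_type[of "{1..N}" \<sigma>] \<sigma> orb k_orbits by simp
  hence "spin_difference N \<sigma> star * 2 ^ g * 2 ^ (k - 1) = fact (N - 1) * 2 ^ (k - 1)"
    using spin_difference_odd_total[OF star orb k_orbits g] e by (simp add: mult.assoc)
  thus ?thesis by simp
qed

theorem theorem4p19:
  fixes p :: "nat multiset" and n k g :: nat
    and \<sigma> :: "nat \<Rightarrow> nat" and star :: nat
  assumes odd_parts: "\<forall>a\<in>#p. odd a"
    and n: "n = sum_mset p" and k: "k = size p" and g: "g = (n - k) div 2"
    and choice: "admissible p \<sigma> star"
  shows "real_of_int (spin_difference n \<sigma> star) = fact (n - 1) / 2 ^ g \<and>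
    (\<forall>p' \<sigma>' star'. (\<forall>a\<in>#p'. odd a) \<and> sum_mset p' = n \<and> size p' = k \<and> admissible p' \<sigma>' star'
           \<longrightarrow> spin_difference n \<sigma>' star' = spin_difference n \<sigma> star)"
proof (intro conjI allI impI)
  have d: "spin_difference n \<sigma> star * 2 ^ g = fact (n - 1)"
    by (rule spin_difference_formula[OF odd_parts n k g choice])
  hence "real_of_int (spin_difference n \<sigma> star) * 2 ^ g = fact (n - 1)"
    by (metis of_int_fact of_int_mult of_int_numeral of_int_power)
  thus "real_of_int (spin_difference n \<sigma> star) = fact (n - 1) / 2 ^ g" by (simp add: field_simps)
  fix p' \<sigma>' star'
  assume p': "(\<forall>a\<in>#p'. odd a) \<and> sum_mset p' = n \<and> size p' = k \<and> admissible p' \<sigma>' star'"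
  \<comment> \<open>Both sides equal \<open>fact (n - 1)\<close>, and \<open>g\<close> is determined
    by \<open>n\<close> and \<open>k\<close>.\<close>
  have "spin_difference n \<sigma>' star' * 2 ^ g = spin_difference n \<sigma> star * 2 ^ g"
    unfolding d using spin_difference_formula[of p' n k g \<sigma>' star'] p' g by blast
  thus "spin_difference n \<sigma>' star' = spin_difference n \<sigma> star" by simp
qed

end
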